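(* Let $P$ be an $r\times r$ refinement mask, let $R\subset W_2^s(\mathbb{R}^d)$ be a finite-dimensional space of solutions $\Phi$ to $\widehat\Phi(2\cdot)=P\widehat\Phi$, let $k>0$, and let $v$ be a vector-valued function (with $r$ components) such that the following assumptions hold: (A1) there exists a neighborhood $\Omega$ of the origin such that, a.e. on $\Omega$, $\|G_{R,s}(\cdot+\pi l)\|=O(1)$ for $l\in E\setminus\{0\}$ and $\|G_{R,s}\|=O(|\cdot|^{2s})$; (A2) the entries of $v$ are $2\pi$-periodic and measurable, and $v^*v$ is bounded, and bounded away from zero, around the origin; (A3) for every $\Phi\in R$, the function $\phi$ defined by $\widehat\phi=v^*\widehat\Phi$ satisfies, for some ball $\Omega$ centered at the origin, $\sum_{\beta\in2\pi\mathbb{Z}^d\setminus\{0\}}|\beta|^{2s}\max_{|\gamma|\le k}\|D^\gamma\widehat\phi\|^2_{L_\infty(\beta+\Omega)}<\infty$. If $P$ and $v$ satisfy Condition $Z_k$, then $v^*G^0_{R,s}v$ has a zero of order $2k$ at the origin, and, in addition, for every $\Phi\in R$, $v^*\widehat\Phi-(v^*\widehat\Phi)(0)=O(|\cdot|^k)$, provided that $v^*\widehat\Phi$ is smooth at the origin. In particular: (a) If $v^*G_{R,s}v\sim|\cdot|^{2s}$ a.e. around the origin, then $v$ is a universal supervector (with respect to $R$) of order $k$, and hence $R$ provides coherent approximation order $k$. This, for example, is the case if $G_{R,s}$ is invertible (a.e.) in a neighborhood of the origin and $\|G_{R,s}^{-1}\|=O(|\cdot|^{-2s})$ a.e. there.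 (b) If, for some $\Phi\in R$, $|v^*\widehat\Phi|\ge c>0$ a.e. around the origin, then (a) applies, and, further, $S_\Phi(W_2^s)$ provides approximation order $k$.
   Context: $\widehat f(\omega)=\int f(x)e^{-i\omega\cdot x}dx$; $W_2^s=W_2^s(\mathbb{R}^d)$ is the space of tempered distributions $f$ with $\widehat f$ locally in $L_2$ and $\|f\|_{W_2^s}^2=\int(1+|\omega|)^{2s}|\widehat f(\omega)|^2d\omega<\infty$. $S_\Phi(W_2^s)$ is the smallest closed subspace of $W_2^s$ containing the entries of $\Phi$ and invariant under integer translations. For $k>s$ it provides approximation order $k$ if, with $S^h=\{g(\cdot/h):g\in S_\Phi(W_2^s)\}$, there is $C$ with $\inf_{g\in S^h}\|f-g\|_{W_2^s}\le Ch^{k-s}\|f\|_{W_2^k}$ for all $f\in W_2^k$, $h>0$. $E=\{0,1\}^d$. $D^\gamma=\partial^\gamma/\gamma!$. A refinement mask $P$ is an $r\times r$ matrix of $2\pi$-periodic measurable functions on $\mathbb{R}^d$. $R\subset W_2^s$ means that every entry of every vector in $R$ lies in $W_2^s$. Gramians: with $(\Phi_1,\dots,\Phi_n)$ a basis of $R$, $G_{R,s}=\sum_{j=1}^n\sum_{\alpha\in2\pi\mathbb{Z}^d}\widehat\Phi_j(\cdot+\alpha)\widehat\Phi_j^*(\cdot+\alpha)|\cdot+\alpha|^{2s}$, and $G^0_{R,s}$ is the same expression with the terms $\alpha=0$ removed (choice of basis is immaterial). Condition $Z_k$ for the pair $P,v$: for each $l\in E$, $v^*(2\cdot)P-\delta_{l,0}v^*$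 has a zero of order $k$ at $\pi l$ (i.e. is $O(|\cdot-\pi l|^k)$ near $\pi l$). $R$ provides coherent approximation order $k$ if for some neighborhood $\Omega$ of $0$ the function $\omega\mapsto|\omega|^{-(2k-2s)}\inf_v\frac{v^*G^0_{R,s}(\omega)v}{v^*G_{R,s}(\omega)v}$ is in $L_\infty(\Omega)$. A measurable $v$ is a universal supervector of order $k$ (with respect to $R$) if a.e. on some neighborhood of the origin $\frac{v^*G^0_{R,s}v}{v^*G_{R,s}v}=O(|\cdot|^{2k-2s})$. "$F_1\sim F_2$" means that each is bounded by a positive constant multiple of the other.
   Formalization: For s<0 with k not an integer, and for s≤-1 in dimension d≥3, the additional assumption that the norm of G^0_{R,s} is O(1) a.e. near the origin is made, because (A1)-(A3) and Condition Z_k alone do not imply the claim in that range. *)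

theory Defs
  imports
    "HOL-Analysis.Analysis"
    "HOL-Library.Function_Algebras"
    "HOL-Library.Landau_Symbols"
    "HOL-Probability.Essential_Supremum"
begin

section \<open>Partial derivatives, Schwartz functions, test functions\<close>

definition partial :: "'d \<Rightarrow> (real^'d::finite \<Rightarrow> complex) \<Rightarrow> real^'d \<Rightarrow> complex" where
  "partial i f x = frechet_derivative f (at x) (axis i 1)"

text \<open>Only meant for open \<open>U\<close>; then this is the class of infinitely differentiable functions on \<open>U\<close>.\<close>

definition smooth_on :: "(real^'d::finite) set \<Rightarrow> (real^'d \<Rightarrow> complex) \<Rightarrow> bool" where
  "smooth_on U f \<longleftrightarrow> (\<forall>is. foldr partial is f differentiable_on U)"

text \<open>The operator \<open>D\<^sup>\<gamma> = \<partial>\<^sup>\<gamma> / \<gamma>!\<close>. It is applied to smooth functions only, so the order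
  in which the partial derivatives are taken is immaterial.\<close>

definition mderiv :: "('d \<Rightarrow> nat) \<Rightarrow> (real^'d::finite \<Rightarrow> complex) \<Rightarrow> real^'d \<Rightarrow> complex" where
  "mderiv \<gamma> f x =
     foldr partial (SOME is. \<forall>i. count_list is i = \<gamma> i) f x / (\<Prod>i\<in>UNIV. fact (\<gamma> i))"

definition schwartz :: "(real^'d::finite \<Rightarrow> complex) \<Rightarrow> bool" where
  "schwartz \<phi> \<longleftrightarrow> smooth_on UNIV \<phi> \<and>
     (\<forall>N is. bounded (range (\<lambda>x. (1 + norm x) ^ N *\<^sub>R foldr partial is \<phi> x)))"

definition schwartz_seminorm :: "nat \<Rightarrow> (real^'d::finite \<Rightarrow> complex) \<Rightarrow> real" where
  "schwartz_seminorm N \<phi> =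
     (SUP (is, x) \<in> {is. length is \<le> N} \<times> UNIV. (1 + norm x) ^ N * norm (foldr partial is \<phi> x))"

definition test_function :: "(real^'d::finite) set \<Rightarrow> (real^'d \<Rightarrow> complex) \<Rightarrow> bool" where
  "test_function U \<eta> \<longleftrightarrow> smooth_on UNIV \<eta> \<and> (\<exists>K\<subseteq>U. compact K \<and> (\<forall>x. x \<notin> K \<longrightarrow> \<eta> x = 0))"


section \<open>Tempered distributions and the spaces \<open>W\<^sub>2\<^sup>s\<close>\<close>

type_synonym 'd functional = "(real^'d \<Rightarrow> complex) \<Rightarrow> complex"

text \<open>A tempered distribution is a continuous linear functional on the Schwartz space. The
  arbitrary value \<open>0\<close> outside the Schwartz space makes equality of functionals
  coincide with equality of distributions.\<close>

definition tempered :: "'d::finite functional \<Rightarrow> bool" where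
  "tempered T \<longleftrightarrow>
     (\<forall>\<phi> \<psi>. schwartz \<phi> \<longrightarrow> schwartz \<psi> \<longrightarrow> T (\<lambda>x. \<phi> x + \<psi> x) = T \<phi> + T \<psi>) \<and>
     (\<forall>c \<phi>. schwartz \<phi> \<longrightarrow> T (\<lambda>x. c * \<phi> x) = c * T \<phi>) \<and>
     (\<exists>C N. \<forall>\<phi>. schwartz \<phi> \<longrightarrow> norm (T \<phi>) \<le> C * schwartz_seminorm N \<phi>) \<and>
     (\<forall>\<phi>. \<not> schwartz \<phi> \<longrightarrow> T \<phi> = 0)"

definition fourier :: "(real^'d::finite \<Rightarrow> complex) \<Rightarrow> real^'d \<Rightarrow> complex" where
  "fourier \<phi> \<omega> = (\<integral>x. \<phi> x * cis (- (\<omega> \<bullet> x)) \<partial>lebesgue)"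

text \<open>The Fourier transform of \<open>T\<close>, defined by duality, is the function \<open>F\<close>, which is
  locally in \<open>L\<^sub>2\<close>.\<close>

definition has_fourier :: "'d::finite functional \<Rightarrow> (real^'d \<Rightarrow> complex) \<Rightarrow> bool" where
  "has_fourier T F \<longleftrightarrow>
     F \<in> borel_measurable lebesgue \<and>
     (\<forall>K. compact K \<longrightarrow> set_integrable lebesgue K (\<lambda>\<omega>. (norm (F \<omega>))\<^sup>2)) \<and>
     (\<forall>\<eta>. test_function UNIV \<eta> \<longrightarrow> T (fourier \<eta>) = (\<integral>\<omega>. F \<omega> * \<eta> \<omega> \<partial>lebesgue))"

text \<open>This is determined only up to a null set.\<close>

definition fhat :: "'d::finite functional \<Rightarrow> real^'d \<Rightarrow> complex" where
  "fhat T = (SOME F. has_fourier T F)"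

definition W2 :: "real \<Rightarrow> 'd::finite functional set" where
  "W2 s = {T. tempered T \<and> (\<exists>F. has_fourier T F) \<and>
     integrable lebesgue (\<lambda>\<omega>. (1 + norm \<omega>) powr (2 * s) * (norm (fhat T \<omega>))\<^sup>2)}"

definition W2_norm :: "real \<Rightarrow> 'd::finite functional \<Rightarrow> real" where
  "W2_norm s T = sqrt (\<integral>\<omega>. (1 + norm \<omega>) powr (2 * s) * (norm (fhat T \<omega>))\<^sup>2 \<partial>lebesgue)"


section \<open>Shift-invariant spaces and approximation order\<close>

definition fscale :: "complex \<Rightarrow> 'd::finite functional \<Rightarrow> 'd functional" where
  "fscale c T = (\<lambda>\<phi>. c * T \<phi>)"

definition vscale :: "complex \<Rightarrow> 'd::finite functional ^ 'r::finite \<Rightarrow> 'd functional ^ 'r" where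
  "vscale c \<Phi> = (\<chi> i. fscale c (\<Phi> $ i))"

interpretation functional: vector_space fscale
  by unfold_locales (auto simp: fscale_def fun_eq_iff algebra_simps)

interpretation vfunctional: vector_space vscale
  by unfold_locales (auto simp: vscale_def fscale_def vec_eq_iff fun_eq_iff algebra_simps)

text \<open>\<open>T(\<cdot> - a)\<close> and \<open>T(\<cdot> / h)\<close>, for \<open>h > 0\<close>, defined by duality.\<close>

definition translate :: "real^'d \<Rightarrow> 'd::finite functional \<Rightarrow> 'd functional" where
  "translate a T = (\<lambda>\<phi>. T (\<lambda>x. \<phi> (x + a)))"

definition dilate :: "real \<Rightarrow> 'd::finite functional \<Rightarrow> 'd functional" where
  "dilate h T = (\<lambda>\<phi>. of_real (h ^ CARD('d)) * T (\<lambda>x. \<phi> (h *\<^sub>R x)))"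

definition int_lattice :: "(real^'d::finite) set" where
  "int_lattice = {a. \<forall>i. a $ i \<in> \<int>}"

definition closed_in_W2 :: "real \<Rightarrow> 'd::finite functional set \<Rightarrow> bool" where
  "closed_in_W2 s V \<longleftrightarrow>
     (\<forall>g f. range g \<subseteq> V \<longrightarrow> f \<in> W2 s \<longrightarrow> (\<lambda>n. W2_norm s (g n - f)) \<longlonglongrightarrow> 0 \<longrightarrow> f \<in> V)"

definition shift_invariant_space :: "real \<Rightarrow> 'd::finite functional ^ 'r::finite \<Rightarrow> 'd functional set" where
  "shift_invariant_space s \<Phi> = \<Inter>{V. V \<subseteq> W2 s \<and> functional.subspace V \<and> closed_in_W2 s V \<and>
     (\<forall>a\<in>int_lattice. \<forall>g\<in>V. translate a g \<in> V) \<and> (\<forall>i. \<Phi> $ i \<in> V)}"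

text \<open>To be used for \<open>k > s\<close>, where \<open>W2 k \<subseteq> W2 s\<close>.\<close>

definition provides_approximation_order ::
    "real \<Rightarrow> real \<Rightarrow> 'd::finite functional ^ 'r::finite \<Rightarrow> bool" where
  "provides_approximation_order s k \<Phi> \<longleftrightarrow>
     (\<exists>C. \<forall>f\<in>W2 k. \<forall>h>0.
        (INF g \<in> dilate h ` shift_invariant_space s \<Phi>. W2_norm s (f - g))
          \<le> C * h powr (k - s) * W2_norm k f)"


section \<open>Gramians\<close>

definition cinner :: "complex^'r::finite \<Rightarrow> complex^'r \<Rightarrow> complex" where
  "cinner v w = (\<Sum>i\<in>UNIV. cnj (v $ i) * w $ i)"

definition conj_vec :: "complex^'r::finite \<Rightarrow> complex^'r" where
  "conj_vec v = (\<chi> i. cnj (v $ i))"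

text \<open>\<open>v\<^sup>*Mv\<close>, which is real for the Hermitian matrices \<open>M\<close> to which this is applied.\<close>

definition qform :: "complex^'r^'r::finite \<Rightarrow> complex^'r \<Rightarrow> real" where
  "qform M v = Re (cinner v (M *v v))"

definition vhat :: "'d::finite functional ^ 'r::finite \<Rightarrow> real^'d \<Rightarrow> complex^'r" where
  "vhat \<Phi> \<omega> = (\<chi> i. fhat (\<Phi> $ i) \<omega>)"

definition dual_lattice :: "(real^'d::finite) set" where
  "dual_lattice = {(2 * pi) *\<^sub>R a | a. a \<in> int_lattice}"

definition gram_sum :: "(real^'d) set \<Rightarrow> real \<Rightarrow> ('d::finite functional ^ 'r::finite) set \<Rightarrow>
    real^'d \<Rightarrow> complex^'r^'r" where
  "gram_sum A s B \<omega> = (\<chi> i j. \<Sum>\<Phi>\<in>B. \<Sum>\<^sub>\<infinity>\<alpha>\<in>A.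
     vhat \<Phi> (\<omega> + \<alpha>) $ i * cnj (vhat \<Phi> (\<omega> + \<alpha>) $ j) * of_real (norm (\<omega> + \<alpha>) powr (2 * s)))"

text \<open>\<open>B\<close> is a basis of the space whose Gramian is formed.\<close>

definition gramian :: "real \<Rightarrow> ('d::finite functional ^ 'r::finite) set \<Rightarrow> real^'d \<Rightarrow> complex^'r^'r"
  where "gramian s B = gram_sum dual_lattice s B"

definition gramian0 :: "real \<Rightarrow> ('d::finite functional ^ 'r::finite) set \<Rightarrow> real^'d \<Rightarrow> complex^'r^'r"
  where "gramian0 s B = gram_sum (dual_lattice - {0}) s B"


section \<open>Local asymptotics up to null sets\<close>

text \<open>A property holds eventually for this filter iff it holds almost everywhere on some
  neighbourhood of \<open>x\<close>.\<close>

definition ae_nhds :: "'a::euclidean_space \<Rightarrow> 'a filter" where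
  "ae_nhds x = inf (nhds x) (ae_filter lebesgue)"

definition ae_zero_of_order :: "real \<Rightarrow> 'a::euclidean_space \<Rightarrow> ('a \<Rightarrow> real) \<Rightarrow> bool" where
  "ae_zero_of_order k x f \<longleftrightarrow> f \<in> O[ae_nhds x](\<lambda>\<omega>. norm (\<omega> - x) powr k)"

text \<open>The smoothness assumption uses weak derivatives, as the functions are defined only
  almost everywhere. The norm below is \<open>\<infinity>\<close> if there is no weak derivative.\<close>

definition has_weak_mderiv :: "(real^'d::finite) set \<Rightarrow> ('d \<Rightarrow> nat) \<Rightarrow> (real^'d \<Rightarrow> complex) \<Rightarrow>
    (real^'d \<Rightarrow> complex) \<Rightarrow> bool" where
  "has_weak_mderiv U \<gamma> f g \<longleftrightarrow>
     (\<forall>K\<subseteq>U. compact K \<longrightarrow> set_integrable lebesgue K f \<and> set_integrable lebesgue K g) \<and>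
     (\<forall>\<eta>. test_function U \<eta> \<longrightarrow>
        (\<integral>x. f x * mderiv \<gamma> \<eta> x \<partial>lebesgue) = (-1) ^ sum \<gamma> UNIV * (\<integral>x. g x * \<eta> x \<partial>lebesgue))"

definition mderiv_Linf_norm :: "(real^'d::finite) set \<Rightarrow> ('d \<Rightarrow> nat) \<Rightarrow> (real^'d \<Rightarrow> complex) \<Rightarrow>
    ennreal" where
  "mderiv_Linf_norm U \<gamma> f =
     (if \<exists>g. has_weak_mderiv U \<gamma> f g
      then esssup (lebesgue_on U) (\<lambda>x. ennreal (norm ((SOME g. has_weak_mderiv U \<gamma> f g) x)))
      else \<infinity>)"


section \<open>Refinement masks, coherent approximation order, supervectors\<close>

definition periodic :: "(real^'d::finite \<Rightarrow> 'b) \<Rightarrow> bool" where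
  "periodic f \<longleftrightarrow> (\<forall>\<omega>. \<forall>\<alpha>\<in>dual_lattice. f (\<omega> + \<alpha>) = f \<omega>)"

definition refinement_mask :: "(real^'d::finite \<Rightarrow> complex^'r^'r::finite) \<Rightarrow> bool" where
  "refinement_mask P \<longleftrightarrow>
     periodic P \<and> (\<forall>i j. (\<lambda>\<omega>. P \<omega> $ i $ j) \<in> borel_measurable lebesgue)"

definition solves_refinement ::
    "(real^'d::finite \<Rightarrow> complex^'r^'r::finite) \<Rightarrow> 'd functional ^ 'r \<Rightarrow> bool" where
  "solves_refinement P \<Phi> \<longleftrightarrow> (AE \<omega> in lebesgue. vhat \<Phi> (2 *\<^sub>R \<omega>) = P \<omega> *v vhat \<Phi> \<omega>)"

definition unit_vertices :: "(real^'d::finite) set" where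
  "unit_vertices = {l. \<forall>i. l $ i \<in> {0, 1}}"

definition condition_Z :: "real \<Rightarrow> (real^'d::finite \<Rightarrow> complex^'r^'r::finite) \<Rightarrow>
    (real^'d \<Rightarrow> complex^'r) \<Rightarrow> bool" where
  "condition_Z k P v \<longleftrightarrow> (\<forall>l\<in>unit_vertices. ae_zero_of_order k (pi *\<^sub>R l)
     (\<lambda>\<omega>. norm (conj_vec (v (2 *\<^sub>R \<omega>)) v* P \<omega> - (if l = 0 then conj_vec (v \<omega>) else 0))))"

text \<open>The infimum is over those vectors for which the quotient makes sense.\<close>

definition coherence_quotient :: "real \<Rightarrow> ('d::finite functional ^ 'r::finite) set \<Rightarrow> real^'d \<Rightarrow>
    ereal" where
  "coherence_quotient s B \<omega> =
     (INF v \<in> {v. qform (gramian s B \<omega>) v \<noteq> 0}.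
        ereal (qform (gramian0 s B \<omega>) v / qform (gramian s B \<omega>) v))"

definition provides_coherent_order ::
    "real \<Rightarrow> real \<Rightarrow> ('d::finite functional ^ 'r::finite) set \<Rightarrow> bool" where
  "provides_coherent_order s k B \<longleftrightarrow>
     (\<exists>\<Omega>. open \<Omega> \<and> 0 \<in> \<Omega> \<and>
        (let q = (\<lambda>\<omega>. ereal (norm \<omega> powr (- (2 * k - 2 * s))) * coherence_quotient s B \<omega>) in
          q \<in> borel_measurable (lebesgue_on \<Omega>) \<and>
          (\<exists>C::real. AE \<omega> in lebesgue_on \<Omega>. \<bar>q \<omega>\<bar> \<le> ereal C)))"

definition universal_supervector :: "real \<Rightarrow> real \<Rightarrow> ('d::finite functional ^ 'r::finite) set \<Rightarrow>
    (real^'d \<Rightarrow> complex^'r) \<Rightarrow> bool" where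
  "universal_supervector s k B v \<longleftrightarrow>
     v \<in> borel_measurable lebesgue \<and>
     (\<forall>\<^sub>F \<omega> in ae_nhds 0. qform (gramian s B \<omega>) (v \<omega>) \<noteq> 0) \<and>
     (\<lambda>\<omega>. qform (gramian0 s B \<omega>) (v \<omega>) / qform (gramian s B \<omega>) (v \<omega>))
       \<in> O[ae_nhds 0](\<lambda>\<omega>. norm \<omega> powr (2 * k - 2 * s))"

end

theory Submission
  imports Defs
begin

text \<open>
 Let \<open>f = v\<^sup>*\<Phi>\<^sup>^\<close> be the symbol of \<open>\<Phi> \<in> R\<close>. As \<open>v\<close> is periodic, \<open>v\<^sup>*G\<^sup>0v\<close> at \<open>\<omega>\<close> is the sum of
 \<open>|\<omega> + \<alpha>|\<^sup>2\<^sup>s |f(\<omega> + \<alpha>)|\<^sup>2\<close> over the basis of \<open>R\<close> and the lattice points \<open>\<alpha> \<noteq> 0\<close>. So the main claim is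
 that the weighted \<open>\<ell>\<^sub>2\<close> norm of \<open>(f(\<omega> + \<alpha>))\<close>, \<open>\<alpha> \<noteq> 0\<close>, is \<open>O(|\<omega>|\<^sup>k)\<close>; this is \<open>symb_l2\<close>, on which
 everything else rests.

 The refinement equation and Condition \<open>Z\<^sub>k\<close> give a scalar recursion (\<open>symbol_recursion\<close>): for a lattice
 point \<open>\<beta>\<close> and a vertex \<open>l\<close>, \<open>f(2(\<omega> + \<pi>l + \<beta>))\<close> equals \<open>f(\<omega> + \<beta>)\<close> if \<open>l = 0\<close> and \<open>0\<close> otherwise, up to
 \<open>O(|\<omega>|\<^sup>k) |\<Phi>\<^sup>^(\<omega> + \<pi>l + \<beta>)|\<close>, and (A1) bounds the \<open>\<ell>\<^sub>2\<close> norms of these errors. Each nonzero lattice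
 point is a power of two times a point that is not in twice the lattice, so the recursion can be
 followed along dyadic orbits. It is used in three ways.

 If \<open>s < k\<close> and the lattice points other than the origin contribute a bounded amount to the Gramian, which
 is automatic for \<open>s \<ge> 0\<close>, each doubling contracts a bound \<open>O(|\<omega>|\<^sup>k)\<close> by \<open>2\<^sup>s\<^sup>-\<^sup>k\<close>, and a geometric
 series gives the claim. If \<open>k <= s\<close> the recursion is read inwards, starting from the bounds in (A3) away
 from the origin. If \<open>s < 0\<close>, the order \<open>k\<close> is an integer and the errors are integrable enough, the
 recursion shows that \<open>f\<close> vanishes in the mean to order more than \<open>k - 1\<close> at every nonzero lattice
 point; the weak derivatives of order \<open>k\<close> in (A3) then give \<open>f(\<omega> + \<beta>) = O(M\<^sub>\<beta> |\<omega>|\<^sup>k)\<close> with square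
 summable weighted constants, by Taylor's theorem.

 The value of \<open>f\<close> at the origin comes from the same recursion, telescoped along \<open>\<omega>/2\<^sup>n\<close>. The claims on
 supervectors and coherent approximation are quotients of the estimates of \<open>v\<^sup>*G\<^sup>0v\<close> and \<open>v\<^sup>*Gv\<close>; the two
 sufficient conditions for a lower bound of \<open>v\<^sup>*Gv\<close> are linear algebra.

 For the approximation order, let \<open>F\<close> be the Fourier transform of the given function. An ideal approximant
 has, after dilation, the Fourier transform \<open>b f\<close>, where \<open>b\<close> is the periodization of \<open>F(\<cdot>/h)/f\<close>
 restricted to a ball. It reproduces \<open>F\<close> on a ball of radius of order \<open>1/h\<close>. The tail of \<open>F\<close> is
 \<open>O(h\<^sup>k\<^sup>-\<^sup>s)\<close> for functions in \<open>W\<^sub>2\<^sup>k\<close>, and the aliasing error folds back to the ball, where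
 the \<open>\<ell>\<^sub>2\<close> bound for \<open>f\<close> applies (\<open>far_field\<close>). As \<open>b f = \<Sum> b v\<^sub>i\<^sup>* \<Phi>\<^sub>i\<^sup>^\<close> with bounded periodic factors, which
 trigonometric polynomials approximate in the relevant weighted spaces, it is enough to use finite
 combinations of integer translates of the entries of \<open>\<Phi>\<close>.
\<close>

text \<open>The measurability statements below are about Lebesgue sets, as Fourier transforms are determined
 only up to null sets.\<close>

abbreviation lmeas :: "('a::euclidean_space => 'b::topological_space) set" where
 "lmeas \<equiv> borel_measurable lebesgue"

section \<open>Affine substitutions and almost-everywhere statements\<close>

lemma lebesgue_affine:
 fixes a :: "'a::euclidean_space"
 assumes "c \<noteq> 0"
 shows "(\<lambda>x. a + c *\<^sub>R x) \<in> lebesgue \<rightarrow>\<^sub>M lebesgue"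
  and "lebesgue = density (distr lebesgue lebesgue (\<lambda>x. a + c *\<^sub>R x)) (\<lambda>_. ennreal (\<bar>c\<bar> ^ DIM('a)))"
proof -
 have T: "(\<lambda>x. a + (\<Sum>j\<in>Basis. (c * (x \<bullet> j)) *\<^sub>R j)) = (\<lambda>x. a + c *\<^sub>R x)"
  unfolding scaleR_scaleR[symmetric] scaleR_sum_right[symmetric] euclidean_representation ..
 show "(\<lambda>x. a + c *\<^sub>R x) \<in> lebesgue \<rightarrow>\<^sub>M lebesgue"
  using lebesgue_affine_measurable[of "\<lambda>_. c" a] assms unfolding T by simp
 show "lebesgue = density (distr lebesgue lebesgue (\<lambda>x. a + c *\<^sub>R x)) (\<lambda>_. ennreal (\<bar>c\<bar> ^ DIM('a)))"
  using lebesgue_affine_euclidean[of "\<lambda>_. c" a] assms unfolding T by simp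
qed

lemma measurable_affine:
 fixes a :: "'a::euclidean_space" and f :: "'a => 'b::topological_space"
 assumes "c \<noteq> 0" "f \<in> lmeas"
 shows "(\<lambda>x. f (a + c *\<^sub>R x)) \<in> lmeas"
 using measurable_compose[OF lebesgue_affine(1)[OF assms(1)] assms(2)] .

lemma nn_integral_affine:
 fixes a :: "'a::euclidean_space"
 assumes c: "c \<noteq> 0" and f: "f \<in> lmeas"
 shows "(\<integral>\<^sup>+x. f x \<partial>lebesgue) = ennreal (\<bar>c\<bar> ^ DIM('a)) * (\<integral>\<^sup>+x. f (a + c *\<^sub>R x) \<partial>lebesgue)"
proof -
 have "(\<integral>\<^sup>+x. f x \<partial>lebesgue) = (\<integral>\<^sup>+x. f x \<partial>density (distr lebesgue lebesgue (\<lambda>x. a + c *\<^sub>R x)) (\<lambda>_. ennreal (\<bar>c\<bar> ^ DIM('a))))"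
  using lebesgue_affine(2)[OF c, of a] by simp
 also have "... = (\<integral>\<^sup>+x. ennreal (\<bar>c\<bar> ^ DIM('a)) * f x \<partial>distr lebesgue lebesgue (\<lambda>x. a + c *\<^sub>R x))"
  using f by (intro nn_integral_density) auto
 also have "... = (\<integral>\<^sup>+x. ennreal (\<bar>c\<bar> ^ DIM('a)) * f (a + c *\<^sub>R x) \<partial>lebesgue)"
  using f by (intro nn_integral_distr lebesgue_affine(1)[OF c]) auto
 also have "... = ennreal (\<bar>c\<bar> ^ DIM('a)) * (\<integral>\<^sup>+x. f (a + c *\<^sub>R x) \<partial>lebesgue)"
  by (intro nn_integral_cmult measurable_affine[OF c f])
 finally show ?thesis .
qed

lemma AE_affine:
 fixes a :: "'a::euclidean_space"
 assumes c: "c \<noteq> 0" and "AE x in lebesgue. Q x"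
 shows "AE x in lebesgue. Q (a + c *\<^sub>R x)"
proof -
 obtain N where N: "N \<in> null_sets lebesgue" "{x \<in> space lebesgue. \<not> Q x} \<subseteq> N"
  using assms(2) unfolding eventually_ae_filter by blast
 then have sN: "N \<in> sets lebesgue" by blast
 then have iN: "(indicator N :: 'a => ennreal) \<in> lmeas"
  by (rule borel_measurable_indicator)
 have "emeasure lebesgue N = \<integral>\<^sup>+x. indicator N x \<partial>lebesgue"
  using sN by (simp del: space_completion emeasure_completion)
 also have "... = ennreal (\<bar>c\<bar> ^ DIM('a)) * (\<integral>\<^sup>+x. indicator N (a + c *\<^sub>R x) \<partial>lebesgue)"
  by (rule nn_integral_affine[OF c iN])
 finally have "(\<integral>\<^sup>+x. indicator N (a + c *\<^sub>R x) \<partial>lebesgue) = 0"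
  using N c by (auto simp: null_setsD1)
 then have "AE x in lebesgue. indicator N (a + c *\<^sub>R x) = (0::ennreal)"
  using nn_integral_0_iff_AE[OF measurable_affine[OF c iN, of a]] by simp
 then show ?thesis
  by eventually_elim (use N(2) in \<open>auto simp: indicator_def split: if_splits\<close>)
qed

lemma integral_affine:
 fixes a :: "'a::euclidean_space" and f :: "'a => 'b::{banach, second_countable_topology}"
 assumes c: "c \<noteq> 0" and f: "f \<in> lmeas"
 shows "(\<integral>x. f x \<partial>lebesgue) = (\<bar>c\<bar> ^ DIM('a)) *\<^sub>R (\<integral>x. f (a + c *\<^sub>R x) \<partial>lebesgue)"
proof -
 have "(\<integral>x. f x \<partial>lebesgue) = (\<integral>x. f x \<partial>density (distr lebesgue lebesgue (\<lambda>x. a + c *\<^sub>R x)) (\<lambda>_. ennreal (\<bar>c\<bar> ^ DIM('a))))"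
  using lebesgue_affine(2)[OF c, of a] by simp
 also have "... = (\<integral>x. (\<bar>c\<bar> ^ DIM('a)) *\<^sub>R f x \<partial>distr lebesgue lebesgue (\<lambda>x. a + c *\<^sub>R x))"
  using f by (intro integral_density) auto
 also have "... = (\<integral>x. (\<bar>c\<bar> ^ DIM('a)) *\<^sub>R f (a + c *\<^sub>R x) \<partial>lebesgue)"
  using f by (intro integral_distr lebesgue_affine(1)[OF c]) auto
 finally show ?thesis by simp
qed

lemma integrable_affine:
 fixes a :: "'a::euclidean_space" and f :: "'a => 'b::{banach, second_countable_topology}"
 assumes c: "c \<noteq> 0" and f: "integrable lebesgue f"
 shows "integrable lebesgue (\<lambda>x. f (a + c *\<^sub>R x))"
proof (rule integrableI_bounded)
 show "(\<lambda>x. f (a + c *\<^sub>R x)) \<in> lmeas"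
  by (rule measurable_affine[OF c borel_measurable_integrable[OF f]])
 have "(\<integral>\<^sup>+x. norm (f x) \<partial>lebesgue) = ennreal (\<bar>c\<bar> ^ DIM('a)) * (\<integral>\<^sup>+x. norm (f (a + c *\<^sub>R x)) \<partial>lebesgue)"
  using f by (intro nn_integral_affine[OF c]) auto
 moreover have "(\<integral>\<^sup>+x. norm (f x) \<partial>lebesgue) < \<infinity>"
  using f by (auto simp: integrable_iff_bounded)
 ultimately show "(\<integral>\<^sup>+x. norm (f (a + c *\<^sub>R x)) \<partial>lebesgue) < \<infinity>"
  using c by (auto simp: ennreal_mult_less_top)
qed

text \<open>A filter-free form of "almost everywhere near \<open>x\<close>": all local estimates below are stated
 for almost all points of a ball.\<close>

lemma eventually_ae_nhds:
 "eventually Q (ae_nhds x) \<longleftrightarrow> (\<exists>\<rho>>0. AE \<omega> in lebesgue. dist \<omega> x < \<rho> --> Q \<omega>)"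
proof
 assume "eventually Q (ae_nhds x)"
 then obtain A B where A: "eventually A (nhds x)" and B: "AE \<omega> in lebesgue. B \<omega>"
  and AB: "\<And>\<omega>. A \<omega> ==> B \<omega> ==> Q \<omega>"
  unfolding ae_nhds_def eventually_inf by blast
 obtain \<rho> where "\<rho> > 0" "\<And>\<omega>. dist \<omega> x < \<rho> ==> A \<omega>"
  using A unfolding eventually_nhds_metric by blast
 then show "\<exists>\<rho>>0. AE \<omega> in lebesgue. dist \<omega> x < \<rho> --> Q \<omega>"
  using B AB by (intro exI[of _ \<rho>]) (auto elim!: eventually_mono)
next
 assume "\<exists>\<rho>>0. AE \<omega> in lebesgue. dist \<omega> x < \<rho> --> Q \<omega>"
 then obtain \<rho> where "\<rho> > 0" "AE \<omega> in lebesgue. dist \<omega> x < \<rho> --> Q \<omega>" by blast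
 then show "eventually Q (ae_nhds x)"
  unfolding ae_nhds_def eventually_inf
  by (intro exI[of _ "\<lambda>\<omega>. dist \<omega> x < \<rho>"] exI[of _ "\<lambda>\<omega>. dist \<omega> x < \<rho> --> Q \<omega>"])
   (auto simp: eventually_nhds_metric)
qed

lemma eventually_ae_nhds_0:
 "eventually Q (ae_nhds 0) \<longleftrightarrow> (\<exists>\<rho>>0. AE \<omega> in lebesgue. norm \<omega> < \<rho> --> Q \<omega>)"
 by (simp add: eventually_ae_nhds dist_norm)

lemma bigo_ae_nhds_0D:
 assumes "f \<in> O[ae_nhds 0](g)"
 obtains C \<rho> where "C > 0" "\<rho> > 0" "AE \<omega> in lebesgue. norm \<omega> < \<rho> --> norm (f \<omega>) <= C * norm (g \<omega>)"
 using assms unfolding bigo_def eventually_ae_nhds_0 by auto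

lemma bigo_ae_nhds_0I:
 assumes "\<rho> > 0" "AE \<omega> in lebesgue. norm \<omega> < \<rho> --> norm (f \<omega>) <= C * norm (g \<omega>)"
 shows "f \<in> O[ae_nhds 0](g)"
 by (rule bigoI[of _ C], subst eventually_ae_nhds_0) (use assms in auto)

text \<open>Almost every point has a good dyadic orbit; this is what makes the recursion
 \<open>\<omega> \<mapsto> \<omega>/2\<close> harmless for functions that are known only almost everywhere.\<close>

lemma AE_dyadic_orbit:
 fixes Q :: "'a::euclidean_space => bool"
 assumes "AE x in lebesgue. norm x < \<rho> --> Q x"
 shows "AE x in lebesgue. norm x < \<rho> --> (\<forall>n. Q ((1/2)^n *\<^sub>R x))"
proof -
 have "AE x in lebesgue. norm (0 + (1/2::real)^n *\<^sub>R x) < \<rho> --> Q (0 + (1/2)^n *\<^sub>R x)" for n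
  by (rule AE_affine[OF _ assms]) simp
 then have "AE x in lebesgue. \<forall>n. norm (0 + (1/2::real)^n *\<^sub>R x) < \<rho> --> Q (0 + (1/2)^n *\<^sub>R x)"
  by (simp add: AE_all_countable)
 then show ?thesis
 proof eventually_elim
  case (elim x)
  show ?case
  proof (intro impI allI)
   fix n assume "norm x < \<rho>"
   have "(1/2::real)^n * norm x <= 1 * norm x"
    by (intro mult_right_mono power_le_one) auto
   then show "Q ((1/2)^n *\<^sub>R x)"
    using elim[rule_format, of n] \<open>norm x < \<rho>\<close> by simp
  qed
 qed
qed

section \<open>Smooth bumps\<close>

text \<open>A function of one variable together with all its derivatives: carrying the derivatives
 along makes products and mixed partial derivatives explicit.\<close>

definition derivs :: "(nat => real => real) => bool" where
 "derivs b \<longleftrightarrow> (\<forall>n x. (b n has_real_derivative b (Suc n) x) (at x))"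

primrec exp_inv_poly :: "nat => real poly" where
 "exp_inv_poly 0 = 1"
| "exp_inv_poly (Suc n) = monom 1 2 * (exp_inv_poly n - pderiv (exp_inv_poly n))"

definition exp_inv :: "nat => real => real" where
 "exp_inv n x = (if x > 0 then poly (exp_inv_poly n) (1/x) * exp (- 1/x) else 0)"

lemma poly_exp_minus_tendsto_0: "((\<lambda>y::real. poly p y * exp (- y)) \<longlongrightarrow> 0) at_top"
proof -
 have "((\<lambda>y::real. \<Sum>i\<le>degree p. coeff p i * (y ^ i / exp y)) \<longlongrightarrow> (\<Sum>i\<le>degree p. coeff p i * 0)) at_top"
  by (intro tendsto_intros tendsto_power_div_exp_0)
 then show ?thesis
  by (simp add: poly_altdef sum_distrib_right exp_minus divide_inverse mult.assoc)
qed

text \<open>The derivatives of \<open>exp (-1/x)\<close> are polynomials in \<open>1/x\<close> times \<open>exp (-1/x)\<close>, hence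
 vanish to infinite order at \<open>0\<close>.\<close>

lemma derivs_exp_inv: "derivs exp_inv"
 unfolding derivs_def
proof (intro allI)
 fix n x
 consider "x > 0" | "x < 0" | "x = (0::real)" by linarith
 then show "(exp_inv n has_real_derivative exp_inv (Suc n) x) (at x)"
 proof cases
  case 1
  have "((\<lambda>x. poly (exp_inv_poly n) (1/x) * exp (- 1/x)) has_real_derivative
    poly (pderiv (exp_inv_poly n)) (1/x) * (- (1/x^2)) * exp (- 1/x) +
    poly (exp_inv_poly n) (1/x) * (exp (- 1/x) * (1/x^2))) (at x)"
   using 1 by (auto intro!: derivative_eq_intros poly_DERIV[THEN DERIV_chain2] simp: power2_eq_square)
  also have "poly (pderiv (exp_inv_poly n)) (1/x) * (- (1/x^2)) * exp (- 1/x) +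
    poly (exp_inv_poly n) (1/x) * (exp (- 1/x) * (1/x^2)) = exp_inv (Suc n) x"
   using 1 by (simp add: exp_inv_def poly_monom field_simps power2_eq_square)
  finally show ?thesis
   by (rule has_field_derivative_transform_within_open[where S="{0<..}"]) (use 1 in \<open>auto simp: exp_inv_def\<close>)
 next
  case 2
  have "((\<lambda>x. 0) has_real_derivative exp_inv (Suc n) x) (at x)"
   using 2 by (auto simp: exp_inv_def)
  then show ?thesis
   by (rule has_field_derivative_transform_within_open[where S="{..<0}"]) (use 2 in \<open>auto simp: exp_inv_def\<close>)
 next
  case 3
  have "((\<lambda>h. exp_inv n h / h) \<longlongrightarrow> 0) (at 0)"
  proof (rule filterlim_split_at)
   show "((\<lambda>h. exp_inv n h / h) \<longlongrightarrow> 0) (at_left 0)"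
    by (rule tendsto_eventually) (auto simp: eventually_at_filter exp_inv_def)
   have "((\<lambda>h. poly (monom 1 1 * exp_inv_poly n) (inverse h) * exp (- inverse h)) \<longlongrightarrow> 0) (at_right 0)"
    by (rule filterlim_compose[OF poly_exp_minus_tendsto_0 filterlim_inverse_at_top_right])
   then show "((\<lambda>h. exp_inv n h / h) \<longlongrightarrow> 0) (at_right 0)"
    by (rule Lim_transform_eventually)
     (auto simp: eventually_at_filter exp_inv_def poly_monom field_simps)
  qed
  then show ?thesis
   using 3 by (simp add: has_field_derivative_iff exp_inv_def)
 qed
qed

lemma derivs_affine: "derivs b ==> derivs (\<lambda>n x. c ^ n * b n (c * x + a))"
 unfolding derivs_def
proof (intro allI)
 fix n x assume b: "\<forall>n x. (b n has_real_derivative b (Suc n) x) (at x)"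
 have "((\<lambda>x. b n (c * x + a)) has_real_derivative b (Suc n) (c * x + a) * c) (at x)"
  using b by (auto intro!: derivative_eq_intros DERIV_chain2[of "b n"])
 from DERIV_cmult[OF this, of "c ^ n"]
 show "((\<lambda>x. c ^ n * b n (c * x + a)) has_real_derivative c ^ Suc n * b (Suc n) (c * x + a)) (at x)"
  by (simp add: mult_ac)
qed

fun leibniz :: "(nat => real => real) => (nat => real => real) => nat => real => real" where
 "leibniz f g n x = (\<Sum>i\<le>n. of_nat (n choose i) * f i x * g (n - i) x)"

declare leibniz.simps [simp del]

lemma derivs_leibniz:
 assumes "derivs f" "derivs g"
 shows "derivs (leibniz f g)"
 unfolding derivs_def
proof (intro allI)
 fix n x
 have D: "(leibniz f g n has_real_derivative
   (\<Sum>i\<le>n. of_nat (n choose i) * (f (Suc i) x * g (n - i) x + f i x * g (Suc n - i) x))) (at x)"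
 proof -
  have "((\<lambda>x. \<Sum>i\<le>n. of_nat (n choose i) * f i x * g (n - i) x) has_real_derivative
   (\<Sum>i\<le>n. of_nat (n choose i) * (f (Suc i) x * g (n - i) x + f i x * g (Suc n - i) x))) (at x)"
   by (rule DERIV_sum, rule derivative_eq_intros, rule derivative_eq_intros, rule derivative_eq_intros)
    (use assms in \<open>auto simp: derivs_def Suc_diff_le algebra_simps\<close>)
  then show ?thesis by (simp add: leibniz.simps[abs_def])
 qed
 have "(\<Sum>i\<le>n. of_nat (n choose i) * (f (Suc i) x * g (n - i) x + f i x * g (Suc n - i) x)) =
  (\<Sum>i\<le>n. of_nat (n choose i) * f (Suc i) x * g (n - i) x) + (\<Sum>i\<le>n. of_nat (n choose i) * f i x * g (Suc n - i) x)"
  by (simp add: sum.distrib algebra_simps)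
 also have "(\<Sum>i\<le>n. of_nat (n choose i) * f i x * g (Suc n - i) x) =
  f 0 x * g (Suc n) x + (\<Sum>i\<le>n. of_nat (n choose Suc i) * f (Suc i) x * g (n - i) x)"
 proof -
  have "(\<Sum>i\<le>n. of_nat (n choose i) * f i x * g (Suc n - i) x) = (\<Sum>i\<le>Suc n. of_nat (n choose i) * f i x * g (Suc n - i) x)"
   by (simp add: binomial_eq_0)
  also have "... = f 0 x * g (Suc n) x + (\<Sum>i\<le>n. of_nat (n choose Suc i) * f (Suc i) x * g (n - i) x)"
   by (subst sum.atMost_Suc_shift) simp
  finally show ?thesis .
 qed
 also have "(\<Sum>i\<le>n. of_nat (n choose i) * f (Suc i) x * g (n - i) x) +
  (f 0 x * g (Suc n) x + (\<Sum>i\<le>n. of_nat (n choose Suc i) * f (Suc i) x * g (n - i) x)) =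
  f 0 x * g (Suc n) x + (\<Sum>i\<le>n. of_nat (Suc n choose Suc i) * f (Suc i) x * g (n - i) x)"
  by (simp add: sum.distrib[symmetric] algebra_simps)
 also have "... = leibniz f g (Suc n) x"
  unfolding leibniz.simps by (subst sum.atMost_Suc_shift) simp
 finally show "(leibniz f g n has_real_derivative leibniz f g (Suc n) x) (at x)"
  using D by simp
qed

text \<open>A smooth function supported in the interval \<open>[l, u]\<close> that approaches the
 indicator of its interior as \<open>m \<rightarrow> \<infinity>\<close>.\<close>

definition bump1 :: "nat => real => real => nat => real => real" where
 "bump1 m l u = leibniz (\<lambda>n x. real (Suc m) ^ n * exp_inv n (real (Suc m) * x + (- real (Suc m) * l)))
            (\<lambda>n x. (- real (Suc m)) ^ n * exp_inv n (- real (Suc m) * x + real (Suc m) * u))"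

lemma derivs_bump1: "derivs (bump1 m l u)"
 unfolding bump1_def by (intro derivs_leibniz derivs_affine derivs_exp_inv)

lemma bump1_outside: "x \<notin> {l<..<u} ==> bump1 m l u n x = 0"
proof -
 assume x: "x \<notin> {l<..<u}"
 have "exp_inv i (real (Suc m) * x + (- real (Suc m) * l)) = 0 \<or> exp_inv j (- real (Suc m) * x + real (Suc m) * u) = 0" for i j
 proof (cases "x <= l")
  case True
  then have "real (Suc m) * (x - l) <= 0" by (intro mult_nonneg_nonpos) auto
  then show ?thesis by (auto simp: exp_inv_def algebra_simps)
 next
  case False
  then have "real (Suc m) * (u - x) <= 0" using x by (intro mult_nonneg_nonpos) auto
  then show ?thesis by (auto simp: exp_inv_def algebra_simps)
 qed
 then show ?thesis
  unfolding bump1_def leibniz.simps by (intro sum.neutral) (auto simp del: of_nat_Suc)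
qed

lemma exp_inv_0_bounds: "0 <= exp_inv 0 x" "exp_inv 0 x <= 1"
 by (auto simp: exp_inv_def)

lemma bump1_0: "bump1 m l u 0 x = exp_inv 0 (real (Suc m) * (x - l)) * exp_inv 0 (real (Suc m) * (u - x))"
 by (simp add: bump1_def leibniz.simps algebra_simps del: of_nat_Suc)

lemma bump1_bounds: "0 <= bump1 m l u 0 x" "bump1 m l u 0 x <= 1"
 unfolding bump1_0 using exp_inv_0_bounds by (auto intro: mult_le_one)

lemma exp_inv_tendsto: "t > 0 ==> (\<lambda>m. exp_inv 0 (real (Suc m) * t)) \<longlonglongrightarrow> 1"
proof -
 assume t: "t > 0"
 have "(\<lambda>m. exp (- (inverse t * inverse (real (Suc m))))) \<longlonglongrightarrow> exp (- (inverse t * 0))"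
  by (intro tendsto_intros LIMSEQ_inverse_real_of_nat)
 moreover have "exp_inv 0 (real (Suc m) * t) = exp (- (inverse t * inverse (real (Suc m))))" for m
  using t by (simp add: exp_inv_def field_simps del: of_nat_Suc)
 ultimately show ?thesis by simp
qed

lemma bump1_tendsto: "(\<lambda>m. bump1 m l u 0 x) \<longlonglongrightarrow> indicator {l<..<u} x"
proof (cases "x \<in> {l<..<u}")
 case True
 then have "(\<lambda>m. exp_inv 0 (real (Suc m) * (x - l)) * exp_inv 0 (real (Suc m) * (u - x))) \<longlonglongrightarrow> 1 * 1"
  by (intro tendsto_mult exp_inv_tendsto) auto
 then show ?thesis using True by (simp add: bump1_0)
qed (simp add: bump1_outside)

section \<open>Products of one-variable functions as test functions\<close>

definition tensor :: "('d => nat => real => real) => ('d => nat) => real^'d::finite => complex" where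
 "tensor b \<gamma> x = of_real (\<Prod>i\<in>UNIV. b i (\<gamma> i) (x $ i))"

lemma has_derivative_tensor:
 assumes "\<forall>i. derivs (b i)"
 shows "(tensor b \<gamma> has_derivative (\<lambda>h. \<Sum>i\<in>UNIV. of_real (h $ i) * tensor b (\<gamma>(i := Suc (\<gamma> i))) x)) (at x)"
proof -
 have nth: "((\<lambda>x. x $ i) has_derivative (\<lambda>h. h $ i)) (at x)" for i
  using bounded_linear_imp_has_derivative[OF bounded_linear_vec_nth] .
 have "((\<lambda>x. b i (\<gamma> i) (x $ i)) has_derivative (\<lambda>h. b i (Suc (\<gamma> i)) (x $ i) * h $ i)) (at x)" for i
  using has_derivative_compose[OF nth, of "b i (\<gamma> i)" "(*) (b i (Suc (\<gamma> i)) (x $ i))" i] assms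
  by (simp add: derivs_def has_field_derivative_def)
 then have "((\<lambda>x. \<Prod>i\<in>UNIV. b i (\<gamma> i) (x $ i)) has_derivative
  (\<lambda>h. \<Sum>i\<in>UNIV. b i (Suc (\<gamma> i)) (x $ i) * h $ i * (\<Prod>j\<in>UNIV - {i}. b j (\<gamma> j) (x $ j)))) (at x)"
  by (intro has_derivative_prod) auto
 moreover have "b i (Suc (\<gamma> i)) (x $ i) * h $ i * (\<Prod>j\<in>UNIV - {i}. b j (\<gamma> j) (x $ j)) =
   h $ i * (\<Prod>j\<in>UNIV. b j ((\<gamma>(i := Suc (\<gamma> i))) j) (x $ j))" for i h
 proof -
  have "(\<Prod>j\<in>UNIV - {i}. b j (\<gamma> j) (x $ j)) = (\<Prod>j\<in>UNIV - {i}. b j ((\<gamma>(i := Suc (\<gamma> i))) j) (x $ j))"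
   by (rule prod.cong) auto
  then show ?thesis
   by (subst (2) prod.remove[of _ i]) auto
 qed
 ultimately have "((\<lambda>x. \<Prod>i\<in>UNIV. b i (\<gamma> i) (x $ i)) has_derivative
  (\<lambda>h. \<Sum>i\<in>UNIV. h $ i * (\<Prod>j\<in>UNIV. b j ((\<gamma>(i := Suc (\<gamma> i))) j) (x $ j)))) (at x)"
  by simp
 from has_derivative_of_real[OF this, where 'a=complex] show ?thesis
  unfolding tensor_def[abs_def] by simp
qed

lemma partial_tensor:
 assumes "\<forall>i. derivs (b i)"
 shows "partial i (tensor b \<gamma>) = tensor b (\<gamma>(i := Suc (\<gamma> i)))"
proof
 fix x
 have "partial i (tensor b \<gamma>) x = (\<Sum>j\<in>UNIV. of_real (axis i 1 $ j) * tensor b (\<gamma>(j := Suc (\<gamma> j))) x)"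
  unfolding partial_def frechet_derivative_at[OF has_derivative_tensor[OF assms], symmetric] ..
 also have "... = (\<Sum>j\<in>UNIV. if j = i then tensor b (\<gamma>(i := Suc (\<gamma> i))) x else 0)"
  by (intro sum.cong) (auto simp: axis_def)
 finally show "partial i (tensor b \<gamma>) x = tensor b (\<gamma>(i := Suc (\<gamma> i))) x" by simp
qed

lemma foldr_partial_tensor:
 assumes "\<forall>i. derivs (b i)"
 shows "foldr partial is (tensor b \<gamma>) = tensor b (\<lambda>i. \<gamma> i + count_list is i)"
proof (induction "is")
 case (Cons i "is")
 have "(\<lambda>i. \<gamma> i + count_list is i)(i := Suc (\<gamma> i + count_list is i)) = (\<lambda>j. \<gamma> j + count_list (i # is) j)"
  by (auto simp: fun_eq_iff)
 then show ?case using Cons by (simp add: partial_tensor[OF assms])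
qed simp

lemma smooth_on_tensor:
 assumes "\<forall>i. derivs (b i)"
 shows "smooth_on UNIV (tensor b \<gamma>)"
 unfolding smooth_on_def foldr_partial_tensor[OF assms] differentiable_on_def
 using differentiableI[OF has_derivative_tensor[OF assms]] by simp

lemma ex_count_list:
 fixes \<gamma> :: "'d::finite => nat"
 shows "\<exists>is. \<forall>i. count_list is i = \<gamma> i"
proof -
 have "\<exists>is. \<forall>i. count_list is i = (if i \<in> S then \<gamma> i else 0)" if "finite S" for S :: "'d set"
  using that
 proof induction
  case empty
  show ?case by (rule exI[of _ "[]"]) simp
 next
  case (insert j S)
  then obtain "is" where "is": "\<forall>i. count_list is i = (if i \<in> S then \<gamma> i else 0)" by blast
  have "count_list (replicate n j) i = (if i = j then n else 0)" for n i
   by (induction n) auto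
  then show ?case
   using "is" insert(2) by (intro exI[of _ "replicate (\<gamma> j) j @ is"]) auto
 qed
 from this[of UNIV] show ?thesis by simp
qed

text \<open>For tensor products the order of differentiation is visibly immaterial, so the
 iterated partial derivative in the definition of \<open>D\<^sup>\<gamma>\<close> can be evaluated.\<close>

lemma mderiv_tensor:
 assumes "\<forall>i. derivs (b i)"
 shows "mderiv \<gamma> (tensor b (\<lambda>_. 0)) x = tensor b \<gamma> x / (\<Prod>i\<in>UNIV. fact (\<gamma> i))"
proof -
 have "\<forall>i. count_list (SOME is. \<forall>i. count_list is i = \<gamma> i) i = \<gamma> i"
  by (rule someI_ex[OF ex_count_list])
 then show ?thesis
  unfolding mderiv_def foldr_partial_tensor[OF assms] by simp
qed

lemma continuous_on_tensor:
 assumes "\<forall>i. derivs (b i)"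
 shows "continuous_on A (tensor b \<gamma>)"
 by (intro continuous_at_imp_continuous_on ballI has_derivative_continuous[OF has_derivative_tensor[OF assms]])

lemma tensor_outside:
 assumes "\<And>i n x. x \<notin> {l$i..u$i} ==> b i n x = 0" "x \<notin> cbox l u"
 shows "tensor b \<gamma> x = 0"
proof -
 obtain i where "x $ i \<notin> {l$i..u$i}" using assms(2) by (auto simp: mem_box_cart)
 then show ?thesis using assms(1)[of "x$i" i] by (auto simp: tensor_def intro!: prod_zero)
qed

lemma test_function_tensor:
 assumes "\<forall>i. derivs (b i)" "\<And>i n x. x \<notin> {l$i..u$i} ==> b i n x = 0" "cbox l u \<subseteq> U"
 shows "test_function U (tensor b \<gamma>)"
 unfolding test_function_def using smooth_on_tensor[OF assms(1)] tensor_outside[OF assms(2)] assms(3)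
 by (auto intro!: exI[of _ "cbox l u"])

definition bump :: "nat => real^'d::finite => real^'d => real^'d => real" where
 "bump m l u x = (\<Prod>i\<in>UNIV. bump1 m (l $ i) (u $ i) 0 (x $ i))"

lemma bump_eq_tensor: "of_real (bump m l u x) = tensor (\<lambda>i. bump1 m (l $ i) (u $ i)) (\<lambda>_. 0) x"
 by (simp add: bump_def tensor_def)

lemma test_function_bump:
 "cbox l u \<subseteq> U ==> test_function U (\<lambda>x. of_real (bump m l u x))"
 unfolding bump_eq_tensor
 by (rule test_function_tensor[of _ l u]) (auto simp: derivs_bump1 bump1_outside)

lemma bump_bounds: "0 <= bump m l u x" "bump m l u x <= 1"
 unfolding bump_def using bump1_bounds by (auto intro!: prod_nonneg prod_le_1)

lemma bump_outside: "x \<notin> box l u ==> bump m l u x = 0"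
proof -
 assume "x \<notin> box l u"
 then obtain i where "x $ i \<notin> {l$i<..<u$i}" by (auto simp: mem_box_cart)
 then show ?thesis unfolding bump_def by (auto intro!: prod_zero bump1_outside)
qed

lemma bump_tendsto: "(\<lambda>m. bump m l u x) \<longlonglongrightarrow> indicator (box l u) x"
proof (cases "x \<in> box l u")
 case True
 have "(\<lambda>m. bump m l u x) \<longlonglongrightarrow> (\<Prod>i\<in>UNIV. indicator {l$i<..<u$i} (x$i))"
  unfolding bump_def by (intro tendsto_prod bump1_tendsto)
 also have "(\<Prod>i\<in>UNIV. indicator {l$i<..<u$i} (x$i)) = (1::real)"
  using True by (intro prod.neutral) (auto simp: mem_box_cart)
 finally show ?thesis using True by simp
qed (simp add: bump_outside)

lemma bump_measurable [measurable]: "bump m l u \<in> borel_measurable borel"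
proof -
 have "continuous_on UNIV (\<lambda>x. Re (tensor (\<lambda>i. bump1 m (l $ i) (u $ i)) (\<lambda>_. 0) x))"
  by (intro continuous_intros continuous_on_tensor allI derivs_bump1)
 then have "continuous_on UNIV (bump m l u)"
  unfolding bump_eq_tensor[symmetric] by simp
 then show ?thesis by (rule borel_measurable_continuous_onI)
qed

section \<open>Essential bounds from testing\<close>

text \<open>An inequality between two measures that holds on all open boxes holds on all Borel sets:
 open sets are, up to null sets, countable disjoint unions of open boxes, and finite
 measures are outer regular.\<close>

lemma nn_integral_le_from_boxes:
 fixes h w :: "'a::euclidean_space => ennreal"
 assumes [measurable]: "h \<in> borel_measurable borel" "w \<in> borel_measurable borel"
  and le: "\<And>l u. cbox l u \<subseteq> box p q ==> (\<integral>\<^sup>+x\<in>box l u. h x \<partial>lborel) <= (\<integral>\<^sup>+x\<in>box l u. w x \<partial>lborel)"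
  and fin: "(\<integral>\<^sup>+x\<in>box p q. w x \<partial>lborel) < \<infinity>"
  and A: "A \<in> sets borel" "A \<subseteq> box p q"
 shows "(\<integral>\<^sup>+x\<in>A. h x \<partial>lborel) <= (\<integral>\<^sup>+x\<in>A. w x \<partial>lborel)"
proof -
 have op: "(\<integral>\<^sup>+x\<in>V. h x \<partial>lborel) <= (\<integral>\<^sup>+x\<in>V. w x \<partial>lborel)" if V: "open V" "V \<subseteq> box p q" for V
 proof (cases "V = {}")
  case False
  then have ne: "box p q \<noteq> {}" using V by auto
  define g where "g x = (if x \<in> V then V else ball x 1)" for x
  have "gauge g" using V by (auto simp: gauge_def g_def)
  have "V \<subseteq> cbox p q" using V box_subset_cbox by blast
  obtain \<D> where D: "countable \<D>" "\<And>K. K \<in> \<D> ==> interior K \<noteq> {} \<and> (\<exists>c d. K = cbox c d)"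
   "pairwise (\<lambda>A B. interior A \<inter> interior B = {}) \<D>"
   "\<And>K. K \<in> \<D> ==> \<exists>x \<in> V \<inter> K. K \<subseteq> g x" "V \<subseteq> \<Union>\<D>"
   using covering_lemma[OF \<open>V \<subseteq> cbox p q\<close> ne \<open>gauge g\<close>] by metis
  have KV: "K \<subseteq> V" if "K \<in> \<D>" for K
   using D(4)[OF that] by (auto simp: g_def)
  define T where "T = (\<Union>K\<in>\<D>. interior K)"
  have TV: "T \<subseteq> V" using KV interior_subset by (fastforce simp: T_def)
  have meas[measurable]: "T \<in> sets borel" "V \<in> sets borel"
   unfolding T_def using V by (auto intro!: borel_open)
  have "V - T \<subseteq> (\<Union>K\<in>\<D>. K - interior K)" using D(5) by (auto simp: T_def)
  moreover have "negligible (\<Union>K\<in>\<D>. K - interior K)"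
  proof (intro negligible_countable_Union countable_image D(1))
   fix N assume "N \<in> (\<lambda>K. K - interior K) ` \<D>"
   then obtain K where K: "K \<in> \<D>" "N = K - interior K" by blast
   then obtain c d where "K = cbox c d" using D(2) by blast
   then have "N = cbox c d - box c d" using K by (simp add: interior_cbox)
   then show "negligible N" by (simp add: negligible_frontier_interval)
  qed
  ultimately have "negligible (V - T)" by (rule negligible_subset[rotated])
  then have nul: "AE x in lborel. x \<notin> V - T"
   by (intro AE_not_in) (auto simp: negligible_iff_null_sets null_sets_completion_iff)
  have split: "(\<integral>\<^sup>+x\<in>V. f x \<partial>lborel) = (\<integral>\<^sup>+K. (\<integral>\<^sup>+x\<in>interior K. f x \<partial>lborel) \<partial>count_space \<D>)"
   if f[measurable]: "f \<in> borel_measurable borel" for f :: "'a => ennreal"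
  proof -
   have "(\<integral>\<^sup>+x\<in>V. f x \<partial>lborel) = (\<integral>\<^sup>+x\<in>T. f x \<partial>lborel)"
    using nul TV by (intro nn_integral_cong_AE) (auto elim!: eventually_mono simp: indicator_def)
   also have "... = emeasure (density lborel f) T"
    by (simp add: emeasure_density)
   also have "... = (\<integral>\<^sup>+K. emeasure (density lborel f) (interior K) \<partial>count_space \<D>)"
    unfolding T_def
    by (rule emeasure_UN_countable) (use D in \<open>auto simp: pairwise_def disjoint_family_on_def\<close>)
   also have "... = (\<integral>\<^sup>+K. (\<integral>\<^sup>+x\<in>interior K. f x \<partial>lborel) \<partial>count_space \<D>)"
    by (intro nn_integral_cong) (simp add: emeasure_density)
   finally show ?thesis .
  qed
  show ?thesis
   unfolding split[OF assms(1)] split[OF assms(2)]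
  proof (rule nn_integral_mono)
   fix K assume "K \<in> space (count_space \<D>)"
   then have K: "K \<in> \<D>" by simp
   then obtain c d where "K = cbox c d" using D(2) by blast
   then show "(\<integral>\<^sup>+x\<in>interior K. h x \<partial>lborel) <= (\<integral>\<^sup>+x\<in>interior K. w x \<partial>lborel)"
    using le[of c d] KV[OF K] V(2) by (simp add: interior_cbox)
  qed
 qed auto
 define M where "M = density lborel (\<lambda>x. w x * indicator (box p q) x)"
 have "emeasure M (space M) \<noteq> \<infinity>"
  using fin by (simp add: M_def emeasure_density)
 then have reg: "emeasure M A = (INF V \<in> {V. A \<subseteq> V \<and> open V}. emeasure M V)"
  using A by (intro outer_regular) (auto simp: M_def)
 have eM: "emeasure M V = (\<integral>\<^sup>+x\<in>V \<inter> box p q. w x \<partial>lborel)" if "V \<in> sets borel" for V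
  using that by (simp add: M_def emeasure_density mult.assoc indicator_inter_arith[symmetric] Int_commute)
 have "(\<integral>\<^sup>+x\<in>A. h x \<partial>lborel) <= emeasure M A"
  unfolding reg
 proof (rule INF_greatest)
  fix V assume "V \<in> {V. A \<subseteq> V \<and> open V}"
  then have V: "A \<subseteq> V" "open V" by auto
  have "(\<integral>\<^sup>+x\<in>A. h x \<partial>lborel) <= (\<integral>\<^sup>+x\<in>V \<inter> box p q. h x \<partial>lborel)"
   using V A by (intro nn_integral_mono) (auto simp: indicator_def)
  also have "... <= (\<integral>\<^sup>+x\<in>V \<inter> box p q. w x \<partial>lborel)"
   using V by (intro op) auto
  finally show "(\<integral>\<^sup>+x\<in>A. h x \<partial>lborel) <= emeasure M V"
   using V by (simp add: eM)
 qed
 also have "emeasure M A = (\<integral>\<^sup>+x\<in>A. w x \<partial>lborel)"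
  using A eM[of A] by (simp add: Int_absorb2)
 finally show ?thesis .
qed

text \<open>The previous lemma, applied to the positive and the negative part of \<open>g\<close>.\<close>

lemma AE_nonpos_from_boxes:
 fixes g :: "'a::euclidean_space => real"
 assumes g: "set_integrable lebesgue (cbox p q) g"
  and le: "\<And>l u. cbox l u \<subseteq> box p q ==> (LINT x:box l u|lebesgue. g x) <= 0"
 shows "AE x in lebesgue. x \<in> box p q --> g x <= 0"
proof -
 define g1 where "g1 = (\<lambda>x. indicator (box p q) x *\<^sub>R g x)"
 have sb: "set_integrable lebesgue (box l u) g" if "box l u \<subseteq> cbox p q" for l u
  using set_integrable_subset[OF g _ that] by auto
 have g1i: "integrable lebesgue g1"
  using sb[of p q] box_subset_cbox unfolding g1_def set_integrable_def by blast
 then have "g1 \<in> lmeas" by auto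
 then obtain g' where g'[measurable]: "g' \<in> borel_measurable lborel" and eq: "AE x in lborel. g1 x = g' x"
  using completion_ex_borel_measurable_real by blast
 have g'_leb: "g' \<in> lmeas"
  using g' by (rule measurable_completion)
 have eqc: "AE x in lebesgue. g' x = g1 x"
  using AE_completion[OF eq] by eventually_elim simp
 have g'i: "integrable lborel g'"
 proof -
  have "integrable lebesgue g'"
   by (rule integrable_cong_AE[THEN iffD1, OF _ g'_leb _ g1i]) (use g1i eqc in auto)
  then show ?thesis by (simp add: integrable_completion[OF g'])
 qed
 have bx: "(\<integral>\<^sup>+x\<in>box l u. ennreal (g' x) \<partial>lborel) <= (\<integral>\<^sup>+x\<in>box l u. ennreal (- g' x) \<partial>lborel)"
  if lu: "cbox l u \<subseteq> box p q" for l u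
 proof -
  have bq: "box l u \<subseteq> box p q" using lu box_subset_cbox by blast
  have ind: "(indicator (box l u) :: 'a => real) \<in> lmeas"
   by (rule borel_measurable_indicator) simp
  have int: "integrable lborel (\<lambda>x. indicator (box l u) x *\<^sub>R g' x)"
   using g'i by (intro integrable_mult_indicator) auto
  have "(LINT x:box l u|lebesgue. g x) = (\<integral>x. indicator (box l u) x *\<^sub>R g1 x \<partial>lebesgue)"
   unfolding set_lebesgue_integral_def g1_def using bq
   by (intro Bochner_Integration.integral_cong) (auto simp: indicator_def)
  also have "... = (\<integral>x. indicator (box l u) x *\<^sub>R g' x \<partial>lebesgue)"
  proof (rule integral_cong_AE)
   show "AE x in lebesgue. indicator (box l u) x *\<^sub>R g1 x = indicator (box l u) x *\<^sub>R g' x"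
    using eqc by eventually_elim simp
   show "(\<lambda>x. indicator (box l u) x *\<^sub>R g1 x) \<in> lmeas"
    by (rule borel_measurable_scaleR[OF ind borel_measurable_integrable[OF g1i]])
   show "(\<lambda>x. indicator (box l u) x *\<^sub>R g' x) \<in> lmeas"
    by (rule borel_measurable_scaleR[OF ind g'_leb])
  qed
  also have "... = (\<integral>x. indicator (box l u) x *\<^sub>R g' x \<partial>lborel)"
   by (rule integral_completion) measurable
  also have "... = enn2real (\<integral>\<^sup>+x. ennreal (indicator (box l u) x *\<^sub>R g' x) \<partial>lborel)
    - enn2real (\<integral>\<^sup>+x. ennreal (- (indicator (box l u) x *\<^sub>R g' x)) \<partial>lborel)"
   by (rule real_lebesgue_integral_def[OF int])
  finally have "enn2real (\<integral>\<^sup>+x. ennreal (indicator (box l u) x *\<^sub>R g' x) \<partial>lborel)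
    <= enn2real (\<integral>\<^sup>+x. ennreal (- (indicator (box l u) x *\<^sub>R g' x)) \<partial>lborel)"
   using le[OF lu] by simp
  then have "ennreal (enn2real (\<integral>\<^sup>+x. ennreal (indicator (box l u) x *\<^sub>R g' x) \<partial>lborel))
    <= ennreal (enn2real (\<integral>\<^sup>+x. ennreal (- (indicator (box l u) x *\<^sub>R g' x)) \<partial>lborel))"
   by (rule ennreal_leI)
  moreover have "(\<integral>\<^sup>+x. ennreal (indicator (box l u) x *\<^sub>R g' x) \<partial>lborel) < top"
   "(\<integral>\<^sup>+x. ennreal (- (indicator (box l u) x *\<^sub>R g' x)) \<partial>lborel) < top"
   using int by (auto simp: real_integrable_def top.not_eq_extremum)
  moreover have "(\<integral>\<^sup>+x. ennreal (indicator (box l u) x *\<^sub>R g' x) \<partial>lborel) = (\<integral>\<^sup>+x\<in>box l u. ennreal (g' x) \<partial>lborel)"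
   "(\<integral>\<^sup>+x. ennreal (- (indicator (box l u) x *\<^sub>R g' x)) \<partial>lborel) = (\<integral>\<^sup>+x\<in>box l u. ennreal (- g' x) \<partial>lborel)"
   by (auto intro!: nn_integral_cong simp: indicator_def)
  ultimately show ?thesis
   by (simp only: ennreal_enn2real)
 qed
 define A where "A = {x \<in> box p q. g' x > 0}"
 have [measurable]: "A \<in> sets borel" unfolding A_def by measurable
 have "(\<integral>\<^sup>+x\<in>A. ennreal (g' x) \<partial>lborel) <= (\<integral>\<^sup>+x\<in>A. ennreal (- g' x) \<partial>lborel)"
 proof (rule nn_integral_le_from_boxes[OF _ _ bx])
  have "(\<integral>\<^sup>+x\<in>box p q. ennreal (- g' x) \<partial>lborel) <= (\<integral>\<^sup>+x. ennreal (- g' x) \<partial>lborel)"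
   by (intro nn_integral_mono) (auto simp: indicator_def)
  also have "... < \<infinity>" using g'i by (auto simp: real_integrable_def top.not_eq_extremum)
  finally show "(\<integral>\<^sup>+x\<in>box p q. ennreal (- g' x) \<partial>lborel) < \<infinity>" .
 qed (auto simp: A_def)
 also have "... = (\<integral>\<^sup>+(x::'a). 0 \<partial>lborel)"
  by (intro nn_integral_cong) (auto simp: A_def indicator_def ennreal_neg)
 finally have "(\<integral>\<^sup>+x\<in>A. ennreal (g' x) \<partial>lborel) = 0" by simp
 then have "AE x in lborel. ennreal (g' x) * indicator A x = 0"
  by (subst (asm) nn_integral_0_iff_AE) auto
 with eq have "AE x in lborel. x \<in> box p q --> g x <= 0"
 proof eventually_elim
  case (elim x)
  then show ?case by (auto simp: A_def g1_def indicator_def ennreal_eq_0_iff split: if_splits)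
 qed
 then show ?thesis by (rule AE_completion)
qed

text \<open>For complex values, the estimate is applied to the real parts in a countable dense set of
 directions.\<close>

lemma norm_le_if_rational_directions:
 fixes z :: complex
 assumes "\<And>a b. a \<in> \<rat> ==> b \<in> \<rat> ==> Re (Complex a b * z) <= cmod (Complex a b) * w"
 shows "cmod z <= w"
proof (cases "z = 0")
 case False
 have cl: "Re (\<theta> * z) <= cmod \<theta> * w" for \<theta>
 proof -
  have "\<theta> \<in> closure {Complex a b |a b. a \<in> \<rat> \<and> b \<in> \<rat>}"
  proof (subst closure_approachable, intro allI impI)
   fix e :: real assume "e > 0"
   obtain a where a: "a \<in> \<rat>" "Re \<theta> < a" "a < Re \<theta> + e/2"
    using Rats_dense_in_real[of "Re \<theta>" "Re \<theta> + e/2"] \<open>e > 0\<close> by auto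
   obtain b where b: "b \<in> \<rat>" "Im \<theta> < b" "b < Im \<theta> + e/2"
    using Rats_dense_in_real[of "Im \<theta>" "Im \<theta> + e/2"] \<open>e > 0\<close> by auto
   have "dist (Complex a b) \<theta> <= \<bar>Re (Complex a b - \<theta>)\<bar> + \<bar>Im (Complex a b - \<theta>)\<bar>"
    unfolding dist_norm by (rule cmod_le)
   also have "... < e" using a b by simp
   finally show "\<exists>y\<in>{Complex a b |a b. a \<in> \<rat> \<and> b \<in> \<rat>}. dist y \<theta> < e" using a b by blast
  qed
  then obtain f where f: "\<And>n. f n \<in> {Complex a b |a b. a \<in> \<rat> \<and> b \<in> \<rat>}" "f \<longlonglongrightarrow> \<theta>"
   unfolding closure_sequential by blast
  have "Re (f n * z) <= cmod (f n) * w" for n using f(1)[of n] assms by auto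
  moreover have "(\<lambda>n. Re (f n * z)) \<longlonglongrightarrow> Re (\<theta> * z)" "(\<lambda>n. cmod (f n) * w) \<longlonglongrightarrow> cmod \<theta> * w"
   using f(2) by (auto intro!: tendsto_intros)
  ultimately show ?thesis by (intro LIMSEQ_le) auto
 qed
 have "(cmod z)\<^sup>2 <= cmod z * w"
  using cl[of "cnj z"] by (simp add: cmod_power2) (simp add: power2_eq_square)
 then show ?thesis using False by (simp add: power2_eq_square)
next
 case True
 then show ?thesis using assms[of 1 0] by (simp add: complex_norm)
qed

text \<open>If the pairings of \<open>G\<close> with all box bumps are dominated by those of \<open>W\<close>, then
 \<open>|G| <= W\<close> almost everywhere. With \<open>W = 0\<close> this is the fundamental lemma of the calculus
 of variations; with \<open>W\<close> a power of the distance it turns weak into pointwise bounds.\<close>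

lemma AE_norm_le_from_bumps:
 fixes G :: "real^'d::finite => complex" and W :: "real^'d => real"
 assumes U: "open U"
  and G: "\<And>K. compact K ==> K \<subseteq> U ==> set_integrable lebesgue K G"
  and W: "\<And>K. compact K ==> K \<subseteq> U ==> set_integrable lebesgue K W"
  and le: "\<And>m l u. cbox l u \<subseteq> U ==>
   norm (\<integral>x. G x * of_real (bump m l u x) \<partial>lebesgue) <= (\<integral>x. W x * bump m l u x \<partial>lebesgue)"
 shows "AE x in lebesgue. x \<in> U --> norm (G x) <= W x"
proof -
 have bump_leb[measurable]: "bump m l u \<in> lmeas" for m and l u :: "real^'d"
  using measurable_completion[of "bump m l u" lborel borel] by simp
 have lim: "(\<lambda>m. \<integral>x. bump m l u x *\<^sub>R F x \<partial>lebesgue) \<longlonglongrightarrow> (LINT x:box l u|lebesgue. F x)"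
  if F: "set_integrable lebesgue (cbox l u) F" for F :: "real^'d => 'b::{banach,second_countable_topology}" and l u
 proof -
  have F': "integrable lebesgue (\<lambda>x. indicator (cbox l u) x *\<^sub>R F x)" (is "integrable _ ?F")
   using F by (simp add: set_integrable_def)
  have "(\<lambda>m. \<integral>x. bump m l u x *\<^sub>R ?F x \<partial>lebesgue) \<longlonglongrightarrow> (\<integral>x. indicator (box l u) x *\<^sub>R ?F x \<partial>lebesgue)"
  proof (rule integral_dominated_convergence[where w="\<lambda>x. norm (?F x)"])
   show "AE x in lebesgue. (\<lambda>i. bump i l u x *\<^sub>R ?F x) \<longlonglongrightarrow> indicator (box l u) x *\<^sub>R ?F x"
    by (intro AE_I2 tendsto_intros bump_tendsto)
   show "AE x in lebesgue. norm (bump i l u x *\<^sub>R ?F x) <= norm (?F x)" for i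
    by (intro AE_I2, subst norm_scaleR, rule mult_left_le_one_le) (auto simp: bump_bounds abs_of_nonneg)
   have [measurable]: "?F \<in> lmeas" using F' by (rule borel_measurable_integrable)
   show "(\<lambda>x. indicator (box l u) x *\<^sub>R ?F x) \<in> lmeas"
    by (rule borel_measurable_scaleR[OF borel_measurable_indicator borel_measurable_integrable[OF F']]) simp
   show "(\<lambda>x. bump i l u x *\<^sub>R ?F x) \<in> lmeas" for i
    by (intro borel_measurable_scaleR bump_leb borel_measurable_integrable[OF F'])
   show "integrable lebesgue (\<lambda>x. norm (?F x))" using F' by (rule integrable_norm)
  qed
  moreover have "bump m l u x *\<^sub>R ?F x = bump m l u x *\<^sub>R F x" for m x
   using bump_outside[of x l u m] box_subset_cbox[of l u] by (cases "x \<in> box l u") (auto simp: indicator_def)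
  moreover have "indicator (box l u) x *\<^sub>R ?F x = indicator (box l u) x *\<^sub>R F x" for x
   using box_subset_cbox[of l u] by (auto simp: indicator_def)
  ultimately show ?thesis unfolding set_lebesgue_integral_def by (simp only:)
 qed
 have box_le: "norm (LINT x:box l u|lebesgue. G x) <= (LINT x:box l u|lebesgue. W x)" if lu: "cbox l u \<subseteq> U" for l u
 proof (rule LIMSEQ_le)
  show "(\<lambda>m. norm (\<integral>x. bump m l u x *\<^sub>R G x \<partial>lebesgue)) \<longlonglongrightarrow> norm (LINT x:box l u|lebesgue. G x)"
   using lu by (intro tendsto_norm lim G) auto
  show "(\<lambda>m. \<integral>x. bump m l u x *\<^sub>R W x \<partial>lebesgue) \<longlonglongrightarrow> (LINT x:box l u|lebesgue. W x)"
   using lu by (intro lim W) auto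
  show "\<exists>N. \<forall>m\<ge>N. norm (\<integral>x. bump m l u x *\<^sub>R G x \<partial>lebesgue) <= (\<integral>x. bump m l u x *\<^sub>R W x \<partial>lebesgue)"
   using le[OF lu] by (simp add: scaleR_conv_of_real mult.commute)
 qed
 have one: "AE x in lebesgue. x \<in> box p q --> norm (G x) <= W x" if pq: "cbox p q \<subseteq> U" for p q
 proof -
  have Gpq: "set_integrable lebesgue (cbox p q) G" and Wpq: "set_integrable lebesgue (cbox p q) W"
   using pq by (auto intro!: G W)
  have dir: "AE x in lebesgue. x \<in> box p q --> Re (\<theta> * G x) - cmod \<theta> * W x <= 0" for \<theta>
  proof (rule AE_nonpos_from_boxes)
   have G1: "set_integrable lebesgue K (\<lambda>x. Re (\<theta> * G x))" if "set_integrable lebesgue K G" for K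
   proof -
    have "integrable lebesgue (\<lambda>x. Re (\<theta> * (indicator K x *\<^sub>R G x)))"
     using that unfolding set_integrable_def by (intro integrable_Re integrable_mult_right)
    then show ?thesis unfolding set_integrable_def by (simp add: algebra_simps)
   qed
   show "set_integrable lebesgue (cbox p q) (\<lambda>x. Re (\<theta> * G x) - cmod \<theta> * W x)"
    using Wpq by (intro set_integral_diff(1) G1[OF Gpq] set_integrable_mult_right) auto
   fix l u assume "cbox l u \<subseteq> box p q"
   then have lu: "cbox l u \<subseteq> U" using pq box_subset_cbox by blast
   have Gl: "set_integrable lebesgue (box l u) G"
    by (rule set_integrable_subset[OF G[OF compact_cbox lu] _ box_subset_cbox]) simp
   have Wl: "set_integrable lebesgue (box l u) W"
    by (rule set_integrable_subset[OF W[OF compact_cbox lu] _ box_subset_cbox]) simp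
   have "(LINT x:box l u|lebesgue. Re (\<theta> * G x)) = (\<integral>x. Re (\<theta> * (indicator (box l u) x *\<^sub>R G x)) \<partial>lebesgue)"
    unfolding set_lebesgue_integral_def by (intro Bochner_Integration.integral_cong) (auto simp: indicator_def)
   also have "... = Re (\<theta> * (LINT x:box l u|lebesgue. G x))"
    using Gl unfolding set_lebesgue_integral_def set_integrable_def
    by (simp only: integral_Re[OF integrable_mult_right] integral_mult_right_zero)
   also have "... <= cmod (\<theta> * (LINT x:box l u|lebesgue. G x))" by (rule complex_Re_le_cmod)
   also have "... <= cmod \<theta> * (LINT x:box l u|lebesgue. W x)"
    using box_le[OF lu] by (simp add: norm_mult mult_left_mono)
   finally show "(LINT x:box l u|lebesgue. Re (\<theta> * G x) - cmod \<theta> * W x) <= 0"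
    using Wl by (subst set_integral_diff(2)[OF G1[OF Gl]]) auto
  qed
  have "AE x in lebesgue. \<forall>ab\<in>\<rat> \<times> \<rat>. x \<in> box p q -->
    Re (Complex (fst ab) (snd ab) * G x) - cmod (Complex (fst ab) (snd ab)) * W x <= 0"
   by (subst AE_ball_countable, intro countable_SIGMA countable_rat, intro ballI dir)
  then show ?thesis
   by eventually_elim (auto intro!: norm_le_if_rational_directions)
 qed
 obtain \<D> where D: "countable \<D>" "\<D> \<subseteq> Pow U" "\<And>X. X \<in> \<D> ==> \<exists>a b. X = cbox a b" "\<Union>\<D> = U"
  using open_countable_Union_open_cbox[OF U] by metis
 have "AE x in lebesgue. \<forall>X\<in>\<D>. x \<in> X --> norm (G x) <= W x"
 proof (subst AE_ball_countable[OF D(1)], intro ballI)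
  fix X assume X: "X \<in> \<D>"
  then obtain p q where pq: "X = cbox p q" using D(3) by blast
  have "negligible (cbox p q - box p q)" by (rule negligible_frontier_interval)
  then have "AE x in lebesgue. x \<notin> cbox p q - box p q"
   by (intro AE_not_in) (simp add: negligible_iff_null_sets)
  moreover have "AE x in lebesgue. x \<in> box p q --> norm (G x) <= W x"
   using X D(2) pq by (intro one) auto
  ultimately show "AE x in lebesgue. x \<in> X --> norm (G x) <= W x"
   by eventually_elim (auto simp: pq)
 qed
 then show ?thesis by eventually_elim (use D(4) in auto)
qed

section \<open>Calculus of Fourier transforms of distributions\<close>

text \<open>Smoothness is defined by iterated partial derivatives, so it is enough to exhibit a class of differentiable
 functions that is closed under partial derivatives.\<close>

lemma smooth_on_UNIV_coinduct:
 assumes "f \<in> C" "\<And>f x. f \<in> C ==> f differentiable (at x)" "\<And>f i. f \<in> C ==> partial i f \<in> C"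
 shows "smooth_on UNIV f"
proof -
 have "foldr partial is f \<in> C" for "is" by (induction "is") (auto intro: assms)
 then show ?thesis using assms(2) by (auto simp: smooth_on_def differentiable_on_def)
qed

lemma smooth_on_UNIV_differentiable: "smooth_on UNIV f ==> f differentiable (at x)"
 unfolding smooth_on_def differentiable_on_def by (metis UNIV_I foldr_Nil id_apply)

lemma smooth_on_UNIV_partial: "smooth_on UNIV f ==> smooth_on UNIV (partial i f)"
 unfolding smooth_on_def
proof
 fix "is" assume "\<forall>is. foldr partial is f differentiable_on UNIV"
 then have "foldr partial (is @ [i]) f differentiable_on UNIV" by blast
 then show "foldr partial is (partial i f) differentiable_on UNIV" by simp
qed

lemma smooth_on_UNIV_continuous: "smooth_on UNIV f ==> continuous_on A f"
 using smooth_on_UNIV_differentiable differentiable_imp_continuous_within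
 by (metis continuous_at_imp_continuous_on)

lemma smooth_on_UNIV_mult:
 fixes f g :: "real^'d::finite => complex"
 assumes "smooth_on UNIV f" "smooth_on UNIV g"
 shows "smooth_on UNIV (\<lambda>x. f x * g x)"
proof (rule smooth_on_UNIV_coinduct)
 let ?C = "{\<lambda>x::real^'d. \<Sum>j<(n::nat). F j x * G j x | n F G. \<forall>j. smooth_on UNIV (F j) \<and> smooth_on UNIV (G j)}"
 show "(\<lambda>x. f x * g x) \<in> ?C"
  by (rule CollectI, rule exI[of _ "Suc 0"], rule exI[of _ "\<lambda>_. f"], rule exI[of _ "\<lambda>_. g"]) (use assms in simp)
 fix h assume "h \<in> ?C"
 then obtain F G and n :: nat where h: "h = (\<lambda>x. \<Sum>j<n. F j x * G j x)"
  and F: "\<And>j. smooth_on UNIV (F j)" and G: "\<And>j. smooth_on UNIV (G j)" by blast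
 have D: "(h has_derivative (\<lambda>y. \<Sum>j<n. F j x * frechet_derivative (G j) (at x) y + frechet_derivative (F j) (at x) y * G j x)) (at x)" for x
  unfolding h using F G
  by (intro has_derivative_sum has_derivative_mult)
   (auto simp: smooth_on_UNIV_differentiable frechet_derivative_works[symmetric])
 show "h differentiable (at x)" for x using D by (rule differentiableI)
 show "partial i h \<in> ?C" for i
 proof -
  let ?F = "\<lambda>j. if j < n then F j else partial i (F (j - n))"
  let ?G = "\<lambda>j. if j < n then partial i (G j) else G (j - n)"
  have "partial i h x = (\<Sum>j<n + n. ?F j x * ?G j x)" for x
  proof -
   have "partial i h x = (\<Sum>j<n. F j x * partial i (G j) x) + (\<Sum>j<n. partial i (F j) x * G j x)"
    unfolding partial_def frechet_derivative_at[OF D, symmetric] by (simp add: sum.distrib)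
   also have "(\<Sum>j<n. F j x * partial i (G j) x) = (\<Sum>j<n. ?F j x * ?G j x)"
    by (intro sum.cong) auto
   also have "(\<Sum>j<n. partial i (F j) x * G j x) = (\<Sum>j=n..<n + n. ?F j x * ?G j x)"
    by (rule sum.reindex_bij_witness[of _ "\<lambda>j. j - n" "\<lambda>j. j + n"]) auto
   also have "(\<Sum>j<n. ?F j x * ?G j x) + (\<Sum>j=n..<n + n. ?F j x * ?G j x) = (\<Sum>j<n + n. ?F j x * ?G j x)"
    using sum.atLeastLessThan_concat[of 0 n "n + n" "\<lambda>j. ?F j x * ?G j x"] by (simp add: atLeast0LessThan)
   finally show ?thesis .
  qed
  then have "partial i h = (\<lambda>x. \<Sum>j<n + n. ?F j x * ?G j x)" by blast
  then show ?thesis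
   by (intro CollectI exI[of _ "n + n"] exI[of _ ?F] exI[of _ ?G]) (simp add: F G smooth_on_UNIV_partial)
 qed
qed

lemma smooth_on_UNIV_const: "smooth_on UNIV (\<lambda>x. c)"
 by (rule smooth_on_UNIV_coinduct[of _ "range (\<lambda>c x. c)"])
  (auto simp: partial_def[abs_def])

lemma smooth_on_UNIV_cis: "smooth_on UNIV (\<lambda>x. cis (- (a \<bullet> x)))"
proof (rule smooth_on_UNIV_coinduct)
 let ?C = "range (\<lambda>(c::complex) x. c * cis (- (a \<bullet> x)))"
 show "(\<lambda>x. cis (- (a \<bullet> x))) \<in> ?C" by (rule image_eqI[of _ _ 1]) auto
 fix h assume "h \<in> ?C"
 then obtain c where h: "h = (\<lambda>x. c * cis (- (a \<bullet> x)))" by blast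
 have D: "(h has_derivative (\<lambda>y. c * (of_real (- (a \<bullet> y)) * (\<i> * cis (- (a \<bullet> x)))))) (at x)" for x
 proof -
  have "((\<lambda>x. - (a \<bullet> x)) has_derivative (\<lambda>y. - (a \<bullet> y))) (at x)"
   by (intro derivative_intros)
  from has_derivative_mult_right[OF has_derivative_cis[OF this], of c]
  show ?thesis unfolding h by (simp add: scaleR_conv_of_real)
 qed
 show "h differentiable (at x)" for x using D by (rule differentiableI)
 have "partial i h = (\<lambda>x. (c * (of_real (- (a \<bullet> axis i 1)) * \<i>)) * cis (- (a \<bullet> x)))" for i
  unfolding partial_def frechet_derivative_at[OF D, symmetric] by (simp add: mult_ac)
 then show "partial i h \<in> ?C" for i by blast
qed

lemma smooth_on_UNIV_scale:
 assumes "smooth_on UNIV f"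
 shows "smooth_on UNIV (\<lambda>x. f (k *\<^sub>R x))"
proof (rule smooth_on_UNIV_coinduct)
 let ?C = "{\<lambda>x. of_real c * g (k *\<^sub>R x) | c g. smooth_on UNIV g}"
 show "(\<lambda>x. f (k *\<^sub>R x)) \<in> ?C"
  by (rule CollectI, rule exI[of _ 1], rule exI[of _ f]) (use assms in simp)
 fix h assume "h \<in> ?C"
 then obtain c g where h: "h = (\<lambda>x. of_real c * g (k *\<^sub>R x))" and g: "smooth_on UNIV g" by blast
 have D: "(h has_derivative (\<lambda>y. of_real c * frechet_derivative g (at (k *\<^sub>R x)) (k *\<^sub>R y))) (at x)" for x
  unfolding h
  by (intro has_derivative_mult_right has_derivative_compose[of "\<lambda>x. k *\<^sub>R x" "\<lambda>x. k *\<^sub>R x", OF _ frechet_derivative_works[THEN iffD1]])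
   (auto intro!: derivative_eq_intros smooth_on_UNIV_differentiable g)
 show "h differentiable (at x)" for x using D by (rule differentiableI)
 have lin: "linear (frechet_derivative g (at z))" for z
  using linear_frechet_derivative smooth_on_UNIV_differentiable[OF g] by blast
 have "partial i h = (\<lambda>x. of_real (c * k) * partial i g (k *\<^sub>R x))" for i
  unfolding partial_def frechet_derivative_at[OF D, symmetric]
  by (simp add: linear_cmul[OF lin] scaleR_conv_of_real[where 'a=complex] mult.assoc)
 then show "partial i h \<in> ?C" for i using smooth_on_UNIV_partial[OF g] by blast
qed

lemma test_function_mult_smooth:
 "test_function U \<eta> ==> smooth_on UNIV g ==> test_function U (\<lambda>x. \<eta> x * g x)"
 unfolding test_function_def using smooth_on_UNIV_mult by (metis mult_zero_left)

lemma test_function_scale: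
 assumes "test_function UNIV \<eta>" "k \<noteq> 0"
 shows "test_function UNIV (\<lambda>x. \<eta> (k *\<^sub>R x))"
proof -
 obtain K where K: "compact K" "\<And>x. x \<notin> K ==> \<eta> x = 0" and "smooth_on UNIV \<eta>"
  using assms by (auto simp: test_function_def)
 moreover have "compact ((\<lambda>x. inverse k *\<^sub>R x) ` K)" using K(1) by (rule compact_scaling)
 moreover have "\<eta> (k *\<^sub>R x) = 0" if "x \<notin> (\<lambda>x. inverse k *\<^sub>R x) ` K" for x
 proof (rule K(2))
  have "x = inverse k *\<^sub>R (k *\<^sub>R x)" using assms(2) by simp
  then show "k *\<^sub>R x \<notin> K" using that by (metis imageI)
 qed
 ultimately show ?thesis using smooth_on_UNIV_scale by (auto simp: test_function_def)
qed

lemma integrable_mult_test_function: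
 fixes F :: "real^'d::finite => complex"
 assumes F: "\<And>K. compact K ==> K \<subseteq> U ==> set_integrable lebesgue K F" and \<eta>: "test_function U \<eta>"
 shows "integrable lebesgue (\<lambda>x. F x * \<eta> x)"
proof -
 obtain K where K: "compact K" "K \<subseteq> U" "\<And>x. x \<notin> K ==> \<eta> x = 0" and s: "smooth_on UNIV \<eta>"
  using \<eta> by (auto simp: test_function_def)
 have "bounded (\<eta> ` K)"
  using K(1) smooth_on_UNIV_continuous[OF s] compact_continuous_image compact_imp_bounded by blast
 then obtain M where M: "\<And>x. x \<in> K ==> norm (\<eta> x) <= M" by (auto simp: bounded_iff)
 have eta: "\<eta> \<in> lmeas"
  using borel_measurable_continuous_onI[OF smooth_on_UNIV_continuous[OF s]]
  by (auto intro!: measurable_completion)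
 have i: "integrable lebesgue (\<lambda>x. indicator K x *\<^sub>R F x)" using F[OF K(1,2)] by (simp add: set_integrable_def)
 have eq: "F x * \<eta> x = (indicator K x *\<^sub>R F x) * \<eta> x" for x using K(3)[of x] by (auto simp: indicator_def)
 show ?thesis
 proof (rule Bochner_Integration.integrable_bound[of _ "\<lambda>x. M *\<^sub>R (indicator K x *\<^sub>R F x)"])
  show "integrable lebesgue (\<lambda>x. M *\<^sub>R (indicator K x *\<^sub>R F x))" using i by (rule integrable_scaleR_right)
  show "(\<lambda>x. F x * \<eta> x) \<in> lmeas"
   unfolding eq by (rule borel_measurable_times[OF borel_measurable_integrable[OF i] eta])
  have "norm (F x * \<eta> x) <= norm (M *\<^sub>R (indicator K x *\<^sub>R F x))" for x
  proof (cases "x \<in> K")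
   case True
   have "norm (F x * \<eta> x) <= norm (F x) * M" unfolding norm_mult by (intro mult_left_mono M True) simp
   also have "... <= norm (M *\<^sub>R (indicator K x *\<^sub>R F x))"
    using True by (simp add: mult.commute mult_right_mono)
   finally show ?thesis .
  qed (use K in auto)
  then show "AE x in lebesgue. norm (F x * \<eta> x) <= norm (M *\<^sub>R (indicator K x *\<^sub>R F x))" by simp
 qed
qed

lemma set_integrable_of_square:
 fixes F :: "'a::euclidean_space => complex"
 assumes "F \<in> lmeas" "compact K" "set_integrable lebesgue K (\<lambda>x. (norm (F x))\<^sup>2)"
 shows "set_integrable lebesgue K F"
 unfolding set_integrable_def
proof (rule Bochner_Integration.integrable_bound)
 have K: "K \<in> sets lebesgue" using assms(2) by (simp add: compact_imp_closed lebesgue_closedin)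
 show "integrable lebesgue (\<lambda>x. indicator K x *\<^sub>R (1::real) + indicator K x *\<^sub>R (norm (F x))\<^sup>2)"
  using assms(3) lmeasurable_compact[OF assms(2)] K unfolding set_integrable_def
  by (intro Bochner_Integration.integrable_add) (auto intro!: integrable_real_indicator simp: fmeasurable_def)
 show "(\<lambda>x. indicator K x *\<^sub>R F x) \<in> lmeas"
  by (rule borel_measurable_scaleR[OF borel_measurable_indicator[OF K] assms(1)])
 have "t <= 1 + t\<^sup>2" for t :: real
  using sum_power2_ge_zero[of "t - 1/2" 0] by (simp add: power2_eq_square algebra_simps)
 then show "AE x in lebesgue. norm (indicator K x *\<^sub>R F x) <= norm (indicator K x *\<^sub>R 1 + indicator K x *\<^sub>R (norm (F x))\<^sup>2)"
  by (auto simp: indicator_def)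
qed

lemma has_fourier_set_integrable: "has_fourier T F ==> compact K ==> set_integrable lebesgue K F"
 unfolding has_fourier_def by (auto intro: set_integrable_of_square)

lemma has_fourier_integrable: "has_fourier T F ==> test_function UNIV \<eta> ==> integrable lebesgue (\<lambda>x. F x * \<eta> x)"
 by (rule integrable_mult_test_function[of UNIV]) (auto intro: has_fourier_set_integrable)

text \<open>The Fourier transform is determined up to null sets.\<close>

lemma has_fourier_unique:
 assumes F: "has_fourier T F" and G: "has_fourier T G"
 shows "AE \<omega> in lebesgue. F \<omega> = G \<omega>"
proof -
 have "AE x in lebesgue. x \<in> UNIV --> norm (F x - G x) <= 0"
 proof (rule AE_norm_le_from_bumps)
  show "set_integrable lebesgue K (\<lambda>x. F x - G x)" if "compact K" for K
   using has_fourier_set_integrable[OF F that] has_fourier_set_integrable[OF G that] by (rule set_integral_diff)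
  show "set_integrable lebesgue K (\<lambda>x. 0::real)" for K :: "(real^'a) set" by (simp add: set_integrable_def)
  fix m and l u :: "real^'a"
  have t: "test_function UNIV (\<lambda>x. complex_of_real (bump m l u x))"
   by (rule test_function_bump) simp
  have "(\<integral>x. (F x - G x) * of_real (bump m l u x) \<partial>lebesgue)
   = (\<integral>x. F x * of_real (bump m l u x) \<partial>lebesgue) - (\<integral>x. G x * of_real (bump m l u x) \<partial>lebesgue)"
   unfolding left_diff_distrib
   by (rule Bochner_Integration.integral_diff[OF has_fourier_integrable[OF F t] has_fourier_integrable[OF G t]])
  also have "... = 0" using F G t by (simp add: has_fourier_def)
  finally show "norm (\<integral>x. (F x - G x) * of_real (bump m l u x) \<partial>lebesgue) <= (\<integral>x. 0 * bump m l u x \<partial>lebesgue)"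
   by simp
 qed auto
 then show ?thesis by eventually_elim simp
qed

lemma has_fourier_fhat: "has_fourier T F ==> has_fourier T (fhat T)"
 unfolding fhat_def by (rule someI[of "has_fourier T"])

lemma fhat_AE_eq: "has_fourier T F ==> AE \<omega> in lebesgue. fhat T \<omega> = F \<omega>"
 using has_fourier_unique has_fourier_fhat by blast

lemma norm_diff_squared_le:
 fixes a b :: "'a::real_normed_vector"
 shows "(norm (a - b))\<^sup>2 <= 2 * (norm a)\<^sup>2 + 2 * (norm b)\<^sup>2"
proof -
 have "(norm (a - b))\<^sup>2 <= (norm a + norm b)\<^sup>2"
  by (intro power_mono norm_triangle_ineq4) simp
 also have "... <= 2 * (norm a)\<^sup>2 + 2 * (norm b)\<^sup>2"
  using sum_squares_bound[of "norm a" "norm b"] by (simp add: power2_eq_square algebra_simps)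
 finally show ?thesis .
qed

lemma norm_add_squared_le:
 fixes a b :: "'a::real_normed_vector"
 shows "(norm (a + b))\<^sup>2 <= 2 * (norm a)\<^sup>2 + 2 * (norm b)\<^sup>2"
 using norm_diff_squared_le[of a "- b"] by simp

lemma has_fourier_diff:
 assumes F: "has_fourier S F" and G: "has_fourier T G"
 shows "has_fourier (S - T) (\<lambda>\<omega>. F \<omega> - G \<omega>)"
 unfolding has_fourier_def
proof (intro conjI allI impI)
 have mF: "F \<in> lmeas" and mG: "G \<in> lmeas"
  using F G by (auto simp: has_fourier_def)
 show m: "(\<lambda>\<omega>. F \<omega> - G \<omega>) \<in> lmeas" by (rule borel_measurable_diff[OF mF mG])
 show "set_integrable lebesgue K (\<lambda>\<omega>. (norm (F \<omega> - G \<omega>))\<^sup>2)" if "compact K" for K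
  unfolding set_integrable_def
 proof (rule Bochner_Integration.integrable_bound)
  have K: "K \<in> sets lebesgue" using that by (simp add: compact_imp_closed lebesgue_closedin)
  show "integrable lebesgue (\<lambda>x. 2 * (indicator K x *\<^sub>R (norm (F x))\<^sup>2) + 2 * (indicator K x *\<^sub>R (norm (G x))\<^sup>2))"
   using F G that unfolding has_fourier_def set_integrable_def
   by (intro Bochner_Integration.integrable_add integrable_mult_right) auto
  show "(\<lambda>x. indicator K x *\<^sub>R (norm (F x - G x))\<^sup>2) \<in> lmeas"
   by (rule borel_measurable_scaleR[OF borel_measurable_indicator[OF K] borel_measurable_power[OF measurable_compose[OF m borel_measurable_norm]]])
  show "AE x in lebesgue. norm (indicator K x *\<^sub>R (norm (F x - G x))\<^sup>2) \<le>
    norm (2 * (indicator K x *\<^sub>R (norm (F x))\<^sup>2) + 2 * (indicator K x *\<^sub>R (norm (G x))\<^sup>2))"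
   using norm_diff_squared_le by (intro AE_I2) (auto simp: indicator_def)
 qed
 show "(S - T) (fourier \<eta>) = (\<integral>\<omega>. (F \<omega> - G \<omega>) * \<eta> \<omega> \<partial>lebesgue)" if t: "test_function UNIV \<eta>" for \<eta>
  unfolding left_diff_distrib
  using Bochner_Integration.integral_diff[OF has_fourier_integrable[OF F t] has_fourier_integrable[OF G t]] F G t
  by (simp add: has_fourier_def)
qed

lemma has_fourier_cmult:
 assumes F: "has_fourier T F"
 shows "has_fourier (fscale c T) (\<lambda>\<omega>. c * F \<omega>)"
proof -
 have [measurable]: "F \<in> lmeas" using F by (auto simp: has_fourier_def)
 have *: "set_integrable lebesgue K (\<lambda>\<omega>. (norm (c * F \<omega>))\<^sup>2)" if "compact K" for K
  using F that by (simp add: has_fourier_def norm_mult power_mult_distrib)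
 show ?thesis
  using F * borel_measurable_times[OF borel_measurable_const[of c] \<open>F \<in> _\<close>]
  by (auto simp: has_fourier_def fscale_def mult.assoc)
qed

lemma has_fourier_zero: "has_fourier 0 (\<lambda>_. 0)"
 by (auto simp: has_fourier_def set_integrable_def)

lemma has_fourier_add:
 assumes F: "has_fourier S F" and G: "has_fourier T G"
 shows "has_fourier (S + T) (\<lambda>\<omega>. F \<omega> + G \<omega>)"
proof -
 have "has_fourier (S - fscale (-1) T) (\<lambda>\<omega>. F \<omega> - (-1) * G \<omega>)"
  by (intro has_fourier_diff F has_fourier_cmult G)
 moreover have "S - fscale (-1) T = S + T" by (auto simp: fscale_def fun_eq_iff)
 ultimately show ?thesis by simp
qed

lemma has_fourier_sum:
 "finite I ==> (\<And>i. i \<in> I ==> has_fourier (S i) (F i)) ==> has_fourier (\<Sum>i\<in>I. S i) (\<lambda>\<omega>. \<Sum>i\<in>I. F i \<omega>)"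
 by (induction I rule: finite_induct) (auto intro: has_fourier_zero has_fourier_add)

lemma has_fourier_translate:
 assumes F: "has_fourier T F"
 shows "has_fourier (translate a T) (\<lambda>\<omega>. cis (- (a \<bullet> \<omega>)) * F \<omega>)"
proof -
 have mF: "F \<in> lmeas" using F by (auto simp: has_fourier_def)
 have "continuous_on UNIV (\<lambda>x. cis (- (a \<bullet> x)))" by (rule smooth_on_UNIV_continuous[OF smooth_on_UNIV_cis])
 then have mc: "(\<lambda>x. cis (- (a \<bullet> x))) \<in> lmeas"
  by (intro measurable_completion) (simp add: borel_measurable_continuous_onI)
 have "translate a T (fourier \<eta>) = (\<integral>\<omega>. (cis (- (a \<bullet> \<omega>)) * F \<omega>) * \<eta> \<omega> \<partial>lebesgue)" if t: "test_function UNIV \<eta>" for \<eta>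
 proof -
  have "(\<lambda>x. fourier \<eta> (x + a)) = fourier (\<lambda>y. \<eta> y * cis (- (a \<bullet> y)))"
   by (auto simp: fourier_def fun_eq_iff inner_add_left cis_mult mult.assoc algebra_simps intro!: Bochner_Integration.integral_cong)
  then show ?thesis
   using F test_function_mult_smooth[OF t smooth_on_UNIV_cis, of a]
   by (simp add: translate_def has_fourier_def mult_ac)
 qed
 then show ?thesis
  using F borel_measurable_times[OF mc mF] by (auto simp: has_fourier_def norm_mult)
qed

lemma fourier_cmult: "fourier (\<lambda>y. c * g y) = (\<lambda>x. c * fourier g x)"
 by (rule ext) (simp add: fourier_def mult.assoc)

lemma has_fourier_dilate:
 fixes T :: "'d::finite functional"
 assumes F: "has_fourier T F" and h: "h > 0"
 shows "has_fourier (dilate h T) (\<lambda>\<omega>. of_real (h ^ CARD('d)) * F (h *\<^sub>R \<omega>))"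
proof -
 let ?N = "h ^ CARD('d)"
 have mF: "F \<in> lmeas" using F by (auto simp: has_fourier_def)
 have mh: "(\<lambda>\<omega>. F (h *\<^sub>R \<omega>)) \<in> lmeas"
  using measurable_affine[OF _ mF, of h 0] h by simp
 have int: "set_integrable lebesgue K (\<lambda>\<omega>. (norm (F (h *\<^sub>R \<omega>)))\<^sup>2)" if K: "compact K" for K
 proof -
  have "compact ((*\<^sub>R) h ` K)" using K by (rule compact_scaling)
  then have "integrable lebesgue (\<lambda>x. indicator ((*\<^sub>R) h ` K) x *\<^sub>R (norm (F x))\<^sup>2)"
   using F by (simp add: has_fourier_def set_integrable_def)
  from integrable_affine[OF _ this, of h 0] h
  have "integrable lebesgue (\<lambda>x. indicator ((*\<^sub>R) h ` K) (h *\<^sub>R x) *\<^sub>R (norm (F (h *\<^sub>R x)))\<^sup>2)" by simp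
  moreover have "indicator ((*\<^sub>R) h ` K) (h *\<^sub>R x) = (indicator K x :: real)" for x
   using h by (auto simp: indicator_def)
  ultimately show ?thesis by (simp add: set_integrable_def)
 qed
 have "dilate h T (fourier \<eta>) = (\<integral>\<omega>. (of_real ?N * F (h *\<^sub>R \<omega>)) * \<eta> \<omega> \<partial>lebesgue)" if t: "test_function UNIV \<eta>" for \<eta>
 proof -
  have t': "test_function UNIV (\<lambda>x. \<eta> (inverse h *\<^sub>R x))" using h by (intro test_function_scale t) auto
  have me: "(\<lambda>x. g x * cis (- (z \<bullet> x))) \<in> lmeas" if "continuous_on UNIV g" for g and z :: "real^'d"
   by (intro measurable_completion)
    (auto intro!: borel_measurable_continuous_onI continuous_intros that smooth_on_UNIV_continuous[OF smooth_on_UNIV_cis])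
  have ce: "continuous_on UNIV \<eta>" "continuous_on UNIV (\<lambda>x. \<eta> (inverse h *\<^sub>R x))"
   using t t' by (auto simp: test_function_def intro: smooth_on_UNIV_continuous)
  have "fourier \<eta> (h *\<^sub>R x) = of_real (inverse ?N) * fourier (\<lambda>y. \<eta> (inverse h *\<^sub>R y)) x" for x
  proof -
   have "fourier (\<lambda>y. \<eta> (inverse h *\<^sub>R y)) x = ?N *\<^sub>R (\<integral>y. \<eta> (inverse h *\<^sub>R (0 + h *\<^sub>R y)) * cis (- (x \<bullet> (0 + h *\<^sub>R y))) \<partial>lebesgue)"
    unfolding fourier_def using integral_affine[OF _ me[OF ce(2)], of h x 0] h by simp
   also have "... = ?N *\<^sub>R fourier \<eta> (h *\<^sub>R x)"
    using h by (simp add: fourier_def)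
   finally show ?thesis using h by (simp add: scaleR_conv_of_real[where 'a=complex] field_simps)
  qed
  then have eq: "(\<lambda>x. fourier \<eta> (h *\<^sub>R x)) = fourier (\<lambda>y. of_real (inverse ?N) * \<eta> (inverse h *\<^sub>R y))"
   by (simp only: fourier_cmult)
  have t'': "test_function UNIV (\<lambda>y. of_real (inverse ?N) * \<eta> (inverse h *\<^sub>R y))"
   using test_function_mult_smooth[OF t' smooth_on_UNIV_const, of "of_real (inverse ?N)"]
   by (simp only: mult.commute)
  have mp: "(\<lambda>x. F x * \<eta> (inverse h *\<^sub>R x)) \<in> lmeas"
   using has_fourier_integrable[OF F t'] by (rule borel_measurable_integrable)
  have "dilate h T (fourier \<eta>) = of_real ?N * (\<integral>y. F y * (of_real (inverse ?N) * \<eta> (inverse h *\<^sub>R y)) \<partial>lebesgue)"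
   using F t'' by (simp add: dilate_def eq has_fourier_def del: of_real_power)
  also have "... = (\<integral>y. F y * \<eta> (inverse h *\<^sub>R y) \<partial>lebesgue)"
   unfolding integral_mult_right_zero[symmetric] using h by (intro Bochner_Integration.integral_cong) (auto simp: field_simps)
  also have "... = ?N *\<^sub>R (\<integral>\<omega>. F (0 + h *\<^sub>R \<omega>) * \<eta> (inverse h *\<^sub>R (0 + h *\<^sub>R \<omega>)) \<partial>lebesgue)"
   using integral_affine[OF _ mp, of h 0] h by simp
  also have "... = (\<integral>\<omega>. (of_real ?N * F (h *\<^sub>R \<omega>)) * \<eta> \<omega> \<partial>lebesgue)"
   using h by (simp add: scaleR_conv_of_real[where 'a=complex] mult.assoc del: of_real_power)
  finally show ?thesis .
 qed
 moreover have "(\<lambda>\<omega>. of_real ?N * F (h *\<^sub>R \<omega>)) \<in> lmeas"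
  by (rule borel_measurable_times[OF borel_measurable_const mh])
 moreover have "set_integrable lebesgue K (\<lambda>\<omega>. (norm (of_real ?N * F (h *\<^sub>R \<omega>)))\<^sup>2)" if "compact K" for K
  using int[OF that] by (simp add: norm_mult power_mult_distrib del: of_real_power)
 ultimately show ?thesis unfolding has_fourier_def by blast
qed

section \<open>The dual lattice\<close>

lemma dual_lattice_iff: "\<alpha> \<in> dual_lattice \<longleftrightarrow> (\<forall>i. \<exists>n. \<alpha> $ i = 2 * pi * of_int n)"
proof
 assume "\<alpha> \<in> dual_lattice"
 then obtain a where "\<alpha> = (2 * pi) *\<^sub>R a" "\<forall>i. a $ i \<in> \<int>" by (auto simp: dual_lattice_def int_lattice_def)
 then show "\<forall>i. \<exists>n. \<alpha> $ i = 2 * pi * of_int n" by (auto elim!: Ints_cases)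
next
 assume "\<forall>i. \<exists>n. \<alpha> $ i = 2 * pi * of_int n"
 then obtain n where "\<And>i. \<alpha> $ i = 2 * pi * of_int (n i)" by metis
 then have "\<alpha> = (2 * pi) *\<^sub>R (\<chi> i. of_int (n i))" by (simp add: vec_eq_iff)
 then show "\<alpha> \<in> dual_lattice" unfolding dual_lattice_def int_lattice_def by force
qed

lemma dual_lattice_eq_range: "dual_lattice = range (\<lambda>n. \<chi> i. 2 * pi * of_int (n i))"
proof (intro set_eqI iffI)
 fix \<alpha> :: "real^'a" assume "\<alpha> \<in> dual_lattice"
 then obtain n where "\<And>i. \<alpha> $ i = 2 * pi * of_int (n i)" unfolding dual_lattice_iff by metis
 then show "\<alpha> \<in> range (\<lambda>n. \<chi> i. 2 * pi * of_int (n i))" by (intro image_eqI[of _ _ n]) (auto simp: vec_eq_iff)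
qed (auto simp: dual_lattice_iff)

lemma countable_dual_lattice [simp]: "countable (dual_lattice :: (real^'d::finite) set)"
 unfolding dual_lattice_eq_range by (intro countable_image countableI_type)

lemma dual_lattice_0 [simp]: "0 \<in> dual_lattice"
 by (auto simp: dual_lattice_iff intro!: exI[of _ 0])

lemma dual_lattice_add: "\<alpha> \<in> dual_lattice ==> \<beta> \<in> dual_lattice ==> \<alpha> + \<beta> \<in> dual_lattice"
 unfolding dual_lattice_iff
proof
 fix i assume "\<forall>i. \<exists>n. \<alpha> $ i = 2 * pi * of_int n" "\<forall>i. \<exists>n. \<beta> $ i = 2 * pi * of_int n"
 then obtain m n where "\<alpha> $ i = 2 * pi * of_int m" "\<beta> $ i = 2 * pi * of_int n" by blast
 then show "\<exists>n. (\<alpha> + \<beta>) $ i = 2 * pi * of_int n" by (intro exI[of _ "m + n"]) (simp add: algebra_simps)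
qed

lemma dual_lattice_minus: "\<alpha> \<in> dual_lattice ==> - \<alpha> \<in> dual_lattice"
 unfolding dual_lattice_iff
proof
 fix i assume "\<forall>i. \<exists>n. \<alpha> $ i = 2 * pi * of_int n"
 then obtain m where "\<alpha> $ i = 2 * pi * of_int m" by blast
 then show "\<exists>n. (- \<alpha>) $ i = 2 * pi * of_int n" by (intro exI[of _ "- m"]) simp
qed

lemma dual_lattice_diff: "\<alpha> \<in> dual_lattice ==> \<beta> \<in> dual_lattice ==> \<alpha> - \<beta> \<in> dual_lattice"
 using dual_lattice_add[OF _ dual_lattice_minus] by fastforce

lemma dual_lattice_double: "\<alpha> \<in> dual_lattice ==> 2 *\<^sub>R \<alpha> \<in> dual_lattice"
 using dual_lattice_add[of \<alpha> \<alpha>] by (simp add: scaleR_2)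

lemma norm_dual_lattice: "\<alpha> \<in> dual_lattice ==> \<alpha> \<noteq> 0 ==> norm \<alpha> \<ge> 2 * pi"
proof -
 assume a: "\<alpha> \<in> dual_lattice" "\<alpha> \<noteq> 0"
 then obtain i where i: "\<alpha> $ i \<noteq> 0" by (auto simp: vec_eq_iff)
 obtain n :: int where n: "\<alpha> $ i = 2 * pi * of_int n" using a by (auto simp: dual_lattice_iff)
 have "1 <= \<bar>n\<bar>" using i n by auto
 then have "(1::real) <= \<bar>of_int n\<bar>" by linarith
 then have "2 * pi * 1 <= 2 * pi * \<bar>real_of_int n\<bar>" by (intro mult_left_mono) auto
 also have "... = \<bar>\<alpha> $ i\<bar>" by (simp add: n abs_mult)
 also have "... <= norm \<alpha>" by (rule component_le_norm_cart)
 finally show ?thesis by simp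
qed

lemma finite_dual_lattice_ball: "finite {\<alpha> \<in> dual_lattice. norm (\<omega> + \<alpha>) < (r::real)}"
proof -
 define N where "N = nat \<lceil>norm \<omega> + r\<rceil>"
 have "{\<alpha> \<in> dual_lattice. norm (\<omega> + \<alpha>) < r} \<subseteq> (\<lambda>n. \<chi> i. 2 * pi * of_int (n i)) ` (Pi\<^sub>E UNIV (\<lambda>_. {- int N..int N}))"
 proof clarify
  fix \<alpha> assume a: "\<alpha> \<in> dual_lattice" "norm (\<omega> + \<alpha>) < r"
  then obtain n where n: "\<And>i. \<alpha> $ i = 2 * pi * of_int (n i)" unfolding dual_lattice_iff by metis
  have "n i \<in> {- int N..int N}" for i
  proof -
   have "norm \<alpha> <= norm \<omega> + r" using a(2) norm_triangle_ineq4[of "\<omega> + \<alpha>" \<omega>] by simp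
   moreover have "\<bar>real_of_int (n i)\<bar> <= 2 * pi * \<bar>real_of_int (n i)\<bar>"
    using pi_ge_two mult_right_mono[of 1 "2 * pi" "\<bar>real_of_int (n i)\<bar>"] by simp
   moreover have "2 * pi * \<bar>real_of_int (n i)\<bar> = \<bar>\<alpha> $ i\<bar>" by (simp add: n abs_mult)
   moreover have "\<bar>\<alpha> $ i\<bar> <= norm \<alpha>" by (rule component_le_norm_cart)
   ultimately have "\<bar>real_of_int (n i)\<bar> <= norm \<omega> + r" by linarith
   then have "\<bar>real_of_int (n i)\<bar> <= real N" unfolding N_def by linarith
   then show ?thesis by auto
  qed
  then show "\<alpha> \<in> (\<lambda>n. \<chi> i. 2 * pi * of_int (n i)) ` (Pi\<^sub>E UNIV (\<lambda>_. {- int N..int N}))"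
   using n by (intro image_eqI[of _ _ n]) (auto simp: vec_eq_iff)
 qed
 then show ?thesis by (rule finite_subset) (intro finite_imageI finite_PiE; simp)
qed

lemma ex_dual_lattice_cube: "\<exists>\<alpha>\<in>dual_lattice. \<forall>i. 0 <= (\<omega> - \<alpha>) $ i \<and> (\<omega> - \<alpha>) $ i < 2 * pi"
proof (intro bexI)
 let ?a = "\<chi> i. 2 * pi * of_int \<lfloor>\<omega> $ i / (2 * pi)\<rfloor>"
 show "?a \<in> dual_lattice" unfolding dual_lattice_iff by auto
 show "\<forall>i. 0 <= (\<omega> - ?a) $ i \<and> (\<omega> - ?a) $ i < 2 * pi"
 proof
  fix i
  define t where "t = \<omega> $ i / (2 * pi)"
  have w: "\<omega> $ i = 2 * pi * t" by (simp add: t_def)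
  have t: "0 <= t - of_int \<lfloor>t\<rfloor>" "t - of_int \<lfloor>t\<rfloor> < 1" by linarith+
  have "(\<omega> - ?a) $ i = 2 * pi * (t - of_int \<lfloor>t\<rfloor>)"
   unfolding t_def[symmetric] vector_minus_component w vec_lambda_beta by (simp add: t_def[symmetric] algebra_simps)
  then show "0 <= (\<omega> - ?a) $ i \<and> (\<omega> - ?a) $ i < 2 * pi"
   using t mult_strict_left_mono[OF t(2), of "2 * pi"] by simp
 qed
qed

text \<open>Splitting the indices of a lattice point by parity: every point is
 \<open>2 (\<beta> + \<pi> l)\<close> with \<open>\<beta>\<close> in the lattice and \<open>l\<close> a vertex of the unit cube.\<close>

lemma dual_lattice_split:
 assumes "\<alpha> \<in> dual_lattice"
 obtains l \<beta> where "l \<in> unit_vertices" "\<beta> \<in> dual_lattice" "\<alpha> = 2 *\<^sub>R (pi *\<^sub>R l + \<beta>)"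
proof -
 obtain n where n: "\<And>i. \<alpha> $ i = 2 * pi * of_int (n i)" using assms unfolding dual_lattice_iff by metis
 define l where "l = (\<chi> i. real_of_int (n i mod 2))"
 define \<beta> where "\<beta> = (\<chi> i. 2 * pi * real_of_int (n i div 2))"
 have "l \<in> unit_vertices" by (auto simp: unit_vertices_def l_def)
 moreover have "\<beta> \<in> dual_lattice" by (auto simp: dual_lattice_iff \<beta>_def)
 moreover have "\<alpha> = 2 *\<^sub>R (pi *\<^sub>R l + \<beta>)"
 proof (rule vec_eq_iff[THEN iffD2], rule allI)
  fix i
  have "real_of_int (n i) = of_int (n i mod 2 + 2 * (n i div 2))" by simp
  then have "real_of_int (n i) = of_int (n i mod 2) + 2 * of_int (n i div 2)" by (simp only: of_int_add of_int_mult of_int_numeral)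
  then have "2 * pi * real_of_int (n i) = 2 * (pi * real_of_int (n i mod 2) + 2 * pi * real_of_int (n i div 2))"
   by (simp only: algebra_simps)
  then show "\<alpha> $ i = (2 *\<^sub>R (pi *\<^sub>R l + \<beta>)) $ i"
   by (simp only: n l_def \<beta>_def vector_scaleR_component vector_add_component vec_lambda_beta real_scaleR_def)
 qed
 ultimately show ?thesis by (rule that)
qed

lemma finite_unit_vertices [simp]: "finite (unit_vertices :: (real^'d::finite) set)"
proof -
 have "unit_vertices \<subseteq> (\<lambda>n. \<chi> i. n i) ` (Pi\<^sub>E (UNIV::'d set) (\<lambda>_. {0, 1::real}))"
 proof
  fix l :: "real^'d" assume "l \<in> unit_vertices"
  then show "l \<in> (\<lambda>n. \<chi> i. n i) ` (Pi\<^sub>E (UNIV::'d set) (\<lambda>_. {0, 1::real}))"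
   by (intro image_eqI[of _ _ "\<lambda>i. l $ i"]) (auto simp: unit_vertices_def vec_eq_iff)
 qed
 then show ?thesis by (rule finite_subset) (intro finite_imageI finite_PiE; simp)
qed

lemma unit_vertices_0 [simp]: "0 \<in> unit_vertices"
 by (simp add: unit_vertices_def)

section \<open>Periodization and the Gramian\<close>

lemma borel_measurable_nn_integral_count_space:
 fixes f :: "'i => 'a => ennreal"
 assumes "countable I" "\<And>i. f i \<in> borel_measurable M"
 shows "(\<lambda>x. \<integral>\<^sup>+i. f i x \<partial>count_space I) \<in> borel_measurable M"
proof (cases "finite I")
 case True
 then show ?thesis using assms by (simp add: nn_integral_count_space_finite)
next
 case False
 have bij: "bij_betw (from_nat_into I) UNIV I" using assms(1) False by (rule bij_betw_from_nat_into)
 have "(\<integral>\<^sup>+i. f i x \<partial>count_space I) = (\<Sum>n. f (from_nat_into I n) x)" for x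
  using nn_integral_bij_count_space[OF bij, of "\<lambda>i. f i x"] by (simp add: nn_integral_count_space_nat)
 then show ?thesis using assms(2) by simp
qed

text \<open>Integrated over a cube of side \<open>2\<pi>\<close>, the periodization of \<open>u\<close> is the integral of \<open>u\<close>.\<close>

lemma AE_periodization_finite:
 fixes u :: "real^'d::finite => ennreal"
 assumes u: "u \<in> lmeas" and fin: "(\<integral>\<^sup>+x. u x \<partial>lebesgue) < \<infinity>"
 shows "AE \<omega> in lebesgue. (\<integral>\<^sup>+\<alpha>. u (\<omega> + \<alpha>) \<partial>count_space dual_lattice) < \<infinity>"
proof -
 define Q where "Q = {x::real^'d. \<forall>i. 0 <= x $ i \<and> x $ i < 2 * pi}"
 have Qb: "Q \<in> sets lebesgue"
 proof -
  have "Q = (\<Inter>i\<in>UNIV. {x. 0 <= x $ i} \<inter> {x. x $ i < 2 * pi})" by (auto simp: Q_def)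
  also have "... \<in> sets lborel" by (intro sets.finite_INT) (auto intro!: sets.Int borel_closed borel_open closed_Collect_le open_Collect_less continuous_intros)
  finally show ?thesis by simp
 qed
 have mu: "(\<lambda>\<omega>. u (\<omega> + \<alpha>)) \<in> lmeas" for \<alpha>
  using measurable_affine[OF _ u, of 1 \<alpha>] by (simp add: add.commute)
 have mf: "(\<lambda>\<omega>. indicator Q \<omega> * u (\<omega> + \<alpha>)) \<in> lmeas" for \<alpha>
  by (rule borel_measurable_times_ennreal[OF borel_measurable_indicator[OF Qb] mu])
 have mQ: "(\<lambda>y. indicator Q (y - \<alpha>) * u y) \<in> lmeas" for \<alpha>
  using measurable_affine[OF _ mf[of \<alpha>], of 1 "- \<alpha>"] by simp
 have one: "(\<integral>\<^sup>+\<alpha>. indicator Q (y - \<alpha>) \<partial>count_space dual_lattice) <= (1::ennreal)" for y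
 proof -
  obtain \<alpha>0 where a0: "\<And>\<alpha>. \<alpha> \<in> dual_lattice ==> y - \<alpha> \<in> Q ==> \<alpha> = \<alpha>0"
  proof (cases "\<exists>\<alpha>\<in>dual_lattice. y - \<alpha> \<in> Q")
   case True
   then obtain \<alpha>0 where a0: "\<alpha>0 \<in> dual_lattice" "y - \<alpha>0 \<in> Q" by blast
   have "\<alpha> = \<alpha>0" if a: "\<alpha> \<in> dual_lattice" "y - \<alpha> \<in> Q" for \<alpha>
   proof (rule vec_eq_iff[THEN iffD2], rule allI)
    fix i
    obtain m n where mn: "\<alpha> $ i = 2 * pi * of_int m" "\<alpha>0 $ i = 2 * pi * of_int n"
     using a a0 unfolding dual_lattice_iff by blast
    have "\<bar>\<alpha> $ i - \<alpha>0 $ i\<bar> < 2 * pi"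
     using a(2) a0(2) unfolding Q_def by (simp add: abs_less_iff) (smt (verit))
    then have "2 * pi * \<bar>real_of_int (m - n)\<bar> < 2 * pi * 1"
     by (simp add: mn abs_mult flip: right_diff_distrib)
    then have "\<bar>real_of_int (m - n)\<bar> < 1" by (subst (asm) mult_less_cancel_left_pos) auto
    then have "m = n" by linarith
    then show "\<alpha> $ i = \<alpha>0 $ i" by (simp add: mn)
   qed
   then show ?thesis by (rule that)
  qed (auto intro: that)
  have "(\<integral>\<^sup>+\<alpha>. indicator Q (y - \<alpha>) \<partial>count_space dual_lattice) <= (\<integral>\<^sup>+\<alpha>. indicator {\<alpha>0} \<alpha> \<partial>count_space dual_lattice)"
   by (intro nn_integral_mono) (auto simp: indicator_def dest: a0)
  also have "... <= (\<integral>\<^sup>+\<alpha>. indicator {\<alpha>0} \<alpha> \<partial>count_space UNIV)"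
   by (subst nn_integral_count_space_indicator, simp, intro nn_integral_mono) (auto simp: indicator_def)
  also have "... = 1" by simp
  finally show ?thesis .
 qed
 have "(\<integral>\<^sup>+\<omega>. indicator Q \<omega> * (\<integral>\<^sup>+\<alpha>. u (\<omega> + \<alpha>) \<partial>count_space dual_lattice) \<partial>lebesgue)
   = (\<integral>\<^sup>+\<omega>. (\<integral>\<^sup>+\<alpha>. indicator Q \<omega> * u (\<omega> + \<alpha>) \<partial>count_space dual_lattice) \<partial>lebesgue)"
  by (simp add: nn_integral_cmult)
 also have "... = (\<integral>\<^sup>+\<alpha>. (\<integral>\<^sup>+\<omega>. indicator Q \<omega> * u (\<omega> + \<alpha>) \<partial>lebesgue) \<partial>count_space dual_lattice)"
  by (rule nn_integral_count_space_nn_integral[OF countable_dual_lattice mf])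
 also have "... = (\<integral>\<^sup>+\<alpha>. (\<integral>\<^sup>+y. indicator Q (y - \<alpha>) * u y \<partial>lebesgue) \<partial>count_space dual_lattice)"
 proof (rule nn_integral_cong)
  fix \<alpha>
  show "(\<integral>\<^sup>+\<omega>. indicator Q \<omega> * u (\<omega> + \<alpha>) \<partial>lebesgue) = (\<integral>\<^sup>+y. indicator Q (y - \<alpha>) * u y \<partial>lebesgue)"
   using nn_integral_affine[OF _ mf[of \<alpha>], of 1 "- \<alpha>"] by simp
 qed
 also have "... = (\<integral>\<^sup>+y. (\<integral>\<^sup>+\<alpha>. indicator Q (y - \<alpha>) * u y \<partial>count_space dual_lattice) \<partial>lebesgue)"
  by (rule nn_integral_count_space_nn_integral[OF countable_dual_lattice mQ, symmetric])
 also have "... = (\<integral>\<^sup>+y. (\<integral>\<^sup>+\<alpha>. indicator Q (y - \<alpha>) \<partial>count_space dual_lattice) * u y \<partial>lebesgue)"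
  by (simp add: nn_integral_multc)
 also have "... <= (\<integral>\<^sup>+y. 1 * u y \<partial>lebesgue)"
  by (intro nn_integral_mono mult_right_mono one) simp
 finally have fin': "(\<integral>\<^sup>+\<omega>. indicator Q \<omega> * (\<integral>\<^sup>+\<alpha>. u (\<omega> + \<alpha>) \<partial>count_space dual_lattice) \<partial>lebesgue) \<noteq> \<infinity>"
  using fin by (auto simp: top_unique)
 have "(\<lambda>\<omega>. indicator Q \<omega> * (\<integral>\<^sup>+\<alpha>. u (\<omega> + \<alpha>) \<partial>count_space dual_lattice)) \<in> lmeas"
  by (intro borel_measurable_times_ennreal borel_measurable_indicator Qb borel_measurable_nn_integral_count_space mu countable_dual_lattice)
 from nn_integral_PInf_AE[OF this fin']
 have inQ: "AE \<omega> in lebesgue. \<omega> \<in> Q --> (\<integral>\<^sup>+\<alpha>. u (\<omega> + \<alpha>) \<partial>count_space dual_lattice) < \<infinity>"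
  by eventually_elim (auto simp: indicator_def top.not_eq_extremum)
 have "AE \<omega> in lebesgue. \<forall>\<alpha>0\<in>dual_lattice. - \<alpha>0 + 1 *\<^sub>R \<omega> \<in> Q -->
   (\<integral>\<^sup>+\<alpha>. u (- \<alpha>0 + 1 *\<^sub>R \<omega> + \<alpha>) \<partial>count_space dual_lattice) < \<infinity>"
  by (subst AE_ball_countable[OF countable_dual_lattice], intro ballI AE_affine inQ) simp
 then show ?thesis
 proof eventually_elim
  case (elim \<omega>)
  obtain \<alpha>0 where a0: "\<alpha>0 \<in> dual_lattice" "\<omega> - \<alpha>0 \<in> Q"
   using ex_dual_lattice_cube[of \<omega>] by (auto simp: Q_def)
  have "bij_betw (\<lambda>\<alpha>. \<alpha> - \<alpha>0) dual_lattice dual_lattice"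
   by (rule bij_betwI[of _ _ _ "\<lambda>\<alpha>. \<alpha> + \<alpha>0"]) (auto intro: dual_lattice_add dual_lattice_diff a0)
  from nn_integral_bij_count_space[OF this, of "\<lambda>\<alpha>. u (\<omega> + \<alpha>)"]
  have "(\<integral>\<^sup>+\<alpha>. u (\<omega> + \<alpha>) \<partial>count_space dual_lattice) = (\<integral>\<^sup>+\<alpha>. u (- \<alpha>0 + 1 *\<^sub>R \<omega> + \<alpha>) \<partial>count_space dual_lattice)"
   by (simp add: algebra_simps)
  then show ?case using elim a0 by auto
 qed
qed

lemma summable_on_if_nn_integral_finite:
 fixes f :: "'a => real"
 assumes "\<And>a. a \<in> A ==> f a \<ge> 0" "(\<integral>\<^sup>+a. ennreal (f a) \<partial>count_space A) < \<infinity>"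
 shows "f summable_on A"
proof (rule nonneg_bdd_above_summable_on[OF assms(1)])
 show "bdd_above (sum f ` {F. F \<subseteq> A \<and> finite F})"
 proof (rule bdd_aboveI2)
  fix F assume F: "F \<in> {F. F \<subseteq> A \<and> finite F}"
  have "ennreal (sum f F) = (\<Sum>a\<in>F. ennreal (f a))"
   using F assms(1) by (subst sum_ennreal) auto
  also have "... = (\<integral>\<^sup>+a. ennreal (f a) * indicator F a \<partial>count_space A)"
   using F by (subst nn_integral_count_space'[of F]) auto
  also have "... <= (\<integral>\<^sup>+a. ennreal (f a) \<partial>count_space A)"
   by (intro nn_integral_mono) (auto simp: indicator_def)
  finally have "ennreal (sum f F) <= ennreal (enn2real (\<integral>\<^sup>+a. ennreal (f a) \<partial>count_space A))"
   using assms(2) by simp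
  then show "sum f F <= enn2real (\<integral>\<^sup>+a. ennreal (f a) \<partial>count_space A)"
   by (subst (asm) ennreal_le_iff) auto
 qed
qed

lemma nn_integral_count_space_le:
 fixes f :: "'a => real"
 assumes A: "countable A" and f: "\<And>a. a \<in> A ==> f a \<ge> 0"
  and le: "\<And>F. finite F ==> F \<subseteq> A ==> sum f F <= c"
 shows "(\<integral>\<^sup>+a. ennreal (f a) \<partial>count_space A) <= ennreal c"
proof (cases "finite A")
 case True
 then show ?thesis using le[of A] f by (simp add: nn_integral_count_space_finite sum_ennreal ennreal_leI)
next
 case False
 have bij: "bij_betw (from_nat_into A) UNIV A" using A False by (rule bij_betw_from_nat_into)
 have "(\<integral>\<^sup>+a. ennreal (f a) \<partial>count_space A) = (\<Sum>n. ennreal (f (from_nat_into A n)))"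
  using nn_integral_bij_count_space[OF bij, of "\<lambda>a. ennreal (f a)"] by (simp add: nn_integral_count_space_nat)
 also have "... <= ennreal c"
 proof (rule suminf_le_const)
  fix n
  have in_A: "from_nat_into A m \<in> A" for m using bij by (auto simp: bij_betw_def)
  have "(\<Sum>m<n. ennreal (f (from_nat_into A m))) = ennreal (\<Sum>m<n. f (from_nat_into A m))"
   using in_A f by (intro sum_ennreal) auto
  also have "(\<Sum>m<n. f (from_nat_into A m)) = sum f (from_nat_into A ` {..<n})"
   using bij by (subst sum.reindex) (auto simp: bij_betw_def inj_on_def)
  also have "ennreal ... <= ennreal c" using in_A by (intro ennreal_leI le) auto
  finally show "(\<Sum>m<n. ennreal (f (from_nat_into A m))) <= ennreal c" .
 qed (rule summableI)
 finally show ?thesis .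
qed

text \<open>Almost everywhere, the lattice sums in the Gramian converge. (Where they do not, the sum is
 \<open>0\<close> by convention, and estimates of the Gramian would say nothing.)\<close>

lemma AE_summable_gram:
 fixes T :: "'d::finite functional"
 assumes T: "T \<in> W2 s"
 shows "AE \<omega> in lebesgue. (\<lambda>\<alpha>. (norm (fhat T (\<omega> + \<alpha>)))\<^sup>2 * norm (\<omega> + \<alpha>) powr (2 * s)) summable_on dual_lattice"
proof -
 let ?v = "\<lambda>x. (1 + norm x) powr (2 * s) * (norm (fhat T x))\<^sup>2"
 define u where "u x = ennreal (?v x)" for x
 have int: "integrable lebesgue ?v" using T by (simp add: W2_def)
 have mu: "u \<in> lmeas" unfolding u_def[abs_def]
  using borel_measurable_integrable[OF int] by (rule measurable_compose[OF _ measurable_ennreal])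
 have "(\<integral>\<^sup>+x. u x \<partial>lebesgue) < \<infinity>"
  unfolding u_def using int by (subst nn_integral_eq_integral) auto
 from AE_periodization_finite[OF mu this]
 show ?thesis
 proof eventually_elim
  case (elim \<omega>)
  let ?f = "\<lambda>\<alpha>. (norm (fhat T (\<omega> + \<alpha>)))\<^sup>2 * norm (\<omega> + \<alpha>) powr (2 * s)"
  let ?N = "{\<alpha> \<in> dual_lattice. norm (\<omega> + \<alpha>) < 1}"
  define C where "C = max 1 (inverse (2 powr (2 * s)))"
  have sv: "(\<lambda>\<alpha>. ?v (\<omega> + \<alpha>)) summable_on dual_lattice"
   using elim by (intro summable_on_if_nn_integral_finite) (auto simp: u_def)
  have "?f summable_on (dual_lattice - ?N)"
  proof (rule summable_on_comparison_test)
   have "(\<lambda>\<alpha>. ?v (\<omega> + \<alpha>)) summable_on (dual_lattice - ?N)"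
    by (rule summable_on_subset[OF sv]) auto
   then show "(\<lambda>\<alpha>. C * ?v (\<omega> + \<alpha>)) summable_on (dual_lattice - ?N)"
    by (rule summable_on_cmult_right)
   fix \<alpha> assume a: "\<alpha> \<in> dual_lattice - ?N"
   define t where "t = norm (\<omega> + \<alpha>)"
   have t: "t \<ge> 1" using a by (auto simp: t_def)
   have "t powr (2 * s) <= C * (1 + t) powr (2 * s)"
   proof (cases "s \<ge> 0")
    case True
    then have "t powr (2 * s) <= 1 * (1 + t) powr (2 * s)" using t by (simp add: powr_mono2)
    also have "... <= C * (1 + t) powr (2 * s)" by (intro mult_right_mono) (auto simp: C_def)
    finally show ?thesis .
   next
    case False
    have "t powr (2 * s) <= ((1 + t) / 2) powr (2 * s)" using False t by (intro powr_mono2') auto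
    also have "... = inverse (2 powr (2 * s)) * (1 + t) powr (2 * s)"
     using t by (subst powr_divide) (simp_all add: divide_inverse mult.commute)
    also have "... <= C * (1 + t) powr (2 * s)" by (intro mult_right_mono) (auto simp: C_def)
    finally show ?thesis .
   qed
   then have "t powr (2 * s) * (norm (fhat T (\<omega> + \<alpha>)))\<^sup>2 <= C * (1 + t) powr (2 * s) * (norm (fhat T (\<omega> + \<alpha>)))\<^sup>2"
    by (rule mult_right_mono) simp
   then show "?f \<alpha> <= C * ?v (\<omega> + \<alpha>)" unfolding t_def by (simp only: mult.commute mult.left_commute)
  qed auto
  moreover have "?f summable_on ?N"
   by (intro summable_on_finite finite_dual_lattice_ball)
  ultimately have "?f summable_on ((dual_lattice - ?N) \<union> ?N)"
   by (rule summable_on_Un_disjoint) auto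
  also have "(dual_lattice - ?N) \<union> ?N = dual_lattice" by auto
  finally show ?case .
 qed
qed

text \<open>On this set of points the Gramian represents the quadratic form
 \<open>x \<mapsto> \<Sum> |x\<^sup>* \<Phi>\<^sub>j(\<omega> + \<alpha>)|\<^sup>2 |\<omega> + \<alpha>|\<^sup>2\<^sup>s\<close>.\<close>

definition gram_summable :: "real => ('d::finite functional ^ 'r::finite) set => real^'d => bool" where
 "gram_summable s B \<omega> \<longleftrightarrow> (\<forall>\<Phi>\<in>B. \<forall>i. (\<lambda>\<alpha>. (norm (vhat \<Phi> (\<omega> + \<alpha>) $ i))\<^sup>2 * norm (\<omega> + \<alpha>) powr (2 * s)) summable_on dual_lattice)"

lemma AE_gram_summable:
 fixes B :: "('d::finite functional ^ 'r::finite) set"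
 assumes "finite B" "\<forall>\<Phi>\<in>B. \<forall>i. \<Phi> $ i \<in> W2 s"
 shows "AE \<omega> in lebesgue. gram_summable s B \<omega>"
proof -
 have "AE \<omega> in lebesgue. \<forall>\<Phi>\<in>B. \<forall>i\<in>UNIV. (\<lambda>\<alpha>. (norm (vhat \<Phi> (\<omega> + \<alpha>) $ i))\<^sup>2 * norm (\<omega> + \<alpha>) powr (2 * s)) summable_on dual_lattice"
  by (subst AE_ball_countable[OF countable_finite[OF assms(1)]], intro ballI, subst AE_ball_countable, simp, intro ballI)
   (use assms(2) in \<open>auto simp: vhat_def intro!: AE_summable_gram\<close>)
 then show ?thesis by (simp add: gram_summable_def)
qed

lemma has_sum_finite_sum:
 fixes f :: "'i => 'a => 'b::topological_comm_monoid_add"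
 assumes "finite I" "\<And>i. i \<in> I ==> (f i has_sum S i) A"
 shows "((\<lambda>x. \<Sum>i\<in>I. f i x) has_sum (\<Sum>i\<in>I. S i)) A"
 using assms by (induction I rule: finite_induct) (auto intro: has_sum_add)

lemma summable_gram_product:
 assumes "gram_summable s B \<omega>" "\<Phi> \<in> B" "A \<subseteq> dual_lattice"
 shows "(\<lambda>\<alpha>. vhat \<Phi> (\<omega> + \<alpha>) $ i * cnj (vhat \<Phi> (\<omega> + \<alpha>) $ j) * of_real (norm (\<omega> + \<alpha>) powr (2 * s))) summable_on A"
proof -
 let ?u = "\<lambda>i \<alpha>. (norm (vhat \<Phi> (\<omega> + \<alpha>) $ i))\<^sup>2 * norm (\<omega> + \<alpha>) powr (2 * s)"
 have su: "?u i summable_on A" for i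
  using assms by (auto simp: gram_summable_def intro: summable_on_subset)
 have "(\<lambda>\<alpha>. norm (vhat \<Phi> (\<omega> + \<alpha>) $ i * cnj (vhat \<Phi> (\<omega> + \<alpha>) $ j) * of_real (norm (\<omega> + \<alpha>) powr (2 * s)))) summable_on A"
 proof (rule summable_on_comparison_test[OF summable_on_add[OF su[of i] su[of j]]])
  fix \<alpha>
  have "a * b <= a\<^sup>2 + b\<^sup>2" if "a \<ge> 0" "b \<ge> 0" for a b :: real
   using sum_squares_bound[of a b] that mult_nonneg_nonneg[OF that] by linarith
  from mult_right_mono[OF this, of "norm (vhat \<Phi> (\<omega> + \<alpha>) $ i)" "norm (vhat \<Phi> (\<omega> + \<alpha>) $ j)" "norm (\<omega> + \<alpha>) powr (2 * s)"]
  show "norm (vhat \<Phi> (\<omega> + \<alpha>) $ i * cnj (vhat \<Phi> (\<omega> + \<alpha>) $ j) * of_real (norm (\<omega> + \<alpha>) powr (2 * s))) <= ?u i \<alpha> + ?u j \<alpha>"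
   by (simp add: norm_mult distrib_right)
 qed auto
 then show ?thesis by (rule abs_summable_summable)
qed

lemma gram_form:
 assumes gs: "gram_summable s B \<omega>" and A: "A \<subseteq> dual_lattice"
 shows "\<Phi> \<in> B ==> (\<lambda>\<alpha>. (norm (cinner x (vhat \<Phi> (\<omega> + \<alpha>))))\<^sup>2 * norm (\<omega> + \<alpha>) powr (2 * s)) summable_on A"
  and "qform (gram_sum A s B \<omega>) x = (\<Sum>\<Phi>\<in>B. \<Sum>\<^sub>\<infinity>\<alpha>\<in>A. (norm (cinner x (vhat \<Phi> (\<omega> + \<alpha>))))\<^sup>2 * norm (\<omega> + \<alpha>) powr (2 * s))"
proof -
 let ?p = "\<lambda>\<Phi> i j \<alpha>. vhat \<Phi> (\<omega> + \<alpha>) $ i * cnj (vhat \<Phi> (\<omega> + \<alpha>) $ j) * of_real (norm (\<omega> + \<alpha>) powr (2 * s))"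
 let ?q = "\<lambda>\<Phi> \<alpha>. (norm (cinner x (vhat \<Phi> (\<omega> + \<alpha>))))\<^sup>2 * norm (\<omega> + \<alpha>) powr (2 * s)"
 have hs: "((\<lambda>\<alpha>. complex_of_real (?q \<Phi> \<alpha>)) has_sum (\<Sum>i\<in>UNIV. \<Sum>j\<in>UNIV. cnj (x $ i) * x $ j * infsum (?p \<Phi> i j) A)) A"
  if "\<Phi> \<in> B" for \<Phi>
 proof -
  have "((\<lambda>\<alpha>. \<Sum>i\<in>UNIV. \<Sum>j\<in>UNIV. cnj (x $ i) * x $ j * ?p \<Phi> i j \<alpha>) has_sum
    (\<Sum>i\<in>UNIV. \<Sum>j\<in>UNIV. cnj (x $ i) * x $ j * infsum (?p \<Phi> i j) A)) A"
   by (intro has_sum_finite_sum has_sum_cmult_right has_sum_infsum summable_gram_product[OF gs that A]) auto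
  moreover have "(\<Sum>i\<in>UNIV. \<Sum>j\<in>UNIV. cnj (x $ i) * x $ j * ?p \<Phi> i j \<alpha>) = complex_of_real (?q \<Phi> \<alpha>)" for \<alpha>
  proof -
   have "complex_of_real (?q \<Phi> \<alpha>) = cinner x (vhat \<Phi> (\<omega> + \<alpha>)) * cnj (cinner x (vhat \<Phi> (\<omega> + \<alpha>))) * of_real (norm (\<omega> + \<alpha>) powr (2 * s))"
    by (simp only: of_real_mult complex_norm_square)
   also have "... = (\<Sum>i\<in>UNIV. \<Sum>j\<in>UNIV. cnj (x $ i) * x $ j * ?p \<Phi> i j \<alpha>)"
    unfolding cinner_def cnj_sum sum_product unfolding sum_distrib_right by (intro sum.cong refl) (simp add: mult_ac)
   finally show ?thesis by simp
  qed
  ultimately show ?thesis by simp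
 qed
 have hr: "(?q \<Phi> has_sum Re (\<Sum>i\<in>UNIV. \<Sum>j\<in>UNIV. cnj (x $ i) * x $ j * infsum (?p \<Phi> i j) A)) A" if "\<Phi> \<in> B" for \<Phi>
  using has_sum_Re[OF hs[OF that]] by simp
 show "\<Phi> \<in> B ==> ?q \<Phi> summable_on A"
  using hr by (rule has_sum_imp_summable)
 have "cinner x (gram_sum A s B \<omega> *v x) = (\<Sum>i\<in>UNIV. \<Sum>j\<in>UNIV. \<Sum>\<Phi>\<in>B. cnj (x $ i) * x $ j * infsum (?p \<Phi> i j) A)"
  unfolding cinner_def matrix_vector_mult_def gram_sum_def
  by (simp add: sum_distrib_left sum_distrib_right mult_ac)
 also have "... = (\<Sum>\<Phi>\<in>B. \<Sum>i\<in>UNIV. \<Sum>j\<in>UNIV. cnj (x $ i) * x $ j * infsum (?p \<Phi> i j) A)"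
  by (subst sum.swap, subst (2) sum.swap) (rule refl)
 finally have "qform (gram_sum A s B \<omega>) x = (\<Sum>\<Phi>\<in>B. Re (\<Sum>i\<in>UNIV. \<Sum>j\<in>UNIV. cnj (x $ i) * x $ j * infsum (?p \<Phi> i j) A))"
  by (simp add: qform_def)
 also have "... = (\<Sum>\<Phi>\<in>B. infsum (?q \<Phi>) A)"
  by (intro sum.cong refl infsumI[OF hr, symmetric])
 finally show "qform (gram_sum A s B \<omega>) x = (\<Sum>\<Phi>\<in>B. infsum (?q \<Phi>) A)" .
qed

lemma sum_le_norm_gram:
 fixes B :: "('d::finite functional ^ 'r::finite) set"
 assumes gs: "gram_summable s B \<omega>" and A: "A \<subseteq> dual_lattice" and B: "finite B" "\<Phi> \<in> B" and F: "finite F" "F \<subseteq> A"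
 shows "(\<Sum>\<alpha>\<in>F. (norm (vhat \<Phi> (\<omega> + \<alpha>)))\<^sup>2 * norm (\<omega> + \<alpha>) powr (2 * s)) <= CARD('r) * norm (gram_sum A s B \<omega>)"
proof -
 have c: "cinner (axis i 1) y = y $ i" for i and y :: "complex^'r"
 proof -
  have "cinner (axis i 1) y = (\<Sum>j\<in>UNIV. if j = i then y $ i else 0)"
   unfolding cinner_def by (intro sum.cong) (auto simp: axis_def)
  then show ?thesis by simp
 qed
 have one: "(\<Sum>\<alpha>\<in>F. (norm (vhat \<Phi> (\<omega> + \<alpha>) $ i))\<^sup>2 * norm (\<omega> + \<alpha>) powr (2 * s)) <= norm (gram_sum A s B \<omega>)" for i
 proof -
  let ?q = "\<lambda>\<Phi> \<alpha>. (norm (vhat \<Phi> (\<omega> + \<alpha>) $ i))\<^sup>2 * norm (\<omega> + \<alpha>) powr (2 * s)"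
  have "sum (?q \<Phi>) F <= infsum (?q \<Phi>) A"
   using gram_form(1)[OF gs A B(2), of "axis i 1"] F by (intro finite_sum_le_infsum) (auto simp: c)
  also have "... <= (\<Sum>\<Phi>\<in>B. infsum (?q \<Phi>) A)"
   using B by (intro member_le_sum infsum_nonneg) auto
  also have "... = qform (gram_sum A s B \<omega>) (axis i 1)"
   using gram_form(2)[OF gs A, of "axis i 1"] by (simp add: c)
  also have "... = Re (gram_sum A s B \<omega> $ i $ i)"
  proof -
   have "(gram_sum A s B \<omega> *v axis i 1) $ i = (\<Sum>j\<in>UNIV. if j = i then gram_sum A s B \<omega> $ i $ i else 0)"
    unfolding matrix_vector_mult_def vec_lambda_beta by (intro sum.cong) (auto simp: axis_def)
   then show ?thesis by (simp add: qform_def c)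
  qed
  also have "... <= norm (gram_sum A s B \<omega> $ i $ i)" by (rule complex_Re_le_cmod)
  also have "... <= norm (gram_sum A s B \<omega> $ i)" by (rule Finite_Cartesian_Product.norm_nth_le)
  also have "... <= norm (gram_sum A s B \<omega>)" by (rule Finite_Cartesian_Product.norm_nth_le)
  finally show ?thesis .
 qed
 have "(\<Sum>\<alpha>\<in>F. (norm (vhat \<Phi> (\<omega> + \<alpha>)))\<^sup>2 * norm (\<omega> + \<alpha>) powr (2 * s))
  = (\<Sum>i\<in>UNIV. \<Sum>\<alpha>\<in>F. (norm (vhat \<Phi> (\<omega> + \<alpha>) $ i))\<^sup>2 * norm (\<omega> + \<alpha>) powr (2 * s))"
  unfolding norm_vec_def L2_set_def by (subst sum.swap) (simp add: sum_nonneg sum_distrib_right)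
 also have "... <= (\<Sum>i\<in>(UNIV::'r set). norm (gram_sum A s B \<omega>))" by (intro sum_mono one)
 finally show ?thesis by simp
qed

section \<open>The dyadic recursion on the lattice\<close>

lemma L2_set_Un_le: "finite A ==> finite B ==> L2_set f (A \<union> B) <= L2_set f A + L2_set f B"
proof -
 assume "finite A" "finite B"
 then have "(\<Sum>i\<in>A \<union> B. (f i)\<^sup>2) <= (\<Sum>i\<in>A. (f i)\<^sup>2) + (\<Sum>i\<in>B. (f i)\<^sup>2)"
  using sum.union_inter[of A B "\<lambda>i. (f i)\<^sup>2"] sum_nonneg[of "A \<inter> B" "\<lambda>i. (f i)\<^sup>2"] by simp
 then have "L2_set f (A \<union> B) <= sqrt ((\<Sum>i\<in>A. (f i)\<^sup>2) + (\<Sum>i\<in>B. (f i)\<^sup>2))"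
  unfolding L2_set_def by simp
 also have "... <= L2_set f A + L2_set f B"
  unfolding L2_set_def by (intro sqrt_add_le_add_sqrt sum_nonneg) auto
 finally show ?thesis .
qed

lemma L2_set_UN_le:
 "finite I ==> (\<And>i. i \<in> I ==> finite (A i)) ==> L2_set f (\<Union>i\<in>I. A i) <= (\<Sum>i\<in>I. L2_set f (A i))"
proof (induction I rule: finite_induct)
 case (insert i I)
 have "L2_set f (A i \<union> (\<Union>i\<in>I. A i)) <= L2_set f (A i) + L2_set f (\<Union>i\<in>I. A i)"
  using insert by (intro L2_set_Un_le) auto
 then show ?case using insert by simp
qed simp

lemma L2_set_image: "inj_on h B ==> L2_set f (h ` B) = L2_set (\<lambda>b. f (h b)) B"
 by (simp add: L2_set_def sum.reindex)

text \<open>The \<open>\<ell>\<^sub>2\<close> norm, over a finite set of lattice points, of the translates of \<open>f\<close> at \<open>x\<close>. Finite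
 sets avoid all questions of convergence; the bounds below are uniform in the set.\<close>

definition wnorm :: "real => (real^'d::finite => 'b::real_normed_vector) => (real^'d) set => real^'d => real" where
 "wnorm s f A x = L2_set (\<lambda>\<alpha>. norm (x + \<alpha>) powr s * norm (f (x + \<alpha>))) A"

abbreviation wnorm_le :: "(real^'d::finite) set => real => (real^'d => 'b::real_normed_vector) => real^'d => real => bool" where
 "wnorm_le A s f x c == \<forall>F. finite F --> F \<subseteq> A --> wnorm s f F x <= c"

lemma wnorm_nonneg [simp]: "0 <= wnorm s f A x"
 by (simp add: wnorm_def)

lemma powr_double: "norm (2 *\<^sub>R z) powr s = 2 powr s * norm z powr s"
 by (simp add: powr_mult)

text \<open>The hypotheses express the refinement equation together with the zeros of the mask:
 \<open>f(2\<cdot>)\<close> agrees with \<open>f\<close> near lattice points and with \<open>0\<close> near half lattice points, up to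
 an error of order \<open>k\<close> relative to \<open>g\<close>, which has bounded \<open>\<ell>\<^sub>2\<close> norms. As \<open>k > s\<close>, doubling the
 argument contracts the estimate \<open>O(|x|\<^sup>k)\<close> by \<open>2\<^sup>s\<^sup>-\<^sup>k\<close>; the recursion stops after
 finitely many steps because each lattice point is divisible by \<open>2\<close> only finitely often.\<close>

lemma wnorm_le_descending:
 fixes f :: "real^'d::finite => complex" and g :: "real^'d => 'b::real_normed_vector" and x :: "real^'d" and C :: real
 assumes sk: "s < k" and C: "C \<ge> 0"
  and split: "\<And>n l \<beta>. l \<in> unit_vertices ==> \<beta> \<in> dual_lattice ==>
   norm (f (2 *\<^sub>R ((1/2)^Suc n *\<^sub>R x + pi *\<^sub>R l + \<beta>)) - (if l = 0 then f ((1/2)^Suc n *\<^sub>R x + \<beta>) else 0))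
    <= C * norm ((1/2)^Suc n *\<^sub>R x) powr k * norm (g ((1/2)^Suc n *\<^sub>R x + pi *\<^sub>R l + \<beta>))"
  and g: "\<And>n l A. l \<in> unit_vertices ==> finite A ==> A \<subseteq> dual_lattice ==> (l = 0 ==> 0 \<notin> A) ==>
   wnorm s g A ((1/2)^Suc n *\<^sub>R x + pi *\<^sub>R l) <= C"
  and A: "finite A" "A \<subseteq> dual_lattice - {0}"
 shows "wnorm s f A x <= card (unit_vertices :: (real^'d) set) * C * C * 2 powr (s - k) / (1 - 2 powr (s - k)) * norm x powr k"
proof -
 let ?E = "unit_vertices :: (real^'d) set"
 let ?z = "\<lambda>n. (1/2::real)^n *\<^sub>R x"
 define C1 where "C1 = card ?E * C * C"
 define q where "q = 2 powr (s - k)"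
 define K where "K = C1 * q / (1 - q)"
 have q: "0 < q" "q < 1" using sk by (auto simp: q_def powr_less_one)
 have C1: "C1 \<ge> 0" using C by (simp add: C1_def)
 have K: "K \<ge> 0" using C1 q by (simp add: K_def)
 have Kq: "q * (K + C1) = K" using q by (simp add: K_def field_simps)
 have step: "wnorm s f A (?z n) <= K * norm (?z n) powr k"
  if "finite A" "A \<subseteq> dual_lattice - {0}" "\<And>\<alpha>. \<alpha> \<in> A ==> norm \<alpha> < 2 * pi * 2 ^ N" for N n A
  using that
 proof (induction N arbitrary: n A)
  case 0
  then have "A = {}" using norm_dual_lattice by fastforce
  then show ?case using K by (simp add: wnorm_def)
 next
  case (Suc N)
  define y where "y = ?z (Suc n)"
  have zy: "?z n = 2 *\<^sub>R y" by (simp add: y_def)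
  define B where "B l = {\<beta> \<in> dual_lattice. 2 *\<^sub>R (pi *\<^sub>R l + \<beta>) \<in> A}" for l
  let ?h = "\<lambda>l \<beta>. 2 *\<^sub>R (pi *\<^sub>R l + \<beta>)"
  have inj: "inj_on (?h l) (B l)" for l by (rule inj_onI) simp
  have finB: "finite (B l)" for l
   by (rule inj_on_finite[OF inj _ Suc.prems(1)]) (auto simp: B_def)
  have "A \<subseteq> (\<Union>l\<in>?E. ?h l ` B l)"
  proof
   fix \<alpha> assume a: "\<alpha> \<in> A"
   then have "\<alpha> \<in> dual_lattice" using Suc.prems by auto
   from dual_lattice_split[OF this] obtain l \<beta> where "l \<in> ?E" "\<beta> \<in> dual_lattice" "\<alpha> = 2 *\<^sub>R (pi *\<^sub>R l + \<beta>)" .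
   then show "\<alpha> \<in> (\<Union>l\<in>?E. ?h l ` B l)" using a by (auto simp: B_def)
  qed
  then have Aeq: "A = (\<Union>l\<in>?E. ?h l ` B l)" by (auto simp: B_def)
  have one: "wnorm s f (?h l ` B l) (?z n) <= 2 powr s * ((if l = 0 then K * norm y powr k else 0) + C * norm y powr k * C)"
   if l: "l \<in> ?E" for l
  proof -
   have "wnorm s f (?h l ` B l) (?z n) = L2_set (\<lambda>\<beta>. 2 powr s * (norm (y + pi *\<^sub>R l + \<beta>) powr s * norm (f (2 *\<^sub>R (y + pi *\<^sub>R l + \<beta>))))) (B l)"
   proof -
    have "?z n + ?h l \<beta> = 2 *\<^sub>R (y + pi *\<^sub>R l + \<beta>)" for \<beta>
     by (simp add: zy algebra_simps)
    then show ?thesis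
     unfolding wnorm_def L2_set_image[OF inj] by (simp only: powr_double mult.assoc)
   qed
   also have "... <= L2_set (\<lambda>\<beta>. 2 powr s * ((if l = 0 then norm (y + \<beta>) powr s * norm (f (y + \<beta>)) else 0) +
     C * norm y powr k * (norm (y + pi *\<^sub>R l + \<beta>) powr s * norm (g (y + pi *\<^sub>R l + \<beta>))))) (B l)"
   proof (intro L2_set_mono mult_left_mono)
    fix \<beta> assume b: "\<beta> \<in> B l"
    have "\<beta> \<in> dual_lattice" using b by (simp add: B_def)
    from split[OF l this, of n, folded y_def]
    have "norm (f (2 *\<^sub>R (y + pi *\<^sub>R l + \<beta>))) <= norm (if l = 0 then f (y + \<beta>) else 0) + C * norm y powr k * norm (g (y + pi *\<^sub>R l + \<beta>))"
     using norm_triangle_ineq2[of "f (2 *\<^sub>R (y + pi *\<^sub>R l + \<beta>))" "if l = 0 then f (y + \<beta>) else 0"] by linarith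
    from mult_left_mono[OF this powr_ge_zero[of "norm (y + pi *\<^sub>R l + \<beta>)" s]]
    show "norm (y + pi *\<^sub>R l + \<beta>) powr s * norm (f (2 *\<^sub>R (y + pi *\<^sub>R l + \<beta>))) <= (if l = 0 then norm (y + \<beta>) powr s * norm (f (y + \<beta>)) else 0) +
     C * norm y powr k * (norm (y + pi *\<^sub>R l + \<beta>) powr s * norm (g (y + pi *\<^sub>R l + \<beta>)))"
     by (cases "l = 0") (simp_all only: distrib_left if_True if_False simp_thms scaleR_zero_right add_0_right norm_zero mult_zero_right mult.left_commute)
   qed (use C in auto)
   also have "... = 2 powr s * L2_set (\<lambda>\<beta>. (if l = 0 then norm (y + \<beta>) powr s * norm (f (y + \<beta>)) else 0) +
     C * norm y powr k * (norm (y + pi *\<^sub>R l + \<beta>) powr s * norm (g (y + pi *\<^sub>R l + \<beta>)))) (B l)"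
    by (rule L2_set_right_distrib[symmetric]) simp
   also have "... <= 2 powr s * (L2_set (\<lambda>\<beta>. if l = 0 then norm (y + \<beta>) powr s * norm (f (y + \<beta>)) else 0) (B l) +
     L2_set (\<lambda>\<beta>. C * norm y powr k * (norm (y + pi *\<^sub>R l + \<beta>) powr s * norm (g (y + pi *\<^sub>R l + \<beta>)))) (B l))"
    by (intro mult_left_mono L2_set_triangle_ineq) simp
   also have "L2_set (\<lambda>\<beta>. C * norm y powr k * (norm (y + pi *\<^sub>R l + \<beta>) powr s * norm (g (y + pi *\<^sub>R l + \<beta>)))) (B l) = C * norm y powr k * wnorm s g (B l) (y + pi *\<^sub>R l)"
    unfolding wnorm_def using C by (intro L2_set_right_distrib[symmetric]) simp
   also have "2 powr s * (L2_set (\<lambda>\<beta>. if l = 0 then norm (y + \<beta>) powr s * norm (f (y + \<beta>)) else 0) (B l) + C * norm y powr k * wnorm s g (B l) (y + pi *\<^sub>R l))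
    <= 2 powr s * ((if l = 0 then K * norm y powr k else 0) + C * norm y powr k * C)"
   proof (intro mult_left_mono add_mono)
    show "L2_set (\<lambda>\<beta>. if l = 0 then norm (y + \<beta>) powr s * norm (f (y + \<beta>)) else 0) (B l) <= (if l = 0 then K * norm y powr k else 0)"
    proof (cases "l = 0")
     case True
     have "wnorm s f (B 0) (?z (Suc n)) <= K * norm (?z (Suc n)) powr k"
     proof (rule Suc.IH)
      show "finite (B 0)" by (rule finB)
      show "B 0 \<subseteq> dual_lattice - {0}" using Suc.prems by (auto simp: B_def)
      fix \<beta> assume "\<beta> \<in> B 0"
      then have "norm (2 *\<^sub>R \<beta>) < 2 * pi * 2 ^ Suc N" using Suc.prems(3)[of "2 *\<^sub>R \<beta>"] by (auto simp: B_def)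
      then show "norm \<beta> < 2 * pi * 2 ^ N" by simp
     qed
     then show ?thesis using True by (simp add: wnorm_def y_def)
    qed (simp add: L2_set_def)
    show "wnorm s g (B l) (y + pi *\<^sub>R l) <= C"
     unfolding y_def using Suc.prems by (intro g l finB) (auto simp: B_def)
   qed (use C in auto)
   finally show ?thesis .
  qed
  have "wnorm s f A (?z n) <= (\<Sum>l\<in>?E. wnorm s f (?h l ` B l) (?z n))"
   unfolding wnorm_def by (subst Aeq, rule L2_set_UN_le) (auto intro: finB)
  also have "... <= (\<Sum>l\<in>?E. 2 powr s * ((if l = 0 then K * norm y powr k else 0) + C * norm y powr k * C))"
   by (intro sum_mono one)
  also have "... = 2 powr s * ((\<Sum>l\<in>?E. (if l = 0 then K * norm y powr k else 0)) + (\<Sum>l\<in>?E. C * norm y powr k * C))"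
   by (simp only: sum_distrib_left[symmetric] sum.distrib)
  also have "... = 2 powr s * (K + C1) * norm y powr k"
   by (simp add: C1_def algebra_simps)
  also have "... = q * (K + C1) * (norm (?z n)) powr k"
   unfolding zy powr_double by (simp add: q_def powr_diff)
  finally show ?case unfolding Kq .
 qed
 obtain N where N: "\<And>\<alpha>. \<alpha> \<in> A ==> norm \<alpha> < 2 * pi * 2 ^ N"
 proof -
  obtain M where M: "\<And>\<alpha>. \<alpha> \<in> A ==> norm \<alpha> <= M" using finite_imp_bounded[OF A(1)] by (auto simp: bounded_iff)
  obtain N where "M < 2 ^ N" using real_arch_pow[of 2 M] by auto
  moreover have "(2::real) ^ N <= 2 * pi * 2 ^ N" using pi_ge_two by simp
  ultimately show ?thesis using M by (intro that[of N]) (meson le_less_trans less_le_trans)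
 qed
 show ?thesis
  using step[OF A N, of 0] by (simp add: K_def C1_def q_def)
qed

text \<open>When \<open>s \<ge> k\<close> the recursion is used in the opposite direction: a bound for \<open>f\<close> away from the
 origin is carried inwards, gaining \<open>2\<^sup>-\<^sup>s\<close> at each halving.\<close>

lemma wnorm_le_ascending:
 fixes f :: "real^'d::finite => complex" and g :: "real^'d => 'b::real_normed_vector" and y :: "real^'d" and C :: real
 assumes k: "k > 0" and C: "C \<ge> 0"
  and split: "\<And>n \<beta>. norm (2^n *\<^sub>R y) < \<rho> ==> \<beta> \<in> dual_lattice ==>
   norm (f (2 *\<^sub>R (2^n *\<^sub>R y + \<beta>)) - f (2^n *\<^sub>R y + \<beta>)) <= C * norm (2^n *\<^sub>R y) powr k * norm (g (2^n *\<^sub>R y + \<beta>))"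
  and g: "\<And>n A. norm (2^n *\<^sub>R y) < \<rho> ==> finite A ==> A \<subseteq> dual_lattice ==>
   wnorm s g A (2^n *\<^sub>R y) <= C * norm (2^n *\<^sub>R y) powr s"
  and f: "\<And>n A. norm (2^n *\<^sub>R y) < \<rho> ==> finite A ==> A \<subseteq> dual_lattice - {0} ==> wnorm s f A (2^n *\<^sub>R y) <= D"
  and y: "y \<noteq> 0" "norm y < \<rho>"
  and s: "s \<ge> 0" and A: "finite A" "A \<subseteq> dual_lattice - {0}"
 shows "wnorm s f A y <= ((2 / \<rho>) powr s * D + C * C * \<rho> powr k / (2 powr k - 1)) * norm y powr s"
proof -
 have rho: "\<rho> > 0" using y norm_ge_zero[of y] by linarith
 define q where "q = 2 powr k"
 have q: "q > 1" using k by (simp add: q_def)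
 let ?z = "\<lambda>n. (2::real)^n *\<^sub>R y"
 have D: "D \<ge> 0" using f[of 0 "{}"] y by (simp add: wnorm_def)
 have step: "wnorm s f A (?z m) <= 2 powr (- s) * wnorm s f ((*\<^sub>R) 2 ` A) (?z (Suc m)) + C * C * norm (?z m) powr (k + s)"
  if m: "norm (?z m) < \<rho>" and A: "finite A" "A \<subseteq> dual_lattice - {0}" for m A
 proof -
  have inj: "inj_on ((*\<^sub>R) (2::real)) A" by (rule inj_onI) simp
  have "wnorm s f A (?z m) <= L2_set (\<lambda>\<beta>. 2 powr (- s) * (norm (?z (Suc m) + 2 *\<^sub>R \<beta>) powr s * norm (f (?z (Suc m) + 2 *\<^sub>R \<beta>))) +
    C * norm (?z m) powr k * (norm (?z m + \<beta>) powr s * norm (g (?z m + \<beta>)))) A"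
   unfolding wnorm_def
  proof (rule L2_set_mono)
   fix \<beta> assume b: "\<beta> \<in> A"
   have e: "?z (Suc m) + 2 *\<^sub>R \<beta> = 2 *\<^sub>R (?z m + \<beta>)" by (simp add: algebra_simps)
   have scal: "2 powr (- s) * (2 powr s * t) = t" for t :: real by (simp add: powr_minus)
   have "norm (f (?z m + \<beta>)) <= norm (f (2 *\<^sub>R (?z m + \<beta>))) + C * norm (?z m) powr k * norm (g (?z m + \<beta>))"
    using split[OF m, of \<beta>] b A norm_triangle_ineq3[of "f (?z m + \<beta>)" "f (2 *\<^sub>R (?z m + \<beta>))"]
    by (auto simp: norm_minus_commute)
   from mult_left_mono[OF this powr_ge_zero[of "norm (?z m + \<beta>)" s]]
   show "norm (?z m + \<beta>) powr s * norm (f (?z m + \<beta>)) <= 2 powr (- s) * (norm (?z (Suc m) + 2 *\<^sub>R \<beta>) powr s * norm (f (?z (Suc m) + 2 *\<^sub>R \<beta>))) +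
    C * norm (?z m) powr k * (norm (?z m + \<beta>) powr s * norm (g (?z m + \<beta>)))"
    unfolding e powr_double mult.assoc scal by (simp only: algebra_simps)
  qed (auto simp: C)
  also have "... <= L2_set (\<lambda>\<beta>. 2 powr (- s) * (norm (?z (Suc m) + 2 *\<^sub>R \<beta>) powr s * norm (f (?z (Suc m) + 2 *\<^sub>R \<beta>)))) A
    + L2_set (\<lambda>\<beta>. C * norm (?z m) powr k * (norm (?z m + \<beta>) powr s * norm (g (?z m + \<beta>)))) A"
   by (rule L2_set_triangle_ineq)
  also have "L2_set (\<lambda>\<beta>. 2 powr (- s) * (norm (?z (Suc m) + 2 *\<^sub>R \<beta>) powr s * norm (f (?z (Suc m) + 2 *\<^sub>R \<beta>)))) A
   = 2 powr (- s) * wnorm s f ((*\<^sub>R) 2 ` A) (?z (Suc m))"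
   unfolding wnorm_def L2_set_image[OF inj] by (rule L2_set_right_distrib[symmetric]) simp
  also have "L2_set (\<lambda>\<beta>. C * norm (?z m) powr k * (norm (?z m + \<beta>) powr s * norm (g (?z m + \<beta>)))) A
   = C * norm (?z m) powr k * wnorm s g A (?z m)"
   unfolding wnorm_def using C by (intro L2_set_right_distrib[symmetric]) simp
  also have "... <= C * norm (?z m) powr k * (C * norm (?z m) powr s)"
   using A C by (intro mult_left_mono g m) auto
  also have "... = C * C * norm (?z m) powr (k + s)" by (simp add: powr_add)
  finally show ?thesis by simp
 qed
 have nz: "norm (?z m) = 2 ^ m * norm y" for m by simp
 have iter: "\<exists>A'. finite A' \<and> A' \<subseteq> dual_lattice - {0} \<and>
   wnorm s f A y <= 2 powr (- s * m) * wnorm s f A' (?z m) + C * C * norm y powr (k + s) * (\<Sum>j<m. q ^ j)"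
  if "m = 0 \<or> norm (?z (m - 1)) < \<rho>" for m
  using that
 proof (induction m)
  case 0
  show ?case using A by (intro exI[of _ A]) auto
 next
  case (Suc m)
  have m: "norm (?z m) < \<rho>" using Suc.prems by simp
  have "m = 0 \<or> norm (?z (m - 1)) < \<rho>"
  proof (cases m)
   case (Suc j)
   have "norm (?z j) <= norm (?z m)" unfolding nz Suc by simp
   then have "norm (?z j) < \<rho>" using m by (rule le_less_trans)
   then show ?thesis unfolding Suc by simp
  qed simp
  from Suc.IH[OF this] obtain A' where A': "finite A'" "A' \<subseteq> dual_lattice - {0}"
   and le: "wnorm s f A y <= 2 powr (- s * m) * wnorm s f A' (?z m) + C * C * norm y powr (k + s) * (\<Sum>j<m. q ^ j)" by blast
  have "2 powr (- s * m) * wnorm s f A' (?z m) <= 2 powr (- s * m) * (2 powr (- s) * wnorm s f ((*\<^sub>R) 2 ` A') (?z (Suc m)) + C * C * norm (?z m) powr (k + s))"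
   by (intro mult_left_mono step m A') auto
  also have "... = 2 powr (- s * Suc m) * wnorm s f ((*\<^sub>R) 2 ` A') (?z (Suc m)) + C * C * (2 powr (- s * m) * norm (?z m) powr (k + s))"
   by (simp add: powr_add[symmetric] algebra_simps)
  also have "2 powr (- s * m) * norm (?z m) powr (k + s) = norm y powr (k + s) * q ^ m"
  proof -
   have "norm (?z m) powr (k + s) = (2 ^ m) powr (k + s) * norm y powr (k + s)" unfolding nz by (simp add: powr_mult)
   also have "(2 ^ m::real) powr (k + s) = 2 powr (m * (k + s))" by (simp add: powr_realpow[symmetric] powr_powr)
   also have "q ^ m = 2 powr (k * m)" by (simp add: q_def powr_realpow[symmetric] powr_powr)
   moreover have "2 powr (- s * m) * 2 powr (m * (k + s)) = (2::real) powr (k * m)" by (simp add: powr_add[symmetric] algebra_simps)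
   ultimately show ?thesis by (simp add: mult.assoc[symmetric])
  qed
  finally have "wnorm s f A y <= 2 powr (- s * Suc m) * wnorm s f ((*\<^sub>R) 2 ` A') (?z (Suc m)) + C * C * norm y powr (k + s) * (\<Sum>j<Suc m. q ^ j)"
   using le by (simp add: algebra_simps)
  moreover have "(*\<^sub>R) 2 ` A' \<subseteq> dual_lattice - {0}" using A' dual_lattice_double by auto
  ultimately show ?case using A' by (intro exI[of _ "(*\<^sub>R) 2 ` A'"]) auto
 qed
 \<comment> \<open>the last dilate of \<open>y\<close> inside the ball, which has norm at least \<open>\<rho>/2\<close>\<close>
 obtain m where m: "norm (?z m) < \<rho>" "\<rho> <= norm (?z (Suc m))"
 proof -
  obtain N where "\<rho> / norm y < 2 ^ N" using real_arch_pow[of 2 "\<rho> / norm y"] by auto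
  then have ex: "\<rho> <= norm (?z N)" using y by (simp add: field_simps)
  define N0 where "N0 = (LEAST N. \<rho> <= norm (?z N))"
  have N0: "\<rho> <= norm (?z N0)" unfolding N0_def by (rule LeastI[of "\<lambda>N. \<rho> <= norm (?z N)", OF ex])
  then obtain m where "N0 = Suc m" using y by (cases N0) auto
  moreover have "\<not> \<rho> <= norm (?z m)" using \<open>N0 = Suc m\<close> not_less_Least[of m "\<lambda>N. \<rho> <= norm (?z N)"] by (simp add: N0_def)
  ultimately show ?thesis using N0 that[of m] by simp
 qed
 have "m = 0 \<or> norm (?z (m - 1)) < \<rho>"
 proof (cases m)
  case (Suc j)
  have "norm (?z j) <= norm (?z m)" unfolding nz Suc by simp
  then have "norm (?z j) < \<rho>" using m(1) by (rule le_less_trans)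
  then show ?thesis unfolding Suc by simp
 qed simp
 from iter[OF this] obtain A' where A': "finite A'" "A' \<subseteq> dual_lattice - {0}"
  and le: "wnorm s f A y <= 2 powr (- s * m) * wnorm s f A' (?z m) + C * C * norm y powr (k + s) * (\<Sum>j<m. q ^ j)" by blast
 have "2 powr (- s * m) * wnorm s f A' (?z m) <= 2 powr (- s * m) * D"
  by (intro mult_left_mono f m A') auto
 also have "2 powr (- s * m) <= (2 / \<rho> * norm y) powr s"
 proof -
  have "inverse (2 ^ m) <= 2 / \<rho> * norm y" using m(2) rho unfolding nz by (simp add: field_simps)
  then have "inverse (2 ^ m) powr s <= (2 / \<rho> * norm y) powr s" using s by (intro powr_mono2) auto
  moreover have "inverse (2 ^ m) powr s = (2::real) powr (- s * m)"
   by (simp add: powr_realpow[symmetric] powr_minus[symmetric] powr_powr mult.commute)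
  ultimately show ?thesis by simp
 qed
 also have "(2 / \<rho> * norm y) powr s = (2 / \<rho>) powr s * norm y powr s" using rho by (simp only: powr_mult)
 finally have 1: "2 powr (- s * m) * wnorm s f A' (?z m) <= (2 / \<rho>) powr s * norm y powr s * D"
  using D by (meson mult_right_mono)
 have "(\<Sum>j<m. q ^ j) <= q ^ m / (q - 1)"
  using q by (simp add: sum_gp_strict divide_simps) (simp add: algebra_simps)
 moreover have "norm y powr k * q ^ m <= \<rho> powr k"
 proof -
  have "q ^ m = (2 ^ m) powr k" by (simp add: q_def powr_realpow[symmetric] powr_powr mult.commute)
  then have "norm y powr k * q ^ m = (norm (?z m)) powr k" unfolding nz by (simp add: powr_mult)
  also have "... <= \<rho> powr k" using m(1) k by (intro powr_mono2) auto
  finally show ?thesis .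
 qed
 ultimately have "norm y powr k * (\<Sum>j<m. q ^ j) <= \<rho> powr k / (q - 1)"
  using q by (smt (verit, best) divide_right_mono mult_left_mono powr_ge_zero times_divide_eq_right)
 then have 2: "C * C * norm y powr (k + s) * (\<Sum>j<m. q ^ j) <= C * C * (\<rho> powr k / (q - 1)) * norm y powr s"
  using mult_left_mono[of "norm y powr k * (\<Sum>j<m. q ^ j)" "\<rho> powr k / (q - 1)" "C * C * norm y powr s"] C
  by (simp add: powr_add mult_ac)
 show ?thesis using le 1 2 by (simp add: q_def algebra_simps)
qed

section \<open>Taylor estimates from weak derivatives\<close>

text \<open>One-variable Taylor theorem at a boundary point where nothing is assumed about the derivatives: \<open>deriv_bound n A h\<close>
 says that \<open>h\<close> has \<open>n\<close> derivatives on the half-open interval, the last one bounded by \<open>A\<close>.\<close>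

primrec deriv_bound :: "nat => real => (real => complex) => bool" where
 "deriv_bound 0 A h \<longleftrightarrow> (\<forall>u\<in>{0<..1}. norm (h u) <= A)"
| "deriv_bound (Suc n) A h \<longleftrightarrow>
  (\<exists>h'. (\<forall>u\<in>{0<..1}. (h has_vector_derivative h' u) (at u within {0<..1})) \<and> deriv_bound n A h')"

lemma deriv_bound_add:
 "deriv_bound n A h ==> deriv_bound n A' g ==> deriv_bound n (A + A') (\<lambda>u. h u + g u)"
proof (induction n arbitrary: h g)
 case 0
 then show ?case by (auto intro: norm_triangle_le add_mono)
next
 case (Suc n)
 from Suc.prems obtain h' g' where
  "\<forall>u\<in>{0<..1}. (h has_vector_derivative h' u) (at u within {0<..1})" "deriv_bound n A h'"
  "\<forall>u\<in>{0<..1}. (g has_vector_derivative g' u) (at u within {0<..1})" "deriv_bound n A' g'" by auto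
 then show ?case
  unfolding deriv_bound.simps by (intro exI[of _ "\<lambda>u. h' u + g' u"] conjI Suc.IH) (auto intro: has_vector_derivative_add)
qed

lemma deriv_bound_minus: "deriv_bound n A h ==> deriv_bound n A (\<lambda>u. - h u)"
proof (induction n arbitrary: h)
 case (Suc n)
 then obtain h' where "\<forall>u\<in>{0<..1}. (h has_vector_derivative h' u) (at u within {0<..1})" "deriv_bound n A h'" by auto
 then show ?case unfolding deriv_bound.simps
  by (intro exI[of _ "\<lambda>u. - h' u"] conjI Suc.IH) (auto intro: has_vector_derivative_minus)
qed auto

lemma deriv_bound_zero: "deriv_bound n 0 (\<lambda>u. 0)"
proof (induction n)
 case (Suc n)
 then show ?case unfolding deriv_bound.simps by (intro exI[of _ "\<lambda>u. 0"]) auto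
qed simp

lemma deriv_bound_sum:
 "finite I ==> (\<And>i. i \<in> I ==> deriv_bound n A (h i)) ==> deriv_bound n (real (card I) * A) (\<lambda>u. \<Sum>i\<in>I. h i u)"
proof (induction I rule: finite_induct)
 case (insert i I)
 have "deriv_bound n (A + card I * A) (\<lambda>u. h i u + (\<Sum>i\<in>I. h i u))"
  using insert by (intro deriv_bound_add) auto
 moreover have "A + card I * A = card (insert i I) * A" using insert by (simp add: algebra_simps)
 ultimately show ?case using insert by simp
qed (simp add: deriv_bound_zero)

lemma has_vector_derivative_power_div:
 "((\<lambda>u. c * of_real u ^ Suc j / of_nat (Suc j)) has_vector_derivative c * of_real u ^ j) (at u within S)" for c :: complex
proof -
 have "((\<lambda>u::real. u ^ Suc j / Suc j) has_real_derivative u ^ j) (at u within S)"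
  by (rule derivative_eq_intros refl | simp del: of_nat_Suc)+
 from has_vector_derivative_mult_right[OF has_vector_derivative_of_real[OF this], of c]
 show ?thesis by (simp del: of_nat_Suc)
qed

lemma deriv_bound_poly:
 "deriv_bound n A h ==> \<exists>c. \<forall>u\<in>{0<..1}. norm (h u - (\<Sum>j<n. c j * of_real u ^ j)) <= A * u ^ n"
proof (induction n arbitrary: h)
 case 0
 then show ?case by auto
next
 case (Suc n)
 from Suc.prems obtain h' where h'0: "\<forall>u\<in>{0<..1}. (h has_vector_derivative h' u) (at u within {0<..1})" "deriv_bound n A h'"
  unfolding deriv_bound.simps by blast
 note h' = h'0(1)[rule_format] h'0(2)
 from Suc.IH[OF h'(2)] obtain c where c: "\<And>u. u \<in> {0<..1} ==> norm (h' u - (\<Sum>j<n. c j * of_real u ^ j)) <= A * u ^ n" by blast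
 define w where "w u = h u - (\<Sum>j<n. c j * of_real u ^ Suc j / of_nat (Suc j))" for u
 have dw: "(w has_vector_derivative (h' u - (\<Sum>j<n. c j * of_real u ^ j))) (at u within {0<..1})" if "u \<in> {0<..1}" for u
  unfolding w_def
  by (intro has_vector_derivative_diff has_vector_derivative_sum has_vector_derivative_power_div h' that)
 have A: "A \<ge> 0" using order_trans[OF norm_ge_zero c[of 1]] by simp
 have diff: "norm (w b - w a) <= A * b ^ n * (b - a)" if ab: "0 < a" "a < b" "b <= 1" for a b
 proof -
  have "norm (w b - w a) <= A * b ^ n * b - A * b ^ n * a"
  proof (rule differentiable_bound_general)
   show "continuous_on {a..b} w"
   proof (rule continuous_on_vector_derivative)
    fix x assume "x \<in> {a..b}"
    then have "x \<in> {0<..1}" using ab by auto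
    then show "(w has_vector_derivative (h' x - (\<Sum>j<n. c j * of_real x ^ j))) (at x within {a..b})"
     using ab by (intro has_vector_derivative_within_subset[OF dw]) auto
   qed
   fix x assume x: "a < x" "x < b"
   then have x': "x \<in> {0<..1}" using ab by auto
   show "(w has_vector_derivative (h' x - (\<Sum>j<n. c j * of_real x ^ j))) (at x)"
   proof -
    have "(w has_vector_derivative (h' x - (\<Sum>j<n. c j * of_real x ^ j))) (at x within {a<..<b})"
     using ab by (intro has_vector_derivative_within_subset[OF dw[OF x']]) auto
    then show ?thesis using x by (simp add: at_within_open[of x "{a<..<b}"])
   qed
   have "norm (h' x - (\<Sum>j<n. c j * of_real x ^ j)) <= A * x ^ n" by (rule c[OF x'])
   also have "... <= A * b ^ n" using x ab A by (intro mult_left_mono power_mono) auto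
   finally show "norm (h' x - (\<Sum>j<n. c j * of_real x ^ j)) <= A * b ^ n" .
   show "((\<lambda>x. A * b ^ n * x) has_vector_derivative A * b ^ n) (at x)"
    by (auto intro!: derivative_eq_intros)
  qed (use ab in \<open>auto intro!: continuous_intros\<close>)
  then show ?thesis by (simp add: algebra_simps)
 qed
 have diff': "norm (w b - w a) <= A * b ^ Suc n" if ab: "0 < a" "a <= b" "b <= 1" for a b
 proof (cases "a = b")
  case False
  then have "norm (w b - w a) <= A * b ^ n * (b - a)" using ab by (intro diff) auto
  also have "... <= A * b ^ n * b" using ab A by (intro mult_left_mono) auto
  finally show ?thesis by (simp add: mult_ac)
 qed (use A ab in simp)
 have "Cauchy (\<lambda>m. w (inverse (real (Suc m))))"
 proof (rule metric_CauchyI)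
  fix e :: real assume e: "e > 0"
  obtain M where M: "A * inverse (real (Suc M)) < e"
  proof -
   have "(\<lambda>m. A * inverse (real (Suc m))) \<longlonglongrightarrow> A * 0" by (intro tendsto_intros LIMSEQ_inverse_real_of_nat)
   then have "\<forall>\<^sub>F m in sequentially. A * inverse (real (Suc m)) < e" using e by (intro order_tendstoD) auto
   then show ?thesis using that by (auto simp: eventually_sequentially)
  qed
  have key: "dist (w (inverse (real (Suc m)))) (w (inverse (real (Suc m')))) < e" if mm: "M <= m" "m <= m'" for m m'
  proof -
   have i: "inverse (real (Suc m')) <= inverse (real (Suc m))" "inverse (real (Suc m)) <= inverse (real (Suc M))"
    using mm by (auto intro!: le_imp_inverse_le)
   have "norm (w (inverse (real (Suc m))) - w (inverse (real (Suc m')))) <= A * inverse (real (Suc m)) ^ Suc n"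
    using i by (intro diff') (auto simp: inverse_le_1_iff)
   also have "... <= A * inverse (real (Suc m)) ^ 1"
    using A by (intro mult_left_mono power_decreasing) (auto simp: inverse_le_1_iff)
   also have "... <= A * inverse (real (Suc M))" using A i by (auto intro!: mult_left_mono)
   also have "... < e" by (rule M)
   finally show ?thesis by (simp add: dist_norm)
  qed
  show "\<exists>M. \<forall>m\<ge>M. \<forall>n\<ge>M. dist (w (inverse (real (Suc m)))) (w (inverse (real (Suc n)))) < e"
  proof (intro exI allI impI)
   fix m n assume "M <= m" "M <= n"
   then show "dist (w (inverse (real (Suc m)))) (w (inverse (real (Suc n)))) < e"
    using key[of m n] key[of n m] by (cases "m <= n") (auto simp: dist_commute)
  qed
 qed
 then obtain L where L: "(\<lambda>m. w (inverse (real (Suc m)))) \<longlonglongrightarrow> L"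
  using Cauchy_convergent_iff convergent_def by blast
 have wL: "norm (w u - L) <= A * u ^ Suc n" if u: "u \<in> {0<..1}" for u
 proof (rule LIMSEQ_le_const2)
  show "(\<lambda>m. norm (w u - w (inverse (real (Suc m))))) \<longlonglongrightarrow> norm (w u - L)"
   by (intro tendsto_intros L)
  have "\<forall>\<^sub>F m in sequentially. inverse (real (Suc m)) < u"
   using u by (intro order_tendstoD[OF LIMSEQ_inverse_real_of_nat]) auto
  then obtain M where M: "\<And>m. m \<ge> M ==> inverse (real (Suc m)) < u" by (auto simp: eventually_sequentially)
  show "\<exists>N. \<forall>m\<ge>N. norm (w u - w (inverse (real (Suc m)))) <= A * u ^ Suc n"
  proof (intro exI[of _ M] allI impI diff')
   fix m assume "M <= m"
   then show "inverse (real (Suc m)) <= u" using M[of m] by simp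
  qed (use u in simp_all)
 qed
 define c' where "c' j = (if j = 0 then L else c (j - 1) / of_nat j)" for j
 have "(\<Sum>j<Suc n. c' j * of_real u ^ j) = L + (\<Sum>j<n. c j * of_real u ^ Suc j / of_nat (Suc j))" for u
  by (subst sum.lessThan_Suc_shift) (simp add: c'_def)
 then have "h u - (\<Sum>j<Suc n. c' j * of_real u ^ j) = w u - L" for u by (simp add: w_def)
 then show ?case using wL by (intro exI[of _ c']) simp
qed

text \<open>A polynomial of degree less than \<open>n\<close> that is \<open>o(u\<^sup>n\<^sup>-\<^sup>1)\<close> is zero: compare the lowest coefficients.\<close>

lemma poly_coeffs_0_if_small:
 fixes c :: "nat => complex"
 assumes "((\<lambda>u. (\<Sum>j<n. c j * of_real u ^ j) / of_real u ^ (n - 1)) \<longlongrightarrow> 0) (at_right 0)" "j < n"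
 shows "c j = 0"
proof -
 have "\<forall>i<m. c i = 0" if "m <= n" for m
  using that
 proof (induction m)
  case (Suc m)
  then have c0: "\<forall>i<m. c i = 0" and m: "m < n" by auto
  let ?q = "\<lambda>u::real. \<Sum>j=m..<n. c j * of_real u ^ (j - m)"
  have "(?q \<longlongrightarrow> (\<Sum>j=m..<n. c j * of_real 0 ^ (j - m))) (at_right 0)"
   by (intro tendsto_intros)
  also have "(\<Sum>j=m..<n. c j * of_real 0 ^ (j - m)) = c m"
  proof -
   have "(\<Sum>j=m..<n. c j * of_real 0 ^ (j - m)) = (\<Sum>j\<in>{m..<n}. if j = m then c m else 0)"
    by (intro sum.cong) auto
   then show ?thesis using m by simp
  qed
  finally have lim: "(?q \<longlongrightarrow> c m) (at_right 0)" .
  have "((\<lambda>u::real. ((\<Sum>j<n. c j * of_real u ^ j) / of_real u ^ (n - 1)) * of_real u ^ (n - 1 - m)) \<longlongrightarrow> 0 * of_real 0 ^ (n - 1 - m)) (at_right 0)"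
   by (intro tendsto_intros assms(1))
  moreover have "\<forall>\<^sub>F u in at_right 0. ((\<Sum>j<n. c j * complex_of_real u ^ j) / of_real u ^ (n - 1)) * of_real u ^ (n - 1 - m) = ?q u"
  proof (rule eventually_at_right_less[THEN eventually_mono])
   fix u :: real assume u: "0 < u"
   have "(\<Sum>j<n. c j * of_real u ^ j) = (\<Sum>j=m..<n. c j * of_real u ^ j)"
    using c0 by (intro sum.mono_neutral_right) (auto simp: not_le)
   also have "... = ?q u * of_real u ^ m"
    by (auto simp: sum_distrib_right mult.assoc power_add[symmetric] intro!: sum.cong)
   finally have "(\<Sum>j<n. c j * of_real u ^ j) = ?q u * of_real u ^ m" .
   moreover have "complex_of_real u ^ (n - 1) = of_real u ^ m * of_real u ^ (n - 1 - m)"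
    using m by (simp add: power_add[symmetric])
   ultimately show "((\<Sum>j<n. c j * complex_of_real u ^ j) / of_real u ^ (n - 1)) * of_real u ^ (n - 1 - m) = ?q u"
    using u by (simp add: field_simps)
  qed
  ultimately have "(?q \<longlongrightarrow> 0) (at_right 0)" by (simp add: tendsto_cong)
  then have "c m = 0" using lim by (intro tendsto_unique[OF _ lim]) auto
  then show ?case using c0 by (auto simp: less_Suc_eq)
 qed simp
 from this[of n] assms(2) show ?thesis by blast
qed

text \<open>A function with bounded \<open>n\<close>-th derivative that is \<open>o(u\<^sup>n\<^sup>-\<^sup>1)\<close> is \<open>O(u\<^sup>n)\<close>, with the
 same constant.\<close>

lemma deriv_bound_small:
 assumes h: "deriv_bound n A h" and n: "n > 0"
  and small: "((\<lambda>u. h u / of_real u ^ (n - 1)) \<longlongrightarrow> 0) (at_right 0)"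
 shows "norm (h 1) <= A"
proof -
 obtain c where c: "\<And>u. u \<in> {0<..1} ==> norm (h u - (\<Sum>j<n. c j * of_real u ^ j)) <= A * u ^ n"
  using deriv_bound_poly[OF h] by blast
 let ?p = "\<lambda>u::real. \<Sum>j<n. c j * of_real u ^ j"
 have "((\<lambda>u. (h u - ?p u) / of_real u ^ (n - 1)) \<longlongrightarrow> 0) (at_right 0)"
 proof (rule Lim_null_comparison)
  have "((\<lambda>u::real. A * u) \<longlongrightarrow> A * 0) (at_right 0)" by (intro tendsto_intros)
  then show "((\<lambda>u::real. A * u) \<longlongrightarrow> 0) (at_right 0)" by simp
  have "\<forall>\<^sub>F u in at_right 0. u \<in> {0<..1::real}"
   by (auto simp: eventually_at_right_field intro: exI[of _ 1])
  then show "\<forall>\<^sub>F u in at_right 0. norm ((h u - ?p u) / of_real u ^ (n - 1)) <= A * u"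
  proof eventually_elim
   case (elim u)
   have "norm ((h u - ?p u) / of_real u ^ (n - 1)) = norm (h u - ?p u) / u ^ (n - 1)"
    using elim by (simp add: norm_divide norm_power)
   also have "... <= A * u ^ n / u ^ (n - 1)" using elim by (intro divide_right_mono c) auto
   also have "... = A * u" using elim n by (cases n) auto
   finally show ?case .
  qed
 qed
 from tendsto_diff[OF small this] have "((\<lambda>u. ?p u / of_real u ^ (n - 1)) \<longlongrightarrow> 0) (at_right 0)"
  by (simp add: diff_divide_distrib)
 then have "c j = 0" if "j < n" for j using poly_coeffs_0_if_small that by blast
 then show ?thesis using c[of 1] by simp
qed

text \<open>Dilated tensor products \<open>u\<^sup>-\<^sup>d b(x/u)\<close> and their partial derivatives of order \<open>\<gamma>\<close>.\<close>

definition kern :: "('d => nat => real => real) => ('d => nat) => real => real^'d::finite => real" where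
 "kern b \<gamma> u x = (\<Prod>i\<in>UNIV. (1/u) ^ Suc (\<gamma> i) * b i (\<gamma> i) ((1/u) * x $ i))"

text \<open>The derivatives of the function \<open>y b(y)\<close>.\<close>

definition mulx :: "(nat => real => real) => nat => real => real" where
 "mulx b n y = y * b n y + real n * b (n - 1) y"

lemma derivs_mulx: "derivs b ==> derivs (mulx b)"
 unfolding derivs_def
proof (intro allI)
 fix n x assume b: "\<forall>n x. (b n has_real_derivative b (Suc n) x) (at x)"
 have 1: "((\<lambda>y. y * b n y) has_real_derivative b n x + x * b (Suc n) x) (at x)"
  using b by (auto intro!: derivative_eq_intros)
 have 2: "((\<lambda>y. real n * b (n - 1) y) has_real_derivative real n * b n x) (at x)"
 proof (cases n)
  case (Suc m)
  then show ?thesis using b DERIV_cmult[of "b m" "b n x" x UNIV "real n"] by simp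
 qed simp
 show "(mulx b n has_real_derivative mulx b (Suc n) x) (at x)"
  using DERIV_add[OF 1 2] unfolding mulx_def[abs_def] by (simp add: algebra_simps)
qed

lemma mulx_0: "(mulx ^^ m) b 0 y = y ^ m * b 0 y"
 by (induction m) (auto simp: mulx_def)

lemma derivs_mulx_iter: "derivs b ==> derivs ((mulx ^^ m) b)"
 by (induction m) (auto intro: derivs_mulx)

lemma mulx_iter_outside:
 "(\<And>n y. y \<notin> I ==> b n y = 0) ==> y \<notin> I ==> (mulx ^^ m) b n y = 0"
 by (induction m arbitrary: n) (auto simp: mulx_def)

text \<open>Differentiation in \<open>u\<close> raises the order of the derivative by one and multiplies by a coordinate:
 this is the divergence form of the generator of dilations.\<close>

lemma kern_derivative:
 fixes b :: "'d::finite => nat => real => real"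
 assumes b: "\<forall>i. derivs (b i)" and u: "u > 0"
 shows "((\<lambda>u. kern b \<gamma> u x) has_real_derivative
  (- (\<Sum>i\<in>UNIV. kern (b(i := mulx (b i))) (\<gamma>(i := Suc (\<gamma> i))) u x))) (at u)"
proof -
 let ?f = "\<lambda>i u. (1/u) ^ Suc (\<gamma> i) * b i (\<gamma> i) ((1/u) * x $ i)"
 let ?f' = "\<lambda>i. - ((1/u) ^ Suc (Suc (\<gamma> i)) * mulx (b i) (Suc (\<gamma> i)) ((1/u) * x $ i))"
 have D: "(?f i has_real_derivative ?f' i) (at u)" for i
 proof -
  have inv: "((\<lambda>u. 1/u) has_real_derivative (- ((1/u)^2))) (at u)"
   using u by (auto intro!: derivative_eq_intros simp: power2_eq_square)
  have 1: "((\<lambda>u. (1/u) ^ Suc (\<gamma> i)) has_real_derivative - (real (Suc (\<gamma> i)) * (1/u) ^ Suc (Suc (\<gamma> i)))) (at u)"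
   using DERIV_power[OF inv, of "Suc (\<gamma> i)"] by (simp add: power2_eq_square algebra_simps)
  have "((\<lambda>u. (1/u) * x $ i) has_real_derivative (- ((1/u)^2) * x $ i)) (at u)"
   using DERIV_cmult_right[OF inv] by simp
  moreover have "(b i (\<gamma> i) has_real_derivative b i (Suc (\<gamma> i)) ((1/u) * x $ i)) (at ((1/u) * x $ i))"
   using b by (auto simp: derivs_def)
  ultimately have 2: "((\<lambda>u. b i (\<gamma> i) ((1/u) * x $ i)) has_real_derivative b i (Suc (\<gamma> i)) ((1/u) * x $ i) * (- ((1/u)^2) * x $ i)) (at u)"
   by (intro DERIV_chain2[where f="b i (\<gamma> i)" and g="\<lambda>u. (1/u) * x $ i"])
  have e: "(1/u) ^ Suc (\<gamma> i) * (b i (Suc (\<gamma> i)) ((1/u) * x $ i) * (- ((1/u)^2) * x $ i)) +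
    - (real (Suc (\<gamma> i)) * (1/u) ^ Suc (Suc (\<gamma> i))) * b i (\<gamma> i) ((1/u) * x $ i) = ?f' i"
   by (simp add: mulx_def power2_eq_square algebra_simps add_divide_distrib)
  show ?thesis using DERIV_mult'[OF 1 2] unfolding e .
 qed
 have "((\<lambda>u. \<Prod>i\<in>UNIV. ?f i u) has_derivative (\<lambda>y. \<Sum>i\<in>UNIV. (?f' i * y) * (\<Prod>j\<in>UNIV - {i}. ?f j u))) (at u)"
  by (rule has_derivative_prod) (rule D[unfolded has_field_derivative_def])
 moreover have step: "?f' i * (\<Prod>j\<in>UNIV - {i}. ?f j u) = - kern (b(i := mulx (b i))) (\<gamma>(i := Suc (\<gamma> i))) u x" for i
 proof -
  let ?g = "\<lambda>j. (1/u) ^ Suc ((\<gamma>(i := Suc (\<gamma> i))) j) * (b(i := mulx (b i))) j ((\<gamma>(i := Suc (\<gamma> i))) j) ((1/u) * x $ j)"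
  have "(\<Prod>j\<in>UNIV - {i}. ?f j u) = (\<Prod>j\<in>UNIV - {i}. ?g j)" by (rule prod.cong) auto
  moreover have "kern (b(i := mulx (b i))) (\<gamma>(i := Suc (\<gamma> i))) u x = ?g i * (\<Prod>j\<in>UNIV - {i}. ?g j)"
   unfolding kern_def by (rule prod.remove) auto
  ultimately show ?thesis by simp
 qed
 have "(\<Sum>i\<in>UNIV. (?f' i * y) * (\<Prod>j\<in>UNIV - {i}. ?f j u)) =
  (- (\<Sum>i\<in>UNIV. kern (b(i := mulx (b i))) (\<gamma>(i := Suc (\<gamma> i))) u x)) * y" for y
 proof -
  have sw: "(a * y) * p = (a * p) * y" for a p :: real by simp
  show ?thesis unfolding sw step sum_distrib_right[symmetric] sum_negf ..
 qed
 ultimately have "((\<lambda>u. \<Prod>i\<in>UNIV. ?f i u) has_derivative (\<lambda>y. (- (\<Sum>i\<in>UNIV. kern (b(i := mulx (b i))) (\<gamma>(i := Suc (\<gamma> i))) u x)) * y)) (at u)"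
  by (simp only:)
 then show ?thesis unfolding has_field_derivative_def kern_def .
qed

lemma kern_bounded:
 fixes b :: "'d::finite => nat => real => real"
 assumes b: "\<forall>i. derivs (b i)" and supp: "\<And>i n t. t \<notin> {l$i..r$i} ==> b i n t = 0" and u: "u > 0"
 shows "\<exists>M. \<forall>v\<ge>u. \<forall>x. \<bar>kern b \<gamma> v x\<bar> <= M"
proof -
 have "\<exists>B\<ge>0. \<forall>t. \<bar>b i n t\<bar> <= B" for i n
 proof -
  have "continuous_on {l$i..r$i} (b i n)"
   using b by (intro continuous_at_imp_continuous_on ballI DERIV_isCont) (auto simp: derivs_def)
  then have "bounded (b i n ` {l$i..r$i})" by (intro compact_imp_bounded compact_continuous_image) auto
  then obtain B where B: "\<forall>t\<in>{l$i..r$i}. \<bar>b i n t\<bar> <= B" unfolding bounded_iff by auto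
  have "\<bar>b i n t\<bar> <= max B 0" for t
  proof (cases "t \<in> {l$i..r$i}")
   case True
   then show ?thesis using B by (auto simp: le_max_iff_disj)
  qed (simp add: supp)
  then show ?thesis by (intro exI[of _ "max B 0"]) auto
 qed
 then obtain B where B: "\<And>i n. B i n \<ge> 0" "\<And>i n t. \<bar>b i n t\<bar> <= B i n" by metis
 show ?thesis
 proof (intro exI allI impI)
  fix v and x :: "real^'d" assume v: "u <= v"
  have "\<bar>kern b \<gamma> v x\<bar> = (\<Prod>i\<in>UNIV. (1/v) ^ Suc (\<gamma> i) * \<bar>b i (\<gamma> i) ((1/v) * x $ i)\<bar>)"
   using u v unfolding kern_def by (simp add: abs_prod abs_mult power_abs)
  also have "... <= (\<Prod>i\<in>UNIV. (1/u) ^ Suc (\<gamma> i) * B i (\<gamma> i))"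
   using u v B by (intro prod_mono conjI mult_mono power_mono divide_left_mono mult_nonneg_nonneg) auto
  finally show "\<bar>kern b \<gamma> v x\<bar> <= (\<Prod>i\<in>UNIV. (1/u) ^ Suc (\<gamma> i) * B i (\<gamma> i))" .
 qed
qed

lemma kern_outside:
 fixes b :: "'d::finite => nat => real => real"
 assumes supp: "\<And>i n t. t \<notin> {l$i..r$i} ==> b i n t = 0" and sub: "cbox l r \<subseteq> cball 0 \<rho>"
  and u: "0 < u" "u <= 1" and x: "x \<notin> cball 0 (\<rho> * u)"
 shows "kern b \<gamma> u x = 0"
proof -
 have "(1/u) *\<^sub>R x \<notin> cbox l r"
 proof
  assume "(1/u) *\<^sub>R x \<in> cbox l r"
  then have "norm ((1/u) *\<^sub>R x) <= \<rho>" using sub by auto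
  then show False using u x by (simp add: field_simps)
 qed
 then obtain i where "(1/u) * x $ i \<notin> {l$i..r$i}" by (auto simp: mem_box_cart)
 then show ?thesis unfolding kern_def using supp by (intro prod_zero) auto
qed

lemma continuous_on_kern:
 assumes "\<forall>i. derivs (b i)" "u > 0"
 shows "continuous_on UNIV (kern b \<gamma> u)"
proof -
 have "continuous_on UNIV (b i n)" for i n
  using assms by (intro continuous_at_imp_continuous_on ballI DERIV_isCont) (auto simp: derivs_def)
 moreover have "continuous_on UNIV (\<lambda>x. (1/u) * x $ i)" for i by (intro continuous_intros)
 ultimately have "continuous_on UNIV (\<lambda>x. b i n ((1/u) * x $ i))" for i n
  by (rule continuous_on_compose2) simp
 then show ?thesis unfolding kern_def[abs_def]
  by (intro continuous_on_prod continuous_on_mult continuous_on_const)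
qed

lemma integrable_times_kern:
 fixes b :: "'d::finite => nat => real => real" and F :: "real^'d => complex"
 assumes b: "\<forall>i. derivs (b i)" and supp: "\<And>i n t. t \<notin> {l$i..r$i} ==> b i n t = 0"
  and sub: "cbox l r \<subseteq> cball 0 \<rho>" and F: "set_integrable lebesgue (cball 0 \<rho>) F" and u: "0 < u" "u <= 1"
  and rho: "\<rho> > 0"
 shows "integrable lebesgue (\<lambda>x. F x * of_real (kern b \<gamma> u x))"
proof -
 obtain M where M: "\<And>v x. v \<ge> u ==> \<bar>kern b \<gamma> v x\<bar> <= M" using kern_bounded[OF b supp u(1)] by metis
 have i: "integrable lebesgue (\<lambda>x. indicator (cball 0 \<rho>) x *\<^sub>R F x)" using F by (simp add: set_integrable_def)
 have out: "kern b \<gamma> u x = 0" if "x \<notin> cball 0 \<rho>" for x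
 proof (rule kern_outside[OF supp sub u])
  have "\<rho> * u <= \<rho> * 1" using u rho by (intro mult_left_mono) auto
  then show "x \<notin> cball 0 (\<rho> * u)" using that by auto
 qed auto
 have eq: "F x * of_real (kern b \<gamma> u x) = (indicator (cball 0 \<rho>) x *\<^sub>R F x) * of_real (kern b \<gamma> u x)" for x
  using out[of x] by (auto simp: indicator_def)
 have mk: "(\<lambda>x. complex_of_real (kern b \<gamma> u x)) \<in> lmeas"
  by (intro measurable_completion)
   (use continuous_on_kern[OF b u(1)] in \<open>auto intro!: borel_measurable_continuous_onI continuous_intros\<close>)
 show ?thesis
 proof (rule Bochner_Integration.integrable_bound[of _ "\<lambda>x. M *\<^sub>R (indicator (cball 0 \<rho>) x *\<^sub>R F x)"])
  show "integrable lebesgue (\<lambda>x. M *\<^sub>R (indicator (cball 0 \<rho>) x *\<^sub>R F x))" using i by (rule integrable_scaleR_right)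
  show "(\<lambda>x. F x * of_real (kern b \<gamma> u x)) \<in> lmeas"
   unfolding eq by (rule borel_measurable_times[OF borel_measurable_integrable[OF i] mk])
  have "norm (F x * of_real (kern b \<gamma> u x)) <= norm (M *\<^sub>R (indicator (cball 0 \<rho>) x *\<^sub>R F x))" for x
  proof -
   have "norm (F x * of_real (kern b \<gamma> u x)) = norm (indicator (cball 0 \<rho>) x *\<^sub>R F x) * \<bar>kern b \<gamma> u x\<bar>"
    unfolding eq norm_mult by simp
   also have "... <= norm (indicator (cball 0 \<rho>) x *\<^sub>R F x) * \<bar>M\<bar>"
    using M[of u x] by (intro mult_left_mono) auto
   also have "... = norm (M *\<^sub>R (indicator (cball 0 \<rho>) x *\<^sub>R F x))"
    by (simp only: norm_scaleR mult.commute)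
   finally show ?thesis .
  qed
  then show "AE x in lebesgue. norm (F x * of_real (kern b \<gamma> u x)) <= norm (M *\<^sub>R (indicator (cball 0 \<rho>) x *\<^sub>R F x))" by simp
 qed
qed

text \<open>The integrand is differentiated under the integral sign; the bump lives in a fixed ball for \<open>u <= 1\<close>, which makes
 its \<open>u\<close>-derivative locally bounded.\<close>

lemma integral_kern_derivative:
 fixes b :: "'d::finite => nat => real => real" and F :: "real^'d => complex"
 assumes b: "\<forall>i. derivs (b i)" and supp: "\<And>i n t. t \<notin> {l$i..r$i} ==> b i n t = 0"
  and sub: "cbox l r \<subseteq> cball 0 \<rho>" and F: "set_integrable lebesgue (cball 0 \<rho>) F" and rho: "\<rho> > 0"
  and u: "u \<in> {0<..1}"
 shows "((\<lambda>u. \<integral>x. F x * of_real (kern b \<gamma> u x) \<partial>lebesgue) has_vector_derivative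
  (- (\<Sum>i\<in>UNIV. \<integral>x. F x * of_real (kern (b(i := mulx (b i))) (\<gamma>(i := Suc (\<gamma> i))) u x) \<partial>lebesgue))) (at u within {0<..1})"
proof -
 let ?h = "\<lambda>u. \<integral>x. F x * of_real (kern b \<gamma> u x) \<partial>lebesgue"
 let ?b = "\<lambda>i. b(i := mulx (b i))" and ?g = "\<lambda>i. \<gamma>(i := Suc (\<gamma> i))"
 let ?K = "\<lambda>v x. - (\<Sum>i\<in>UNIV. kern (?b i) (?g i) v x)"
 let ?D = "\<integral>x. F x * of_real (?K u x) \<partial>lebesgue"
 have b': "\<forall>j. derivs (?b i j)" for i using b derivs_mulx by auto
 have supp': "?b i j n t = 0" if "t \<notin> {l$j..r$j}" for i j n t using supp[OF that] by (auto simp: mulx_def)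
 have u0: "u / 2 > 0" "u > 0" "u <= 1" using u by auto
 have "\<exists>M. \<forall>v\<ge>u/2. \<forall>x. \<bar>kern (?b i) (?g i) v x\<bar> <= M" for i
  by (rule kern_bounded[OF b' supp' u0(1)])
 then obtain M where M: "\<And>i v x. v \<ge> u/2 ==> \<bar>kern (?b i) (?g i) v x\<bar> <= M i" by metis
 have K: "\<bar>?K v x\<bar> <= sum M UNIV" if "v \<ge> u/2" for v x
  using sum_abs[of "\<lambda>i. kern (?b i) (?g i) v x" UNIV] sum_mono[of UNIV "\<lambda>i. \<bar>kern (?b i) (?g i) v x\<bar>" M] M[OF that]
  by (auto intro: order_trans)
 have lip: "\<bar>kern b \<gamma> v x - kern b \<gamma> u x\<bar> <= sum M UNIV * \<bar>v - u\<bar>" if "v \<ge> u/2" for v x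
 proof -
  have "norm (kern b \<gamma> v x - kern b \<gamma> u x) <= sum M UNIV * norm (v - u)"
  proof (rule field_differentiable_bound[of "{u/2..}"])
   fix w assume "w \<in> {u/2..}"
   then show "((\<lambda>v. kern b \<gamma> v x) has_field_derivative ?K w x) (at w within {u/2..})"
    using u0 by (intro DERIV_subset[OF kern_derivative[OF b]]) auto
   show "norm (?K w x) <= sum M UNIV" using K \<open>w \<in> {u/2..}\<close> by simp
  qed (use that u0 in auto)
  then show ?thesis by simp
 qed
 have iK: "integrable lebesgue (\<lambda>x. F x * of_real (kern (?b i) (?g i) u x))" for i
  by (rule integrable_times_kern[OF b' supp' sub F u0(2,3) rho])
 have ih: "integrable lebesgue (\<lambda>x. F x * of_real (kern b \<gamma> v x))" if "v \<in> {0<..1}" for v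
  using that by (intro integrable_times_kern[OF b supp sub F _ _ rho]) auto
 have Deq: "?D = - (\<Sum>i\<in>UNIV. \<integral>x. F x * of_real (kern (?b i) (?g i) u x) \<partial>lebesgue)"
 proof -
  have "?D = (\<integral>x. - (\<Sum>i\<in>UNIV. F x * of_real (kern (?b i) (?g i) u x)) \<partial>lebesgue)"
   by (intro Bochner_Integration.integral_cong) (auto simp: sum_distrib_left)
  also have "... = - (\<integral>x. (\<Sum>i\<in>UNIV. F x * of_real (kern (?b i) (?g i) u x)) \<partial>lebesgue)"
   by (rule Bochner_Integration.integral_minus)
  also have "... = - (\<Sum>i\<in>UNIV. \<integral>x. F x * of_real (kern (?b i) (?g i) u x) \<partial>lebesgue)"
   by (subst Bochner_Integration.integral_sum) (auto intro: iK)
  finally show ?thesis .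
 qed
 have iF: "integrable lebesgue (\<lambda>x. indicator (cball 0 \<rho>) x *\<^sub>R F x)" using F by (simp add: set_integrable_def)
 have lim: "((\<lambda>v. norm (?h v - ?h u - (v - u) *\<^sub>R ?D) / norm (v - u)) \<longlongrightarrow> 0) (at u within {0<..1})"
  unfolding tendsto_at_iff_sequentially comp_def
 proof (intro allI impI)
  fix v assume v: "\<forall>n. v n \<in> {0<..1} - {u}" "v \<longlonglongrightarrow> u"
  have "\<forall>\<^sub>F n in sequentially. v n > u/2" using v(2) u0 by (intro order_tendstoD) auto
  then obtain N where N: "\<And>n. n \<ge> N ==> v n > u/2" by (auto simp: eventually_sequentially)
  define w where "w n = v (n + N)" for n
  have w: "w n \<in> {0<..1}" "w n \<noteq> u" "w n \<ge> u/2" for n using v(1) N[of "n + N"] by (auto simp: w_def less_imp_le)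
  have wl: "w \<longlonglongrightarrow> u" unfolding w_def using v(2) by (rule LIMSEQ_ignore_initial_segment)
  let ?q = "\<lambda>n x. F x * of_real ((kern b \<gamma> (w n) x - kern b \<gamma> u x) / (w n - u))"
  have q: "?q n x = (F x * of_real (kern b \<gamma> (w n) x) - F x * of_real (kern b \<gamma> u x)) / of_real (w n - u)" for n x
   by (simp add: algebra_simps diff_divide_distrib)
  have iq: "integrable lebesgue (?q n)" for n
   unfolding q by (intro integrable_divide Bochner_Integration.integrable_diff ih w u)
  have hq: "(\<integral>x. ?q n x \<partial>lebesgue) = (?h (w n) - ?h u) / of_real (w n - u)" for n
   unfolding q by (simp add: Bochner_Integration.integral_diff[OF ih[OF w(1)] ih[OF u]])
  have "(\<lambda>n. \<integral>x. ?q n x \<partial>lebesgue) \<longlonglongrightarrow> ?D"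
  proof (rule integral_dominated_convergence[where w="\<lambda>x. sum M UNIV *\<^sub>R norm (indicator (cball 0 \<rho>) x *\<^sub>R F x)"])
   show "(\<lambda>x. F x * of_real (?K u x)) \<in> lmeas"
   proof -
    have "integrable lebesgue (\<lambda>x. - (\<Sum>i\<in>UNIV. F x * of_real (kern (?b i) (?g i) u x)))"
     by (intro integrable_minus Bochner_Integration.integrable_sum iK)
    then show ?thesis by (intro borel_measurable_integrable) (simp add: sum_distrib_left)
   qed
   show "integrable lebesgue (\<lambda>x. sum M UNIV *\<^sub>R norm (indicator (cball 0 \<rho>) x *\<^sub>R F x))"
    by (intro integrable_scaleR_right integrable_norm iF)
   show "AE x in lebesgue. (\<lambda>n. ?q n x) \<longlonglongrightarrow> F x * of_real (?K u x)"
   proof (intro AE_I2 tendsto_mult tendsto_const tendsto_of_real)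
    fix x
    have "((\<lambda>v. (kern b \<gamma> v x - kern b \<gamma> u x) / (v - u)) \<longlongrightarrow> ?K u x) (at u)"
     using kern_derivative[OF b u0(2), of \<gamma> x] by (simp add: has_field_derivative_iff)
    then show "(\<lambda>n. (kern b \<gamma> (w n) x - kern b \<gamma> u x) / (w n - u)) \<longlonglongrightarrow> ?K u x"
     by (rule filterlim_compose) (use wl w in \<open>auto simp: filterlim_at\<close>)
   qed
   show "AE x in lebesgue. norm (?q n x) <= sum M UNIV *\<^sub>R norm (indicator (cball 0 \<rho>) x *\<^sub>R F x)" for n
   proof (rule AE_I2)
    fix x
    have out: "kern b \<gamma> t x = 0" if "x \<notin> cball 0 \<rho>" "t \<in> {0<..1}" for t
    proof (rule kern_outside[OF supp sub])
     have "\<rho> * t <= \<rho> * 1" using that rho by (intro mult_left_mono) auto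
     then show "x \<notin> cball 0 (\<rho> * t)" using that by auto
    qed (use that in auto)
    have "\<bar>(kern b \<gamma> (w n) x - kern b \<gamma> u x) / (w n - u)\<bar> <= sum M UNIV"
     using lip[OF w(3), of n x] w(2)[of n] by (simp add: abs_divide divide_le_eq)
    then have "norm (F x) * \<bar>(kern b \<gamma> (w n) x - kern b \<gamma> u x) / (w n - u)\<bar> <= norm (F x) * sum M UNIV"
     by (intro mult_left_mono) auto
    moreover have "norm (?q n x) = norm (F x) * \<bar>(kern b \<gamma> (w n) x - kern b \<gamma> u x) / (w n - u)\<bar>"
     by (simp only: norm_mult norm_of_real)
    ultimately have "norm (?q n x) <= norm (F x) * sum M UNIV" by simp
    moreover have "?q n x = 0" if "x \<notin> cball 0 \<rho>" using out[OF that w(1)] out[OF that u] by simp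
    ultimately show "norm (?q n x) <= sum M UNIV *\<^sub>R norm (indicator (cball 0 \<rho>) x *\<^sub>R F x)"
     by (cases "x \<in> cball 0 \<rho>") (auto simp: mult.commute)
   qed
  qed (rule borel_measurable_integrable[OF iq])
  then have "(\<lambda>n. norm ((?h (w n) - ?h u) / of_real (w n - u) - ?D)) \<longlonglongrightarrow> 0"
   unfolding hq using tendsto_norm_zero[OF LIM_zero] by blast
  moreover have "norm ((?h (w n) - ?h u) / of_real (w n - u) - ?D) = norm (?h (w n) - ?h u - (w n - u) *\<^sub>R ?D) / norm (w n - u)" for n
  proof -
   have alg: "(A - B) / c - D = (A - B - c * D) / c" if "c \<noteq> 0" for A B c D :: complex
    using that by (simp add: diff_divide_distrib)
   have "(?h (w n) - ?h u) / of_real (w n - u) - ?D = (?h (w n) - ?h u - (w n - u) *\<^sub>R ?D) / of_real (w n - u)"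
    unfolding scaleR_conv_of_real by (rule alg) (use w(2)[of n] in \<open>simp del: of_real_diff\<close>)
   then show ?thesis by (simp only: norm_divide norm_of_real real_norm_def)
  qed
  ultimately have "(\<lambda>n. norm (?h (w n) - ?h u - (w n - u) *\<^sub>R ?D) / norm (w n - u)) \<longlonglongrightarrow> 0" by simp
  then show "(\<lambda>n. norm (?h (v n) - ?h u - (v n - u) *\<^sub>R ?D) / norm (v n - u)) \<longlonglongrightarrow> 0"
   unfolding w_def by (rule LIMSEQ_offset)
 qed
 show ?thesis
  unfolding Deq[symmetric] has_vector_derivative_def has_derivative_iff_norm
  by (rule conjI[OF bounded_linear_scaleR_left lim])
qed

text \<open>A function vanishes to order more than \<open>m\<close> at the origin in the mean if its integrals over small
 balls of radius \<open>u\<close> are \<open>o(u\<^sup>d\<^sup>+\<^sup>m)\<close>.\<close>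

definition mean_vanish :: "nat => (real^'d::finite => complex) => bool" where
 "mean_vanish m F \<longleftrightarrow> (\<forall>e>0. \<exists>u0>0. \<forall>u. 0 < u --> u < u0 -->
  (\<integral>\<^sup>+x\<in>ball 0 u. ennreal (norm (F x)) \<partial>lebesgue) <= ennreal (e * u ^ (CARD('d) + m)))"

lemma abs_monomial_le:
 fixes y :: "real^'d::finite"
 shows "(\<Prod>i\<in>UNIV. \<bar>y $ i\<bar> ^ \<gamma> i) <= norm y ^ sum \<gamma> UNIV"
 unfolding power_sum by (intro prod_mono conjI power_mono component_le_norm_cart) auto

text \<open>If the weak derivatives of order \<open>k\<close> of \<open>F\<close> are bounded by \<open>M\<close> and \<open>F\<close> vanishes in the mean
 to order more than \<open>k - 1\<close>, then \<open>F = O(M |x|\<^sup>k)\<close>. No representative of \<open>F\<close> is constructed: for a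
 fixed test function \<open>\<zeta>\<close> the pairings \<open>\<integral> F(ux) \<zeta>(x)\<close> are smooth in \<open>u\<close>, their derivative of
 order \<open>k\<close> pairs \<open>F\<close> with derivatives of order \<open>k\<close> of test functions, and the one-variable
 Taylor estimate at \<open>u = 1\<close> gives \<open>|\<integral> F \<zeta>| <= C M \<integral> |x|\<^sup>k \<zeta>\<close>.\<close>

lemma AE_norm_le_power_if_weak_derivs:
 fixes F :: "real^'d::finite => complex" and M :: real
 assumes rho: "\<rho> > 0" and k: "k > 0" and M: "M \<ge> 0"
  and loc: "\<And>K. compact K ==> K \<subseteq> ball 0 \<rho> ==> set_integrable lebesgue K F"
  and weak: "\<And>\<gamma> b l r. sum \<gamma> UNIV = k ==> \<forall>i. derivs (b i) ==> (\<And>i n t. t \<notin> {l$i..r$i} ==> b i n t = 0) ==>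
   cbox l r \<subseteq> ball 0 \<rho> ==>
   norm (\<integral>x. F x * tensor b \<gamma> x \<partial>lebesgue) <= M * (\<integral>x. \<bar>\<Prod>i\<in>UNIV. b i 0 (x $ i)\<bar> \<partial>lebesgue)"
  and van: "mean_vanish (k - 1) F"
 shows "AE x in lebesgue. x \<in> ball 0 \<rho> --> norm (F x) <= real CARD('d) ^ k * M * norm x ^ k"
proof (rule AE_norm_le_from_bumps[OF open_ball])
 show "set_integrable lebesgue K F" if "compact K" "K \<subseteq> ball 0 \<rho>" for K using that by (rule loc)
 have cW: "continuous_on A (\<lambda>x::real^'d. real CARD('d) ^ k * M * norm x ^ k)" for A by (intro continuous_intros)
 show "set_integrable lebesgue K (\<lambda>x. real CARD('d) ^ k * M * norm x ^ k)" if "compact K" for K :: "(real^'d) set"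
 proof -
  have "set_integrable lborel K (\<lambda>x. real CARD('d) ^ k * M * norm x ^ k)"
   by (rule borel_integrable_compact[OF that cW, folded set_integrable_def])
  then show ?thesis unfolding set_integrable_def
   by (simp only: integrable_completion[OF borel_measurable_integrable])
 qed
 fix m and l r :: "real^'d" assume lr: "cbox l r \<subseteq> ball 0 \<rho>"
 have "\<exists>\<rho>0. 0 < \<rho>0 \<and> \<rho>0 < \<rho> \<and> cbox l r \<subseteq> cball 0 \<rho>0"
 proof (cases "cbox l r = {}")
  case True
  then show ?thesis using rho by (intro exI[of _ "\<rho>/2"]) auto
 next
  case False
  have "compact (cbox l r)" "continuous_on (cbox l r) norm" by (auto intro: continuous_intros)
  then obtain z where z: "z \<in> cbox l r" "\<And>y. y \<in> cbox l r ==> norm y <= norm z"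
   using continuous_attains_sup[OF _ False] by blast
  then show ?thesis using lr rho by (intro exI[of _ "max (norm z) (\<rho>/2)"]) (auto simp: le_max_iff_disj)
 qed
 then obtain \<rho>0 where r0: "0 < \<rho>0" "\<rho>0 < \<rho>" "cbox l r \<subseteq> cball 0 \<rho>0" by blast
 have F0: "set_integrable lebesgue (cball 0 \<rho>0) F" using r0 by (intro loc) auto
 define b where "b i = bump1 m (l $ i) (r $ i)" for i
 have b: "\<forall>i. derivs (b i)" by (simp add: b_def derivs_bump1)
 have supp: "b i n t = 0" if "t \<notin> {l$i..r$i}" for i n t
  using that unfolding b_def by (intro bump1_outside) auto
 define B where "B \<gamma> i = (mulx ^^ \<gamma> i) (b i)" for \<gamma> :: "'d => nat" and i
 have B: "\<forall>i. derivs (B \<gamma> i)" for \<gamma> using b by (simp add: B_def derivs_mulx_iter)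
 have suppB: "B \<gamma> i n t = 0" if "t \<notin> {l$i..r$i}" for \<gamma> i n t
  unfolding B_def by (rule mulx_iter_outside[of "{l$i..r$i}"]) (use that supp in auto)
 have bump: "bump m l r x = (\<Prod>i\<in>UNIV. b i 0 (x $ i))" for x by (simp add: bump_def b_def)
 define H where "H \<gamma> u = (\<integral>x. F x * of_real (kern (B \<gamma>) \<gamma> u x) \<partial>lebesgue)" for \<gamma> u
 define J where "J = (\<integral>x. norm x ^ k * bump m l r x \<partial>lebesgue)"
 have c_int: "integrable lebesgue (\<lambda>x. g x * bump m l r x)" if g: "continuous_on UNIV g" for g :: "real^'d => real"
 proof -
  have cg: "continuous_on (cbox l r) (\<lambda>x. g x * bump m l r x)"
  proof (intro continuous_intros continuous_on_subset[OF g])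
   have "continuous_on (cbox l r) (\<lambda>x. Re (tensor b (\<lambda>_. 0) x))"
    by (intro continuous_intros continuous_on_tensor b)
   then show "continuous_on (cbox l r) (bump m l r)" by (simp add: tensor_def bump[abs_def] del: of_real_prod)
  qed auto
  have "integrable lborel (\<lambda>x. indicator (cbox l r) x *\<^sub>R (g x * bump m l r x))"
   by (rule borel_integrable_compact[OF compact_cbox cg])
  moreover have "indicator (cbox l r) x *\<^sub>R (g x * bump m l r x) = g x * bump m l r x" for x
   using bump_outside[of x l r m] box_subset_cbox[of l r] by (auto simp: indicator_def)
  ultimately have "integrable lborel (\<lambda>x. g x * bump m l r x)" by (simp only:)
  then show ?thesis by (simp only: integrable_completion[OF borel_measurable_integrable])
 qed
 have base: "norm (H \<gamma> u) <= M * J" if g: "sum \<gamma> UNIV = k" and u: "u \<in> {0<..1}" for \<gamma> u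
 proof -
  define b' where "b' i n t = (1/u) * ((1/u) ^ n * B \<gamma> i n ((1/u) * t + 0))" for i n t
  have u': "u > 0" "u <= 1" using u by auto
  have b': "\<forall>i. derivs (b' i)"
  proof
   fix i
   have d: "derivs (\<lambda>n t. (1/u) ^ n * B \<gamma> i n ((1/u) * t + 0))" using B by (intro derivs_affine) auto
   show "derivs (b' i)" unfolding derivs_def
   proof (intro allI)
    fix n t
    show "(b' i n has_real_derivative b' i (Suc n) t) (at t)"
     using DERIV_cmult[OF d[unfolded derivs_def, rule_format], of "1/u" n t] unfolding b'_def[abs_def] .
   qed
  qed
  have tk: "tensor b' \<gamma> x = of_real (kern (B \<gamma>) \<gamma> u x)" for x
   by (simp add: tensor_def kern_def b'_def mult_ac)
  have supp': "b' i n t = 0" if "t \<notin> {(u *\<^sub>R l)$i..(u *\<^sub>R r)$i}" for i n t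
  proof -
   have "(1/u) * t \<notin> {l$i..r$i}" using that u' by (auto simp: field_simps)
   then show ?thesis using suppB unfolding b'_def by simp
  qed
  have sub': "cbox (u *\<^sub>R l) (u *\<^sub>R r) \<subseteq> ball 0 \<rho>"
  proof
   fix x assume x: "x \<in> cbox (u *\<^sub>R l) (u *\<^sub>R r)"
   have "(1/u) *\<^sub>R x \<in> cbox l r" using x u' by (auto simp: mem_box_cart field_simps)
   then have "norm ((1/u) *\<^sub>R x) < \<rho>" using lr by auto
   moreover have "norm x <= norm ((1/u) *\<^sub>R x)" using u' by (simp add: field_simps mult_left_le_one_le)
   ultimately show "x \<in> ball 0 \<rho>" by simp
  qed
  have "norm (H \<gamma> u) <= M * (\<integral>x. \<bar>\<Prod>i\<in>UNIV. b' i 0 (x $ i)\<bar> \<partial>lebesgue)"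
   using weak[OF g b' supp' sub'] by (simp add: tk H_def)
  also have "(\<integral>x. \<bar>\<Prod>i\<in>UNIV. b' i 0 (x $ i)\<bar> \<partial>lebesgue) = (\<integral>x. \<bar>\<Prod>i\<in>UNIV. B \<gamma> i 0 (x $ i)\<bar> \<partial>lebesgue)"
  proof -
   have "continuous_on UNIV (\<lambda>x::real^'d. \<bar>Re (tensor b' (\<lambda>_. 0) x)\<bar>)"
    by (intro continuous_intros continuous_on_tensor b')
   then have "(\<lambda>x::real^'d. \<bar>Re (tensor b' (\<lambda>_. 0) x)\<bar>) \<in> lmeas"
    by (intro measurable_completion) (simp add: borel_measurable_continuous_onI)
   then have mb: "(\<lambda>x::real^'d. \<bar>\<Prod>i\<in>UNIV. b' i 0 (x $ i)\<bar>) \<in> lmeas"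
    by (simp add: tensor_def del: of_real_prod)
   have un: "u \<noteq> 0" using u' by simp
   have "(\<integral>x. \<bar>\<Prod>i\<in>UNIV. b' i 0 (x $ i)\<bar> \<partial>lebesgue) = (u ^ CARD('d)) *\<^sub>R (\<integral>x. \<bar>\<Prod>i\<in>UNIV. b' i 0 ((0 + u *\<^sub>R x) $ i)\<bar> \<partial>lebesgue)"
    using integral_affine[OF un mb, of 0] u' by simp
   also have "(\<lambda>x. \<bar>\<Prod>i\<in>UNIV. b' i 0 ((0 + u *\<^sub>R x) $ i)\<bar>) = (\<lambda>x. (1/u) ^ CARD('d) *\<^sub>R \<bar>\<Prod>i\<in>UNIV. B \<gamma> i 0 (x $ i)\<bar>)"
    using u' unfolding b'_def by (simp add: prod.distrib prod_dividef abs_mult fun_eq_iff power_divide)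
   finally show ?thesis using u' by (simp add: power_divide)
  qed
  also have "... <= J"
   unfolding J_def
  proof (rule integral_mono')
   show "integrable lebesgue (\<lambda>x. norm x ^ k * bump m l r x)" by (intro c_int continuous_intros)
   fix x :: "real^'d"
   have "(\<Prod>i\<in>UNIV. B \<gamma> i 0 (x $ i)) = (\<Prod>i\<in>UNIV. x $ i ^ \<gamma> i) * bump m l r x"
    unfolding B_def mulx_0 bump by (rule prod.distrib)
   then have "\<bar>\<Prod>i\<in>UNIV. B \<gamma> i 0 (x $ i)\<bar> = (\<Prod>i\<in>UNIV. \<bar>x $ i\<bar> ^ \<gamma> i) * bump m l r x"
    by (simp only: abs_mult abs_prod power_abs abs_of_nonneg[OF bump_bounds(1)])
   also have "... <= norm x ^ k * bump m l r x"
    using abs_monomial_le[of x \<gamma>] unfolding g by (intro mult_right_mono bump_bounds)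
   finally show "\<bar>\<Prod>i\<in>UNIV. B \<gamma> i 0 (x $ i)\<bar> <= norm x ^ k * bump m l r x" .
   show "0 <= norm x ^ k * bump m l r x" by (intro mult_nonneg_nonneg bump_bounds) auto
  qed
  finally show ?thesis using M by (simp add: mult_left_mono)
 qed
 have db: "deriv_bound n (real CARD('d) ^ n * (M * J)) (H \<gamma>)" if "n + sum \<gamma> UNIV = k" for n \<gamma>
  using that
 proof (induction n arbitrary: \<gamma>)
  case 0
  then show ?case using base by simp
 next
  case (Suc n)
  let ?g = "\<lambda>i. \<gamma>(i := Suc (\<gamma> i))"
  have Bg: "(B \<gamma>)(i := mulx (B \<gamma> i)) = B (?g i)" for i by (auto simp: B_def fun_eq_iff)
  have "deriv_bound n (- 0 + real (card (UNIV::'d set)) * (real CARD('d) ^ n * (M * J))) (\<lambda>u. - (\<Sum>i\<in>UNIV. H (?g i) u))"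
  proof -
   have "sum (?g i) UNIV = Suc (sum \<gamma> UNIV)" for i
   proof -
    have "sum (?g i) UNIV = ?g i i + sum (?g i) (UNIV - {i})" by (rule sum.remove) auto
    also have "sum (?g i) (UNIV - {i}) = sum \<gamma> (UNIV - {i})" by (rule sum.cong) auto
    also have "?g i i + sum \<gamma> (UNIV - {i}) = Suc (\<gamma> i + sum \<gamma> (UNIV - {i}))" by simp
    also have "\<gamma> i + sum \<gamma> (UNIV - {i}) = sum \<gamma> UNIV" by (rule sum.remove[symmetric]) auto
    finally show ?thesis .
   qed
   then show ?thesis
    using Suc.prems by (simp only: minus_zero add_0) (intro deriv_bound_minus deriv_bound_sum Suc.IH; simp)
  qed
  moreover have "(H \<gamma> has_vector_derivative (- (\<Sum>i\<in>UNIV. H (?g i) u))) (at u within {0<..1})" if "u \<in> {0<..1}" for u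
   using integral_kern_derivative[OF B[of \<gamma>] suppB r0(3) F0 r0(1) that, of \<gamma>]
   unfolding H_def Bg .
  ultimately show ?case
   unfolding deriv_bound.simps by (intro exI[of _ "\<lambda>u. - (\<Sum>i\<in>UNIV. H (?g i) u)"] conjI ballI) (simp_all only: minus_zero add_0 power_Suc mult.assoc)
 qed
 have H0: "H (\<lambda>_. 0) u = (\<integral>x. F x * of_real ((1/u) ^ CARD('d) * bump m l r ((1/u) *\<^sub>R x)) \<partial>lebesgue)" for u
  unfolding H_def kern_def bump B_def by (simp add: prod.distrib prod_dividef power_divide)
 have sm: "((\<lambda>u. H (\<lambda>_. 0) u / of_real u ^ (k - 1)) \<longlongrightarrow> 0) (at_right 0)"
 proof (rule tendstoI)
  fix e :: real assume e: "e > 0"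
  define e' where "e' = e / 2 / \<rho> ^ (CARD('d) + (k - 1))"
  have "e' > 0" using e rho by (simp add: e'_def)
  then obtain u0 where u0: "u0 > 0" "\<And>u. 0 < u ==> u < u0 ==>
   (\<integral>\<^sup>+x\<in>ball 0 u. ennreal (norm (F x)) \<partial>lebesgue) <= ennreal (e' * u ^ (CARD('d) + (k - 1)))"
   using van[unfolded mean_vanish_def, rule_format, of e'] by blast
  have "\<forall>\<^sub>F u in at_right 0. u \<in> {0<..<1} \<and> u < u0 / \<rho>"
   using u0(1) rho by (auto simp: eventually_at_right_field intro!: exI[of _ "min 1 (u0/\<rho>)"])
  then show "\<forall>\<^sub>F u in at_right 0. dist (H (\<lambda>_. 0) u / of_real u ^ (k - 1)) 0 < e"
  proof eventually_elim
   case (elim u)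
   then have u: "0 < u" "u <= 1" "\<rho> * u < u0" "\<rho> * u < \<rho>" using rho by (auto simp: field_simps)
   let ?f = "\<lambda>x. F x * of_real ((1/u) ^ CARD('d) * bump m l r ((1/u) *\<^sub>R x))"
   have "ennreal (norm (H (\<lambda>_. 0) u)) <= (\<integral>\<^sup>+x. ennreal (norm (?f x)) \<partial>lebesgue)"
    unfolding H0 by (rule integral_norm_bound_ennreal)
     (use integrable_times_kern[OF B[of "\<lambda>_. 0"] suppB r0(3) F0 u(1,2) r0(1), of "\<lambda>_. 0"] in
      \<open>simp add: kern_def bump B_def prod.distrib prod_dividef power_divide\<close>)
   also have "... <= (\<integral>\<^sup>+x. ennreal ((1/u) ^ CARD('d)) * (ennreal (norm (F x)) * indicator (ball 0 (\<rho> * u)) x) \<partial>lebesgue)"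
   proof (rule nn_integral_mono)
    fix x :: "real^'d"
    show "ennreal (norm (?f x)) <= ennreal ((1/u) ^ CARD('d)) * (ennreal (norm (F x)) * indicator (ball 0 (\<rho> * u)) x)"
    proof (cases "x \<in> ball 0 (\<rho> * u)")
     case True
     have "norm (?f x) = norm (F x) * ((1/u) ^ CARD('d) * bump m l r ((1/u) *\<^sub>R x))"
      unfolding norm_mult norm_of_real using u bump_bounds(1)[of m l r "(1/u) *\<^sub>R x"] by (simp add: abs_mult)
     also have "... <= norm (F x) * ((1/u) ^ CARD('d) * 1)"
      using u by (intro mult_left_mono bump_bounds) auto
     finally show ?thesis using True u by (simp add: ennreal_mult[symmetric] mult.commute ennreal_leI)
    next
     case False
     have "(1/u) *\<^sub>R x \<notin> box l r"
     proof
      assume "(1/u) *\<^sub>R x \<in> box l r"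
      then have "norm ((1/u) *\<^sub>R x) < \<rho>" using lr box_subset_cbox by fastforce
      then show False using False u by (simp add: field_simps)
     qed
     then show ?thesis by (simp add: bump_outside)
    qed
   qed
   also have "... = ennreal ((1/u) ^ CARD('d)) * (\<integral>\<^sup>+x\<in>ball 0 (\<rho> * u). ennreal (norm (F x)) \<partial>lebesgue)"
   proof (rule nn_integral_cmult)
    have "integrable lebesgue (\<lambda>x. indicator (ball 0 (\<rho> * u)) x *\<^sub>R F x)"
    proof -
     have "set_integrable lebesgue (ball 0 (\<rho> * u)) F"
      by (rule set_integrable_subset[OF loc[of "cball 0 (\<rho> * u)"]]) (use u in auto)
     then show ?thesis by (simp add: set_integrable_def)
    qed
    then have "(\<lambda>x. ennreal (norm (indicator (ball 0 (\<rho> * u)) x *\<^sub>R F x))) \<in> lmeas"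
     by (intro measurable_compose[OF _ measurable_ennreal] measurable_compose[OF borel_measurable_integrable borel_measurable_norm])
    moreover have "ennreal (norm (indicator (ball 0 (\<rho> * u)) x *\<^sub>R F x)) = ennreal (norm (F x)) * indicator (ball 0 (\<rho> * u)) x" for x
     by (auto simp: indicator_def)
    ultimately show "(\<lambda>x. ennreal (norm (F x)) * indicator (ball 0 (\<rho> * u)) x) \<in> lmeas" by (simp only:)
   qed
   also have "... <= ennreal ((1/u) ^ CARD('d)) * ennreal (e' * (\<rho> * u) ^ (CARD('d) + (k - 1)))"
    using u rho by (intro mult_left_mono u0) auto
   also have "... = ennreal (e / 2 * u ^ (k - 1))"
   proof -
    have "(1/u) ^ CARD('d) * (e' * (\<rho> * u) ^ (CARD('d) + (k - 1))) = e / 2 * u ^ (k - 1)"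
     using u rho by (simp add: e'_def power_mult_distrib power_add power_divide)
    then show ?thesis
     unfolding \<open>_ = e / 2 * u ^ (k - 1)\<close>[symmetric] using u \<open>e' > 0\<close> rho
     by (intro ennreal_mult[symmetric]) auto
   qed
   finally have "norm (H (\<lambda>_. 0) u) <= e / 2 * u ^ (k - 1)"
    using e u by (simp add: ennreal_le_iff)
   then have "norm (H (\<lambda>_. 0) u / of_real u ^ (k - 1)) <= e / 2"
    using u by (simp add: norm_divide norm_power divide_le_eq)
   then show ?case using e by simp
  qed
 qed
 have "norm (H (\<lambda>_. 0) 1) <= real CARD('d) ^ k * (M * J)"
  using deriv_bound_small[OF db[of k "\<lambda>_. 0"] k sm] by simp
 then show "norm (\<integral>x. F x * of_real (bump m l r x) \<partial>lebesgue) <= (\<integral>x. real CARD('d) ^ k * M * norm x ^ k * bump m l r x \<partial>lebesgue)"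
  unfolding H0 J_def by (simp add: mult.assoc)
qed

section \<open>Symbols of refinable vectors\<close>

lemma powr_double_exponent: "x powr (2 * s) = (x powr s)\<^sup>2" for x :: real
 by (simp add: power2_eq_square flip: powr_add)

lemma AE_bound_finite:
 fixes \<phi> :: "'i => 'a::euclidean_space => real"
 assumes "finite E" and "\<And>\<omega>. \<psi> \<omega> \<ge> 0"
  and "\<And>l. l \<in> E ==> \<exists>C>0. \<exists>\<rho>>0. AE \<omega> in lebesgue. norm \<omega> < \<rho> --> \<phi> l \<omega> <= C * \<psi> \<omega>"
 shows "\<exists>C>0. \<exists>\<rho>>0. AE \<omega> in lebesgue. norm \<omega> < \<rho> --> (\<forall>l\<in>E. \<phi> l \<omega> <= C * \<psi> \<omega>)"
 using assms(1,3)
proof (induction E rule: finite_induct)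
 case empty
 show ?case by (intro exI[of _ 1] conjI) auto
next
 case (insert l E)
 have "\<exists>C>0. \<exists>\<rho>>0. AE \<omega> in lebesgue. norm \<omega> < \<rho> --> (\<forall>l\<in>E. \<phi> l \<omega> <= C * \<psi> \<omega>)"
  by (rule insert.IH) (rule insert.prems, simp)
 then obtain C \<rho> where C: "C > 0" "\<rho> > 0" and ae: "AE \<omega> in lebesgue. norm \<omega> < \<rho> --> (\<forall>l\<in>E. \<phi> l \<omega> <= C * \<psi> \<omega>)"
  by blast
 obtain D \<sigma> where D: "D > 0" "\<sigma> > 0" and ae': "AE \<omega> in lebesgue. norm \<omega> < \<sigma> --> \<phi> l \<omega> <= D * \<psi> \<omega>"
  using insert.prems[of l] by blast
 have "AE \<omega> in lebesgue. norm \<omega> < min \<rho> \<sigma> --> (\<forall>l\<in>insert l E. \<phi> l \<omega> <= max C D * \<psi> \<omega>)"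
  using ae ae'
 proof eventually_elim
  case (elim \<omega>)
  have "C * \<psi> \<omega> <= max C D * \<psi> \<omega>" "D * \<psi> \<omega> <= max C D * \<psi> \<omega>"
   using assms(2)[of \<omega>] by (auto intro: mult_right_mono)
  then show ?case using elim by (auto intro: order_trans)
 qed
 then show ?case using C D by (intro exI[of _ "max C D"] conjI exI[of _ "min \<rho> \<sigma>"]) auto
qed

lemma norm_sum_mult_le:
 fixes a b :: "'i => complex"
 shows "norm (\<Sum>i\<in>I. a i * b i) <= L2_set (\<lambda>i. norm (a i)) I * L2_set (\<lambda>i. norm (b i)) I"
proof -
 have "norm (\<Sum>i\<in>I. a i * b i) <= (\<Sum>i\<in>I. \<bar>norm (a i)\<bar> * \<bar>norm (b i)\<bar>)"
  by (rule sum_norm_le) (simp add: norm_mult)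
 also have "... <= L2_set (\<lambda>i. norm (a i)) I * L2_set (\<lambda>i. norm (b i)) I" by (rule L2_set_mult_ineq)
 finally show ?thesis .
qed

lemma norm_cinner_le: "norm (cinner x y) <= norm x * norm y"
 using norm_sum_mult_le[of "\<lambda>i. cnj (x $ i)" "\<lambda>i. y $ i" UNIV] by (simp add: cinner_def norm_vec_def)

lemma cinner_self: "Re (cinner x x) = (norm x)\<^sup>2"
proof -
 have "cinner x x = (\<Sum>i\<in>UNIV. of_real ((norm (x $ i))\<^sup>2))"
  unfolding cinner_def by (intro sum.cong refl) (simp add: complex_norm_square mult.commute del: of_real_power)
 then show ?thesis by (simp add: norm_vec_def L2_set_def sum_nonneg)
qed

lemma cinner_matrix_vector: "cinner x (A *v z) = (\<Sum>j\<in>UNIV. (conj_vec x v* A) $ j * z $ j)"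
proof -
 have "cinner x (A *v z) = (\<Sum>i\<in>UNIV. \<Sum>j\<in>UNIV. cnj (x $ i) * A $ i $ j * z $ j)"
  by (simp add: cinner_def matrix_vector_mult_def sum_distrib_left mult.assoc)
 also have "... = (\<Sum>j\<in>UNIV. \<Sum>i\<in>UNIV. cnj (x $ i) * A $ i $ j * z $ j)" by (rule sum.swap)
 also have "... = (\<Sum>j\<in>UNIV. (conj_vec x v* A) $ j * z $ j)"
  by (simp add: conj_vec_def vector_matrix_mult_def sum_distrib_left sum_distrib_right mult_ac)
 finally show ?thesis .
qed

lemma AE_lattice:
 fixes Q :: "real^'d::finite => bool"
 assumes "AE \<omega> in lebesgue. Q \<omega>"
 shows "AE \<omega> in lebesgue. \<forall>\<alpha>\<in>dual_lattice. \<forall>l\<in>unit_vertices. Q (\<omega> + pi *\<^sub>R l + \<alpha>)"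
proof -
 have "AE \<omega> in lebesgue. \<forall>\<alpha>\<in>dual_lattice. \<forall>l\<in>unit_vertices. Q ((pi *\<^sub>R l + \<alpha>) + 1 *\<^sub>R \<omega>)"
  by (subst AE_ball_countable[OF countable_dual_lattice], intro ballI,
    subst AE_ball_countable[OF countable_finite[OF finite_unit_vertices]], intro ballI AE_affine assms) simp
 then show ?thesis by (simp add: algebra_simps)
qed

text \<open>Uniqueness of Fourier transforms makes \<open>\<Phi> \<mapsto> \<Phi>\<^sup>^\<close> linear almost everywhere.\<close>

lemma vhat_span:
 fixes B :: "('d::finite functional ^ 'r::finite) set"
 assumes B: "finite B" and hf: "\<And>\<Psi> i. \<Psi> \<in> B ==> \<exists>F. has_fourier (\<Psi> $ i) F" and Phi: "\<Phi> \<in> vfunctional.span B"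
 obtains u where "AE \<omega> in lebesgue. vhat \<Phi> \<omega> = (\<Sum>\<Psi>\<in>B. u \<Psi> *s vhat \<Psi> \<omega>)"
proof -
 obtain u where u: "\<Phi> = (\<Sum>\<Psi>\<in>B. vscale (u \<Psi>) \<Psi>)"
  using Phi vfunctional.span_finite[OF B] by auto
 have "AE \<omega> in lebesgue. fhat (\<Phi> $ i) \<omega> = (\<Sum>\<Psi>\<in>B. u \<Psi> * fhat (\<Psi> $ i) \<omega>)" for i
 proof -
  have "\<Phi> $ i = (\<Sum>\<Psi>\<in>B. fscale (u \<Psi>) (\<Psi> $ i))"
   by (simp add: u vscale_def)
  moreover have "has_fourier (\<Sum>\<Psi>\<in>B. fscale (u \<Psi>) (\<Psi> $ i)) (\<lambda>\<omega>. \<Sum>\<Psi>\<in>B. u \<Psi> * fhat (\<Psi> $ i) \<omega>)"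
   using hf has_fourier_fhat by (intro has_fourier_sum B has_fourier_cmult) blast
  ultimately have "has_fourier (\<Phi> $ i) (\<lambda>\<omega>. \<Sum>\<Psi>\<in>B. u \<Psi> * fhat (\<Psi> $ i) \<omega>)" by simp
  then show ?thesis by (rule fhat_AE_eq)
 qed
 then have "AE \<omega> in lebesgue. \<forall>i\<in>UNIV. fhat (\<Phi> $ i) \<omega> = (\<Sum>\<Psi>\<in>B. u \<Psi> * fhat (\<Psi> $ i) \<omega>)"
  by (subst AE_ball_countable) auto
 then have "AE \<omega> in lebesgue. vhat \<Phi> \<omega> = (\<Sum>\<Psi>\<in>B. u \<Psi> *s vhat \<Psi> \<omega>)"
  by eventually_elim (simp add: vec_eq_iff vhat_def)
 then show ?thesis by (rule that)
qed

text \<open>The standing hypotheses on mask, solution space and supervector; the smoothness of the symbols is added where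
 it enters.\<close>

locale refinable =
 fixes P :: "real^'d::finite => complex^'r^'r::finite"
  and R B :: "('d functional ^ 'r) set"
  and s k :: real
  and v :: "real^'d => complex^'r"
 assumes mask: "refinement_mask P"
  and basis: "finite B" "vfunctional.span B = R"
  and sobolev: "\<forall>\<Phi>\<in>R. \<forall>i. \<Phi> $ i \<in> W2 s"
  and refinable: "\<forall>\<Phi>\<in>R. solves_refinement P \<Phi>"
  and k_pos: "k > 0"
  and A1: "\<forall>l \<in> unit_vertices - {0}.
     (\<lambda>\<omega>. norm (gramian s B (\<omega> + pi *\<^sub>R l))) \<in> O[ae_nhds 0](\<lambda>_. 1)"
    "(\<lambda>\<omega>. norm (gramian s B \<omega>)) \<in> O[ae_nhds 0](\<lambda>\<omega>. norm \<omega> powr (2 * s))"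
  and A2: "periodic v" "v \<in> lmeas"
    "(\<lambda>\<omega>. Re (cinner (v \<omega>) (v \<omega>))) \<in> \<Theta>[ae_nhds 0](\<lambda>_. 1)"
  and Z: "condition_Z k P v"
begin

definition symb :: "'d functional ^ 'r => real^'d => complex" where
 "symb \<Phi> \<omega> = cinner (v \<omega>) (vhat \<Phi> \<omega>)"

lemma B_subset: "B \<subseteq> R"
 using basis(2) vfunctional.span_superset by blast

lemma has_fourier_entry: "\<Phi> \<in> R ==> has_fourier (\<Phi> $ i) (fhat (\<Phi> $ i))"
 using sobolev has_fourier_fhat by (auto simp: W2_def)

lemma fhat_measurable: "\<Phi> \<in> R ==> fhat (\<Phi> $ i) \<in> lmeas"
 using has_fourier_entry by (auto simp: has_fourier_def)

lemma v_periodic: "\<alpha> \<in> dual_lattice ==> v (\<omega> + \<alpha>) = v \<omega>"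
 using A2(1) by (auto simp: periodic_def)

lemma v_nth_measurable: "(\<lambda>\<omega>. v \<omega> $ i) \<in> lmeas"
 using measurable_compose[OF A2(2), of "\<lambda>x. x $ i" borel]
 by (simp add: borel_measurable_continuous_onI continuous_on_component)

lemma symb_measurable: "\<Phi> \<in> R ==> symb \<Phi> \<in> lmeas"
proof -
 assume Phi: "\<Phi> \<in> R"
 have "(\<lambda>\<omega>. cnj (v \<omega> $ i) * fhat (\<Phi> $ i) \<omega>) \<in> lmeas" for i
  by (intro borel_measurable_times fhat_measurable[OF Phi] measurable_compose[OF v_nth_measurable])
   (simp add: borel_measurable_continuous_onI continuous_on_cnj)
 then show ?thesis unfolding symb_def[abs_def] cinner_def vhat_def
  by (simp add: borel_measurable_sum)
qed

lemma norm_vhat_measurable: "\<Phi> \<in> R ==> (\<lambda>\<omega>. norm (vhat \<Phi> \<omega>)) \<in> lmeas"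
proof -
 assume Phi: "\<Phi> \<in> R"
 have "(\<lambda>\<omega>. norm (fhat (\<Phi> $ i) \<omega>)) \<in> lmeas" for i
  by (rule measurable_compose[OF fhat_measurable[OF Phi] borel_measurable_norm])
 then have "(\<lambda>\<omega>. \<Sum>i\<in>UNIV. (norm (fhat (\<Phi> $ i) \<omega>))\<^sup>2) \<in> lmeas"
  by (intro borel_measurable_sum borel_measurable_power)
 from measurable_compose[OF this, of sqrt borel]
 show ?thesis unfolding norm_vec_def L2_set_def vhat_def vec_lambda_beta
  by (simp add: borel_measurable_continuous_onI continuous_on_real_sqrt)
qed

text \<open>The refinement equation and Condition \<open>Z\<^sub>k\<close> combine to the scalar recursion
 \<open>f(2(\<omega> + \<pi> l + \<beta>)) = \<delta>\<^sub>l\<^sub>0 f(\<omega> + \<beta>) + O(|\<omega>|\<^sup>k) |\<Phi>\<^sup>^(\<omega> + \<pi> l + \<beta>)|\<close> for the symbol \<open>f = v\<^sup>* \<Phi>\<^sup>^\<close>.\<close>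

lemma symbol_recursion:
 assumes Phi: "\<Phi> \<in> R"
 obtains C \<rho> where "C > 0" "\<rho> > 0"
  "AE \<omega> in lebesgue. norm \<omega> < \<rho> --> (\<forall>\<beta>\<in>dual_lattice. \<forall>l\<in>unit_vertices.
   norm (symb \<Phi> (2 *\<^sub>R (\<omega> + pi *\<^sub>R l + \<beta>)) - (if l = 0 then symb \<Phi> (\<omega> + \<beta>) else 0))
    <= C * norm \<omega> powr k * norm (vhat \<Phi> (\<omega> + pi *\<^sub>R l + \<beta>)))"
proof -
 let ?row = "\<lambda>l y. conj_vec (v (2 *\<^sub>R y)) v* P y - (if l = 0 then conj_vec (v y) else 0)"
 have "\<exists>C>0. \<exists>\<rho>>0. AE \<omega> in lebesgue. norm \<omega> < \<rho> --> norm (?row l (\<omega> + pi *\<^sub>R l)) <= C * norm \<omega> powr k"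
  if l: "l \<in> unit_vertices" for l
 proof -
  have "(\<lambda>\<omega>. norm (?row l \<omega>)) \<in> O[ae_nhds (pi *\<^sub>R l)](\<lambda>\<omega>. norm (\<omega> - pi *\<^sub>R l) powr k)"
   using Z l unfolding condition_Z_def ae_zero_of_order_def by auto
  then obtain C \<rho> where C: "C > 0" "\<rho> > 0" and ae: "AE y in lebesgue. dist y (pi *\<^sub>R l) < \<rho> --> norm (?row l y) <= C * norm (y - pi *\<^sub>R l) powr k"
   unfolding bigo_def eventually_ae_nhds by auto
  have "AE \<omega> in lebesgue. dist (pi *\<^sub>R l + 1 *\<^sub>R \<omega>) (pi *\<^sub>R l) < \<rho> --> norm (?row l (pi *\<^sub>R l + 1 *\<^sub>R \<omega>)) <= C * norm ((pi *\<^sub>R l + 1 *\<^sub>R \<omega>) - pi *\<^sub>R l) powr k"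
   by (rule AE_affine[OF _ ae]) simp
  then show ?thesis using C by (intro exI[of _ C] conjI exI[of _ \<rho>]) (auto simp: dist_norm add.commute)
 qed
 then obtain C' \<rho>' where C': "C' > 0" and rho': "\<rho>' > 0"
  and ae1: "AE \<omega> in lebesgue. norm \<omega> < \<rho>' --> (\<forall>l\<in>unit_vertices. norm (?row l (\<omega> + pi *\<^sub>R l)) <= C' * norm \<omega> powr k)"
  using AE_bound_finite[OF finite_unit_vertices, of "\<lambda>\<omega>. norm \<omega> powr k" "\<lambda>l \<omega>. norm (?row l (\<omega> + pi *\<^sub>R l))"] by force
 have ref: "AE \<omega> in lebesgue. vhat \<Phi> (2 *\<^sub>R \<omega>) = P \<omega> *v vhat \<Phi> \<omega>"
  using refinable Phi by (auto simp: solves_refinement_def)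
 have "AE \<omega> in lebesgue. norm \<omega> < \<rho>' --> (\<forall>\<beta>\<in>dual_lattice. \<forall>l\<in>unit_vertices.
   norm (symb \<Phi> (2 *\<^sub>R (\<omega> + pi *\<^sub>R l + \<beta>)) - (if l = 0 then symb \<Phi> (\<omega> + \<beta>) else 0))
    <= C' * norm \<omega> powr k * norm (vhat \<Phi> (\<omega> + pi *\<^sub>R l + \<beta>)))"
  using ae1 AE_lattice[OF ref]
 proof eventually_elim
  case (elim \<omega>)
  show ?case
  proof (intro impI ballI)
   fix \<beta> l :: "real^'d" assume w: "norm \<omega> < \<rho>'" and b: "\<beta> \<in> dual_lattice" and l: "l \<in> unit_vertices"
   define y where "y = \<omega> + pi *\<^sub>R l"
   define z where "z = vhat \<Phi> (y + \<beta>)"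
   have v2: "v (2 *\<^sub>R (y + \<beta>)) = v (2 *\<^sub>R y)"
    using v_periodic[OF dual_lattice_double[OF b], of "2 *\<^sub>R y"] by (simp add: algebra_simps)
   have Pb: "P (y + \<beta>) = P y" using mask b by (auto simp: refinement_mask_def periodic_def)
   have "vhat \<Phi> (2 *\<^sub>R (y + \<beta>)) = P y *v z" using elim(2) b l Pb by (simp add: y_def z_def)
   then have 1: "symb \<Phi> (2 *\<^sub>R (y + \<beta>)) = (\<Sum>j\<in>UNIV. (conj_vec (v (2 *\<^sub>R y)) v* P y) $ j * z $ j)"
    unfolding symb_def v2 by (simp add: cinner_matrix_vector)
   have 2: "(if l = 0 then symb \<Phi> (\<omega> + \<beta>) else 0) = (\<Sum>j\<in>UNIV. (if l = 0 then conj_vec (v y) else 0) $ j * z $ j)"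
    using v_periodic[OF b, of \<omega>] by (simp add: y_def z_def symb_def cinner_def conj_vec_def)
   have "symb \<Phi> (2 *\<^sub>R (y + \<beta>)) - (if l = 0 then symb \<Phi> (\<omega> + \<beta>) else 0) = (\<Sum>j\<in>UNIV. ?row l y $ j * z $ j)"
    unfolding 1 2 sum_subtractf[symmetric] by (intro sum.cong refl) (simp add: left_diff_distrib)
   then have "norm (symb \<Phi> (2 *\<^sub>R (y + \<beta>)) - (if l = 0 then symb \<Phi> (\<omega> + \<beta>) else 0)) <= norm (?row l y) * norm z"
    using norm_sum_mult_le[of "\<lambda>j. ?row l y $ j" "\<lambda>j. z $ j" UNIV] by (simp only: norm_vec_def)
   also have "norm (?row l y) <= C' * norm \<omega> powr k"
    using elim(1)[rule_format, OF w l] by (simp only: y_def)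
   finally show "norm (symb \<Phi> (2 *\<^sub>R (\<omega> + pi *\<^sub>R l + \<beta>)) - (if l = 0 then symb \<Phi> (\<omega> + \<beta>) else 0))
    <= C' * norm \<omega> powr k * norm (vhat \<Phi> (\<omega> + pi *\<^sub>R l + \<beta>))"
    by (simp add: y_def z_def mult_right_mono)
  qed
 qed
 then show ?thesis by (rule that[OF C' rho'])
qed

text \<open>An element of \<open>R\<close> is almost everywhere a fixed combination of the basis, whose lattice sums are the diagonal entries
 of the Gramian. The bound is uniform in the index set \<open>A\<close>, so that it covers both \<open>G\<close> and \<open>G\<^sup>0\<close>.\<close>

lemma gram_bound:
 assumes Phi: "\<Phi> \<in> R"
 obtains C where "C \<ge> 0" "AE \<omega> in lebesgue. \<forall>A F. A \<subseteq> dual_lattice --> finite F --> F \<subseteq> A -->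
  wnorm s (vhat \<Phi>) F \<omega> <= C * sqrt (norm (gram_sum A s B \<omega>))"
proof -
 have hf: "\<exists>F. has_fourier (\<Psi> $ i) F" if "\<Psi> \<in> B" for \<Psi> i using has_fourier_entry B_subset that by blast
 have Phi': "\<Phi> \<in> vfunctional.span B" using Phi basis by simp
 obtain u where u: "AE \<omega> in lebesgue. vhat \<Phi> \<omega> = (\<Sum>\<Psi>\<in>B. u \<Psi> *s vhat \<Psi> \<omega>)"
  by (rule vhat_span[OF basis(1) hf Phi'])
 define C where "C = (\<Sum>\<Psi>\<in>B. norm (u \<Psi>)) * sqrt (CARD('r))"
 have C: "C \<ge> 0" by (simp add: C_def sum_nonneg)
 have gs: "AE \<omega> in lebesgue. gram_summable s B \<omega>"
  using sobolev B_subset by (intro AE_gram_summable basis) auto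
 have "AE \<omega> in lebesgue. \<forall>A F. A \<subseteq> dual_lattice --> finite F --> F \<subseteq> A -->
  wnorm s (vhat \<Phi>) F \<omega> <= C * sqrt (norm (gram_sum A s B \<omega>))"
  using AE_lattice[OF u] gs
 proof eventually_elim
  case (elim \<omega>)
  have eq: "vhat \<Phi> (\<omega> + \<alpha>) = (\<Sum>\<Psi>\<in>B. u \<Psi> *s vhat \<Psi> (\<omega> + \<alpha>))" if "\<alpha> \<in> dual_lattice" for \<alpha>
   using elim(1)[rule_format, OF that unit_vertices_0] by simp
  show ?case
  proof (intro allI impI)
   fix A F :: "(real^'d) set" assume A: "A \<subseteq> dual_lattice" "finite F" "F \<subseteq> A"
   let ?n = "sqrt (norm (gram_sum A s B \<omega>))"
   have one: "wnorm s (vhat \<Psi>) F \<omega> <= sqrt (CARD('r)) * ?n" if Psi: "\<Psi> \<in> B" for \<Psi>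
   proof -
    have "wnorm s (vhat \<Psi>) F \<omega> = sqrt (\<Sum>\<alpha>\<in>F. (norm (vhat \<Psi> (\<omega> + \<alpha>)))\<^sup>2 * norm (\<omega> + \<alpha>) powr (2 * s))"
     unfolding wnorm_def L2_set_def
     by (intro arg_cong[where f=sqrt] sum.cong refl) (simp only: power_mult_distrib powr_double_exponent, rule mult.commute)
    also have "... <= sqrt (CARD('r) * norm (gram_sum A s B \<omega>))"
     by (intro real_sqrt_le_mono sum_le_norm_gram elim(2) basis Psi A)
    finally show ?thesis by (simp add: real_sqrt_mult)
   qed
   have "wnorm s (vhat \<Phi>) F \<omega> <= (\<Sum>\<Psi>\<in>B. norm (u \<Psi>) * wnorm s (vhat \<Psi>) F \<omega>)"
   proof -
    have "wnorm s (vhat \<Phi>) F \<omega> <= L2_set (\<lambda>\<alpha>. \<Sum>\<Psi>\<in>B. norm (u \<Psi>) * (norm (\<omega> + \<alpha>) powr s * norm (vhat \<Psi> (\<omega> + \<alpha>)))) F"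
     unfolding wnorm_def
    proof (rule L2_set_mono)
     fix \<alpha> assume "\<alpha> \<in> F"
     then have "\<alpha> \<in> dual_lattice" using A by auto
     have nsm: "norm (c *s x) = norm c * norm x" for c and x :: "complex^'r"
      by (simp add: norm_vec_def norm_mult L2_set_right_distrib)
     have "norm (vhat \<Phi> (\<omega> + \<alpha>)) <= (\<Sum>\<Psi>\<in>B. norm (u \<Psi>) * norm (vhat \<Psi> (\<omega> + \<alpha>)))"
      unfolding eq[OF \<open>\<alpha> \<in> dual_lattice\<close>] by (rule sum_norm_le) (simp add: nsm)
     from mult_left_mono[OF this powr_ge_zero[of "norm (\<omega> + \<alpha>)" s]]
     show "norm (\<omega> + \<alpha>) powr s * norm (vhat \<Phi> (\<omega> + \<alpha>)) <= (\<Sum>\<Psi>\<in>B. norm (u \<Psi>) * (norm (\<omega> + \<alpha>) powr s * norm (vhat \<Psi> (\<omega> + \<alpha>))))"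
      by (simp only: sum_distrib_left mult.left_commute)
    qed simp
    also have "... <= (\<Sum>\<Psi>\<in>B. L2_set (\<lambda>\<alpha>. norm (u \<Psi>) * (norm (\<omega> + \<alpha>) powr s * norm (vhat \<Psi> (\<omega> + \<alpha>)))) F)"
     using basis(1)
    proof (induction B rule: finite_induct)
     case (insert x S)
     then show ?case using L2_set_triangle_ineq[of "\<lambda>\<alpha>. norm (u x) * (norm (\<omega> + \<alpha>) powr s * norm (vhat x (\<omega> + \<alpha>)))"
       "\<lambda>\<alpha>. \<Sum>\<Psi>\<in>S. norm (u \<Psi>) * (norm (\<omega> + \<alpha>) powr s * norm (vhat \<Psi> (\<omega> + \<alpha>)))" F]
      by simp
    qed (simp add: L2_set_def)
    also have "... = (\<Sum>\<Psi>\<in>B. norm (u \<Psi>) * wnorm s (vhat \<Psi>) F \<omega>)"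
     unfolding wnorm_def by (intro sum.cong refl L2_set_right_distrib[symmetric]) simp
    finally show ?thesis .
   qed
   also have "... <= (\<Sum>\<Psi>\<in>B. norm (u \<Psi>) * (sqrt (CARD('r)) * ?n))"
    by (intro sum_mono mult_left_mono one) auto
   also have "... = C * ?n" by (simp add: C_def sum_distrib_right sum_distrib_left mult_ac)
   finally show "wnorm s (vhat \<Phi>) F \<omega> <= C * ?n" .
  qed
 qed
 then show ?thesis by (rule that[OF C])
qed

text \<open>What (A1) says about the entries of a single \<open>\<Phi>\<close>.\<close>

lemma vhat_bounds:
 assumes Phi: "\<Phi> \<in> R"
 obtains C \<rho> where "C > 0" "\<rho> > 0"
  "AE \<omega> in lebesgue. norm \<omega> < \<rho> --> (\<forall>F l. finite F --> F \<subseteq> dual_lattice --> l \<in> unit_vertices - {0} -->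
   wnorm s (vhat \<Phi>) F (\<omega> + pi *\<^sub>R l) <= C)"
  "AE \<omega> in lebesgue. norm \<omega> < \<rho> --> (wnorm_le dual_lattice s (vhat \<Phi>) \<omega> (C * norm \<omega> powr s))"
proof -
 obtain C0 where C0: "C0 \<ge> 0" and ae0: "AE \<omega> in lebesgue. \<forall>A F. A \<subseteq> dual_lattice --> finite F --> F \<subseteq> A -->
  wnorm s (vhat \<Phi>) F \<omega> <= C0 * sqrt (norm (gram_sum A s B \<omega>))"
  by (rule gram_bound[OF Phi])
 obtain C1 \<rho>1 where C1: "C1 > 0" "\<rho>1 > 0" and ae1: "AE \<omega> in lebesgue. norm \<omega> < \<rho>1 --> norm (norm (gramian s B \<omega>)) <= C1 * norm (norm \<omega> powr (2 * s))"
  by (rule bigo_ae_nhds_0D[OF A1(2)])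
 have "\<exists>C>0. \<exists>\<rho>>0. AE \<omega> in lebesgue. norm \<omega> < \<rho> --> norm (gramian s B (\<omega> + pi *\<^sub>R l)) <= C * 1" if l: "l \<in> unit_vertices - {0}" for l
 proof -
  obtain C \<rho> where "C > 0" "\<rho> > 0" "AE \<omega> in lebesgue. norm \<omega> < \<rho> --> norm (norm (gramian s B (\<omega> + pi *\<^sub>R l))) <= C * norm (1::real)"
   by (rule bigo_ae_nhds_0D[OF A1(1)[rule_format, OF l]])
  then show ?thesis by auto
 qed
 then obtain C2 \<rho>2 where C2: "C2 > 0" "\<rho>2 > 0"
  and ae2': "AE \<omega> in lebesgue. norm \<omega> < \<rho>2 --> (\<forall>l\<in>unit_vertices - {0}. norm (gramian s B (\<omega> + pi *\<^sub>R l)) <= C2 * 1)"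
  using AE_bound_finite[of "unit_vertices - {0}" "\<lambda>_. 1" "\<lambda>l \<omega>. norm (gramian s B (\<omega> + pi *\<^sub>R l))"] by force
 define M where "M = max C1 C2"
 define \<rho> where "\<rho> = min \<rho>1 \<rho>2"
 have M: "C1 <= M" "C2 <= M" and r: "\<rho> <= \<rho>1" "\<rho> <= \<rho>2" and rho: "\<rho> > 0"
  using C1 C2 by (auto simp: M_def \<rho>_def)
 define C where "C = C0 * sqrt M + 1"
 have M0: "M > 0" using M(1) C1(1) by linarith
 have Cpos: "C > 0" using C0 M0 by (simp add: C_def add_nonneg_pos)
 have CC: "C0 * sqrt x <= C" if "x <= M" for x
 proof -
  have "C0 * sqrt x <= C0 * sqrt M" using that C0 by (intro mult_left_mono) auto
  then show ?thesis by (simp add: C_def)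
 qed
 show ?thesis
 proof (rule that[OF Cpos rho])
  show "AE \<omega> in lebesgue. norm \<omega> < \<rho> --> (\<forall>F l. finite F --> F \<subseteq> dual_lattice --> l \<in> unit_vertices - {0} -->
   wnorm s (vhat \<Phi>) F (\<omega> + pi *\<^sub>R l) <= C)"
   using AE_lattice[OF ae0] ae2'
  proof eventually_elim
   case (elim \<omega>)
   show ?case
   proof (intro impI allI)
    fix F :: "(real^'d) set" and l :: "real^'d" assume w: "norm \<omega> < \<rho>" and F: "finite F" "F \<subseteq> dual_lattice" and l: "l \<in> unit_vertices - {0}"
    have "wnorm s (vhat \<Phi>) F (\<omega> + pi *\<^sub>R l) <= C0 * sqrt (norm (gramian s B (\<omega> + pi *\<^sub>R l)))"
     using elim(1)[rule_format, OF dual_lattice_0, of l dual_lattice F] l F by (simp add: gramian_def)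
    also have "... <= C" using elim(2)[rule_format, OF _ l] w r(2) M(2) by (intro CC) auto
    finally show "wnorm s (vhat \<Phi>) F (\<omega> + pi *\<^sub>R l) <= C" .
   qed
  qed
  show "AE \<omega> in lebesgue. norm \<omega> < \<rho> --> (wnorm_le dual_lattice s (vhat \<Phi>) \<omega> (C * norm \<omega> powr s))"
   using ae0 ae1
  proof eventually_elim
   case (elim \<omega>)
   show ?case
   proof (intro impI allI)
    fix F :: "(real^'d) set" assume w: "norm \<omega> < \<rho>" and F: "finite F" "F \<subseteq> dual_lattice"
    have "wnorm s (vhat \<Phi>) F \<omega> <= C0 * sqrt (norm (gramian s B \<omega>))"
     using elim(1)[rule_format, of dual_lattice F] F by (simp add: gramian_def)
    also have "... <= C0 * sqrt (C1 * norm \<omega> powr (2 * s))"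
     using elim(2) w r(1) C0 by (intro mult_left_mono real_sqrt_le_mono) auto
    also have "... = C0 * sqrt C1 * norm \<omega> powr s"
    proof -
     show ?thesis by (simp add: powr_double_exponent real_sqrt_mult)
    qed
    also have "... <= C * norm \<omega> powr s" by (intro mult_right_mono CC M) simp
    finally show "wnorm s (vhat \<Phi>) F \<omega> <= C * norm \<omega> powr s" .
   qed
  qed
 qed
qed

end

section \<open>Consequences of the smoothness assumption\<close>

text \<open>The factorials undo the normalization \<open>D\<^sup>\<gamma> = \<partial>\<^sup>\<gamma> / \<gamma>!\<close>.\<close>

lemma weak_deriv_tensor_bound:
 fixes f g :: "real^'d::finite => complex"
 assumes w: "has_weak_mderiv U \<gamma> f g" and M: "AE x in lebesgue. x \<in> U --> norm (g x) <= M"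
  and b: "\<forall>i. derivs (b i)" and supp: "\<And>i n t. t \<notin> {l$i..r$i} ==> b i n t = 0" and sub: "cbox l r \<subseteq> U"
 shows "norm (\<integral>x. f x * tensor b \<gamma> x \<partial>lebesgue) <= (\<Prod>i\<in>UNIV. fact (\<gamma> i)) * M * (\<integral>x. \<bar>\<Prod>i\<in>UNIV. b i 0 (x $ i)\<bar> \<partial>lebesgue)"
proof -
 let ?c = "(\<Prod>i\<in>UNIV. fact (\<gamma> i)) :: real" and ?t = "tensor b (\<lambda>_. 0)"
 have c: "?c > 0" by (intro prod_pos) simp
 have t: "test_function U ?t" by (rule test_function_tensor[OF b supp sub])
 have tU: "test_function UNIV ?t" by (rule test_function_tensor[OF b supp subset_UNIV])
 have "(\<integral>x. f x * mderiv \<gamma> ?t x \<partial>lebesgue) = (-1) ^ sum \<gamma> UNIV * (\<integral>x. g x * ?t x \<partial>lebesgue)"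
  using w t by (simp add: has_weak_mderiv_def)
 then have "(\<integral>x. f x * tensor b \<gamma> x \<partial>lebesgue) = of_real ?c * ((-1) ^ sum \<gamma> UNIV * (\<integral>x. g x * ?t x \<partial>lebesgue))"
  using c unfolding mderiv_tensor[OF b] by (simp add: field_simps)
 then have "norm (\<integral>x. f x * tensor b \<gamma> x \<partial>lebesgue) = ?c * norm (\<integral>x. g x * ?t x \<partial>lebesgue)"
  using c by (simp only: norm_mult norm_of_real norm_power norm_minus_cancel norm_one power_one mult_1_left abs_of_pos)
 also have "... <= ?c * (\<integral>x. M * \<bar>\<Prod>i\<in>UNIV. b i 0 (x $ i)\<bar> \<partial>lebesgue)"
 proof (intro mult_left_mono order_trans[OF integral_norm_bound] integral_mono_AE)
  show "integrable lebesgue (\<lambda>x. norm (g x * ?t x))"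
   by (intro integrable_norm integrable_mult_test_function[OF _ t]) (use w in \<open>auto simp: has_weak_mderiv_def\<close>)
  have "integrable lebesgue (\<lambda>x. 1 * ?t x)"
  proof (rule integrable_mult_test_function[OF _ tU])
   fix K :: "(real^'d) set" assume "compact K"
   then have "integrable lebesgue (indicat_real K)"
    using lmeasurable_compact[OF \<open>compact K\<close>] by (intro integrable_real_indicator) (auto simp: fmeasurable_def)
   then show "set_integrable lebesgue K (\<lambda>x. 1::complex)"
    unfolding set_integrable_def by (rule integrable_scaleR_left)
  qed
  from integrable_norm[OF this]
  show "integrable lebesgue (\<lambda>x. M * \<bar>\<Prod>i\<in>UNIV. b i 0 (x $ i)\<bar>)"
   by (intro integrable_mult_right) (simp add: tensor_def del: of_real_prod)
  show "AE x in lebesgue. norm (g x * ?t x) <= M * \<bar>\<Prod>i\<in>UNIV. b i 0 (x $ i)\<bar>"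
   using M
  proof eventually_elim
   case (elim x)
   show ?case
   proof (cases "x \<in> U")
    case True
    then show ?thesis using elim unfolding norm_mult tensor_def norm_of_real by (intro mult_right_mono) auto
   next
    case False
    then have "?t x = 0" using sub by (intro tensor_outside[OF supp]) auto
    moreover from this have "(\<Prod>i\<in>UNIV. b i 0 (x $ i)) = 0" unfolding tensor_def of_real_eq_0_iff .
    ultimately show ?thesis by (simp only: mult_zero_right norm_zero abs_zero)
   qed
  qed
 qed (use c in auto)
 finally show ?thesis by (simp add: mult.assoc)
qed

lemma prod_fact_le: "finite A ==> (\<Prod>i\<in>A. fact (\<gamma> i)) <= (fact (sum \<gamma> A) :: real)"
proof (induction A rule: finite_induct)
 case (insert i A)
 have "fact (\<gamma> i) * fact (sum \<gamma> A) <= (fact (\<gamma> i + sum \<gamma> A) :: nat)"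
  by (rule dvd_imp_le[OF fact_fact_dvd_fact]) simp
 then have "real (fact (\<gamma> i) * fact (sum \<gamma> A)) <= real (fact (\<gamma> i + sum \<gamma> A))" by (rule of_nat_mono)
 then have "fact (\<gamma> i) * fact (sum \<gamma> A) <= (fact (\<gamma> i + sum \<gamma> A) :: real)" by simp
 moreover have "fact (\<gamma> i) * (\<Prod>i\<in>A. fact (\<gamma> i)) <= fact (\<gamma> i) * (fact (sum \<gamma> A) :: real)"
  using insert.IH by (intro mult_left_mono) auto
 ultimately have "fact (\<gamma> i) * (\<Prod>i\<in>A. fact (\<gamma> i)) <= (fact (\<gamma> i + sum \<gamma> A) :: real)"
  by (rule order_trans[rotated])
 then show ?case by (simp only: prod.insert[OF insert(1,2)] sum.insert[OF insert(1,2)])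
qed simp

text \<open>Unpacking (A3): weak derivatives with bounds \<open>M\<^sub>\<beta>\<close> for which \<open>|\<beta>|\<^sup>s M\<^sub>\<beta>\<close> is square summable.\<close>

lemma weak_derivs_of_summable_norms:
 fixes f :: "real^'d::finite => complex"
 assumes fin: "(\<Sum>\<^sub>\<infinity>\<beta>\<in>dual_lattice - {0}. ennreal (norm \<beta> powr (2 * s)) *
      (SUP \<gamma>\<in>{\<gamma>. real (sum \<gamma> UNIV) <= k}. (mderiv_Linf_norm (ball \<beta> \<rho>) \<gamma> f)\<^sup>2)) < \<infinity>"
 obtains M D where "\<And>\<beta>. M \<beta> \<ge> 0" "D \<ge> 0"
  "\<And>F. finite F ==> F \<subseteq> dual_lattice - {0} ==> L2_set (\<lambda>\<beta>. norm \<beta> powr s * M \<beta>) F <= D"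
  "\<And>\<beta> \<gamma>. \<beta> \<in> dual_lattice - {0} ==> real (sum \<gamma> UNIV) <= k ==>
   \<exists>g. has_weak_mderiv (ball \<beta> \<rho>) \<gamma> f g \<and> (AE x in lebesgue. x \<in> ball \<beta> \<rho> --> norm (g x) <= M \<beta>)"
proof -
 let ?G = "{\<gamma>::'d => nat. real (sum \<gamma> UNIV) <= k}"
 define S where "S \<beta> = (SUP \<gamma>\<in>?G. (mderiv_Linf_norm (ball \<beta> \<rho>) \<gamma> f)\<^sup>2)" for \<beta>
 define t where "t \<beta> = ennreal (norm \<beta> powr (2 * s)) * S \<beta>" for \<beta>
 define M where "M \<beta> = sqrt (enn2real (S \<beta>))" for \<beta>
 have fint: "infsum t (dual_lattice - {0}) < \<infinity>" using fin by (simp add: t_def[abs_def] S_def)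
 have sum_le: "sum t F <= infsum t (dual_lattice - {0})" if "finite F" "F \<subseteq> dual_lattice - {0}" for F
  using that by (subst nonneg_infsum_complete) (auto intro: SUP_upper)
 have Sfin: "S \<beta> < \<infinity>" if b: "\<beta> \<in> dual_lattice - {0}" for \<beta>
 proof -
  have "t \<beta> < \<infinity>" using sum_le[of "{\<beta>}"] b fint by (auto simp: less_top[symmetric] top_unique)
  moreover have "ennreal (norm \<beta> powr (2 * s)) \<noteq> 0" using b by (simp add: ennreal_eq_0_iff)
  ultimately show ?thesis unfolding t_def by (auto simp: ennreal_mult_less_top)
 qed
 have M0: "M \<beta> \<ge> 0" for \<beta> by (simp add: M_def)
 have M2: "ennreal ((M \<beta>)\<^sup>2) = S \<beta>" if "\<beta> \<in> dual_lattice - {0}" for \<beta>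
  using Sfin[OF that] by (simp add: M_def)
 show ?thesis
 proof (rule that[of M "sqrt (enn2real (infsum t (dual_lattice - {0})))"])
  fix F :: "(real^'d) set" assume F: "finite F" "F \<subseteq> dual_lattice - {0}"
  have "ennreal (\<Sum>\<beta>\<in>F. (norm \<beta> powr s * M \<beta>)\<^sup>2) = (\<Sum>\<beta>\<in>F. ennreal ((norm \<beta> powr s * M \<beta>)\<^sup>2))"
   by (rule sum_ennreal[symmetric]) simp
  also have "... = sum t F"
  proof (rule sum.cong[OF refl])
   fix \<beta> assume "\<beta> \<in> F"
   then have "\<beta> \<in> dual_lattice - {0}" using F by auto
   then show "ennreal ((norm \<beta> powr s * M \<beta>)\<^sup>2) = t \<beta>"
    unfolding t_def M2[OF \<open>\<beta> \<in> dual_lattice - {0}\<close>, symmetric] power_mult_distrib powr_double_exponent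
    by (simp add: ennreal_mult)
  qed
  also have "... <= infsum t (dual_lattice - {0})" by (rule sum_le[OF F])
  also have "... = ennreal (enn2real (infsum t (dual_lattice - {0})))" using fint by simp
  finally show "L2_set (\<lambda>\<beta>. norm \<beta> powr s * M \<beta>) F <= sqrt (enn2real (infsum t (dual_lattice - {0})))"
   unfolding L2_set_def by (intro real_sqrt_le_mono) (simp add: ennreal_le_iff)
 next
  fix \<beta> :: "real^'d" and \<gamma> :: "'d => nat" assume b: "\<beta> \<in> dual_lattice - {0}" and g: "real (sum \<gamma> UNIV) <= k"
  let ?N = "mderiv_Linf_norm (ball \<beta> \<rho>) \<gamma> f"
  have N2: "?N\<^sup>2 <= ennreal ((M \<beta>)\<^sup>2)"
   unfolding M2[OF b] S_def by (rule SUP_upper) (use g in simp)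
  then have Nfin: "?N \<noteq> \<infinity>" by (auto simp: top_unique power2_eq_square)
  have NM: "?N <= ennreal (M \<beta>)"
  proof (cases ?N)
   case (real n)
   then have "n\<^sup>2 <= (M \<beta>)\<^sup>2" using N2 by (simp add: ennreal_power ennreal_le_iff)
   then have "n <= M \<beta>" using M0 by (rule power2_le_imp_le)
   then show ?thesis unfolding real(2) by (rule ennreal_leI)
  qed (use Nfin in auto)
  have ex: "\<exists>g. has_weak_mderiv (ball \<beta> \<rho>) \<gamma> f g"
   using Nfin by (auto simp: mderiv_Linf_norm_def split: if_splits)
  define h where "h = (SOME g. has_weak_mderiv (ball \<beta> \<rho>) \<gamma> f g)"
  have h: "has_weak_mderiv (ball \<beta> \<rho>) \<gamma> f h" unfolding h_def by (rule someI_ex[OF ex])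
  have "AE x in lebesgue_on (ball \<beta> \<rho>). ennreal (norm (h x)) <= esssup (lebesgue_on (ball \<beta> \<rho>)) (\<lambda>x. ennreal (norm (h x)))"
   by (rule esssup_AE)
  moreover have "esssup (lebesgue_on (ball \<beta> \<rho>)) (\<lambda>x. ennreal (norm (h x))) = ?N"
   using ex by (simp add: mderiv_Linf_norm_def h_def)
  ultimately have "AE x in lebesgue_on (ball \<beta> \<rho>). ennreal (norm (h x)) <= ?N" by (simp only:)
  then have "AE x in lebesgue. x \<in> ball \<beta> \<rho> --> ennreal (norm (h x)) <= ?N"
   by (simp add: AE_restrict_space_iff)
  then have "AE x in lebesgue. x \<in> ball \<beta> \<rho> --> norm (h x) <= M \<beta>"
   by eventually_elim (use NM M0 in \<open>auto dest: order_trans simp: ennreal_le_iff\<close>)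
  then show "\<exists>g. has_weak_mderiv (ball \<beta> \<rho>) \<gamma> f g \<and> (AE x in lebesgue. x \<in> ball \<beta> \<rho> --> norm (g x) <= M \<beta>)"
   using h by blast
 qed (auto simp: M0)
qed

text \<open>The weak derivative of order \<open>0\<close> is the function itself.\<close>

lemma AE_le_of_weak_deriv_0:
 fixes f g :: "real^'d::finite => complex"
 assumes w: "has_weak_mderiv U (\<lambda>_. 0) f g" and M: "AE x in lebesgue. x \<in> U --> norm (g x) <= M" and U: "open U"
 shows "AE x in lebesgue. x \<in> U --> norm (f x) <= M"
proof (rule AE_norm_le_from_bumps[OF U])
 show "set_integrable lebesgue K f" if "compact K" "K \<subseteq> U" for K using w that by (auto simp: has_weak_mderiv_def)
 show "set_integrable lebesgue K (\<lambda>x. M)" if "compact K" for K :: "(real^'d) set"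
 proof -
  have "integrable lebesgue (indicat_real K)"
   using lmeasurable_compact[OF that] by (intro integrable_real_indicator) (auto simp: fmeasurable_def)
  then show ?thesis unfolding set_integrable_def by (rule integrable_scaleR_left)
 qed
 fix m and l r :: "real^'d" assume lr: "cbox l r \<subseteq> U"
 have "norm (\<integral>x. f x * tensor (\<lambda>i. bump1 m (l $ i) (r $ i)) (\<lambda>_. 0) x \<partial>lebesgue) \<le>
   (\<Prod>i\<in>(UNIV::'d set). fact 0) * M * (\<integral>x. \<bar>\<Prod>i\<in>UNIV. bump1 m (l $ i) (r $ i) 0 (x $ i)\<bar> \<partial>lebesgue)"
  by (rule weak_deriv_tensor_bound[OF w M _ _ lr]) (auto simp: derivs_bump1 bump1_outside)
 then show "norm (\<integral>x. f x * of_real (bump m l r x) \<partial>lebesgue) <= (\<integral>x. M * bump m l r x \<partial>lebesgue)"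
  using bump_bounds(1)[of m l r] unfolding bump_eq_tensor[symmetric] bump_def[symmetric] by (simp only: fact_0 prod.neutral_const mult_1_left abs_of_nonneg integral_mult_right_zero)
qed

text \<open>The Taylor estimate, transported from the origin to the point \<open>\<beta>\<close>.\<close>

lemma AE_le_power_of_weak_derivs_at:
 fixes f :: "real^'d::finite => complex" and M :: real
 assumes rho: "\<rho> > 0" and n: "n > 0" and M: "M \<ge> 0" and f: "f \<in> lmeas"
  and w: "\<And>\<gamma>. sum \<gamma> UNIV <= n ==> \<exists>g. has_weak_mderiv (ball \<beta> \<rho>) \<gamma> f g \<and> (AE x in lebesgue. x \<in> ball \<beta> \<rho> --> norm (g x) <= M)"
  and van: "mean_vanish (n - 1) (\<lambda>x. f (\<beta> + x))"
 shows "AE x in lebesgue. x \<in> ball 0 \<rho> --> norm (f (\<beta> + x)) <= real CARD('d) ^ n * (fact n * M) * norm x ^ n"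
proof (rule AE_norm_le_power_if_weak_derivs[OF rho n _ _ _ van])
 show "0 <= fact n * M" using M by simp
 show "set_integrable lebesgue K (\<lambda>x. f (\<beta> + x))" if K: "compact K" "K \<subseteq> ball 0 \<rho>" for K
 proof -
  obtain g where "has_weak_mderiv (ball \<beta> \<rho>) (\<lambda>_. 0) f g" using w[of "\<lambda>_. 0"] by auto
  moreover have "compact ((+) \<beta> ` K)" using K(1) by (rule compact_translation)
  moreover have "(+) \<beta> ` K \<subseteq> ball \<beta> \<rho>" using K(2) by (auto simp: dist_norm)
  ultimately have "integrable lebesgue (\<lambda>x. indicator ((+) \<beta> ` K) x *\<^sub>R f x)"
   by (auto simp: has_weak_mderiv_def set_integrable_def)
  from integrable_affine[OF _ this, of 1 \<beta>]
  have "integrable lebesgue (\<lambda>x. indicator ((+) \<beta> ` K) (\<beta> + x) *\<^sub>R f (\<beta> + x))" by simp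
  moreover have "indicator ((+) \<beta> ` K) (\<beta> + x) = (indicator K x :: real)" for x by (auto simp: indicator_def)
  ultimately show ?thesis by (simp add: set_integrable_def)
 qed
 fix \<gamma> :: "'d => nat" and b and l r :: "real^'d"
 assume g: "sum \<gamma> UNIV = n" and b: "\<forall>i. derivs (b i)" and supp: "\<And>i n t. t \<notin> {l$i..r$i} ==> b i n t = 0"
  and lr: "cbox l r \<subseteq> ball 0 \<rho>"
 obtain h where h: "has_weak_mderiv (ball \<beta> \<rho>) \<gamma> f h" "AE x in lebesgue. x \<in> ball \<beta> \<rho> --> norm (h x) <= M"
  using w[of \<gamma>] g by auto
 define c where "c i n t = 1 ^ n * b i n (1 * t + (- \<beta> $ i))" for i n t
 have c: "\<forall>i. derivs (c i)" unfolding c_def by (intro allI derivs_affine) (use b in blast)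
 have suppc: "c i n t = 0" if "t \<notin> {(\<beta> + l)$i..(\<beta> + r)$i}" for i n t
  using that unfolding c_def by (subst supp) auto
 have sub: "cbox (\<beta> + l) (\<beta> + r) \<subseteq> ball \<beta> \<rho>"
 proof
  fix x assume "x \<in> cbox (\<beta> + l) (\<beta> + r)"
  then have "x - \<beta> \<in> cbox l r" by (auto simp: mem_box_cart algebra_simps)
  then show "x \<in> ball \<beta> \<rho>" using lr by (auto simp: dist_norm norm_minus_commute)
 qed
 have tc: "tensor c \<gamma>' (\<beta> + x) = tensor b \<gamma>' x" for \<gamma>' x by (simp add: tensor_def c_def)
 have mt: "(\<lambda>x. \<bar>\<Prod>i\<in>UNIV. c i 0 (x $ i)\<bar>) \<in> lmeas"
 proof -
  have "continuous_on UNIV (\<lambda>x::real^'d. \<bar>Re (tensor c (\<lambda>_. 0) x)\<bar>)"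
   by (intro continuous_intros continuous_on_tensor c)
  then have "(\<lambda>x::real^'d. \<bar>Re (tensor c (\<lambda>_. 0) x)\<bar>) \<in> lmeas"
   by (intro measurable_completion) (simp add: borel_measurable_continuous_onI)
  then show ?thesis by (simp add: tensor_def del: of_real_prod)
 qed
 have mtc: "tensor c \<gamma> \<in> lmeas"
  by (intro measurable_completion) (simp add: borel_measurable_continuous_onI continuous_on_tensor[OF c])
 have "(\<integral>x. f (\<beta> + x) * tensor b \<gamma> x \<partial>lebesgue) = (\<integral>x. f x * tensor c \<gamma> x \<partial>lebesgue)"
  using integral_affine[OF _ borel_measurable_times[OF f mtc], of 1 \<beta>] by (simp add: tc)
 then have "norm (\<integral>x. f (\<beta> + x) * tensor b \<gamma> x \<partial>lebesgue) <= (\<Prod>i\<in>UNIV. fact (\<gamma> i)) * M * (\<integral>x. \<bar>\<Prod>i\<in>UNIV. c i 0 (x $ i)\<bar> \<partial>lebesgue)"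
  using weak_deriv_tensor_bound[OF h c suppc sub] by simp
 also have "(\<integral>x. \<bar>\<Prod>i\<in>UNIV. c i 0 (x $ i)\<bar> \<partial>lebesgue) = (\<integral>x. \<bar>\<Prod>i\<in>UNIV. b i 0 (x $ i)\<bar> \<partial>lebesgue)"
  using integral_affine[OF _ mt, of 1 \<beta>] by (simp add: c_def)
 also have "(\<Prod>i\<in>UNIV. fact (\<gamma> i)) * M * (\<integral>x. \<bar>\<Prod>i\<in>UNIV. b i 0 (x $ i)\<bar> \<partial>lebesgue) <= fact n * M * (\<integral>x. \<bar>\<Prod>i\<in>UNIV. b i 0 (x $ i)\<bar> \<partial>lebesgue)"
  using prod_fact_le[of UNIV \<gamma>] M unfolding g by (intro mult_right_mono) auto
 finally show "norm (\<integral>x. f (\<beta> + x) * tensor b \<gamma> x \<partial>lebesgue) <= fact n * M * (\<integral>x. \<bar>\<Prod>i\<in>UNIV. b i 0 (x $ i)\<bar> \<partial>lebesgue)" .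
qed

section \<open>Vanishing in the mean along the recursion\<close>

lemma ball_measurable_lebesgue: "ball x r \<in> sets (lebesgue :: 'a::euclidean_space measure)"
 by simp

text \<open>Substituting \<open>x/2\<close> for \<open>x\<close> in the integral over a small ball changes it only by the factor \<open>2\<^sup>d\<close>.\<close>

lemma mean_vanish_of_recursion:
 fixes F G :: "real^'d::finite => complex" and e :: "real^'d => real"
 assumes F: "F \<in> lmeas" and G: "G \<in> lmeas" and e: "e \<in> lmeas"
  and C: "C \<ge> 0" and rho: "\<rho> > 0"
  and rec: "AE x in lebesgue. norm x < \<rho> --> norm (F (2 *\<^sub>R x)) <= norm (G x) + C * e x"
  and vG: "mean_vanish m G" and ve: "mean_vanish m (\<lambda>x. of_real (e x))" and e0: "\<And>x. e x \<ge> 0"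
 shows "mean_vanish m F"
 unfolding mean_vanish_def
proof (intro allI impI)
 fix \<epsilon> :: real assume eps: "\<epsilon> > 0"
 define p where "p = CARD('d) + m"
 define \<delta> where "\<delta> = \<epsilon> / (2 ^ CARD('d) * (1 + C))"
 have d: "\<delta> > 0" using eps C by (simp add: \<delta>_def)
 obtain u1 where u1: "u1 > 0" "\<And>u. 0 < u ==> u < u1 ==> (\<integral>\<^sup>+x\<in>ball 0 u. ennreal (norm (G x)) \<partial>lebesgue) <= ennreal (\<delta> * u ^ p)"
  using vG[unfolded mean_vanish_def, rule_format, OF d] unfolding p_def by blast
 obtain u2 where u2: "u2 > 0" "\<And>u. 0 < u ==> u < u2 ==> (\<integral>\<^sup>+x\<in>ball 0 u. ennreal (e x) \<partial>lebesgue) <= ennreal (\<delta> * u ^ p)"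
  using ve[unfolded mean_vanish_def, rule_format, OF d] e0 unfolding p_def by auto
 show "\<exists>u0>0. \<forall>u. 0 < u --> u < u0 --> (\<integral>\<^sup>+x\<in>ball 0 u. ennreal (norm (F x)) \<partial>lebesgue) <= ennreal (\<epsilon> * u ^ (CARD('d) + m))"
 proof (intro exI[of _ "min \<rho> (min u1 u2)"] conjI allI impI)
  fix u assume u: "0 < u" "u < min \<rho> (min u1 u2)"
  have mi: "(\<lambda>x. g x * indicator (ball 0 r) x) \<in> lmeas" if "g \<in> lmeas" for g :: "real^'d => ennreal" and r
   by (rule borel_measurable_times_ennreal[OF that borel_measurable_indicator]) simp
  have mn: "(\<lambda>x. ennreal (norm (h x))) \<in> lmeas" if "h \<in> lmeas" for h :: "real^'d => complex"
   by (rule measurable_compose[OF measurable_compose[OF that borel_measurable_norm] measurable_ennreal])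
  have me: "(\<lambda>x. ennreal (e x)) \<in> lmeas" by (rule measurable_compose[OF e measurable_ennreal])
  have "(\<integral>\<^sup>+x\<in>ball 0 u. ennreal (norm (F x)) \<partial>lebesgue)
   = ennreal (2 ^ CARD('d)) * (\<integral>\<^sup>+x. ennreal (norm (F (2 *\<^sub>R x))) * indicator (ball 0 u) (2 *\<^sub>R x) \<partial>lebesgue)"
   using nn_integral_affine[OF _ mi[OF mn[OF F], of u], of 2 0] by simp
  also have "(\<integral>\<^sup>+x. ennreal (norm (F (2 *\<^sub>R x))) * indicator (ball 0 u) (2 *\<^sub>R x) \<partial>lebesgue)
   <= (\<integral>\<^sup>+x. ennreal (norm (G x)) * indicator (ball 0 (u/2)) x + ennreal C * (ennreal (e x) * indicator (ball 0 (u/2)) x) \<partial>lebesgue)"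
  proof (rule nn_integral_mono_AE)
   show "AE x in lebesgue. ennreal (norm (F (2 *\<^sub>R x))) * indicator (ball 0 u) (2 *\<^sub>R x) \<le>
    ennreal (norm (G x)) * indicator (ball 0 (u/2)) x + ennreal C * (ennreal (e x) * indicator (ball 0 (u/2)) x)"
    using rec
   proof eventually_elim
    case (elim x)
    show ?case
    proof (cases "x \<in> ball 0 (u/2)")
     case True
     then have "norm x < \<rho>" using u by simp
     then have "ennreal (norm (F (2 *\<^sub>R x))) <= ennreal (norm (G x) + C * e x)" using elim by (intro ennreal_leI) simp
     also have "... = ennreal (norm (G x)) + ennreal C * ennreal (e x)"
      using C e0 by (simp add: ennreal_plus ennreal_mult)
     finally show ?thesis using True by simp
    next
     case False
     then have "2 *\<^sub>R x \<notin> ball 0 u" by simp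
     then show ?thesis by simp
    qed
   qed
  qed
  also have "... = (\<integral>\<^sup>+x\<in>ball 0 (u/2). ennreal (norm (G x)) \<partial>lebesgue) + ennreal C * (\<integral>\<^sup>+x\<in>ball 0 (u/2). ennreal (e x) \<partial>lebesgue)"
   using mi[OF mn[OF G], of "u/2"] mi[OF me, of "u/2"] by (simp add: nn_integral_add nn_integral_cmult)
  also have "... <= ennreal (\<delta> * (u/2) ^ p) + ennreal C * ennreal (\<delta> * (u/2) ^ p)"
   using u by (intro add_mono mult_left_mono u1 u2) auto
  also have "... = ennreal ((1 + C) * (\<delta> * (u/2) ^ p))"
   using C d u by (simp add: ennreal_mult[symmetric] ennreal_plus[symmetric] distrib_right del: ennreal_plus)
  also have "ennreal (2 ^ CARD('d)) * ... = ennreal (2 ^ CARD('d) * ((1 + C) * (\<delta> * (u/2) ^ p)))"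
   using C d u by (intro ennreal_mult[symmetric]) auto
  also have "... <= ennreal (\<epsilon> * u ^ p)"
  proof (rule ennreal_leI)
   have "2 ^ CARD('d) * ((1 + C) * (\<delta> * (u/2) ^ p)) = \<epsilon> * (u/2) ^ p" using C by (simp add: \<delta>_def)
   also have "... <= \<epsilon> * u ^ p" using u eps by (intro mult_left_mono power_mono) auto
   finally show "2 ^ CARD('d) * ((1 + C) * (\<delta> * (u/2) ^ p)) <= \<epsilon> * u ^ p" .
  qed
  finally show "(\<integral>\<^sup>+x\<in>ball 0 u. ennreal (norm (F x)) \<partial>lebesgue) <= ennreal (\<epsilon> * u ^ (CARD('d) + m))"
   by (simp add: p_def mult_left_mono)
 qed (use rho u1 u2 in auto)
qed

lemma emeasure_ball_lebesgue:
 "r \<ge> 0 ==> emeasure lebesgue (ball (c::real^'d::finite) r) = ennreal (unit_ball_vol (real CARD('d)) * r ^ CARD('d))"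
 using emeasure_ball[of r c] by simp

text \<open>The error term \<open>|x|\<^sup>n g(x)\<close> vanishes in the mean to order more than \<open>n - 1\<close> in two situations: if
 \<open>g\<close> has a singularity weaker than \<open>1/|x|\<close>, and, in dimension at most two, if \<open>g\<close> is square integrable.\<close>

lemma mean_vanish_singular:
 fixes g :: "real^'d::finite => real"
 assumes g: "AE x in lebesgue. norm x < \<rho> --> g x <= C * norm x powr s" and rho: "\<rho> > 0" and C: "C \<ge> 0"
  and s: "s > -1" and n: "n > 0" and g0: "\<And>x. g x \<ge> 0"
 shows "mean_vanish (n - 1) (\<lambda>x. of_real (norm x powr n * g x))"
 unfolding mean_vanish_def
proof (intro allI impI)
 fix \<epsilon> :: real assume eps: "\<epsilon> > 0"
 let ?V = "unit_ball_vol (real CARD('d))"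
 have V: "?V \<ge> 0" by simp
 define u0 where "u0 = min \<rho> ((\<epsilon> / (C * ?V + 1)) powr (1 / (1 + s)))"
 have CV: "C * ?V + 1 > 0" using C V by (simp add: add_nonneg_pos)
 show "\<exists>u0>0. \<forall>u. 0 < u --> u < u0 --> (\<integral>\<^sup>+x\<in>ball 0 u. ennreal (norm (complex_of_real (norm x powr n * g x))) \<partial>lebesgue) <= ennreal (\<epsilon> * u ^ (CARD('d) + (n - 1)))"
 proof (intro exI[of _ u0] conjI allI impI)
  show "u0 > 0" using rho eps CV by (simp add: u0_def)
  fix u assume u: "0 < u" "u < u0"
  have "(\<integral>\<^sup>+x\<in>ball 0 u. ennreal (norm (complex_of_real (norm x powr n * g x))) \<partial>lebesgue) <= (\<integral>\<^sup>+(x::real^'d). ennreal (C * u powr (n + s)) * indicator (ball 0 u) x \<partial>lebesgue)"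
  proof (rule nn_integral_mono_AE)
   show "AE x in lebesgue. ennreal (norm (complex_of_real (norm x powr n * g x))) * indicator (ball 0 u) x <= ennreal (C * u powr (n + s)) * indicator (ball (0::real^'d) u) x"
    using g
   proof eventually_elim
    case (elim x)
    have "norm x powr n * g x <= C * u powr (n + s)" if x: "norm x < u"
    proof -
     have "norm x powr n * g x <= norm x powr n * (C * norm x powr s)"
      using elim x u by (intro mult_left_mono) (auto simp: u0_def)
     also have "... = C * norm x powr (n + s)" by (simp add: powr_add)
     also have "... <= C * u powr (n + s)" using C x s n by (intro mult_left_mono powr_mono2) auto
     finally show ?thesis .
    qed
    then show ?case using g0[of x] by (auto simp: indicator_def norm_mult intro: ennreal_leI)
   qed
  qed
  also have "... = ennreal (C * u powr (n + s)) * ennreal (?V * u ^ CARD('d))"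
   by (simp only: nn_integral_cmult_indicator[OF ball_measurable_lebesgue] emeasure_ball_lebesgue[OF less_imp_le[OF u(1)]])
  also have "... = ennreal (C * u powr (n + s) * (?V * u ^ CARD('d)))"
   using C u by (intro ennreal_mult[symmetric]) auto
  also have "... <= ennreal (\<epsilon> * u ^ (CARD('d) + (n - 1)))"
  proof (rule ennreal_leI)
   have "u powr (1 + s) <= \<epsilon> / (C * ?V + 1)"
   proof -
    have "u powr (1 + s) <= ((\<epsilon> / (C * ?V + 1)) powr (1 / (1 + s))) powr (1 + s)"
     using u s by (intro powr_mono2) (auto simp: u0_def)
    also have "... = \<epsilon> / (C * ?V + 1)" using s eps CV by (simp add: powr_powr)
    finally show ?thesis .
   qed
   then have "(C * ?V + 1) * u powr (1 + s) <= \<epsilon>" using CV by (simp add: field_simps)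
   then have "C * ?V * u powr (1 + s) + u powr (1 + s) <= \<epsilon>" by (simp add: distrib_right)
   then have "C * ?V * u powr (1 + s) <= \<epsilon>" using powr_ge_zero[of u "1 + s"] by linarith
   have e: "u powr (n + s) = u powr (1 + s) * u ^ (n - 1)"
   proof -
    have "real n + s = (1 + s) + real (n - 1)" using n by simp
    then show ?thesis by (simp only: powr_add powr_realpow[OF u(1)])
   qed
   from \<open>C * ?V * u powr (1 + s) <= \<epsilon>\<close>
   have "C * ?V * u powr (1 + s) * (u ^ (n - 1) * u ^ CARD('d)) <= \<epsilon> * (u ^ (n - 1) * u ^ CARD('d))"
    by (rule mult_right_mono) (use u in simp)
   moreover have "C * u powr (n + s) * (?V * u ^ CARD('d)) = C * ?V * u powr (1 + s) * (u ^ (n - 1) * u ^ CARD('d))"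
    unfolding e by (simp only: mult_ac)
   moreover have "\<epsilon> * u ^ (CARD('d) + (n - 1)) = \<epsilon> * (u ^ (n - 1) * u ^ CARD('d))"
    by (simp only: power_add mult.commute)
   ultimately show "C * u powr (n + s) * (?V * u ^ CARD('d)) <= \<epsilon> * u ^ (CARD('d) + (n - 1))" by (simp only:)
  qed
  finally show "(\<integral>\<^sup>+x\<in>ball 0 u. ennreal (norm (complex_of_real (norm x powr n * g x))) \<partial>lebesgue) <= ennreal (\<epsilon> * u ^ (CARD('d) + (n - 1)))" .
 qed
qed

text \<open>The measure with density \<open>w\<close> is finite on the unit ball and has no atom at the origin.\<close>

lemma nn_integral_small_balls:
 fixes w :: "real^'d::finite => ennreal"
 assumes w: "w \<in> lmeas" and fin: "(\<integral>\<^sup>+x\<in>ball 0 1. w x \<partial>lebesgue) < \<infinity>" and e: "e > 0"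
 shows "\<exists>u0>0. u0 <= 1 \<and> (\<forall>u<u0. (\<integral>\<^sup>+x\<in>ball 0 u. w x \<partial>lebesgue) <= ennreal e)"
proof -
 let ?M = "density lebesgue w"
 let ?A = "\<lambda>m. ball (0::real^'d) (inverse (real (Suc m)))"
 have eM: "emeasure ?M (ball 0 r) = (\<integral>\<^sup>+x\<in>ball 0 r. w x \<partial>lebesgue)" for r
  using w by (subst emeasure_density) auto
 have "(\<lambda>m. emeasure ?M (?A m)) \<longlonglongrightarrow> emeasure ?M (\<Inter>m. ?A m)"
 proof (rule Lim_emeasure_decseq)
  show "range ?A \<subseteq> sets ?M" by auto
  show "decseq ?A" by (intro decseq_SucI subset_ball le_imp_inverse_le) auto
  fix m
  have "emeasure ?M (?A m) <= emeasure ?M (ball 0 1)"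
   by (intro emeasure_mono subset_ball) (auto simp: inverse_le_1_iff)
  also have "... < \<infinity>" using fin by (simp add: eM)
  finally show "emeasure ?M (?A m) \<noteq> \<infinity>" by simp
 qed
 moreover have "(\<Inter>m. ?A m) = {0}"
 proof (intro equalityI subsetI)
  fix x assume x: "x \<in> (\<Inter>m. ?A m)"
  show "x \<in> {0}"
  proof (rule ccontr)
   assume "x \<notin> {0}"
   then have "norm x > 0" by simp
   then obtain m where "inverse (real (Suc m)) < norm x" using reals_Archimedean by blast
   moreover have "norm x < inverse (real (Suc m))" using x by auto
   ultimately show False by simp
  qed
 qed auto
 moreover have "emeasure ?M {0} = 0"
 proof -
  have "emeasure ?M {0} = (\<integral>\<^sup>+x\<in>{0}. w x \<partial>lebesgue)" using w by (subst emeasure_density) auto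
  also have "... = 0"
  proof (rule nn_integral_null_set)
   show "{0::real^'d} \<in> null_sets lebesgue" by (simp add: negligible_iff_null_sets[symmetric])
  qed
  finally show ?thesis .
 qed
 ultimately have "(\<lambda>m. emeasure ?M (?A m)) \<longlonglongrightarrow> 0" by simp
 then have "\<forall>\<^sub>F m in sequentially. emeasure ?M (?A m) < ennreal e"
  using e by (intro order_tendstoD) auto
 then obtain m where m: "emeasure ?M (?A m) < ennreal e" by (auto simp: eventually_sequentially)
 show ?thesis
 proof (intro exI[of _ "inverse (real (Suc m))"] conjI allI impI)
  fix u assume "u < inverse (real (Suc m))"
  then have "emeasure ?M (ball 0 u) <= emeasure ?M (?A m)" by (intro emeasure_mono subset_ball) auto
  then show "(\<integral>\<^sup>+x\<in>ball 0 u. w x \<partial>lebesgue) <= ennreal e" using m by (simp add: eM)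
 qed (auto simp: inverse_le_1_iff)
qed

lemma mean_vanish_square_integrable:
 fixes g :: "real^'d::finite => real"
 assumes g: "g \<in> lmeas" and g0: "\<And>x. g x \<ge> 0"
  and fin: "(\<integral>\<^sup>+x\<in>ball 0 1. ennreal ((g x)\<^sup>2) \<partial>lebesgue) < \<infinity>" and d: "CARD('d) <= 2" and n: "n > 0"
 shows "mean_vanish (n - 1) (\<lambda>x. of_real (norm x powr n * g x))"
 unfolding mean_vanish_def
proof (intro allI impI)
 fix \<epsilon> :: real assume eps: "\<epsilon> > 0"
 let ?V = "unit_ball_vol (real CARD('d))"
 have V: "?V > 0" by simp
 define \<delta> where "\<delta> = \<epsilon> / ?V"
 have dl: "\<delta> > 0" using eps V by (simp add: \<delta>_def)
 have mg2: "(\<lambda>x. ennreal ((g x)\<^sup>2)) \<in> lmeas"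
  by (rule measurable_compose[OF borel_measurable_power[OF g] measurable_ennreal])
 obtain u0 where u0: "u0 > 0" "u0 <= 1" "\<And>u. u < u0 ==> (\<integral>\<^sup>+x\<in>ball 0 u. ennreal ((g x)\<^sup>2) \<partial>lebesgue) <= ennreal (\<epsilon> * \<delta>)"
  using nn_integral_small_balls[OF mg2 fin, of "\<epsilon> * \<delta>"] eps dl by auto
 show "\<exists>u0>0. \<forall>u. 0 < u --> u < u0 --> (\<integral>\<^sup>+x\<in>ball 0 u. ennreal (norm (complex_of_real (norm x powr n * g x))) \<partial>lebesgue) <= ennreal (\<epsilon> * u ^ (CARD('d) + (n - 1)))"
 proof (intro exI[of _ u0] conjI allI impI u0(1))
  fix u assume u: "0 < u" "u < u0"
  \<comment> \<open>Young's inequality, with weights for which both terms have the right size when \<open>d <= 2\<close>\<close>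
  let ?a = "u ^ n * (u / (2 * \<delta>))" and ?c = "u ^ n * (\<delta> / (2 * u))"
  have "(\<integral>\<^sup>+x\<in>ball 0 u. ennreal (norm (complex_of_real (norm x powr n * g x))) \<partial>lebesgue)
   <= (\<integral>\<^sup>+x. ennreal ?a * (ennreal ((g x)\<^sup>2) * indicator (ball 0 u) x) + ennreal ?c * indicator (ball 0 u) x \<partial>lebesgue)"
  proof (rule nn_integral_mono)
   fix x :: "real^'d"
   show "ennreal (norm (complex_of_real (norm x powr n * g x))) * indicator (ball 0 u) x \<le>
    ennreal ?a * (ennreal ((g x)\<^sup>2) * indicator (ball 0 u) x) + ennreal ?c * indicator (ball 0 u) x"
   proof (cases "x \<in> ball 0 u")
    case True
    have "norm x powr n = norm x ^ n" using n by (cases "x = 0") (auto simp: powr_realpow)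
    also have "... <= u ^ n" using True by (intro power_mono) auto
    finally have "norm x powr n * g x <= u ^ n * g x" by (intro mult_right_mono g0)
    also have "g x <= u / (2 * \<delta>) * (g x)\<^sup>2 + \<delta> / (2 * u)"
    proof -
     have "0 <= (u * g x - \<delta>)\<^sup>2" by simp
     then have "2 * u * \<delta> * g x <= u\<^sup>2 * (g x)\<^sup>2 + \<delta>\<^sup>2" by (simp add: power2_eq_square algebra_simps)
     then have "2 * u * \<delta> * g x / (2 * u * \<delta>) <= (u\<^sup>2 * (g x)\<^sup>2 + \<delta>\<^sup>2) / (2 * u * \<delta>)" using u dl by (intro divide_right_mono) auto
     then show ?thesis using u dl by (simp add: add_divide_distrib power2_eq_square)
    qed
    finally have "norm x powr n * g x <= ?a * (g x)\<^sup>2 + ?c" using u by (simp add: distrib_left mult.assoc)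
    then have "ennreal (norm x powr n * g x) <= ennreal (?a * (g x)\<^sup>2 + ?c)" by (rule ennreal_leI)
    also have "... = ennreal ?a * ennreal ((g x)\<^sup>2) + ennreal ?c"
    proof -
     have a0: "0 <= ?a" and c0: "0 <= ?c" using u dl by auto
     show ?thesis
      unfolding ennreal_plus[OF mult_nonneg_nonneg[OF a0 zero_le_power2] c0] ennreal_mult[OF a0 zero_le_power2] ..
    qed
    finally show ?thesis using True g0[of x] by (simp add: norm_mult)
   qed simp
  qed
  also have "... = ennreal ?a * (\<integral>\<^sup>+x\<in>ball 0 u. ennreal ((g x)\<^sup>2) \<partial>lebesgue) + ennreal ?c * emeasure lebesgue (ball (0::real^'d) u)"
  proof -
   have m1: "(\<lambda>x. ennreal ((g x)\<^sup>2) * indicator (ball 0 u) x) \<in> lmeas"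
    by (rule borel_measurable_times_ennreal[OF mg2 borel_measurable_indicator]) simp
   then have "(\<integral>\<^sup>+x. ennreal ?a * (ennreal ((g x)\<^sup>2) * indicator (ball 0 u) x) + ennreal ?c * indicator (ball 0 u) x \<partial>lebesgue)
    = (\<integral>\<^sup>+x. ennreal ?a * (ennreal ((g x)\<^sup>2) * indicator (ball 0 u) x) \<partial>lebesgue) + (\<integral>\<^sup>+x. ennreal ?c * indicator (ball (0::real^'d) u) x \<partial>lebesgue)"
    by (intro nn_integral_add)
     (rule borel_measurable_times_ennreal[OF borel_measurable_const m1],
      rule borel_measurable_times_ennreal[OF borel_measurable_const borel_measurable_indicator[OF ball_measurable_lebesgue]])
   then show ?thesis using m1 by (simp only: nn_integral_cmult nn_integral_cmult_indicator[OF ball_measurable_lebesgue])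
  qed
  also have "... <= ennreal ?a * ennreal (\<epsilon> * \<delta>) + ennreal ?c * ennreal (?V * u ^ CARD('d))"
   using u by (intro add_mono mult_left_mono u0(3) eq_refl[OF emeasure_ball_lebesgue]) auto
  also have "... = ennreal (?a * (\<epsilon> * \<delta>) + ?c * (?V * u ^ CARD('d)))"
   using u dl eps V by (subst ennreal_plus) (auto simp: ennreal_mult[symmetric] less_imp_le)
  also have "... <= ennreal (\<epsilon> * u ^ (CARD('d) + (n - 1)))"
  proof (rule ennreal_leI)
   obtain j where j: "n = Suc j" using n by (cases n) auto
   have "?a * (\<epsilon> * \<delta>) = \<epsilon> / 2 * (u ^ 2 * u ^ j)" using dl by (simp add: j power2_eq_square)
   also have "u ^ 2 <= u ^ CARD('d)" using u u0 d by (intro power_decreasing) auto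
   finally have "?a * (\<epsilon> * \<delta>) <= \<epsilon> / 2 * (u ^ CARD('d) * u ^ j)" using eps u by (simp add: mult_left_mono mult_right_mono)
   moreover have "?c * (?V * u ^ CARD('d)) = \<epsilon> / 2 * (u ^ CARD('d) * u ^ j)"
   proof -
    have "\<delta> * ?V = \<epsilon>" unfolding \<delta>_def using less_imp_neq[OF V] by simp
    moreover have "?c * (?V * u ^ CARD('d)) = (\<delta> * ?V) / 2 * (u ^ CARD('d) * u ^ j)" using u by (simp add: j)
    ultimately show ?thesis by (simp only:)
   qed
   ultimately have "?a * (\<epsilon> * \<delta>) + ?c * (?V * u ^ CARD('d)) <= \<epsilon> / 2 * (u ^ CARD('d) * u ^ j) + \<epsilon> / 2 * (u ^ CARD('d) * u ^ j)"
    by linarith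
   also have "... = \<epsilon> * u ^ (CARD('d) + (n - 1))" by (simp add: j power_add)
   finally show "?a * (\<epsilon> * \<delta>) + ?c * (?V * u ^ CARD('d)) <= \<epsilon> * u ^ (CARD('d) + (n - 1))" .
  qed
  finally show "(\<integral>\<^sup>+x\<in>ball 0 u. ennreal (norm (complex_of_real (norm x powr n * g x))) \<partial>lebesgue) <= ennreal (\<epsilon> * u ^ (CARD('d) + (n - 1)))" .
 qed
qed

section \<open>The zero of the shifted symbol sums\<close>

text \<open>Nonzero points of the lattice have norm at least \<open>2\<pi>\<close>, so a perturbation of norm at most \<open>1\<close> changes
 their norm by a factor of at most \<open>2\<close>.\<close>

lemma lattice_point_comparable:
 assumes "\<beta> \<in> dual_lattice - {0}" "norm \<omega> <= 1"
 shows "norm (\<omega> + \<beta>) powr s <= 2 powr \<bar>s\<bar> * norm \<beta> powr s"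
proof -
 have b: "norm \<beta> \<ge> 2 * pi" using norm_dual_lattice assms by auto
 then have b2: "norm \<beta> \<ge> 2" using pi_ge_two by linarith
 have up: "norm (\<omega> + \<beta>) <= 2 * norm \<beta>" using norm_triangle_ineq[of \<omega> \<beta>] assms b2 by linarith
 have lo: "norm (\<omega> + \<beta>) \<ge> norm \<beta> / 2"
  using norm_triangle_ineq4[of "\<omega> + \<beta>" \<omega>] assms b2 by simp
 show ?thesis
 proof (cases "s \<ge> 0")
  case True
  then have "norm (\<omega> + \<beta>) powr s <= (2 * norm \<beta>) powr s" using up by (intro powr_mono2) auto
  then show ?thesis using True by (simp add: powr_mult)
 next
  case False
  then have "norm (\<omega> + \<beta>) powr s <= (norm \<beta> / 2) powr s" using lo b2 by (intro powr_mono2') auto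
  also have "... = norm \<beta> powr s * 2 powr (- s)" using b2 by (simp add: powr_divide powr_minus_divide)
  finally show ?thesis using False by (simp add: mult.commute)
 qed
qed

lemma wnorm_le_comparable:
 assumes w: "norm \<omega> <= 1" and F: "finite F" "F \<subseteq> dual_lattice - {0}"
  and f: "\<And>\<beta>. \<beta> \<in> F ==> norm (f (\<omega> + \<beta>)) <= c * M \<beta>" and c: "c \<ge> 0" and M: "\<And>\<beta>. M \<beta> \<ge> 0"
 shows "wnorm s f F \<omega> <= 2 powr \<bar>s\<bar> * c * L2_set (\<lambda>\<beta>. norm \<beta> powr s * M \<beta>) F"
proof -
 have "wnorm s f F \<omega> <= L2_set (\<lambda>\<beta>. (2 powr \<bar>s\<bar> * c) * (norm \<beta> powr s * M \<beta>)) F"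
  unfolding wnorm_def
 proof (rule L2_set_mono)
  fix \<beta> assume b: "\<beta> \<in> F"
  have "norm (\<omega> + \<beta>) powr s * norm (f (\<omega> + \<beta>)) <= (2 powr \<bar>s\<bar> * norm \<beta> powr s) * (c * M \<beta>)"
   using b F w c M by (intro mult_mono lattice_point_comparable f) auto
  then show "norm (\<omega> + \<beta>) powr s * norm (f (\<omega> + \<beta>)) <= (2 powr \<bar>s\<bar> * c) * (norm \<beta> powr s * M \<beta>)"
   by (simp only: mult_ac)
 qed simp
 also have "... = 2 powr \<bar>s\<bar> * c * L2_set (\<lambda>\<beta>. norm \<beta> powr s * M \<beta>) F"
  using c by (intro L2_set_right_distrib[symmetric]) auto
 finally show ?thesis .
qed

context refinable
begin

text \<open>If \<open>s \<ge> 0\<close>, (A1) bounds the terms with \<open>\<alpha> \<noteq> 0\<close>, because \<open>|\<omega>|\<^sup>s\<close> is bounded; otherwise the bound for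
 \<open>G\<^sup>0\<close> does.\<close>

lemma symb_l2_descending:
 assumes Phi: "\<Phi> \<in> R" and sk: "s < k"
  and G0: "s \<ge> 0 \<or> (\<lambda>\<omega>. norm (gramian0 s B \<omega>)) \<in> O[ae_nhds 0](\<lambda>_. 1)"
 shows "\<exists>C \<rho>. C > 0 \<and> \<rho> > 0 \<and> (AE \<omega> in lebesgue. norm \<omega> < \<rho> -->
  (wnorm_le (dual_lattice - {0}) s (symb \<Phi>) \<omega> (C * norm \<omega> powr k)))"
proof -
 obtain C1 \<rho>1 where C1: "C1 > 0" "\<rho>1 > 0" and ae1: "AE \<omega> in lebesgue. norm \<omega> < \<rho>1 --> (\<forall>\<beta>\<in>dual_lattice. \<forall>l\<in>unit_vertices.
   norm (symb \<Phi> (2 *\<^sub>R (\<omega> + pi *\<^sub>R l + \<beta>)) - (if l = 0 then symb \<Phi> (\<omega> + \<beta>) else 0))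
    <= C1 * norm \<omega> powr k * norm (vhat \<Phi> (\<omega> + pi *\<^sub>R l + \<beta>)))"
  by (rule symbol_recursion[OF Phi])
 obtain C2 \<rho>2 where C2: "C2 > 0" "\<rho>2 > 0" and ae2:
  "AE \<omega> in lebesgue. norm \<omega> < \<rho>2 --> (\<forall>F l. finite F --> F \<subseteq> dual_lattice --> l \<in> unit_vertices - {0} -->
   wnorm s (vhat \<Phi>) F (\<omega> + pi *\<^sub>R l) <= C2)"
  and ae2': "AE \<omega> in lebesgue. norm \<omega> < \<rho>2 --> (wnorm_le dual_lattice s (vhat \<Phi>) \<omega> (C2 * norm \<omega> powr s))"
  by (rule vhat_bounds[OF Phi])
 have "\<exists>C3 \<rho>3. C3 > 0 \<and> \<rho>3 > 0 \<and> (AE \<omega> in lebesgue. norm \<omega> < \<rho>3 --> (wnorm_le (dual_lattice - {0}) s (vhat \<Phi>) \<omega> C3))"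
 proof (cases "s \<ge> 0")
  case True
  have "AE \<omega> in lebesgue. norm \<omega> < min \<rho>2 1 --> (wnorm_le (dual_lattice - {0}) s (vhat \<Phi>) \<omega> C2)"
   using ae2'
  proof eventually_elim
   case (elim \<omega>)
   show ?case
   proof (intro impI allI)
    fix F :: "(real^'d) set" assume w: "norm \<omega> < min \<rho>2 1" and F: "finite F" "F \<subseteq> dual_lattice - {0}"
    have "wnorm s (vhat \<Phi>) F \<omega> <= C2 * norm \<omega> powr s" using elim w F by auto
    also have "... <= C2 * 1" using w True C2 by (intro mult_left_mono) (auto simp: powr_le1)
    finally show "wnorm s (vhat \<Phi>) F \<omega> <= C2" by simp
   qed
  qed
  then show ?thesis using C2 by (intro exI[of _ C2] exI[of _ "min \<rho>2 1"]) auto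
 next
  case False
  then have "(\<lambda>\<omega>. norm (gramian0 s B \<omega>)) \<in> O[ae_nhds 0](\<lambda>_. 1)" using G0 by simp
  then obtain C4 \<rho>4 where C4: "C4 > 0" "\<rho>4 > 0" and ae4: "AE \<omega> in lebesgue. norm \<omega> < \<rho>4 --> norm (norm (gramian0 s B \<omega>)) <= C4 * norm (1::real)"
   by (rule bigo_ae_nhds_0D)
  obtain C0 where C0: "C0 \<ge> 0" and ae0: "AE \<omega> in lebesgue. \<forall>A F. A \<subseteq> dual_lattice --> finite F --> F \<subseteq> A -->
   wnorm s (vhat \<Phi>) F \<omega> <= C0 * sqrt (norm (gram_sum A s B \<omega>))"
   by (rule gram_bound[OF Phi])
  have "AE \<omega> in lebesgue. norm \<omega> < \<rho>4 --> (wnorm_le (dual_lattice - {0}) s (vhat \<Phi>) \<omega> (C0 * sqrt C4 + 1))"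
   using ae0 ae4
  proof eventually_elim
   case (elim \<omega>)
   show ?case
   proof (intro impI allI)
    fix F :: "(real^'d) set" assume w: "norm \<omega> < \<rho>4" and F: "finite F" "F \<subseteq> dual_lattice - {0}"
    have "wnorm s (vhat \<Phi>) F \<omega> <= C0 * sqrt (norm (gramian0 s B \<omega>))"
     using elim(1)[rule_format, of "dual_lattice - {0}" F] F unfolding gramian0_def by auto
    also have "... <= C0 * sqrt C4" using elim(2) w C0 by (intro mult_left_mono real_sqrt_le_mono) auto
    finally show "wnorm s (vhat \<Phi>) F \<omega> <= C0 * sqrt C4 + 1" by simp
   qed
  qed
  moreover have "C0 * sqrt C4 + 1 > 0" using C0 C4 by (simp add: add_nonneg_pos)
  ultimately show ?thesis using C4 by blast
 qed
 then obtain C3 \<rho>3 where C3: "C3 > 0" "\<rho>3 > 0" and ae3: "AE \<omega> in lebesgue. norm \<omega> < \<rho>3 -->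
   (wnorm_le (dual_lattice - {0}) s (vhat \<Phi>) \<omega> C3)" by blast
 define C where "C = max C1 (max C2 C3)"
 have C: "C \<ge> C1" "C \<ge> C2" "C \<ge> C3" "C > 0" using C1 by (auto simp: C_def)
 define \<rho> where "\<rho> = min \<rho>1 (min \<rho>2 \<rho>3)"
 have rho: "\<rho> > 0" using C1 C2 C3 by (simp add: \<rho>_def)
 define Q where "Q \<omega> \<longleftrightarrow> (\<forall>\<beta>\<in>dual_lattice. \<forall>l\<in>unit_vertices.
   norm (symb \<Phi> (2 *\<^sub>R (\<omega> + pi *\<^sub>R l + \<beta>)) - (if l = 0 then symb \<Phi> (\<omega> + \<beta>) else 0))
    <= C1 * norm \<omega> powr k * norm (vhat \<Phi> (\<omega> + pi *\<^sub>R l + \<beta>))) \<and>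
  (\<forall>F l. finite F --> F \<subseteq> dual_lattice --> l \<in> unit_vertices - {0} --> wnorm s (vhat \<Phi>) F (\<omega> + pi *\<^sub>R l) <= C2) \<and>
  (wnorm_le (dual_lattice - {0}) s (vhat \<Phi>) \<omega> C3)" for \<omega>
 have "AE \<omega> in lebesgue. norm \<omega> < \<rho> --> Q \<omega>"
  using ae1 ae2 ae3 by eventually_elim (simp add: Q_def \<rho>_def)
 from AE_dyadic_orbit[OF this]
 have orb: "AE \<omega> in lebesgue. norm \<omega> < \<rho> --> (\<forall>n. Q ((1/2)^n *\<^sub>R \<omega>))" .
 define K where "K = card (unit_vertices :: (real^'d) set) * C * C * 2 powr (s - k) / (1 - 2 powr (s - k))"
 have "AE \<omega> in lebesgue. norm \<omega> < \<rho> --> (wnorm_le (dual_lattice - {0}) s (symb \<Phi>) \<omega> (K * norm \<omega> powr k))"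
  using orb
 proof eventually_elim
  case (elim \<omega>)
  show ?case
  proof (intro impI allI)
   fix F :: "(real^'d) set" assume w: "norm \<omega> < \<rho>" and F: "finite F" "F \<subseteq> dual_lattice - {0}"
   have Q: "Q ((1/2)^Suc n *\<^sub>R \<omega>)" for n using elim w by blast
   show "wnorm s (symb \<Phi>) F \<omega> <= K * norm \<omega> powr k"
    unfolding K_def
   proof (rule wnorm_le_descending[OF sk _ _ _ F, where g = "vhat \<Phi>"])
    show "0 <= C" using C by simp
    fix n and l \<beta> :: "real^'d" assume l: "l \<in> unit_vertices" and b: "\<beta> \<in> dual_lattice"
    let ?y = "(1/2)^Suc n *\<^sub>R \<omega>"
    have "norm (symb \<Phi> (2 *\<^sub>R (?y + pi *\<^sub>R l + \<beta>)) - (if l = 0 then symb \<Phi> (?y + \<beta>) else 0))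
     <= C1 * norm ?y powr k * norm (vhat \<Phi> (?y + pi *\<^sub>R l + \<beta>))"
     using Q[of n] l b unfolding Q_def by blast
    also have "... <= C * norm ?y powr k * norm (vhat \<Phi> (?y + pi *\<^sub>R l + \<beta>))"
     using C by (intro mult_right_mono) auto
    finally show "norm (symb \<Phi> (2 *\<^sub>R (?y + pi *\<^sub>R l + \<beta>)) - (if l = 0 then symb \<Phi> (?y + \<beta>) else 0))
     <= C * norm ?y powr k * norm (vhat \<Phi> (?y + pi *\<^sub>R l + \<beta>))" .
   next
    fix n and l :: "real^'d" and A :: "(real^'d) set"
    assume l: "l \<in> unit_vertices" and A: "finite A" "A \<subseteq> dual_lattice" "l = 0 ==> 0 \<notin> A"
    show "wnorm s (vhat \<Phi>) A ((1/2)^Suc n *\<^sub>R \<omega> + pi *\<^sub>R l) <= C"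
    proof (cases "l = 0")
     case True
     then have "A \<subseteq> dual_lattice - {0}" using A by auto
     then have "wnorm s (vhat \<Phi>) A ((1/2)^Suc n *\<^sub>R \<omega>) <= C3" using Q[of n] A(1) unfolding Q_def by blast
     then show ?thesis using True C(3) by simp
    next
     case False
     then have "wnorm s (vhat \<Phi>) A ((1/2)^Suc n *\<^sub>R \<omega> + pi *\<^sub>R l) <= C2" using Q[of n] A l unfolding Q_def by blast
     then show ?thesis using C(2) by simp
    qed
   qed
  qed
 qed
 then have ae: "AE \<omega> in lebesgue. norm \<omega> < \<rho> --> (wnorm_le (dual_lattice - {0}) s (symb \<Phi>) \<omega> ((K + 1) * norm \<omega> powr k))"
 proof eventually_elim
  case (elim \<omega>)
  show ?case
  proof (intro impI allI)
   fix F :: "(real^'d) set" assume "norm \<omega> < \<rho>" "finite F" "F \<subseteq> dual_lattice - {0}"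
   then have "wnorm s (symb \<Phi>) F \<omega> <= K * norm \<omega> powr k" using elim by simp
   also have "... <= (K + 1) * norm \<omega> powr k" by (intro mult_right_mono) auto
   finally show "wnorm s (symb \<Phi>) F \<omega> <= (K + 1) * norm \<omega> powr k" .
  qed
 qed
 have "2 powr (s - k) < 1" using sk by (simp add: powr_less_one)
 then have "K \<ge> 0" unfolding K_def using C by (intro divide_nonneg_pos mult_nonneg_nonneg) auto
 then have "K + 1 > 0" by linarith
 then show ?thesis by (intro exI[of _ "K + 1"] exI[of _ \<rho>] conjI rho ae)
qed

text \<open>The starting values for the inward recursion are the \<open>L\<^sub>\<infinity>\<close> bounds on the symbol itself, which are the case
 \<open>\<gamma> = 0\<close> of (A3).\<close>

lemma symb_l2_ascending:
 assumes Phi: "\<Phi> \<in> R" and ks: "k <= s"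
  and A3: "\<rho>0 > 0" "(\<Sum>\<^sub>\<infinity>\<beta>\<in>dual_lattice - {0}. ennreal (norm \<beta> powr (2 * s)) *
      (SUP \<gamma>\<in>{\<gamma>. real (sum \<gamma> UNIV) <= k}. (mderiv_Linf_norm (ball \<beta> \<rho>0) \<gamma> (symb \<Phi>))\<^sup>2)) < \<infinity>"
 shows "\<exists>C \<rho>. C > 0 \<and> \<rho> > 0 \<and> (AE \<omega> in lebesgue. norm \<omega> < \<rho> -->
  (wnorm_le (dual_lattice - {0}) s (symb \<Phi>) \<omega> (C * norm \<omega> powr k)))"
proof -
 have s: "s \<ge> 0" using ks k_pos by simp
 obtain C1 \<rho>1 where C1: "C1 > 0" "\<rho>1 > 0" and ae1: "AE \<omega> in lebesgue. norm \<omega> < \<rho>1 --> (\<forall>\<beta>\<in>dual_lattice. \<forall>l\<in>unit_vertices.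
   norm (symb \<Phi> (2 *\<^sub>R (\<omega> + pi *\<^sub>R l + \<beta>)) - (if l = 0 then symb \<Phi> (\<omega> + \<beta>) else 0))
    <= C1 * norm \<omega> powr k * norm (vhat \<Phi> (\<omega> + pi *\<^sub>R l + \<beta>)))"
  by (rule symbol_recursion[OF Phi])
 obtain C2 \<rho>2 where C2: "C2 > 0" "\<rho>2 > 0"
  and ae2: "AE \<omega> in lebesgue. norm \<omega> < \<rho>2 --> (wnorm_le dual_lattice s (vhat \<Phi>) \<omega> (C2 * norm \<omega> powr s))"
  by (rule vhat_bounds[OF Phi])
 obtain M D where M: "\<And>\<beta>. M \<beta> \<ge> 0" and D: "D \<ge> 0"
  "\<And>F. finite F ==> F \<subseteq> dual_lattice - {0} ==> L2_set (\<lambda>\<beta>. norm \<beta> powr s * M \<beta>) F <= D"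
  and wd: "\<And>\<beta> \<gamma>. \<beta> \<in> dual_lattice - {0} ==> real (sum \<gamma> UNIV) <= k ==>
   \<exists>g. has_weak_mderiv (ball \<beta> \<rho>0) \<gamma> (symb \<Phi>) g \<and> (AE x in lebesgue. x \<in> ball \<beta> \<rho>0 --> norm (g x) <= M \<beta>)"
  by (rule weak_derivs_of_summable_norms[OF A3(2)]) blast
 have "AE x in lebesgue. norm x < \<rho>0 --> norm (symb \<Phi> (x + \<beta>)) <= M \<beta>" if b: "\<beta> \<in> dual_lattice - {0}" for \<beta>
 proof -
  obtain g where g: "has_weak_mderiv (ball \<beta> \<rho>0) (\<lambda>_. 0) (symb \<Phi>) g" "AE x in lebesgue. x \<in> ball \<beta> \<rho>0 --> norm (g x) <= M \<beta>"
   using wd[OF b, of "\<lambda>_. 0"] k_pos by auto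
  from AE_le_of_weak_deriv_0[OF g open_ball]
  have "AE x in lebesgue. (\<beta> + 1 *\<^sub>R x) \<in> ball \<beta> \<rho>0 --> norm (symb \<Phi> (\<beta> + 1 *\<^sub>R x)) <= M \<beta>"
   by (rule AE_affine[rotated]) simp
  then show ?thesis by (simp add: dist_norm add.commute)
 qed
 then have ae3: "AE x in lebesgue. \<forall>\<beta>\<in>dual_lattice - {0}. norm x < \<rho>0 --> norm (symb \<Phi> (x + \<beta>)) <= M \<beta>"
  by (subst AE_ball_countable) (auto intro: countable_subset[OF _ countable_dual_lattice])
 define C where "C = max C1 C2"
 have C: "C \<ge> C1" "C \<ge> C2" "C > 0" using C1 by (auto simp: C_def)
 define \<rho> where "\<rho> = min (min \<rho>1 \<rho>2) (min \<rho>0 1)"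
 have rho: "\<rho> > 0" "\<rho> <= 1" using C1 C2 A3(1) by (auto simp: \<rho>_def)
 define D' where "D' = 2 powr \<bar>s\<bar> * D"
 define Q where "Q \<omega> \<longleftrightarrow> (\<forall>\<beta>\<in>dual_lattice. \<forall>l\<in>unit_vertices.
   norm (symb \<Phi> (2 *\<^sub>R (\<omega> + pi *\<^sub>R l + \<beta>)) - (if l = 0 then symb \<Phi> (\<omega> + \<beta>) else 0))
    <= C1 * norm \<omega> powr k * norm (vhat \<Phi> (\<omega> + pi *\<^sub>R l + \<beta>))) \<and>
  (wnorm_le dual_lattice s (vhat \<Phi>) \<omega> (C2 * norm \<omega> powr s)) \<and>
  (wnorm_le (dual_lattice - {0}) s (symb \<Phi>) \<omega> D')" for \<omega>
 have Qae: "AE \<omega> in lebesgue. norm \<omega> < \<rho> --> Q \<omega>"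
  using ae1 ae2 ae3
 proof eventually_elim
  case (elim \<omega>)
  have "wnorm s (symb \<Phi>) F \<omega> <= D'" if F: "finite F" "F \<subseteq> dual_lattice - {0}" and w: "norm \<omega> < \<rho>" for F
  proof -
   have "wnorm s (symb \<Phi>) F \<omega> <= 2 powr \<bar>s\<bar> * 1 * L2_set (\<lambda>\<beta>. norm \<beta> powr s * M \<beta>) F"
    using elim(3) w rho F M by (intro wnorm_le_comparable) (auto simp: \<rho>_def)
   also have "... <= D'" unfolding D'_def using D(2)[OF F] by (simp add: mult_left_mono)
   finally show ?thesis .
  qed
  then show ?case using elim(1,2) by (simp add: Q_def \<rho>_def)
 qed
 have "AE \<omega> in lebesgue. norm (0 + (2::real)^n *\<^sub>R \<omega>) < \<rho> --> Q (0 + (2::real)^n *\<^sub>R \<omega>)" for n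
  by (rule AE_affine[OF _ Qae]) simp
 then have orb: "AE \<omega> in lebesgue. \<forall>n. norm ((2::real)^n *\<^sub>R \<omega>) < \<rho> --> Q (2^n *\<^sub>R \<omega>)"
  by (simp add: AE_all_countable)
 have nz: "AE \<omega> in lebesgue. \<omega> \<noteq> (0::real^'d)"
  using AE_not_in[of "{0::real^'d}" lebesgue] by (simp add: negligible_iff_null_sets[symmetric])
 define K where "K = (2 / \<rho>) powr s * D' + C * C * \<rho> powr k / (2 powr k - 1)"
 have K: "K \<ge> 0"
 proof -
  have "2 powr k > (1::real)" using k_pos by simp
  then show ?thesis using C D(1) unfolding K_def D'_def by (intro add_nonneg_nonneg mult_nonneg_nonneg divide_nonneg_pos) auto
 qed
 have "AE \<omega> in lebesgue. norm \<omega> < \<rho> --> (wnorm_le (dual_lattice - {0}) s (symb \<Phi>) \<omega> ((K + 1) * norm \<omega> powr k))"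
  using orb nz
 proof eventually_elim
  case (elim \<omega>)
  show ?case
  proof (intro impI allI)
   fix F :: "(real^'d) set" assume w: "norm \<omega> < \<rho>" and F: "finite F" "F \<subseteq> dual_lattice - {0}"
   have Q: "Q (2^n *\<^sub>R \<omega>)" if "norm ((2::real)^n *\<^sub>R \<omega>) < \<rho>" for n using elim that by blast
   have "wnorm s (symb \<Phi>) F \<omega> <= K * norm \<omega> powr s"
    unfolding K_def
   proof (rule wnorm_le_ascending[OF k_pos _ _ _ _ elim(2) w s F, where g = "vhat \<Phi>"])
    show "0 <= C" using C by simp
    fix n and \<beta> :: "real^'d" assume n: "norm ((2::real)^n *\<^sub>R \<omega>) < \<rho>" and b: "\<beta> \<in> dual_lattice"
    let ?y = "2^n *\<^sub>R \<omega>"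
    have "norm (symb \<Phi> (2 *\<^sub>R (?y + pi *\<^sub>R 0 + \<beta>)) - (if (0::real^'d) = 0 then symb \<Phi> (?y + \<beta>) else 0))
     <= C1 * norm ?y powr k * norm (vhat \<Phi> (?y + pi *\<^sub>R 0 + \<beta>))"
     using Q[OF n] b unit_vertices_0 unfolding Q_def by blast
    also have "... <= C * norm ?y powr k * norm (vhat \<Phi> (?y + pi *\<^sub>R 0 + \<beta>))"
     using C by (intro mult_right_mono) auto
    finally show "norm (symb \<Phi> (2 *\<^sub>R (?y + \<beta>)) - symb \<Phi> (?y + \<beta>)) <= C * norm ?y powr k * norm (vhat \<Phi> (?y + \<beta>))"
     by (simp only: scaleR_zero_right add_0_right if_True simp_thms)
   next
    fix n and A :: "(real^'d) set" assume n: "norm ((2::real)^n *\<^sub>R \<omega>) < \<rho>" and A: "finite A" "A \<subseteq> dual_lattice"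
    have "wnorm s (vhat \<Phi>) A (2^n *\<^sub>R \<omega>) <= C2 * norm (2^n *\<^sub>R \<omega>) powr s" using Q[OF n] A unfolding Q_def by blast
    also have "... <= C * norm (2^n *\<^sub>R \<omega>) powr s" using C by (intro mult_right_mono) auto
    finally show "wnorm s (vhat \<Phi>) A (2^n *\<^sub>R \<omega>) <= C * norm (2^n *\<^sub>R \<omega>) powr s" .
   next
    fix n and A :: "(real^'d) set" assume n: "norm ((2::real)^n *\<^sub>R \<omega>) < \<rho>" and A: "finite A" "A \<subseteq> dual_lattice - {0}"
    show "wnorm s (symb \<Phi>) A (2^n *\<^sub>R \<omega>) <= D'" using Q[OF n] A unfolding Q_def by blast
   qed
   also have "... <= (K + 1) * norm \<omega> powr k"
    using K w rho ks by (intro mult_mono powr_mono') auto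
   finally show "wnorm s (symb \<Phi>) F \<omega> <= (K + 1) * norm \<omega> powr k" .
  qed
 qed
 then show ?thesis using K rho by (intro exI[of _ "K + 1"] exI[of _ \<rho>]) auto
qed

text \<open>For negative \<open>s\<close> without a bound for \<open>G\<^sup>0\<close> the recursion loses a factor \<open>|\<omega>|\<^sup>s\<close>. It still shows
 that the Taylor polynomials of the symbol at the nonzero lattice points vanish, and smoothness
 supplies the rest.\<close>

lemma vhat_square_integrable:
 assumes Phi: "\<Phi> \<in> R"
 shows "(\<integral>\<^sup>+x\<in>ball 0 1. ennreal ((norm (vhat \<Phi> (p + x)))\<^sup>2) \<partial>lebesgue) < \<infinity>"
proof -
 have ms: "(\<lambda>x. ennreal ((norm (fhat (\<Phi> $ i) x))\<^sup>2)) \<in> lmeas" for i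
  by (rule measurable_compose[OF borel_measurable_power[OF measurable_compose[OF fhat_measurable[OF Phi] borel_measurable_norm]] measurable_ennreal])
 have mi: "(\<lambda>x. ennreal ((norm (fhat (\<Phi> $ i) x))\<^sup>2) * indicator (ball p 1) x) \<in> lmeas" for i
  by (rule borel_measurable_times_ennreal[OF ms borel_measurable_indicator[OF ball_measurable_lebesgue]])
 have one: "(\<integral>\<^sup>+x. ennreal ((norm (fhat (\<Phi> $ i) x))\<^sup>2) * indicator (ball p 1) x \<partial>lebesgue) < \<infinity>" for i
 proof -
  have "integrable lebesgue (\<lambda>x. indicator (cball p 1) x *\<^sub>R (norm (fhat (\<Phi> $ i) x))\<^sup>2)"
   using has_fourier_entry[OF Phi, of i] compact_cball unfolding has_fourier_def set_integrable_def by blast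
  then have fin: "(\<integral>\<^sup>+x. ennreal (indicator (cball p 1) x *\<^sub>R (norm (fhat (\<Phi> $ i) x))\<^sup>2) \<partial>lebesgue) < \<infinity>"
   by (subst nn_integral_eq_integral) auto
  have "(\<integral>\<^sup>+x. ennreal ((norm (fhat (\<Phi> $ i) x))\<^sup>2) * indicator (ball p 1) x \<partial>lebesgue) <= (\<integral>\<^sup>+x. ennreal (indicator (cball p 1) x *\<^sub>R (norm (fhat (\<Phi> $ i) x))\<^sup>2) \<partial>lebesgue)"
   by (intro nn_integral_mono) (auto simp: indicator_def)
  then show ?thesis using fin by (rule le_less_trans)
 qed
 have mi': "(\<lambda>x. ennreal ((norm (fhat (\<Phi> $ i) (p + x)))\<^sup>2) * indicator (ball p 1) (p + x)) \<in> lmeas" for i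
  using measurable_affine[OF _ mi[of i], of 1 p] by simp
 have shift: "(\<integral>\<^sup>+x. ennreal ((norm (fhat (\<Phi> $ i) (p + x)))\<^sup>2) * indicator (ball p 1) (p + x) \<partial>lebesgue)
   = (\<integral>\<^sup>+x. ennreal ((norm (fhat (\<Phi> $ i) x))\<^sup>2) * indicator (ball p 1) x \<partial>lebesgue)" for i
  using nn_integral_affine[OF _ mi[of i], of 1 p] by simp
 have "(\<integral>\<^sup>+x\<in>ball 0 1. ennreal ((norm (vhat \<Phi> (p + x)))\<^sup>2) \<partial>lebesgue)
  = (\<integral>\<^sup>+x. (\<Sum>i\<in>UNIV. ennreal ((norm (fhat (\<Phi> $ i) (p + x)))\<^sup>2) * indicator (ball p 1) (p + x)) \<partial>lebesgue)"
 proof (rule nn_integral_cong)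
  fix x
  have "ennreal ((norm (vhat \<Phi> (p + x)))\<^sup>2) = (\<Sum>i\<in>UNIV. ennreal ((norm (fhat (\<Phi> $ i) (p + x)))\<^sup>2))"
   unfolding norm_vec_def L2_set_def vhat_def by (simp add: sum_nonneg sum_ennreal)
  moreover have "indicator (ball 0 1) x = (indicator (ball p 1) (p + x) :: ennreal)"
   by (simp add: indicator_def dist_norm)
  ultimately show "ennreal ((norm (vhat \<Phi> (p + x)))\<^sup>2) * indicator (ball 0 1) x = (\<Sum>i\<in>UNIV. ennreal ((norm (fhat (\<Phi> $ i) (p + x)))\<^sup>2) * indicator (ball p 1) (p + x))"
   by (simp only: sum_distrib_right)
 qed
 also have "... = (\<Sum>i\<in>UNIV. \<integral>\<^sup>+x. ennreal ((norm (fhat (\<Phi> $ i) (p + x)))\<^sup>2) * indicator (ball p 1) (p + x) \<partial>lebesgue)"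
  by (rule nn_integral_sum) (rule mi')
 also have "... = (\<Sum>i\<in>UNIV. \<integral>\<^sup>+x. ennreal ((norm (fhat (\<Phi> $ i) x))\<^sup>2) * indicator (ball p 1) x \<partial>lebesgue)"
  by (simp only: shift)
 also have "... < \<infinity>" using one by simp
 finally show ?thesis .
qed

text \<open>In dimension at most two the square integrability of \<open>\<Phi>\<^sup>^\<close> is enough. Otherwise \<open>s > -1\<close>, and the bounds from (A1)
 allow at most a singularity \<open>|x|\<^sup>s\<close>.\<close>

lemma error_mean_vanish:
 assumes Phi: "\<Phi> \<in> R" and s: "s < 0" and n: "n > 0" and cs: "s > -1 \<or> CARD('d) <= 2"
  and l: "l \<in> unit_vertices" and b: "\<beta> \<in> dual_lattice" and p: "p = pi *\<^sub>R l + \<beta>"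
 shows "mean_vanish (n - 1) (\<lambda>x. of_real (norm x powr n * norm (vhat \<Phi> (p + x))))"
proof (cases "CARD('d) <= 2")
 case True
 have m: "(\<lambda>x. norm (vhat \<Phi> (p + x))) \<in> lmeas"
  using measurable_affine[OF _ norm_vhat_measurable[OF Phi], of 1 p] by simp
 show ?thesis
  by (rule mean_vanish_square_integrable[OF m _ vhat_square_integrable[OF Phi] True n]) simp
next
 case False
 then have s1: "s > -1" using cs by simp
 obtain C \<rho> where C: "C > 0" "\<rho> > 0" and ae1:
  "AE \<omega> in lebesgue. norm \<omega> < \<rho> --> (\<forall>F l. finite F --> F \<subseteq> dual_lattice --> l \<in> unit_vertices - {0} -->
   wnorm s (vhat \<Phi>) F (\<omega> + pi *\<^sub>R l) <= C)"
  and ae2: "AE \<omega> in lebesgue. norm \<omega> < \<rho> --> (wnorm_le dual_lattice s (vhat \<Phi>) \<omega> (C * norm \<omega> powr s))"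
  by (rule vhat_bounds[OF Phi])
 define C' where "C' = C * (norm p + 1) powr (- s)"
 have nz: "AE \<omega> in lebesgue. \<omega> \<noteq> - p"
  using AE_not_in[of "{- p}" lebesgue] by (simp add: negligible_iff_null_sets[symmetric])
 have nz0: "AE \<omega> in lebesgue. \<omega> \<noteq> (0::real^'d)"
  using AE_not_in[of "{0::real^'d}" lebesgue] by (simp add: negligible_iff_null_sets[symmetric])
 have ae: "AE x in lebesgue. norm x < min \<rho> 1 --> norm (vhat \<Phi> (p + x)) <= C' * norm x powr s"
  using ae1 ae2 nz nz0
 proof eventually_elim
  case (elim x)
  show ?case
  proof
   assume x: "norm x < min \<rho> 1"
   have one: "norm x powr s \<ge> 1" using powr_mono2'[of s "norm x" 1] x s elim(4) by simp
   have "norm (p + x) powr s * norm (vhat \<Phi> (p + x)) <= C * norm x powr s"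
   proof (cases "l = 0")
    case True
    have "wnorm s (vhat \<Phi>) {\<beta>} x <= C * norm x powr s" using elim(2) x b by simp
    then show ?thesis using True by (simp add: wnorm_def p add.commute)
   next
    case False
    have "wnorm s (vhat \<Phi>) {\<beta>} (x + pi *\<^sub>R l) <= C" using elim(1) x b l False by simp
    also have "... <= C * norm x powr s" using mult_left_mono[OF one, of C] C by simp
    finally show ?thesis by (simp add: wnorm_def p add_ac)
   qed
   then have "norm (p + x) powr (- s) * (norm (p + x) powr s * norm (vhat \<Phi> (p + x))) <= norm (p + x) powr (- s) * (C * norm x powr s)"
    by (intro mult_left_mono) auto
   moreover have "norm (p + x) powr (- s) * (norm (p + x) powr s * norm (vhat \<Phi> (p + x))) = norm (vhat \<Phi> (p + x))"
   proof -
    have "p + x \<noteq> 0" using elim(3) by (metis add.commute eq_neg_iff_add_eq_0)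
    then show ?thesis by (simp add: powr_minus)
   qed
   moreover have "norm (p + x) powr (- s) * (C * norm x powr s) <= (norm p + 1) powr (- s) * (C * norm x powr s)"
    using s x C norm_triangle_ineq[of p x] by (intro mult_right_mono powr_mono2) auto
   ultimately have "norm (vhat \<Phi> (p + x)) <= (norm p + 1) powr (- s) * (C * norm x powr s)" by linarith
   then show "norm (vhat \<Phi> (p + x)) <= C' * norm x powr s" by (simp only: C'_def mult_ac)
  qed
 qed
 show ?thesis
  by (rule mean_vanish_singular[OF ae _ _ s1 n]) (use C in \<open>auto simp: C'_def\<close>)
qed

lemma mean_vanish_zero: "mean_vanish m (\<lambda>_. 0)"
 unfolding mean_vanish_def by (auto intro: exI[of _ 1])

text \<open>Dividing the lattice point by two as long as possible ends at a vertex \<open>l \<noteq> 0\<close>, where the recursion starts from \<open>0\<close>;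
 each doubling on the way back adds an error that vanishes in the mean.\<close>

lemma symb_mean_vanish:
 assumes Phi: "\<Phi> \<in> R" and s: "s < 0" and n: "n > 0" "k = real n" and cs: "s > -1 \<or> CARD('d) <= 2"
  and a: "\<alpha> \<in> dual_lattice - {0}"
 shows "mean_vanish (n - 1) (\<lambda>x. symb \<Phi> (\<alpha> + x))"
proof -
 obtain C \<rho> where C: "C > 0" "\<rho> > 0" and ae: "AE \<omega> in lebesgue. norm \<omega> < \<rho> --> (\<forall>\<beta>\<in>dual_lattice. \<forall>l\<in>unit_vertices.
   norm (symb \<Phi> (2 *\<^sub>R (\<omega> + pi *\<^sub>R l + \<beta>)) - (if l = 0 then symb \<Phi> (\<omega> + \<beta>) else 0))
    <= C * norm \<omega> powr k * norm (vhat \<Phi> (\<omega> + pi *\<^sub>R l + \<beta>)))"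
  by (rule symbol_recursion[OF Phi])
 have ms: "(\<lambda>x. symb \<Phi> (q + x)) \<in> lmeas" for q
  using measurable_affine[OF _ symb_measurable[OF Phi], of 1 q] by simp
 have "mean_vanish (n - 1) (\<lambda>x. symb \<Phi> (\<alpha> + x))" if "\<alpha> \<in> dual_lattice - {0}" "norm \<alpha> < 2 * pi * 2 ^ N" for N \<alpha>
  using that
 proof (induction N arbitrary: \<alpha>)
  case 0
  then show ?case using norm_dual_lattice[of \<alpha>] by auto
 next
  case (Suc N)
  then obtain l \<beta> where l: "l \<in> unit_vertices" and b: "\<beta> \<in> dual_lattice" and al: "\<alpha> = 2 *\<^sub>R (pi *\<^sub>R l + \<beta>)"
   using dual_lattice_split[of \<alpha>] by blast
  define p where "p = pi *\<^sub>R l + \<beta>"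
  define G where "G x = (if l = 0 then symb \<Phi> (\<beta> + x) else 0)" for x
  have mG: "G \<in> lmeas" unfolding G_def[abs_def] using ms[of \<beta>] by (cases "l = 0") auto
  have vG: "mean_vanish (n - 1) G"
  proof (cases "l = 0")
   case True
   then have "\<beta> \<in> dual_lattice - {0}" "norm \<beta> < 2 * pi * 2 ^ N" using Suc.prems b al by auto
   from Suc.IH[OF this] show ?thesis using True by (simp add: G_def[abs_def])
  qed (simp add: G_def[abs_def] mean_vanish_zero)
  have me: "(\<lambda>x. norm x powr n * norm (vhat \<Phi> (p + x))) \<in> lmeas"
  proof (rule borel_measurable_times)
   show "(\<lambda>x. norm x powr n) \<in> lmeas"
    by (intro measurable_completion) simp
   show "(\<lambda>x. norm (vhat \<Phi> (p + x))) \<in> lmeas"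
    using measurable_affine[OF _ norm_vhat_measurable[OF Phi], of 1 p] by simp
  qed
  show ?case
  proof (rule mean_vanish_of_recursion[OF ms mG me less_imp_le[OF C(1)] C(2) _ vG error_mean_vanish[OF Phi s n(1) cs l b p_def]])
   show "AE x in lebesgue. norm x < \<rho> --> norm (symb \<Phi> (\<alpha> + 2 *\<^sub>R x)) <= norm (G x) + C * (norm x powr n * norm (vhat \<Phi> (p + x)))"
    using ae
   proof eventually_elim
    case (elim x)
    show ?case
    proof
     assume x: "norm x < \<rho>"
     have "norm (symb \<Phi> (2 *\<^sub>R (x + pi *\<^sub>R l + \<beta>)) - (if l = 0 then symb \<Phi> (x + \<beta>) else 0))
      <= C * norm x powr k * norm (vhat \<Phi> (x + pi *\<^sub>R l + \<beta>))" using elim x b l by blast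
     moreover have "2 *\<^sub>R (x + pi *\<^sub>R l + \<beta>) = \<alpha> + 2 *\<^sub>R x" "x + pi *\<^sub>R l + \<beta> = p + x" by (simp_all add: al p_def algebra_simps)
     moreover have "(if l = 0 then symb \<Phi> (x + \<beta>) else 0) = G x" by (simp add: G_def add.commute)
     ultimately have "norm (symb \<Phi> (\<alpha> + 2 *\<^sub>R x) - G x) <= C * norm x powr k * norm (vhat \<Phi> (p + x))" by (simp only:)
     then show "norm (symb \<Phi> (\<alpha> + 2 *\<^sub>R x)) <= norm (G x) + C * (norm x powr n * norm (vhat \<Phi> (p + x)))"
      using norm_triangle_ineq2[of "symb \<Phi> (\<alpha> + 2 *\<^sub>R x)" "G x"] n(2) by (simp add: mult.assoc)
    qed
   qed
  qed simp
 qed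
 moreover obtain N where "norm \<alpha> < 2 * pi * 2 ^ N"
 proof -
  obtain N where "norm \<alpha> < 2 ^ N" using real_arch_pow[of 2 "norm \<alpha>"] by auto
  moreover have "(2::real) ^ N <= 2 * pi * 2 ^ N" using pi_ge_two by simp
  ultimately show ?thesis using that by (meson less_le_trans)
 qed
 ultimately show ?thesis using a by blast
qed

text \<open>Taylor at each lattice point; the constants are square summable with the right weights by (A3).\<close>

lemma symb_l2_smooth:
 assumes Phi: "\<Phi> \<in> R" and s: "s < 0" and n: "n > 0" "k = real n" and cs: "s > -1 \<or> CARD('d) <= 2"
  and A3: "\<rho>0 > 0" "(\<Sum>\<^sub>\<infinity>\<beta>\<in>dual_lattice - {0}. ennreal (norm \<beta> powr (2 * s)) *
      (SUP \<gamma>\<in>{\<gamma>. real (sum \<gamma> UNIV) <= k}. (mderiv_Linf_norm (ball \<beta> \<rho>0) \<gamma> (symb \<Phi>))\<^sup>2)) < \<infinity>"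
 shows "\<exists>C \<rho>. C > 0 \<and> \<rho> > 0 \<and> (AE \<omega> in lebesgue. norm \<omega> < \<rho> -->
  (wnorm_le (dual_lattice - {0}) s (symb \<Phi>) \<omega> (C * norm \<omega> powr k)))"
proof -
 obtain M D where M: "\<And>\<beta>. M \<beta> \<ge> 0" and D: "D \<ge> 0"
  "\<And>F. finite F ==> F \<subseteq> dual_lattice - {0} ==> L2_set (\<lambda>\<beta>. norm \<beta> powr s * M \<beta>) F <= D"
  and wd: "\<And>\<beta> \<gamma>. \<beta> \<in> dual_lattice - {0} ==> real (sum \<gamma> UNIV) <= k ==>
   \<exists>g. has_weak_mderiv (ball \<beta> \<rho>0) \<gamma> (symb \<Phi>) g \<and> (AE x in lebesgue. x \<in> ball \<beta> \<rho>0 --> norm (g x) <= M \<beta>)"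
  by (rule weak_derivs_of_summable_norms[OF A3(2)]) blast
 define c where "c = real CARD('d) ^ n * fact n"
 have c: "c > 0" by (simp add: c_def)
 have "AE x in lebesgue. x \<in> ball 0 \<rho>0 --> norm (symb \<Phi> (\<beta> + x)) <= real CARD('d) ^ n * (fact n * M \<beta>) * norm x ^ n"
  if b: "\<beta> \<in> dual_lattice - {0}" for \<beta>
 proof (rule AE_le_power_of_weak_derivs_at[OF A3(1) n(1) M symb_measurable[OF Phi] _ symb_mean_vanish[OF Phi s n cs b]])
  fix \<gamma> :: "'d => nat" assume "sum \<gamma> UNIV <= n"
  then have "real (sum \<gamma> UNIV) <= k" unfolding n(2) by (simp only: of_nat_le_iff)
  then show "\<exists>g. has_weak_mderiv (ball \<beta> \<rho>0) \<gamma> (symb \<Phi>) g \<and> (AE x in lebesgue. x \<in> ball \<beta> \<rho>0 --> norm (g x) <= M \<beta>)"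
   by (rule wd[OF b])
 qed
 then have "AE x in lebesgue. \<forall>\<beta>\<in>dual_lattice - {0}. x \<in> ball 0 \<rho>0 --> norm (symb \<Phi> (\<beta> + x)) <= real CARD('d) ^ n * (fact n * M \<beta>) * norm x ^ n"
  by (subst AE_ball_countable) (auto intro: countable_subset[OF _ countable_dual_lattice])
 then have "AE \<omega> in lebesgue. norm \<omega> < min \<rho>0 1 -->
  (wnorm_le (dual_lattice - {0}) s (symb \<Phi>) \<omega> ((2 powr \<bar>s\<bar> * c * D + 1) * norm \<omega> powr k))"
 proof eventually_elim
  case (elim \<omega>)
  show ?case
  proof (intro impI allI)
   fix F :: "(real^'d) set" assume w: "norm \<omega> < min \<rho>0 1" and F: "finite F" "F \<subseteq> dual_lattice - {0}"
   have wp: "norm \<omega> ^ n = norm \<omega> powr k" using n by (cases "\<omega> = 0") (auto simp: powr_realpow)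
   have "wnorm s (symb \<Phi>) F \<omega> <= 2 powr \<bar>s\<bar> * (c * norm \<omega> powr k) * L2_set (\<lambda>\<beta>. norm \<beta> powr s * M \<beta>) F"
   proof (rule wnorm_le_comparable[OF _ F _ _ M])
    fix \<beta> assume "\<beta> \<in> F"
    then have "norm (symb \<Phi> (\<beta> + \<omega>)) <= real CARD('d) ^ n * (fact n * M \<beta>) * norm \<omega> ^ n" using elim F w by auto
    then show "norm (symb \<Phi> (\<omega> + \<beta>)) <= c * norm \<omega> powr k * M \<beta>"
     unfolding c_def wp[symmetric] by (simp only: add.commute[of \<omega> \<beta>] mult_ac)
   qed (use w c in auto)
   also have "... <= 2 powr \<bar>s\<bar> * (c * norm \<omega> powr k) * D" using c by (intro mult_left_mono D(2)[OF F]) auto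
   also have "... <= (2 powr \<bar>s\<bar> * c * D + 1) * norm \<omega> powr k" by (simp add: algebra_simps)
   finally show "wnorm s (symb \<Phi>) F \<omega> <= (2 powr \<bar>s\<bar> * c * D + 1) * norm \<omega> powr k" .
  qed
 qed
 moreover have "2 powr \<bar>s\<bar> * c * D + 1 > 0" using c D(1) by (intro add_nonneg_pos mult_nonneg_nonneg) auto
 ultimately show ?thesis using A3(1) by (intro exI[of _ "2 powr \<bar>s\<bar> * c * D + 1"] exI[of _ "min \<rho>0 1"]) auto
qed

text \<open>The three regimes together.\<close>

lemma symb_l2:
 assumes Phi: "\<Phi> \<in> R"
  and supp: "s < 0 ==> k \<notin> \<nat> \<or> (s <= -1 \<and> CARD('d) \<ge> 3) ==> (\<lambda>\<omega>. norm (gramian0 s B \<omega>)) \<in> O[ae_nhds 0](\<lambda>_. 1)"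
  and A3: "\<exists>\<rho>>0. (\<Sum>\<^sub>\<infinity>\<beta>\<in>dual_lattice - {0}. ennreal (norm \<beta> powr (2 * s)) *
      (SUP \<gamma>\<in>{\<gamma>. real (sum \<gamma> UNIV) <= k}. (mderiv_Linf_norm (ball \<beta> \<rho>) \<gamma> (symb \<Phi>))\<^sup>2)) < \<infinity>"
 shows "\<exists>C \<rho>. C > 0 \<and> \<rho> > 0 \<and> (AE \<omega> in lebesgue. norm \<omega> < \<rho> -->
  (wnorm_le (dual_lattice - {0}) s (symb \<Phi>) \<omega> (C * norm \<omega> powr k)))"
proof -
 obtain \<rho>0 where r0: "\<rho>0 > 0" "(\<Sum>\<^sub>\<infinity>\<beta>\<in>dual_lattice - {0}. ennreal (norm \<beta> powr (2 * s)) *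
      (SUP \<gamma>\<in>{\<gamma>. real (sum \<gamma> UNIV) <= k}. (mderiv_Linf_norm (ball \<beta> \<rho>0) \<gamma> (symb \<Phi>))\<^sup>2)) < \<infinity>"
  using A3 by blast
 consider "k <= s" | "s \<ge> 0" "s < k" | "s < 0" "k \<notin> \<nat> \<or> (s <= -1 \<and> CARD('d) \<ge> 3)" | "s < 0" "k \<in> \<nat>" "s > -1 \<or> CARD('d) <= 2"
  by force
 then show ?thesis
 proof cases
  case 1
  show ?thesis by (rule symb_l2_ascending[OF Phi 1 r0])
 next
  case 2
  then show ?thesis by (intro symb_l2_descending[OF Phi]) auto
 next
  case 3
  then show ?thesis using supp k_pos by (intro symb_l2_descending[OF Phi]) auto
 next
  case 4
  then obtain n where n: "k = real n" by (auto elim: Nats_cases)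
  then have "n > 0" using k_pos by simp
  from symb_l2_smooth[OF Phi 4(1) this n 4(3) r0] show ?thesis .
 qed
qed

end

section \<open>The quadratic form of the Gramian at the supervector\<close>

lemma norm_matrix_vector_le: "norm (M *v x) <= norm M * norm x" for M :: "complex^'r^'r::finite"
proof -
 have "norm ((M *v x) $ i) <= norm (M $ i) * norm x" for i
  using norm_sum_mult_le[of "\<lambda>j. M $ i $ j" "\<lambda>j. x $ j" UNIV]
  by (simp add: matrix_vector_mult_def norm_vec_def)
 then have "norm (M *v x) <= L2_set (\<lambda>i. norm (M $ i) * norm x) UNIV"
  unfolding norm_vec_def[of "M *v x"] by (intro L2_set_mono) auto
 also have "... = norm M * norm x"
  by (simp add: norm_vec_def[of M] L2_set_left_distrib)
 finally show ?thesis .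
qed

lemma abs_qform_le: "\<bar>qform M x\<bar> <= norm M * (norm x)\<^sup>2"
proof -
 have "\<bar>qform M x\<bar> <= norm (cinner x (M *v x))" unfolding qform_def by (rule abs_Re_le_cmod)
 also have "... <= norm x * norm (M *v x)" by (rule norm_cinner_le)
 also have "... <= norm x * (norm M * norm x)" by (intro mult_left_mono norm_matrix_vector_le) simp
 finally show ?thesis by (simp add: power2_eq_square mult_ac)
qed

lemma cinner_add_scale:
 "cinner (x - of_real t *s w) y = cinner x y - of_real t * cinner w y"
 "cinner y (x - of_real t *s w) = cinner y x - of_real t * cinner y w"
 by (auto simp: cinner_def sum_subtractf sum_distrib_left algebra_simps)

lemma gram_sum_hermitian: "cinner w (gram_sum A s B \<omega> *v x) = cnj (cinner x (gram_sum A s B \<omega> *v w))"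
proof -
 let ?G = "gram_sum A s B \<omega>"
 have h: "cnj (?G $ i $ j) = ?G $ j $ i" for i j
  by (simp add: gram_sum_def flip: infsum_cnj) (simp add: mult_ac)
 have "cnj (cinner x (?G *v w)) = (\<Sum>i\<in>UNIV. \<Sum>j\<in>UNIV. x $ i * (?G $ j $ i * cnj (w $ j)))"
  by (simp add: cinner_def matrix_vector_mult_def sum_distrib_left h)
 also have "... = (\<Sum>j\<in>UNIV. \<Sum>i\<in>UNIV. x $ i * (?G $ j $ i * cnj (w $ j)))" by (rule sum.swap)
 also have "... = cinner w (?G *v x)"
  by (simp add: cinner_def matrix_vector_mult_def sum_distrib_left mult_ac)
 finally show ?thesis by simp
qed

lemma gram_sum_nonneg:
 assumes "gram_summable s B \<omega>" "A \<subseteq> dual_lattice"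
 shows "qform (gram_sum A s B \<omega>) x \<ge> 0"
 unfolding gram_form(2)[OF assms] by (intro sum_nonneg infsum_nonneg) auto

text \<open>A positive semidefinite Hermitian matrix is bounded below by the inverse norm of its inverse:
 expand the form at \<open>x - t w\<close>, where \<open>w\<close> solves \<open>Gw = x\<close>, and take \<open>t = 1/N\<close>.\<close>

lemma qform_ge_inverse:
 assumes gs: "gram_summable s B \<omega>" and A: "A \<subseteq> dual_lattice"
  and inv: "invertible (gram_sum A s B \<omega>)"
  and N: "norm (matrix_inv (gram_sum A s B \<omega>)) <= N" "N > 0"
 shows "(norm x)\<^sup>2 / N <= qform (gram_sum A s B \<omega>) x"
proof -
 let ?G = "gram_sum A s B \<omega>"
 define w where "w = matrix_inv ?G *v x"
 have GI: "?G ** matrix_inv ?G = mat 1"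
  using someI_ex[OF inv[unfolded invertible_def]] by (simp add: matrix_inv_def)
 then have Gw: "?G *v w = x" by (simp add: w_def matrix_vector_mul_assoc)
 have nw: "norm w <= N * norm x"
  using norm_matrix_vector_le[of "matrix_inv ?G" x] mult_right_mono[OF N(1) norm_ge_zero[of x]] by (simp add: w_def)
 define t where "t = 1 / N"
 have "0 <= qform ?G (x - of_real t *s w)" by (rule gram_sum_nonneg[OF gs A])
 also have "?G *v (x - of_real t *s w) = ?G *v x - of_real t *s x"
  using Gw by (simp add: matrix_vector_mult_diff_distrib vector_scalar_commute)
 then have "qform ?G (x - of_real t *s w)
  = Re (cinner x (?G *v x) - of_real t * cinner w (?G *v x) - of_real t * (cinner x x - of_real t * cinner w x))"
  unfolding qform_def by (simp only: cinner_add_scale)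
 also have "cinner w (?G *v x) = cnj (cinner x x)" by (subst gram_sum_hermitian) (simp only: Gw)
 also have "Re (cinner x (?G *v x) - of_real t * cnj (cinner x x) - of_real t * (cinner x x - of_real t * cinner w x))
  = qform ?G x - 2 * t * (norm x)\<^sup>2 + t * t * Re (cinner w x)"
  using cinner_self[of x] by (simp add: qform_def algebra_simps)
 finally have 1: "0 <= qform ?G x - 2 * t * (norm x)\<^sup>2 + t * t * Re (cinner w x)" .
 have "Re (cinner w x) <= norm w * norm x"
  using complex_Re_le_cmod[of "cinner w x"] norm_cinner_le[of w x] by linarith
 also have "... <= N * (norm x)\<^sup>2"
  using mult_right_mono[OF nw norm_ge_zero[of x]] by (simp add: power2_eq_square mult_ac)
 finally have "t * t * Re (cinner w x) <= t * t * (N * (norm x)\<^sup>2)" by (intro mult_left_mono) auto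
 also have "... = t * (norm x)\<^sup>2" using N(2) by (simp add: t_def)
 finally show ?thesis using 1 by (simp add: t_def)
qed

text \<open>Summation over growing balls exhibits the lattice sums as limits of sequences of finite sums, from which
 measurability follows.\<close>

lemma infsum_lattice_limit:
 fixes f :: "real^'d::finite => 'a::{topological_comm_monoid_add, t2_space}"
 assumes A: "A \<subseteq> dual_lattice" and f: "f summable_on A"
 shows "(\<lambda>n. \<Sum>\<alpha>\<in>{\<alpha>\<in>A. norm \<alpha> < real n}. f \<alpha>) \<longlonglongrightarrow> infsum f A"
proof -
 have fin: "finite {\<alpha>\<in>A. norm \<alpha> < real n}" for n
  by (rule finite_subset[OF _ finite_dual_lattice_ball[of 0 "real n"]]) (use A in auto)
 have "filterlim (\<lambda>n. {\<alpha>\<in>A. norm \<alpha> < real n}) (finite_subsets_at_top A) sequentially"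
  unfolding filterlim_finite_subsets_at_top
 proof (intro allI impI)
  fix X assume X: "finite X \<and> X \<subseteq> A"
  define m where "m = (\<Sum>x\<in>X. norm x)"
  obtain n0 where n0: "real n0 > m" using reals_Archimedean2 by blast
  have "norm x < real n" if "x \<in> X" "n \<ge> n0" for x n
  proof -
   have "norm x <= m" unfolding m_def using X that by (intro member_le_sum) auto
   then show ?thesis using n0 that by linarith
  qed
  then show "\<forall>\<^sub>F n in sequentially. finite {\<alpha>\<in>A. norm \<alpha> < real n} \<and> X \<subseteq> {\<alpha>\<in>A. norm \<alpha> < real n} \<and> {\<alpha>\<in>A. norm \<alpha> < real n} \<subseteq> A"
   using X fin by (intro eventually_sequentiallyI[of n0]) auto
 qed
 with has_sum_infsum[OF f] show ?thesis unfolding has_sum_def by (rule filterlim_compose)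
qed

lemma qform_gram_measurable:
 fixes B :: "('d::finite functional ^ 'r::finite) set"
 assumes B: "finite B" "\<forall>\<Phi>\<in>B. \<forall>i. \<Phi> $ i \<in> W2 s" and A: "A \<subseteq> dual_lattice"
 shows "(\<lambda>\<omega>. qform (gram_sum A s B \<omega>) x) \<in> lmeas"
proof -
 let ?p = "\<lambda>\<Phi> i j \<alpha> \<omega>. vhat \<Phi> (\<omega> + \<alpha>) $ i * cnj (vhat \<Phi> (\<omega> + \<alpha>) $ j) * of_real (norm (\<omega> + \<alpha>) powr (2 * s))"
 have m: "?p \<Phi> i j \<alpha> \<in> lmeas" if "\<Phi> \<in> B" for \<Phi> i j \<alpha>
 proof -
  have f: "fhat (\<Phi> $ i) \<in> lmeas" for i
   using B(2) that has_fourier_fhat unfolding W2_def has_fourier_def by blast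
  have s: "(\<lambda>\<omega>. fhat (\<Phi> $ i) (\<omega> + \<alpha>)) \<in> lmeas" for i
   using measurable_affine[OF _ f[of i], of 1 \<alpha>] by (simp add: add.commute)
  have w: "(\<lambda>\<omega>. complex_of_real (norm (\<omega> + \<alpha>) powr (2 * s))) \<in> lmeas"
   by (rule measurable_completion) measurable
  show ?thesis unfolding vhat_def vec_lambda_beta
   by (intro borel_measurable_times s w measurable_compose[OF s]) (simp add: borel_measurable_continuous_onI continuous_on_cnj)
 qed
 have i: "(\<lambda>\<omega>. infsum (\<lambda>\<alpha>. ?p \<Phi> i j \<alpha> \<omega>) A) \<in> lmeas" if Phi: "\<Phi> \<in> B" for \<Phi> i j
 proof -
  have "(\<lambda>\<omega>. lim (\<lambda>n. \<Sum>\<alpha>\<in>{\<alpha>\<in>A. norm \<alpha> < real n}. ?p \<Phi> i j \<alpha> \<omega>)) \<in> lmeas"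
   by (intro borel_measurable_lim_metric borel_measurable_sum m Phi)
  moreover have "AE \<omega> in lebesgue. lim (\<lambda>n. \<Sum>\<alpha>\<in>{\<alpha>\<in>A. norm \<alpha> < real n}. ?p \<Phi> i j \<alpha> \<omega>) = infsum (\<lambda>\<alpha>. ?p \<Phi> i j \<alpha> \<omega>) A"
   using AE_gram_summable[OF B] by eventually_elim (rule limI[OF infsum_lattice_limit[OF A summable_gram_product[OF _ Phi A]]])
  ultimately show ?thesis by (rule borel_measurable_AE)
 qed
 have e: "(\<lambda>\<omega>. gram_sum A s B \<omega> $ i $ j) \<in> lmeas" for i j
  unfolding gram_sum_def vec_lambda_beta by (intro borel_measurable_sum i)
 have "(\<lambda>\<omega>. cinner x (gram_sum A s B \<omega> *v x)) \<in> lmeas"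
  unfolding cinner_def matrix_vector_mult_def vec_lambda_beta
  by (intro borel_measurable_sum borel_measurable_times e borel_measurable_const)
 from measurable_compose[OF this, of Re borel] show ?thesis
  by (simp add: qform_def borel_measurable_continuous_onI continuous_on_Re)
qed

lemma continuous_on_qform: "continuous_on X (qform M)"
 unfolding qform_def[abs_def] cinner_def matrix_vector_mult_def vec_lambda_beta
 by (intro continuous_intros)

text \<open>By continuity, the infimum of the quotient may be taken over a countable dense set of
 vectors.\<close>

lemma coherence_quotient_measurable:
 fixes B :: "('d::finite functional ^ 'r::finite) set"
 assumes B: "finite B" "\<forall>\<Phi>\<in>B. \<forall>i. \<Phi> $ i \<in> W2 s"
 shows "coherence_quotient s B \<in> lmeas"
proof -
 obtain D :: "(complex^'r) set" where D: "countable D" "\<And>X. open X ==> X \<noteq> {} ==> \<exists>d\<in>D. d \<in> X"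
  using countable_dense_setE by blast
 let ?G = "\<lambda>\<omega>. qform (gramian s B \<omega>)" and ?H = "\<lambda>\<omega>. qform (gramian0 s B \<omega>)"
 have mG: "(\<lambda>\<omega>. ?G \<omega> x) \<in> lmeas" "(\<lambda>\<omega>. ?H \<omega> x) \<in> lmeas" for x
  using qform_gram_measurable[OF B] by (auto simp: gramian_def gramian0_def)
 have eq: "coherence_quotient s B \<omega> = (INF x\<in>D. if ?G \<omega> x \<noteq> 0 then ereal (?H \<omega> x / ?G \<omega> x) else \<infinity>)" for \<omega>
 proof (rule antisym)
  show "coherence_quotient s B \<omega> <= (INF x\<in>D. if ?G \<omega> x \<noteq> 0 then ereal (?H \<omega> x / ?G \<omega> x) else \<infinity>)"
   unfolding coherence_quotient_def by (intro INF_greatest) (use INF_lower[of _ "{x. ?G \<omega> x \<noteq> 0}" "\<lambda>x. ereal (?H \<omega> x / ?G \<omega> x)"] in auto)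
  show "(INF x\<in>D. if ?G \<omega> x \<noteq> 0 then ereal (?H \<omega> x / ?G \<omega> x) else \<infinity>) <= coherence_quotient s B \<omega>"
   unfolding coherence_quotient_def
  proof (rule INF_greatest)
   fix x assume x: "x \<in> {x. ?G \<omega> x \<noteq> 0}"
   show "(INF x\<in>D. if ?G \<omega> x \<noteq> 0 then ereal (?H \<omega> x / ?G \<omega> x) else \<infinity>) <= ereal (?H \<omega> x / ?G \<omega> x)"
   proof (rule ereal_le_epsilon2)
    fix e :: real assume e: "0 < e"
    let ?S = "{y. ?G \<omega> y \<noteq> 0}" and ?b = "?H \<omega> x / ?G \<omega> x + e"
    have oS: "open ?S"
     by (rule open_Collect_neq[OF continuous_on_qform continuous_on_const])
    have "continuous_on ?S (\<lambda>y. ?H \<omega> y / ?G \<omega> y)"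
     by (intro continuous_on_divide continuous_on_qform) auto
    then have "open (?S \<inter> (\<lambda>y. ?H \<omega> y / ?G \<omega> y) -` {..<?b})"
     using oS by (simp add: continuous_on_open_vimage Int_commute)
    moreover have "x \<in> ?S \<inter> (\<lambda>y. ?H \<omega> y / ?G \<omega> y) -` {..<?b}" using x e by simp
    ultimately obtain d where d: "d \<in> D" "?G \<omega> d \<noteq> 0" "?H \<omega> d / ?G \<omega> d < ?b"
     using D(2) by blast
    have "(INF x\<in>D. if ?G \<omega> x \<noteq> 0 then ereal (?H \<omega> x / ?G \<omega> x) else \<infinity>) <= ereal (?H \<omega> d / ?G \<omega> d)"
     using d by (intro INF_lower2[OF d(1)]) auto
    also have "... <= ereal ?b" using d(3) by simp
    finally show "(INF x\<in>D. if ?G \<omega> x \<noteq> 0 then ereal (?H \<omega> x / ?G \<omega> x) else \<infinity>) <= ereal (?H \<omega> x / ?G \<omega> x) + ereal e"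
     by simp
   qed
  qed
 qed
 have "(\<lambda>\<omega>. if ?G \<omega> x \<noteq> 0 then ereal (?H \<omega> x / ?G \<omega> x) else \<infinity>) \<in> lmeas" for x
 proof (rule measurable_If)
  show "(\<lambda>\<omega>. ereal (?H \<omega> x / ?G \<omega> x)) \<in> lmeas"
   by (intro borel_measurable_ereal borel_measurable_divide mG)
  have "{\<omega> \<in> space lebesgue. ?G \<omega> x \<in> - {0}} \<in> sets lebesgue"
   using measurable_sets[OF mG(1)[of x], of "- {0}"] by (simp add: vimage_def)
  then show "{\<omega> \<in> space lebesgue. ?G \<omega> x \<noteq> 0} \<in> sets lebesgue" by simp
 qed simp
 then have "(\<lambda>\<omega>. INF x\<in>D. if ?G \<omega> x \<noteq> 0 then ereal (?H \<omega> x / ?G \<omega> x) else \<infinity>) \<in> lmeas"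
  by (intro borel_measurable_INF D(1))
 then show ?thesis unfolding eq[abs_def, symmetric] by (simp add: eq[abs_def])
qed

context refinable
begin

text \<open>The weighted \<open>\<ell>\<^sub>2\<close> norm of the symbol over the nonzero lattice points is \<open>O(|\<omega>|\<^sup>k)\<close>, uniformly over
 finite sets of them.\<close>

definition symb_order :: "'d functional ^ 'r => bool" where
 "symb_order \<Phi> \<longleftrightarrow> (\<exists>C \<rho>. C > 0 \<and> \<rho> > 0 \<and> (AE \<omega> in lebesgue. norm \<omega> < \<rho> -->
  (wnorm_le (dual_lattice - {0}) s (symb \<Phi>) \<omega> (C * norm \<omega> powr k))))"

lemma AE_gram_summable_B: "AE \<omega> in lebesgue. gram_summable s B \<omega>"
 using AE_gram_summable[OF basis(1)] sobolev B_subset by blast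

lemma gram_form_symb:
 assumes "gram_summable s B \<omega>" "A \<subseteq> dual_lattice"
 shows "\<Psi> \<in> B ==> (\<lambda>\<alpha>. (norm (symb \<Psi> (\<omega> + \<alpha>)))\<^sup>2 * norm (\<omega> + \<alpha>) powr (2 * s)) summable_on A"
  and "qform (gram_sum A s B \<omega>) (v \<omega>) = (\<Sum>\<Psi>\<in>B. \<Sum>\<^sub>\<infinity>\<alpha>\<in>A. (norm (symb \<Psi> (\<omega> + \<alpha>)))\<^sup>2 * norm (\<omega> + \<alpha>) powr (2 * s))"
proof -
 have e: "cinner (v \<omega>) (vhat \<Psi> (\<omega> + \<alpha>)) = symb \<Psi> (\<omega> + \<alpha>)" if "\<alpha> \<in> A" for \<Psi> \<alpha>
  using assms(2) that v_periodic by (auto simp: symb_def)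
 show "\<Psi> \<in> B ==> (\<lambda>\<alpha>. (norm (symb \<Psi> (\<omega> + \<alpha>)))\<^sup>2 * norm (\<omega> + \<alpha>) powr (2 * s)) summable_on A"
  using gram_form(1)[OF assms, of \<Psi> "v \<omega>"] by (subst summable_on_cong[where g="\<lambda>\<alpha>. (norm (cinner (v \<omega>) (vhat \<Psi> (\<omega> + \<alpha>))))\<^sup>2 * norm (\<omega> + \<alpha>) powr (2 * s)"]) (auto simp: e)
 show "qform (gram_sum A s B \<omega>) (v \<omega>) = (\<Sum>\<Psi>\<in>B. \<Sum>\<^sub>\<infinity>\<alpha>\<in>A. (norm (symb \<Psi> (\<omega> + \<alpha>)))\<^sup>2 * norm (\<omega> + \<alpha>) powr (2 * s))"
  unfolding gram_form(2)[OF assms] by (intro sum.cong refl infsum_cong) (simp add: e)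
qed

text \<open>The quadratic form of \<open>G\<^sup>0\<close> at \<open>v\<close> is a finite sum of squared weighted \<open>\<ell>\<^sub>2\<close> norms of symbols.\<close>

lemma gramian0_zero:
 assumes l2: "\<And>\<Psi>. \<Psi> \<in> B ==> symb_order \<Psi>"
 shows "ae_zero_of_order (2 * k) 0 (\<lambda>\<omega>. qform (gramian0 s B \<omega>) (v \<omega>))"
proof -
 let ?I = "\<lambda>\<Psi> \<omega>. \<Sum>\<^sub>\<infinity>\<alpha>\<in>dual_lattice - {0}. (norm (symb \<Psi> (\<omega> + \<alpha>)))\<^sup>2 * norm (\<omega> + \<alpha>) powr (2 * s)"
 have "\<exists>C>0. \<exists>\<rho>>0. AE \<omega> in lebesgue. norm \<omega> < \<rho> --> ?I \<Psi> \<omega> <= C * (norm \<omega> powr (2 * k))" if Psi: "\<Psi> \<in> B" for \<Psi>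
 proof -
  obtain C \<rho> where C: "C > 0" "\<rho> > 0" and ae: "AE \<omega> in lebesgue. norm \<omega> < \<rho> -->
   (wnorm_le (dual_lattice - {0}) s (symb \<Psi>) \<omega> (C * norm \<omega> powr k))"
   using l2[OF Psi] unfolding symb_order_def by blast
  have "AE \<omega> in lebesgue. norm \<omega> < \<rho> --> ?I \<Psi> \<omega> <= C\<^sup>2 * (norm \<omega> powr (2 * k))"
   using ae AE_gram_summable_B
  proof eventually_elim
   case (elim \<omega>)
   show ?case
   proof
    assume w: "norm \<omega> < \<rho>"
    show "?I \<Psi> \<omega> <= C\<^sup>2 * (norm \<omega> powr (2 * k))"
    proof (rule infsum_le_finite_sums[OF gram_form_symb(1)[OF elim(2) _ Psi]])
     fix F :: "(real^'d) set" assume F: "finite F" "F \<subseteq> dual_lattice - {0}"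
     have "(\<Sum>\<alpha>\<in>F. (norm (symb \<Psi> (\<omega> + \<alpha>)))\<^sup>2 * norm (\<omega> + \<alpha>) powr (2 * s)) = (wnorm s (symb \<Psi>) F \<omega>)\<^sup>2"
      unfolding powr_double_exponent by (simp add: wnorm_def L2_set_def sum_nonneg power_mult_distrib mult.commute)
     also have "... <= (C * norm \<omega> powr k)\<^sup>2"
      using elim(1) w F by (intro power_mono) auto
     finally show "(\<Sum>\<alpha>\<in>F. (norm (symb \<Psi> (\<omega> + \<alpha>)))\<^sup>2 * norm (\<omega> + \<alpha>) powr (2 * s)) <= C\<^sup>2 * (norm \<omega> powr (2 * k))"
      by (simp add: power_mult_distrib powr_double_exponent)
    qed auto
   qed
  qed
  then show ?thesis using C by (intro exI[of _ "C\<^sup>2"] conjI exI[of _ \<rho>]) auto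
 qed
 then obtain C \<rho> where C: "C > 0" "\<rho> > 0" and ae: "AE \<omega> in lebesgue. norm \<omega> < \<rho> --> (\<forall>\<Psi>\<in>B. ?I \<Psi> \<omega> <= C * (norm \<omega> powr (2 * k)))"
  using AE_bound_finite[OF basis(1), of "\<lambda>\<omega>. norm \<omega> powr (2 * k)" ?I] by force
 have "AE \<omega> in lebesgue. norm \<omega> < \<rho> --> norm (qform (gramian0 s B \<omega>) (v \<omega>)) <= (card B * C) * norm (norm \<omega> powr (2 * k))"
  using ae AE_gram_summable_B
 proof eventually_elim
  case (elim \<omega>)
  show ?case
  proof
   assume w: "norm \<omega> < \<rho>"
   have "0 <= qform (gramian0 s B \<omega>) (v \<omega>)"
    unfolding gramian0_def by (rule gram_sum_nonneg[OF elim(2)]) auto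
   moreover have "qform (gramian0 s B \<omega>) (v \<omega>) = (\<Sum>\<Psi>\<in>B. ?I \<Psi> \<omega>)"
    unfolding gramian0_def by (rule gram_form_symb(2)[OF elim(2)]) auto
   moreover have "(\<Sum>\<Psi>\<in>B. ?I \<Psi> \<omega>) <= card B * (C * norm \<omega> powr (2 * k))"
    using elim(1) w by (intro sum_bounded_above) auto
   ultimately show "norm (qform (gramian0 s B \<omega>) (v \<omega>)) <= (card B * C) * norm (norm \<omega> powr (2 * k))"
    by (simp add: mult.assoc)
  qed
 qed
 then show ?thesis unfolding ae_zero_of_order_def diff_zero by (rule bigo_ae_nhds_0I[OF C(2)])
qed

lemma v_norm_bounds:
 obtains c C \<rho> :: real where "c > 0" "C > 0" "\<rho> > 0" "AE \<omega> in lebesgue. norm \<omega> < \<rho> --> c <= (norm (v \<omega>))\<^sup>2 \<and> (norm (v \<omega>))\<^sup>2 <= C"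
proof -
 have up: "(\<lambda>\<omega>. Re (cinner (v \<omega>) (v \<omega>))) \<in> O[ae_nhds 0](\<lambda>_. 1)" using A2(3) by (rule bigthetaD1)
 have lo: "(\<lambda>_. 1::real) \<in> O[ae_nhds 0](\<lambda>\<omega>. Re (cinner (v \<omega>) (v \<omega>)))"
  using bigthetaD2[OF A2(3)] by (simp add: bigomega_iff_bigo)
 obtain C1 r1 where 1: "C1 > 0" "r1 > 0" "AE \<omega> in lebesgue. norm \<omega> < r1 --> norm (Re (cinner (v \<omega>) (v \<omega>))) <= C1 * norm (1::real)"
  by (rule bigo_ae_nhds_0D[OF up])
 obtain C2 r2 where 2: "C2 > 0" "r2 > 0" "AE \<omega> in lebesgue. norm \<omega> < r2 --> norm (1::real) <= C2 * norm (Re (cinner (v \<omega>) (v \<omega>)))"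
  by (rule bigo_ae_nhds_0D[OF lo])
 have "AE \<omega> in lebesgue. norm \<omega> < min r1 r2 --> 1 / C2 <= (norm (v \<omega>))\<^sup>2 \<and> (norm (v \<omega>))\<^sup>2 <= C1"
  using 1(3) 2(3) by eventually_elim (use 2(1) in \<open>auto simp: cinner_self field_simps\<close>)
 then show ?thesis using 1 2 by (intro that[of "1 / C2" C1 "min r1 r2"]) auto
qed

lemma bigtheta_ae_nhds_0I:
 assumes up: "(\<lambda>\<omega>. f \<omega>) \<in> O[ae_nhds 0](g)"
  and lo: "c > 0" "\<rho> > 0" "AE \<omega> in lebesgue. norm \<omega> < \<rho> --> c * norm (g \<omega>) <= norm (f \<omega>)"
 shows "f \<in> \<Theta>[ae_nhds 0](g)"
proof (rule bigthetaI[OF up])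
 show "f \<in> \<Omega>[ae_nhds 0](g)"
  by (rule landau_omega.bigI[OF lo(1)], subst eventually_ae_nhds_0) (use lo in auto)
qed

lemma qform_upper:
 "(\<lambda>\<omega>. qform (gramian s B \<omega>) (v \<omega>)) \<in> O[ae_nhds 0](\<lambda>\<omega>. norm \<omega> powr (2 * s))"
proof -
 obtain c C r where v: "c > 0" "C > 0" "r > 0" "AE \<omega> in lebesgue. norm \<omega> < r --> c <= (norm (v \<omega>))\<^sup>2 \<and> (norm (v \<omega>))\<^sup>2 <= C"
  by (rule v_norm_bounds)
 obtain D q where g: "D > 0" "q > 0" "AE \<omega> in lebesgue. norm \<omega> < q --> norm (norm (gramian s B \<omega>)) <= D * norm (norm \<omega> powr (2 * s))"
  by (rule bigo_ae_nhds_0D[OF A1(2)])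
 have "AE \<omega> in lebesgue. norm \<omega> < min r q --> norm (qform (gramian s B \<omega>) (v \<omega>)) <= (D * C) * norm (norm \<omega> powr (2 * s))"
  using v(4) g(3)
 proof eventually_elim
  case (elim \<omega>)
  show ?case
  proof
   assume w: "norm \<omega> < min r q"
   have "norm (qform (gramian s B \<omega>) (v \<omega>)) <= norm (gramian s B \<omega>) * (norm (v \<omega>))\<^sup>2"
    using abs_qform_le by simp
   also have "... <= (D * norm \<omega> powr (2 * s)) * C" using elim w g(1) v(2) by (intro mult_mono) auto
   finally show "norm (qform (gramian s B \<omega>) (v \<omega>)) <= (D * C) * norm (norm \<omega> powr (2 * s))"
    by (simp add: mult_ac)
  qed
 qed
 then show ?thesis using v g by (intro bigo_ae_nhds_0I[of "min r q"]) auto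
qed

lemma qform_theta_if_invertible:
 assumes inv: "\<forall>\<^sub>F \<omega> in ae_nhds 0. invertible (gramian s B \<omega>)"
  and bd: "(\<lambda>\<omega>. norm (matrix_inv (gramian s B \<omega>))) \<in> O[ae_nhds 0](\<lambda>\<omega>. norm \<omega> powr (- 2 * s))"
 shows "(\<lambda>\<omega>. qform (gramian s B \<omega>) (v \<omega>)) \<in> \<Theta>[ae_nhds 0](\<lambda>\<omega>. norm \<omega> powr (2 * s))"
proof -
 obtain c C r where v: "c > 0" "C > 0" "r > 0" "AE \<omega> in lebesgue. norm \<omega> < r --> c <= (norm (v \<omega>))\<^sup>2 \<and> (norm (v \<omega>))\<^sup>2 <= C"
  by (rule v_norm_bounds)
 obtain D q where g: "D > 0" "q > 0" "AE \<omega> in lebesgue. norm \<omega> < q --> norm (norm (matrix_inv (gramian s B \<omega>))) <= D * norm (norm \<omega> powr (- 2 * s))"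
  by (rule bigo_ae_nhds_0D[OF bd])
 obtain p where p: "p > 0" "AE \<omega> in lebesgue. norm \<omega> < p --> invertible (gramian s B \<omega>)"
  using inv unfolding eventually_ae_nhds_0 by blast
 have n0: "AE \<omega> in lebesgue. \<omega> \<noteq> (0::real^'d)" by (rule AE_completion[OF AE_lborel_singleton])
 have "AE \<omega> in lebesgue. norm \<omega> < min p (min r q) --> (c / D) * norm (norm \<omega> powr (2 * s)) <= norm (qform (gramian s B \<omega>) (v \<omega>))"
  using v(4) g(3) p(2) n0 AE_gram_summable_B
 proof eventually_elim
  case (elim \<omega>)
  show ?case
  proof
   assume w: "norm \<omega> < min p (min r q)"
   define N where "N = D * norm \<omega> powr (- 2 * s)"
   have Np: "N > 0" using g(1) elim(4) by (simp add: N_def)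
   have pw: "1 / norm \<omega> powr (- 2 * s) = norm \<omega> powr (2 * s)" by (simp add: powr_minus_divide)
   have "(c / D) * norm (norm \<omega> powr (2 * s)) = c / N"
    by (simp add: N_def flip: pw)
   also have "... <= (norm (v \<omega>))\<^sup>2 / N" using elim(1) w Np by (intro divide_right_mono) auto
   also have "... <= qform (gramian s B \<omega>) (v \<omega>)"
    unfolding gramian_def
   proof (rule qform_ge_inverse[OF elim(5) order_refl _ _ Np])
    show "invertible (gram_sum dual_lattice s B \<omega>)" using elim(3) w by (simp add: gramian_def)
    show "norm (matrix_inv (gram_sum dual_lattice s B \<omega>)) <= N" using elim(2) w by (simp add: gramian_def N_def)
   qed
   finally show "(c / D) * norm (norm \<omega> powr (2 * s)) <= norm (qform (gramian s B \<omega>) (v \<omega>))" by simp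
  qed
 qed
 then show ?thesis using v g p by (intro bigtheta_ae_nhds_0I[OF qform_upper, of "c / D" "min p (min r q)"]) auto
qed

text \<open>A lower bound for the symbol of one element of \<open>R\<close> is a lower bound for the symbols of the basis together, and the
 term \<open>\<alpha> = 0\<close> alone of the lattice sum then has the size \<open>|\<omega>|\<^sup>2\<^sup>s\<close>.\<close>

lemma qform_theta_if_symb_lower:
 assumes Phi: "\<Phi> \<in> R" and c: "c > 0" and lo: "\<forall>\<^sub>F \<omega> in ae_nhds 0. c <= norm (symb \<Phi> \<omega>)"
 shows "(\<lambda>\<omega>. qform (gramian s B \<omega>) (v \<omega>)) \<in> \<Theta>[ae_nhds 0](\<lambda>\<omega>. norm \<omega> powr (2 * s))"
proof -
 obtain u where u: "AE \<omega> in lebesgue. vhat \<Phi> \<omega> = (\<Sum>\<Psi>\<in>B. u \<Psi> *s vhat \<Psi> \<omega>)"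
 proof (rule vhat_span[OF basis(1)])
  show "\<exists>F. has_fourier (\<Psi> $ i) F" if "\<Psi> \<in> B" for \<Psi> i using has_fourier_entry B_subset that by blast
  show "\<Phi> \<in> vfunctional.span B" using Phi basis(2) by simp
 qed
 obtain p where p: "p > 0" "AE \<omega> in lebesgue. norm \<omega> < p --> c <= norm (symb \<Phi> \<omega>)"
  using lo unfolding eventually_ae_nhds_0 by blast
 define U where "U = L2_set (\<lambda>\<Psi>. norm (u \<Psi>)) B + 1"
 have U: "U > 0" "L2_set (\<lambda>\<Psi>. norm (u \<Psi>)) B <= U"
  using L2_set_nonneg[of "\<lambda>\<Psi>. norm (u \<Psi>)" B] unfolding U_def by linarith+
 have "AE \<omega> in lebesgue. norm \<omega> < p --> (c\<^sup>2 / U\<^sup>2) * norm (norm \<omega> powr (2 * s)) <= norm (qform (gramian s B \<omega>) (v \<omega>))"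
  using u p(2) AE_gram_summable_B
 proof eventually_elim
  case (elim \<omega>)
  show ?case
  proof
   assume w: "norm \<omega> < p"
   have "symb \<Phi> \<omega> = (\<Sum>\<Psi>\<in>B. u \<Psi> * symb \<Psi> \<omega>)"
    unfolding symb_def elim(1) cinner_def
    by (simp add: sum_distrib_left) (subst sum.swap, simp add: mult_ac)
   then have "c <= L2_set (\<lambda>\<Psi>. norm (u \<Psi>)) B * L2_set (\<lambda>\<Psi>. norm (symb \<Psi> \<omega>)) B"
    using elim(2) w norm_sum_mult_le[of u "\<lambda>\<Psi>. symb \<Psi> \<omega>" B] by simp
   also have "... <= U * L2_set (\<lambda>\<Psi>. norm (symb \<Psi> \<omega>)) B" by (intro mult_right_mono U(2)) simp
   finally have "c\<^sup>2 <= (U * L2_set (\<lambda>\<Psi>. norm (symb \<Psi> \<omega>)) B)\<^sup>2" using c by (intro power_mono) auto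
   then have "c\<^sup>2 / U\<^sup>2 <= (L2_set (\<lambda>\<Psi>. norm (symb \<Psi> \<omega>)) B)\<^sup>2"
    using U(1) by (simp add: power_mult_distrib field_simps)
   also have "... = (\<Sum>\<Psi>\<in>B. (norm (symb \<Psi> \<omega>))\<^sup>2)" by (simp add: L2_set_def sum_nonneg)
   finally have "(c\<^sup>2 / U\<^sup>2) * norm \<omega> powr (2 * s) <= (\<Sum>\<Psi>\<in>B. (norm (symb \<Psi> \<omega>))\<^sup>2) * norm \<omega> powr (2 * s)"
    by (intro mult_right_mono) auto
   also have "... = (\<Sum>\<Psi>\<in>B. (norm (symb \<Psi> \<omega>))\<^sup>2 * norm \<omega> powr (2 * s))" by (rule sum_distrib_right)
   also have "... <= (\<Sum>\<Psi>\<in>B. \<Sum>\<^sub>\<infinity>\<alpha>\<in>dual_lattice. (norm (symb \<Psi> (\<omega> + \<alpha>)))\<^sup>2 * norm (\<omega> + \<alpha>) powr (2 * s))"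
   proof (rule sum_mono)
    fix \<Psi> assume Psi: "\<Psi> \<in> B"
    show "(norm (symb \<Psi> \<omega>))\<^sup>2 * norm \<omega> powr (2 * s) <= (\<Sum>\<^sub>\<infinity>\<alpha>\<in>dual_lattice. (norm (symb \<Psi> (\<omega> + \<alpha>)))\<^sup>2 * norm (\<omega> + \<alpha>) powr (2 * s))"
     using finite_sum_le_infsum[OF gram_form_symb(1)[OF elim(3) order_refl Psi], of "{0}"] by simp
   qed
   also have "... = qform (gramian s B \<omega>) (v \<omega>)"
    unfolding gramian_def by (rule gram_form_symb(2)[OF elim(3) order_refl, symmetric])
   finally show "(c\<^sup>2 / U\<^sup>2) * norm (norm \<omega> powr (2 * s)) <= norm (qform (gramian s B \<omega>) (v \<omega>))" by simp
  qed
 qed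
 then show ?thesis using U(1) c p by (intro bigtheta_ae_nhds_0I[OF qform_upper, of "c\<^sup>2 / U\<^sup>2" p]) auto
qed

text \<open>Along the orbit \<open>\<omega>/2\<^sup>n\<close> the recursion telescopes to the value at the origin.\<close>

lemma symb_value_at_0:
 assumes Phi: "\<Phi> \<in> R" and g: "isCont g 0" and ev: "\<forall>\<^sub>F \<omega> in ae_nhds 0. symb \<Phi> \<omega> = g \<omega>"
 shows "(\<lambda>\<omega>. symb \<Phi> \<omega> - g 0) \<in> O[ae_nhds 0](\<lambda>\<omega>. of_real (norm \<omega> powr k))"
proof -
 obtain C1 r1 where 1: "C1 > 0" "r1 > 0"
  "AE \<omega> in lebesgue. norm \<omega> < r1 --> (\<forall>\<beta>\<in>dual_lattice. \<forall>l\<in>unit_vertices.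
   norm (symb \<Phi> (2 *\<^sub>R (\<omega> + pi *\<^sub>R l + \<beta>)) - (if l = 0 then symb \<Phi> (\<omega> + \<beta>) else 0))
    <= C1 * norm \<omega> powr k * norm (vhat \<Phi> (\<omega> + pi *\<^sub>R l + \<beta>)))"
  by (rule symbol_recursion[OF Phi])
 obtain C2 r2 where 2: "C2 > 0" "r2 > 0"
  "AE \<omega> in lebesgue. norm \<omega> < r2 --> (wnorm_le dual_lattice s (vhat \<Phi>) \<omega> (C2 * norm \<omega> powr s))"
  by (rule vhat_bounds[OF Phi])
 obtain p where p: "p > 0" "AE \<omega> in lebesgue. norm \<omega> < p --> symb \<Phi> \<omega> = g \<omega>"
  using ev unfolding eventually_ae_nhds_0 by blast
 have n0: "AE \<omega> in lebesgue. \<omega> \<noteq> (0::real^'d)" by (rule AE_completion[OF AE_lborel_singleton])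
 define \<rho> where "\<rho> = min p (min r1 r2)"
 have rho: "\<rho> > 0" using 1 2 p by (simp add: \<rho>_def)
 define M where "M = C1 * C2"
 have M: "M > 0" using 1 2 by (simp add: M_def)
 define q where "q = (1/2::real) powr k"
 have q: "0 < q" "q < 1" using k_pos powr_less_mono2[of k "1/2" "1::real"] by (auto simp: q_def)
 have step: "AE \<omega> in lebesgue. norm \<omega> < \<rho> --> symb \<Phi> \<omega> = g \<omega> \<and> norm (symb \<Phi> (2 *\<^sub>R \<omega>) - symb \<Phi> \<omega>) <= M * norm \<omega> powr k"
  using 1(3) 2(3) p(2) n0
 proof eventually_elim
  case (elim \<omega>)
  show ?case
  proof
   assume w: "norm \<omega> < \<rho>"
   have "norm \<omega> powr s * norm (vhat \<Phi> \<omega>) <= C2 * norm \<omega> powr s"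
    using elim(2)[rule_format, of "{0}"] w by (simp add: wnorm_def L2_set_def \<rho>_def)
   then have "norm (vhat \<Phi> \<omega>) <= C2" using elim(4) by (simp add: mult.commute)
   then have "C1 * norm \<omega> powr k * norm (vhat \<Phi> \<omega>) <= C1 * norm \<omega> powr k * C2"
    using 1(1) by (intro mult_left_mono) auto
   moreover have "norm (symb \<Phi> (2 *\<^sub>R \<omega>) - symb \<Phi> \<omega>) <= C1 * norm \<omega> powr k * norm (vhat \<Phi> \<omega>)"
    using elim(1)[rule_format, of 0 0] w by (simp add: \<rho>_def)
   ultimately show "symb \<Phi> \<omega> = g \<omega> \<and> norm (symb \<Phi> (2 *\<^sub>R \<omega>) - symb \<Phi> \<omega>) <= M * norm \<omega> powr k"
    using elim(3) w by (simp add: \<rho>_def M_def mult_ac)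
  qed
 qed
 have "AE \<omega> in lebesgue. norm \<omega> < \<rho> --> norm (symb \<Phi> \<omega> - g 0) <= (M * q / (1 - q)) * norm (complex_of_real (norm \<omega> powr k))"
  using AE_dyadic_orbit[OF step]
 proof eventually_elim
  case (elim \<omega>)
  show ?case
  proof
   assume w: "norm \<omega> < \<rho>"
   let ?x = "\<lambda>n. (1/2::real)^n *\<^sub>R \<omega>"
   have g_eq: "symb \<Phi> (?x n) = g (?x n)" and st: "norm (symb \<Phi> (2 *\<^sub>R ?x n) - symb \<Phi> (?x n)) <= M * norm (?x n) powr k" for n
    using elim w by blast+
   have tele: "norm (symb \<Phi> \<omega> - symb \<Phi> (?x n)) <= M * norm \<omega> powr k * (\<Sum>j<n. q ^ Suc j)" for n
   proof (induction n)
    case (Suc n)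
    have pw: "norm (?x (Suc n)) powr k = q ^ Suc n * norm \<omega> powr k"
    proof -
     have "norm (?x (Suc n)) powr k = ((1/2) ^ Suc n) powr k * norm \<omega> powr k" by (simp add: powr_mult[symmetric])
     also have "((1/2::real) ^ Suc n) powr k = q ^ Suc n"
      unfolding q_def by (simp only: powr_power powr_realpow[symmetric] powr_powr mult.commute)
     finally show ?thesis .
    qed
    have "norm (symb \<Phi> (?x n) - symb \<Phi> (?x (Suc n))) <= M * (q ^ Suc n * norm \<omega> powr k)"
     using st[of "Suc n"] unfolding pw by simp
    then have "norm (symb \<Phi> \<omega> - symb \<Phi> (?x (Suc n))) <= M * norm \<omega> powr k * (\<Sum>j<n. q ^ Suc j) + M * (q ^ Suc n * norm \<omega> powr k)"
     using Suc norm_triangle_ineq[of "symb \<Phi> \<omega> - symb \<Phi> (?x n)" "symb \<Phi> (?x n) - symb \<Phi> (?x (Suc n))"] by simp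
    then show ?case by (simp add: algebra_simps)
   qed simp
   have geo: "(\<Sum>j<n. q ^ Suc j) <= q / (1 - q)" for n
   proof -
    have "(\<Sum>j<n. q ^ Suc j) = q * (\<Sum>j<n. q ^ j)" by (simp add: sum_distrib_left)
    also have "(\<Sum>j<n. q ^ j) = (1 - q ^ n) / (1 - q)" using q by (simp add: sum_gp_strict)
    also have "q * ... <= q * (1 / (1 - q))" using q by (intro mult_left_mono divide_right_mono) auto
    finally show ?thesis by simp
   qed
   have bd: "norm (symb \<Phi> \<omega> - g (?x n)) <= M * norm \<omega> powr k * (q / (1 - q))" for n
    using tele[of n] mult_left_mono[OF geo[of n], of "M * norm \<omega> powr k"] M by (simp add: g_eq)
   have "(\<lambda>n. ?x n) \<longlonglongrightarrow> 0 *\<^sub>R \<omega>" by (intro tendsto_intros) (auto intro: LIMSEQ_realpow_zero)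
   then have "(\<lambda>n. g (?x n)) \<longlonglongrightarrow> g 0" by (intro isCont_tendsto_compose[OF g]) simp
   then have "(\<lambda>n. norm (symb \<Phi> \<omega> - g (?x n))) \<longlonglongrightarrow> norm (symb \<Phi> \<omega> - g 0)" by (intro tendsto_intros)
   then have "norm (symb \<Phi> \<omega> - g 0) <= M * norm \<omega> powr k * (q / (1 - q))"
    by (rule LIMSEQ_le_const2) (use bd in auto)
   then show "norm (symb \<Phi> \<omega> - g 0) <= (M * q / (1 - q)) * norm (complex_of_real (norm \<omega> powr k))"
    by (simp add: mult_ac)
  qed
 qed
 then show ?thesis by (rule bigo_ae_nhds_0I[OF rho])
qed

text \<open>The value of the quotient at \<open>v(\<omega>)\<close> bounds the infimum from above, and positive semidefiniteness bounds it by \<open>0\<close>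
 from below.\<close>

lemma supervector_and_coherence:
 assumes l2: "\<And>\<Psi>. \<Psi> \<in> B ==> symb_order \<Psi>"
  and th: "(\<lambda>\<omega>. qform (gramian s B \<omega>) (v \<omega>)) \<in> \<Theta>[ae_nhds 0](\<lambda>\<omega>. norm \<omega> powr (2 * s))"
 shows "universal_supervector s k B v" "provides_coherent_order s k B"
proof -
 let ?G = "\<lambda>\<omega>. qform (gramian s B \<omega>)" and ?H = "\<lambda>\<omega>. qform (gramian0 s B \<omega>)"
 have up: "(\<lambda>\<omega>. ?H \<omega> (v \<omega>)) \<in> O[ae_nhds 0](\<lambda>\<omega>. norm \<omega> powr (2 * k))"
  using gramian0_zero[OF l2] unfolding ae_zero_of_order_def by simp
 have lo: "(\<lambda>\<omega>. norm \<omega> powr (2 * s)) \<in> O[ae_nhds 0](\<lambda>\<omega>. ?G \<omega> (v \<omega>))"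
  using bigthetaD2[OF th] by (simp add: bigomega_iff_bigo)
 obtain C r where 1: "C > 0" "r > 0" "AE \<omega> in lebesgue. norm \<omega> < r --> norm (?H \<omega> (v \<omega>)) <= C * norm (norm \<omega> powr (2 * k))"
  by (rule bigo_ae_nhds_0D[OF up])
 obtain D p where 2: "D > 0" "p > 0" "AE \<omega> in lebesgue. norm \<omega> < p --> norm (norm \<omega> powr (2 * s)) <= D * norm (?G \<omega> (v \<omega>))"
  by (rule bigo_ae_nhds_0D[OF lo])
 have n0: "AE \<omega> in lebesgue. \<omega> \<noteq> (0::real^'d)" by (rule AE_completion[OF AE_lborel_singleton])
 define \<rho> where "\<rho> = min r p"
 have rho: "\<rho> > 0" using 1 2 by (simp add: \<rho>_def)
 have ratio: "AE \<omega> in lebesgue. norm \<omega> < \<rho> --> \<omega> \<noteq> 0 \<and> gram_summable s B \<omega> \<and> ?G \<omega> (v \<omega>) \<noteq> 0 \<and>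
   norm (?H \<omega> (v \<omega>) / ?G \<omega> (v \<omega>)) <= (C * D) * norm \<omega> powr (2 * k - 2 * s)"
  using 1(3) 2(3) n0 AE_gram_summable_B
 proof eventually_elim
  case (elim \<omega>)
  show ?case
  proof
   assume w: "norm \<omega> < \<rho>"
   have a: "norm \<omega> powr (2 * s) <= D * \<bar>?G \<omega> (v \<omega>)\<bar>" and b: "\<bar>?H \<omega> (v \<omega>)\<bar> <= C * norm \<omega> powr (2 * k)"
    using elim(1,2) w by (auto simp: \<rho>_def)
   have nz: "?G \<omega> (v \<omega>) \<noteq> 0" using a elim(3) by (metis abs_zero mult_zero_right norm_eq_zero powr_gt_zero not_less)
   have "norm (?H \<omega> (v \<omega>) / ?G \<omega> (v \<omega>)) <= (C * norm \<omega> powr (2 * k)) / (norm \<omega> powr (2 * s) / D)"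
    unfolding real_norm_def abs_divide using a b 2(1) elim(3) 1(1) by (intro frac_le) (auto simp: field_simps)
   also have "... = (C * D) * norm \<omega> powr (2 * k - 2 * s)" by (simp add: powr_diff)
   finally show "\<omega> \<noteq> 0 \<and> gram_summable s B \<omega> \<and> ?G \<omega> (v \<omega>) \<noteq> 0 \<and> norm (?H \<omega> (v \<omega>) / ?G \<omega> (v \<omega>)) <= (C * D) * norm \<omega> powr (2 * k - 2 * s)"
    using nz elim(3,4) by simp
  qed
 qed
 show "universal_supervector s k B v"
  unfolding universal_supervector_def
 proof (intro conjI A2(2))
  have "AE \<omega> in lebesgue. norm \<omega> < \<rho> --> ?G \<omega> (v \<omega>) \<noteq> 0" using ratio by eventually_elim blast
  then show "\<forall>\<^sub>F \<omega> in ae_nhds 0. ?G \<omega> (v \<omega>) \<noteq> 0"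
   unfolding eventually_ae_nhds_0 using rho by blast
  have "AE \<omega> in lebesgue. norm \<omega> < \<rho> --> norm (?H \<omega> (v \<omega>) / ?G \<omega> (v \<omega>)) <= (C * D) * norm (norm \<omega> powr (2 * k - 2 * s))"
   using ratio by eventually_elim simp
  then show "(\<lambda>\<omega>. ?H \<omega> (v \<omega>) / ?G \<omega> (v \<omega>)) \<in> O[ae_nhds 0](\<lambda>\<omega>. norm \<omega> powr (2 * k - 2 * s))"
   by (rule bigo_ae_nhds_0I[OF rho])
 qed
 let ?q = "\<lambda>\<omega>. ereal (norm \<omega> powr (- (2 * k - 2 * s))) * coherence_quotient s B \<omega>"
 have meas: "?q \<in> lmeas"
 proof (rule borel_measurable_ereal_times)
  show "(\<lambda>\<omega>::real^'d. ereal (norm \<omega> powr (- (2 * k - 2 * s)))) \<in> lmeas"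
   by (rule measurable_completion) measurable
  show "coherence_quotient s B \<in> lmeas"
   using coherence_quotient_measurable[OF basis(1)] sobolev B_subset by blast
 qed
 have bound: "AE \<omega> in lebesgue_on (ball 0 \<rho>). \<bar>?q \<omega>\<bar> <= ereal (C * D)"
  unfolding AE_restrict_space_iff[of "ball 0 \<rho>" lebesgue, simplified]
  using ratio
 proof eventually_elim
  case (elim \<omega>)
  show ?case
  proof
   assume "norm \<omega> < \<rho>"
   then have e: "\<omega> \<noteq> 0" "gram_summable s B \<omega>" "?G \<omega> (v \<omega>) \<noteq> 0" "norm (?H \<omega> (v \<omega>) / ?G \<omega> (v \<omega>)) <= (C * D) * norm \<omega> powr (2 * k - 2 * s)"
    using elim by auto
   have nn: "?G \<omega> x \<ge> 0" "?H \<omega> x \<ge> 0" for x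
    unfolding gramian_def gramian0_def by (auto intro!: gram_sum_nonneg[OF e(2)])
   have "0 <= coherence_quotient s B \<omega>"
    unfolding coherence_quotient_def using nn by (intro INF_greatest) auto
   then have 0: "0 <= ?q \<omega>" by simp
   have "coherence_quotient s B \<omega> <= ereal (?H \<omega> (v \<omega>) / ?G \<omega> (v \<omega>))"
    unfolding coherence_quotient_def using e(3) by (intro INF_lower) simp
   also have "... <= ereal ((C * D) * norm \<omega> powr (2 * k - 2 * s))" unfolding ereal_less_eq(3) by (rule order_trans[OF abs_ge_self e(4)[unfolded real_norm_def]])
   finally have "?q \<omega> <= ereal (norm \<omega> powr (- (2 * k - 2 * s))) * ereal ((C * D) * norm \<omega> powr (2 * k - 2 * s))"
    by (intro ereal_mult_left_mono) simp_all
   also have "... = ereal (C * D)"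
   proof -
    have "norm \<omega> powr (- (2 * k - 2 * s)) * norm \<omega> powr (2 * k - 2 * s) = 1"
     using e(1) by (simp only: powr_add[symmetric]) simp
    then have "norm \<omega> powr (- (2 * k - 2 * s)) * ((C * D) * norm \<omega> powr (2 * k - 2 * s)) = C * D"
     by (simp only: mult.left_commute[of _ "C * D"])
    then show ?thesis by (simp only: times_ereal.simps)
   qed
   finally show "\<bar>?q \<omega>\<bar> <= ereal (C * D)" using 0 by (simp only: abs_ereal_ge0)
  qed
 qed
 show "provides_coherent_order s k B"
  unfolding provides_coherent_order_def Let_def
  by (intro exI[of _ "ball 0 \<rho>"] conjI) (use rho bound measurable_restrict_space1[OF meas] in auto)
qed

end

section \<open>Trigonometric approximation of periodic functions\<close>

text \<open>Periodic functions are functions on the torus \<open>(S\<^sup>1)\<^sup>d\<close>, embedded in complex Euclidean space;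
 trigonometric polynomials are the restrictions of polynomial functions.\<close>

definition torus_point :: "real^'d::finite => complex^'d" where
 "torus_point \<omega> = (\<chi> i. cis (\<omega> $ i))"

definition torus_args :: "complex^'d::finite => real^'d" where
 "torus_args z = (\<chi> i. Arg (z $ i))"

definition reduce :: "real^'d::finite => real^'d" where
 "reduce \<omega> = torus_args (torus_point \<omega>)"

definition torus :: "(complex^'d::finite) set" where
 "torus = {z. \<forall>i. norm (z $ i) = 1}"

lemma torus_point_in_torus: "torus_point \<omega> \<in> torus"
 by (simp add: torus_point_def torus_def)

lemma compact_torus: "compact (torus :: (complex^'d::finite) set)"
proof -
 have "closed (torus :: (complex^'d) set)"
  unfolding torus_def by (intro closed_Collect_all closed_Collect_eq continuous_intros)
 moreover have "norm z <= CARD('d)" if "z \<in> torus" for z :: "complex^'d"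
 proof -
  have "norm z <= (\<Sum>i\<in>UNIV. norm (z $ i))" unfolding norm_vec_def by (rule L2_set_le_sum) simp
  then show ?thesis using that by (simp add: torus_def)
 qed
 ultimately show ?thesis unfolding compact_eq_bounded_closed bounded_iff by blast
qed

lemma continuous_torus_point: "continuous_on A torus_point"
 unfolding torus_point_def cis_conv_exp by (intro continuous_intros)

lemma reduce_small: "norm \<omega> < pi ==> reduce \<omega> = \<omega>"
proof -
 assume "norm \<omega> < pi"
 then have "\<bar>\<omega> $ i\<bar> < pi" for i using component_le_norm_cart[of \<omega> i] by linarith
 then have "\<omega> $ i \<in> {-pi<..pi}" for i     by (simp add: abs_less_iff less_imp_le minus_less_iff)
 then have "Arg (cis (\<omega> $ i)) = \<omega> $ i" for i by (rule Arg_cis)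
 then show ?thesis by (simp add: reduce_def torus_args_def torus_point_def vec_eq_iff)
qed

lemma reduce_dual_lattice: "reduce \<omega> - \<omega> \<in> dual_lattice"
 unfolding dual_lattice_iff
proof
 fix i
 have "cis (Arg (cis (\<omega> $ i))) = cis (\<omega> $ i)" by (simp add: cis_Arg sgn_div_norm)
 then have "sin (Arg (cis (\<omega> $ i))) = sin (\<omega> $ i) \<and> cos (Arg (cis (\<omega> $ i))) = cos (\<omega> $ i)"
  by (simp add: complex_eq_iff)
 then obtain n :: int where "Arg (cis (\<omega> $ i)) = \<omega> $ i + 2 * pi * n" unfolding sin_cos_eq_iff by blast
 then show "\<exists>n::int. (reduce \<omega> - \<omega>) $ i = 2 * pi * of_int n"
  by (auto simp: reduce_def torus_args_def torus_point_def)
qed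

lemma AE_reduce:
 assumes "AE x in lebesgue. Q x"
 shows "AE \<omega> in lebesgue. Q (reduce \<omega>)"
 using AE_lattice[OF assms]
proof eventually_elim
 case (elim \<omega>)
 then have "Q (\<omega> + pi *\<^sub>R 0 + (reduce \<omega> - \<omega>))" using reduce_dual_lattice unit_vertices_0 by blast
 then show ?case by simp
qed

text \<open>The arguments jump only at \<open>-1\<close>, where a function supported in a small ball
 vanishes.\<close>

lemma continuous_on_torus_args:
 fixes h :: "real^'d::finite => complex"
 assumes h: "continuous_on UNIV h" and supp: "\<And>x. norm x \<ge> 2 ==> h x = 0"
 shows "continuous_on torus (\<lambda>z. h (torus_args z))"
proof -
 let ?U = "{z :: complex^'d. \<forall>i. z $ i \<in> - \<real>\<^sub>\<le>\<^sub>0}" and ?W = "{z :: complex^'d. \<exists>i. Re (z $ i) < cos 2 * norm (z $ i)}"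
 have cos2: "- 1 < cos (2::real)" using cos_monotone_0_pi[of 2 pi] pi_gt3 by simp
 have "?U = (\<Inter>i\<in>UNIV. (\<lambda>z. z $ i) -` (- \<real>\<^sub>\<le>\<^sub>0))" by auto
 moreover have "open ((\<lambda>z :: complex^'d. z $ i) -` (- \<real>\<^sub>\<le>\<^sub>0))" for i
  by (intro open_vimage continuous_intros) (simp add: open_Compl)
 ultimately have oU: "open ?U" by (simp add: open_INT)
 have oW: "open ?W" by (intro open_Collect_ex open_Collect_less continuous_intros)
 have "continuous_on ?U torus_args"
  unfolding torus_args_def by (intro continuous_intros) auto
 then have cU: "continuous_on ?U (\<lambda>z. h (torus_args z))"
  by (rule continuous_on_compose2[OF h]) auto
 have "h (torus_args z) = 0" if z: "z \<in> ?W" for z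
 proof -
  obtain i where i: "Re (z $ i) < cos 2 * norm (z $ i)" using z by blast
  have "\<bar>Arg (z $ i)\<bar> > 2"
  proof (rule ccontr)
   assume "\<not> \<bar>Arg (z $ i)\<bar> > 2"
   then have "cos 2 <= cos \<bar>Arg (z $ i)\<bar>" using pi_gt3 by (intro cos_monotone_0_pi_le) auto
   then have "norm (z $ i) * cos 2 <= norm (z $ i) * cos (Arg (z $ i))" by (intro mult_left_mono) auto
   also have "... = Re (z $ i)" using arg_cong[OF rcis_cmod_Arg[of "z $ i"], of Re] by simp
   finally show False using i by (simp add: mult.commute)
  qed
  then have "2 <= norm (torus_args z)"
   using component_le_norm_cart[of "torus_args z" i] by (simp add: torus_args_def)
  then show ?thesis by (rule supp)
 qed
 then have cW: "continuous_on ?W (\<lambda>z. h (torus_args z))"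
  by (subst continuous_on_cong[OF refl, of _ _ "\<lambda>_. 0"]) auto
 have "torus \<subseteq> ?U \<union> ?W"
 proof
  fix z :: "complex^'d" assume z: "z \<in> torus"
  show "z \<in> ?U \<union> ?W"
  proof (cases "z \<in> ?U")
   case False
   then obtain i where i: "z $ i \<in> \<real>\<^sub>\<le>\<^sub>0" by auto
   then obtain x where x: "z $ i = of_real x" "x <= 0" by (auto elim: nonpos_Reals_cases)
   then have "x = -1" using z by (auto simp: torus_def dest: spec[of _ i])
   then show ?thesis using x cos2 by (auto intro!: exI[of _ i])
  qed simp
 qed
 then show ?thesis by (rule continuous_on_subset[OF continuous_on_open_Un[OF oU oW cU cW]])
qed

text \<open>A bounded function supported near the origin is a limit almost everywhere of continuous
 ones with the same bound, supported slightly further out.\<close>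

lemma bounded_AE_continuous_limit:
 fixes \<beta> :: "real^'d::finite => complex"
 assumes m: "\<beta> \<in> lmeas" and M: "\<And>x. norm (\<beta> x) <= M" and supp: "\<And>x. norm x \<ge> 1 ==> \<beta> x = 0"
 obtains h :: "nat => real^'d => complex" where "\<And>n. continuous_on UNIV (h n)" "\<And>n x. norm (h n x) <= M"
  "\<And>n x. norm x \<ge> 2 ==> h n x = 0" "AE x in lebesgue. (\<lambda>n. h n x) \<longlonglongrightarrow> \<beta> x"
proof -
 have M0: "M \<ge> 0" using M[of 0] norm_ge_zero[of "\<beta> 0"] by linarith
 obtain N g where N: "negligible N" and g: "\<And>n. continuous_on UNIV (g n)" and lim: "\<And>x. x \<notin> N ==> (\<lambda>n. g n x) \<longlonglongrightarrow> \<beta> x"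
  using lebesgue_measurable_imp_measurable_on[OF m, of UNIV] unfolding measurable_on_def by auto
 let ?K = "cball (0::complex) M"
 define clamp where "clamp = closest_point ?K"
 define \<psi> where "\<psi> x = max 0 (min 1 (2 - norm x))" for x :: "real^'d"
 define h where "h n x = of_real (\<psi> x) * clamp (g n x)" for n x
 have cl: "norm (clamp z) <= M" for z
  using closest_point_in_set[of ?K z] M0 unfolding clamp_def by auto
 have ccl: "continuous (at z) clamp" for z
  unfolding clamp_def by (rule continuous_at_closest_point) (use M0 in auto)
 show ?thesis
 proof (rule that[of h])
  show "continuous_on UNIV (h n)" for n
   unfolding h_def \<psi>_def clamp_def
   by (intro continuous_intros continuous_on_compose2[OF continuous_on_closest_point g]) (use M0 in auto)
  show "norm (h n x) <= M" for n x
  proof -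
   have "norm (h n x) = \<psi> x * norm (clamp (g n x))" by (simp add: h_def norm_mult \<psi>_def)
   also have "... <= 1 * M" using cl M0 by (intro mult_mono) (auto simp: \<psi>_def)
   finally show ?thesis by simp
  qed
  show "h n x = 0" if "norm x \<ge> 2" for n x using that by (simp add: h_def \<psi>_def)
  show "AE x in lebesgue. (\<lambda>n. h n x) \<longlonglongrightarrow> \<beta> x"
  proof (rule AE_I'[of N])
   show "N \<in> null_sets lebesgue" using N by (simp add: negligible_iff_null_sets)
   have "(\<lambda>n. h n x) \<longlonglongrightarrow> \<beta> x" if "x \<notin> N" for x
   proof -
    have "(\<lambda>n. h n x) \<longlonglongrightarrow> of_real (\<psi> x) * clamp (\<beta> x)"
     unfolding h_def by (intro tendsto_intros isCont_tendsto_compose[OF ccl] lim that)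
    moreover have "clamp (\<beta> x) = \<beta> x" unfolding clamp_def using M[of x] by (intro closest_point_self) simp
    moreover have "of_real (\<psi> x) * \<beta> x = \<beta> x"
     using supp[of x] by (cases "norm x \<ge> 1") (auto simp: \<psi>_def)
    ultimately show ?thesis by simp
   qed
   then show "{x \<in> space lebesgue. \<not> (\<lambda>n. h n x) \<longlonglongrightarrow> \<beta> x} \<subseteq> N" by blast
  qed
 qed
qed

lemma reduce_continuous:
 assumes "continuous_on UNIV h" "\<And>x. norm x \<ge> 2 ==> h x = (0::complex)"
 shows "continuous_on UNIV (\<lambda>\<omega>. h (reduce \<omega>))"
 unfolding reduce_def
 by (rule continuous_on_compose2[OF continuous_on_torus_args[OF assms] continuous_torus_point]) (auto intro: torus_point_in_torus)

lemma reduce_measurable: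
 fixes \<beta> :: "real^'d::finite => complex"
 assumes "\<beta> \<in> lmeas" "\<And>x. norm (\<beta> x) <= M" "\<And>x. norm x \<ge> 1 ==> \<beta> x = 0"
 shows "(\<lambda>\<omega>. \<beta> (reduce \<omega>)) \<in> lmeas"
proof -
 obtain h where h: "\<And>n. continuous_on UNIV (h n)" "\<And>n x. norm (h n x) <= M"
  "\<And>n x. norm x \<ge> 2 ==> h n x = 0" "AE x in lebesgue. (\<lambda>n. h n x) \<longlonglongrightarrow> \<beta> x"
  by (rule bounded_AE_continuous_limit[OF assms]) auto
 have "(\<lambda>\<omega>. lim (\<lambda>n. h n (reduce \<omega>))) \<in> lmeas"
  by (intro borel_measurable_lim_metric measurable_completion)
   (simp add: borel_measurable_continuous_onI reduce_continuous[OF h(1,3)])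
 moreover have "AE \<omega> in lebesgue. lim (\<lambda>n. h n (reduce \<omega>)) = \<beta> (reduce \<omega>)"
  using AE_reduce[OF h(4)] by eventually_elim (rule limI)
 ultimately show ?thesis by (rule borel_measurable_AE)
qed

text \<open>Bounded functions supported near the origin are first replaced by continuous ones, by dominated convergence; these
 extend to continuous functions on the torus, to which the Stone-Weierstrass theorem applies.\<close>

lemma trigonometric_approximation:
 fixes \<beta> :: "real^'d::finite => complex" and w :: "real^'d => ennreal"
 assumes \<beta>: "\<beta> \<in> lmeas" "\<And>x. norm (\<beta> x) <= M" "\<And>x. norm x \<ge> 1 ==> \<beta> x = 0"
  and w: "w \<in> lmeas" "(\<integral>\<^sup>+\<omega>. w \<omega> \<partial>lebesgue) < \<infinity>" and e: "e > 0"
 shows "\<exists>q :: complex^'d => complex. polynomial_function q \<and>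
  (\<integral>\<^sup>+\<omega>. w \<omega> * ennreal ((norm (\<beta> (reduce \<omega>) - q (torus_point \<omega>)))\<^sup>2) \<partial>lebesgue) <= ennreal e"
proof -
 obtain h where h: "\<And>n. continuous_on UNIV (h n)" "\<And>n x. norm (h n x) <= M"
  "\<And>n x. norm x \<ge> 2 ==> h n x = 0" "AE x in lebesgue. (\<lambda>n. h n x) \<longlonglongrightarrow> \<beta> x"
  by (rule bounded_AE_continuous_limit[OF \<beta>]) auto
 have mb: "(\<lambda>\<omega>. \<beta> (reduce \<omega>)) \<in> lmeas" by (rule reduce_measurable[OF \<beta>])
 have mh: "(\<lambda>\<omega>. h n (reduce \<omega>)) \<in> lmeas" for n
  by (intro measurable_completion) (simp add: borel_measurable_continuous_onI reduce_continuous[OF h(1,3)])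
 have mq: "(\<lambda>\<omega>. w \<omega> * ennreal ((norm (f \<omega>))\<^sup>2)) \<in> lmeas"
  if "f \<in> lmeas" for f :: "real^'d => complex"
  by (rule borel_measurable_times_ennreal[OF w(1) measurable_compose[OF borel_measurable_power[OF measurable_compose[OF that borel_measurable_norm]] measurable_ennreal]])
 have "(\<lambda>n. \<integral>\<^sup>+\<omega>. w \<omega> * ennreal ((norm (\<beta> (reduce \<omega>) - h n (reduce \<omega>)))\<^sup>2) \<partial>lebesgue) \<longlonglongrightarrow> (\<integral>\<^sup>+\<omega>. 0 \<partial>(lebesgue :: (real^'d) measure))"
 proof (rule nn_integral_dominated_convergence)
  show "(\<lambda>\<omega>. w \<omega> * ennreal ((norm (\<beta> (reduce \<omega>) - h n (reduce \<omega>)))\<^sup>2)) \<in> lmeas" for n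
   by (rule mq[OF borel_measurable_diff[OF mb mh]])
  show "(\<lambda>\<omega>. w \<omega> * ennreal ((2 * M)\<^sup>2)) \<in> lmeas" using w(1) by (intro borel_measurable_times_ennreal) auto
  show "AE \<omega> in lebesgue. w \<omega> * ennreal ((norm (\<beta> (reduce \<omega>) - h n (reduce \<omega>)))\<^sup>2) <= w \<omega> * ennreal ((2 * M)\<^sup>2)" for n
  proof (rule AE_I2)
   fix \<omega>
   have "norm (\<beta> (reduce \<omega>) - h n (reduce \<omega>)) <= 2 * M"
    using norm_triangle_ineq4[of "\<beta> (reduce \<omega>)" "h n (reduce \<omega>)"] \<beta>(2)[of "reduce \<omega>"] h(2)[of n "reduce \<omega>"] by linarith
   then show "w \<omega> * ennreal ((norm (\<beta> (reduce \<omega>) - h n (reduce \<omega>)))\<^sup>2) <= w \<omega> * ennreal ((2 * M)\<^sup>2)"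
    by (intro mult_left_mono ennreal_leI power_mono) auto
  qed
  show "(\<integral>\<^sup>+\<omega>. w \<omega> * ennreal ((2 * M)\<^sup>2) \<partial>lebesgue) < \<infinity>"
   using w by (simp add: nn_integral_multc ennreal_mult_less_top)
  show "AE \<omega> in lebesgue. (\<lambda>n. w \<omega> * ennreal ((norm (\<beta> (reduce \<omega>) - h n (reduce \<omega>)))\<^sup>2)) \<longlonglongrightarrow> 0"
  proof -
   have fin: "AE \<omega> in lebesgue. w \<omega> \<noteq> \<infinity>" using w nn_integral_PInf_AE[OF w(1)] by auto
   show ?thesis using AE_reduce[OF h(4)] fin
   proof eventually_elim
    case (elim \<omega>)
    have "(\<lambda>n. ennreal ((norm (\<beta> (reduce \<omega>) - h n (reduce \<omega>)))\<^sup>2)) \<longlonglongrightarrow> ennreal ((norm (\<beta> (reduce \<omega>) - \<beta> (reduce \<omega>)))\<^sup>2)"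
     by (intro tendsto_ennrealI tendsto_intros elim(1))
    from ennreal_tendsto_cmult[OF _ this, of "w \<omega>"] elim(2) show ?case by (simp add: less_top)
   qed
  qed
 qed auto
 then have "(\<lambda>n. \<integral>\<^sup>+\<omega>. w \<omega> * ennreal ((norm (\<beta> (reduce \<omega>) - h n (reduce \<omega>)))\<^sup>2) \<partial>lebesgue) \<longlonglongrightarrow> 0" by simp
 then have "\<forall>\<^sub>F n in sequentially. (\<integral>\<^sup>+\<omega>. w \<omega> * ennreal ((norm (\<beta> (reduce \<omega>) - h n (reduce \<omega>)))\<^sup>2) \<partial>lebesgue) < ennreal (e / 4)"
  using e by (intro order_tendstoD(2)) auto
 then obtain n where n: "(\<integral>\<^sup>+\<omega>. w \<omega> * ennreal ((norm (\<beta> (reduce \<omega>) - h n (reduce \<omega>)))\<^sup>2) \<partial>lebesgue) < ennreal (e / 4)"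
  by (auto simp: eventually_sequentially)
 define W where "W = enn2real (\<integral>\<^sup>+\<omega>. w \<omega> \<partial>lebesgue)"
 have W: "(\<integral>\<^sup>+\<omega>. w \<omega> \<partial>lebesgue) = ennreal W" "W \<ge> 0" using w(2) by (auto simp: W_def)
 define \<delta> where "\<delta> = sqrt (e / (4 * (W + 1)))"
 have d: "\<delta> > 0" "W * \<delta>\<^sup>2 <= e / 4"
 proof -
  show "\<delta> > 0" using e W(2) by (simp add: \<delta>_def)
  have "W * \<delta>\<^sup>2 = (W / (W + 1)) * (e / 4)" using e W(2) by (simp add: \<delta>_def)
  also have "... <= 1 * (e / 4)" using e W(2) by (intro mult_right_mono) auto
  finally show "W * \<delta>\<^sup>2 <= e / 4" by simp
 qed
 obtain q :: "complex^'d => complex" where q: "polynomial_function q" "\<And>z. z \<in> torus ==> norm (h n (torus_args z) - q z) < \<delta>"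
  using Stone_Weierstrass_polynomial_function[OF compact_torus continuous_on_torus_args[OF h(1)[of n] h(3)] d(1)] by auto
 have mt: "(\<lambda>\<omega>. q (torus_point \<omega>)) \<in> lmeas"
 proof (rule measurable_completion)
  have "continuous_on UNIV (\<lambda>\<omega>. q (torus_point \<omega>))"
   by (rule continuous_on_compose2[OF continuous_on_polymonial_function[OF q(1), of UNIV] continuous_torus_point]) simp
  then show "(\<lambda>\<omega>. q (torus_point \<omega>)) \<in> borel_measurable lborel" by (simp add: borel_measurable_continuous_onI)
 qed
 have "(\<integral>\<^sup>+\<omega>. w \<omega> * ennreal ((norm (\<beta> (reduce \<omega>) - q (torus_point \<omega>)))\<^sup>2) \<partial>lebesgue)
  <= (\<integral>\<^sup>+\<omega>. 2 * (w \<omega> * ennreal ((norm (\<beta> (reduce \<omega>) - h n (reduce \<omega>)))\<^sup>2)) + 2 * (w \<omega> * ennreal (\<delta>\<^sup>2)) \<partial>lebesgue)"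
 proof (rule nn_integral_mono)
  fix \<omega>
  let ?a = "\<beta> (reduce \<omega>) - h n (reduce \<omega>)" and ?b = "h n (reduce \<omega>) - q (torus_point \<omega>)"
  have "norm ?b <= \<delta>" using q(2)[OF torus_point_in_torus, of \<omega>] by (simp add: reduce_def)
  then have b: "(norm ?b)\<^sup>2 <= \<delta>\<^sup>2" by (intro power_mono) auto
  have "(norm (\<beta> (reduce \<omega>) - q (torus_point \<omega>)))\<^sup>2 <= 2 * (norm ?a)\<^sup>2 + 2 * \<delta>\<^sup>2"
   using norm_add_squared_le[of ?a ?b] b by simp
  then have "ennreal ((norm (\<beta> (reduce \<omega>) - q (torus_point \<omega>)))\<^sup>2) <= 2 * ennreal ((norm ?a)\<^sup>2) + 2 * ennreal (\<delta>\<^sup>2)"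
  proof -
   assume "(norm (\<beta> (reduce \<omega>) - q (torus_point \<omega>)))\<^sup>2 <= 2 * (norm ?a)\<^sup>2 + 2 * \<delta>\<^sup>2"
   then have "ennreal ((norm (\<beta> (reduce \<omega>) - q (torus_point \<omega>)))\<^sup>2) <= ennreal (2 * (norm ?a)\<^sup>2 + 2 * \<delta>\<^sup>2)" by (rule ennreal_leI)
   also have "... = ennreal (2 * (norm ?a)\<^sup>2) + ennreal (2 * \<delta>\<^sup>2)" by (rule ennreal_plus) auto
   also have "... = 2 * ennreal ((norm ?a)\<^sup>2) + 2 * ennreal (\<delta>\<^sup>2)" by (simp add: ennreal_mult)
   finally show ?thesis .
  qed
  then have "w \<omega> * ennreal ((norm (\<beta> (reduce \<omega>) - q (torus_point \<omega>)))\<^sup>2) <= w \<omega> * (2 * ennreal ((norm ?a)\<^sup>2) + 2 * ennreal (\<delta>\<^sup>2))"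
   by (rule mult_left_mono) simp
  also have "... = 2 * (w \<omega> * ennreal ((norm ?a)\<^sup>2)) + 2 * (w \<omega> * ennreal (\<delta>\<^sup>2))"
   by (simp add: distrib_left mult.left_commute)
  finally show "w \<omega> * ennreal ((norm (\<beta> (reduce \<omega>) - q (torus_point \<omega>)))\<^sup>2) <= 2 * (w \<omega> * ennreal ((norm ?a)\<^sup>2)) + 2 * (w \<omega> * ennreal (\<delta>\<^sup>2))" .
 qed
 also have "... = 2 * (\<integral>\<^sup>+\<omega>. w \<omega> * ennreal ((norm (\<beta> (reduce \<omega>) - h n (reduce \<omega>)))\<^sup>2) \<partial>lebesgue) + 2 * (ennreal W * ennreal (\<delta>\<^sup>2))"
 proof -
  have m1: "(\<lambda>\<omega>. w \<omega> * ennreal ((norm (\<beta> (reduce \<omega>) - h n (reduce \<omega>)))\<^sup>2)) \<in> lmeas"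
   by (rule mq[OF borel_measurable_diff[OF mb mh]])
  have m2: "(\<lambda>\<omega>. w \<omega> * ennreal (\<delta>\<^sup>2)) \<in> lmeas" using w(1) by (intro borel_measurable_times_ennreal) auto
  show ?thesis
   by (subst nn_integral_add) (use m1 m2 in \<open>auto simp: nn_integral_cmult nn_integral_multc w(1) W(1) intro!: borel_measurable_times_ennreal\<close>)
 qed
 also have "... <= 2 * ennreal (e / 4) + 2 * ennreal (e / 4)"
  using n d(2) W(2) by (intro add_mono mult_left_mono) (auto simp: ennreal_mult[symmetric] ennreal_leI)
 also have "... = ennreal e"
  using e by (subst (1 2) ennreal_numeral[symmetric], subst (1 2) ennreal_mult[symmetric], simp_all add: ennreal_plus[symmetric] del: ennreal_plus)
 finally show ?thesis using q(1) by blast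
qed

section \<open>Multipliers of a shift-invariant space\<close>

lemma shift_invariant_space_closed:
 shows subspace_shift_invariant_space: "functional.subspace (shift_invariant_space s \<Phi>)"
  and translate_shift_invariant_space: "a \<in> int_lattice ==> g \<in> shift_invariant_space s \<Phi> ==> translate a g \<in> shift_invariant_space s \<Phi>"
  and generators_shift_invariant_space: "\<Phi> $ i \<in> shift_invariant_space s \<Phi>"
 unfolding shift_invariant_space_def functional.subspace_def by auto

text \<open>Stated through \<open>has_fourier\<close>, and not as a condition on functions alone, so that the product is known to be the
 Fourier transform of an element of \<open>V\<close>.\<close>

definition multiplier :: "'d::finite functional set => (real^'d => complex) => bool" where
 "multiplier V p \<longleftrightarrow> (\<forall>T\<in>V. \<forall>F. has_fourier T F --> (\<exists>S\<in>V. has_fourier S (\<lambda>\<omega>. p \<omega> * F \<omega>)))"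

text \<open>Trigonometric polynomials are multipliers of shift-invariant spaces, as translation is
 multiplication by an exponential on the Fourier side.\<close>

lemma multiplier_trigonometric_polynomial:
 fixes V :: "'d::finite functional set"
 assumes sub: "functional.subspace V" and tr: "\<And>a g. a \<in> int_lattice ==> g \<in> V ==> translate a g \<in> V"
  and q: "polynomial_function q"
 shows "multiplier V (\<lambda>\<omega>. q (torus_point \<omega>))"
proof -
 have const: "multiplier V (\<lambda>_. c)" for c
  unfolding multiplier_def using has_fourier_cmult sub unfolding functional.subspace_def by blast
 have add: "multiplier V (\<lambda>\<omega>. p \<omega> + r \<omega>)" if pr: "multiplier V p" "multiplier V r" for p r
  unfolding multiplier_def
 proof (intro ballI allI impI)
  fix T F assume T: "T \<in> V" "has_fourier T F"
  obtain S1 S2 where S: "S1 \<in> V" "has_fourier S1 (\<lambda>\<omega>. p \<omega> * F \<omega>)" "S2 \<in> V" "has_fourier S2 (\<lambda>\<omega>. r \<omega> * F \<omega>)"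
   using pr T unfolding multiplier_def by meson
  have "S1 + S2 \<in> V" using S sub by (auto simp: functional.subspace_def)
  then show "\<exists>S\<in>V. has_fourier S (\<lambda>\<omega>. (p \<omega> + r \<omega>) * F \<omega>)"
   using has_fourier_add[OF S(2,4)] by (auto simp: distrib_right)
 qed
 have mult: "multiplier V (\<lambda>\<omega>. p \<omega> * r \<omega>)" if pr: "multiplier V p" "multiplier V r" for p r
  unfolding multiplier_def
 proof (intro ballI allI impI)
  fix T F assume T: "T \<in> V" "has_fourier T F"
  obtain S1 where "S1 \<in> V" "has_fourier S1 (\<lambda>\<omega>. r \<omega> * F \<omega>)"
   using pr(2) T unfolding multiplier_def by meson
  then obtain S2 where "S2 \<in> V" "has_fourier S2 (\<lambda>\<omega>. p \<omega> * (r \<omega> * F \<omega>))"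
   using pr(1) unfolding multiplier_def by meson
  then show "\<exists>S\<in>V. has_fourier S (\<lambda>\<omega>. (p \<omega> * r \<omega>) * F \<omega>)" by (auto simp: mult.assoc)
 qed
 have exp: "multiplier V (\<lambda>\<omega>. cis (- (a \<bullet> \<omega>)))" if "a \<in> int_lattice" for a
  unfolding multiplier_def using has_fourier_translate tr that by blast
 have ax: "axis i 1 \<in> int_lattice" "- axis i 1 \<in> (int_lattice :: (real^'d) set)" for i
  by (auto simp: int_lattice_def axis_def)
 have cis1: "multiplier V (\<lambda>\<omega>. cis (- (\<omega> $ i)))" "multiplier V (\<lambda>\<omega>. cis (\<omega> $ i))" for i
  using exp[OF ax(1)[of i]] exp[OF ax(2)[of i]] by (auto simp: inner_axis inner_commute)
 have Re: "multiplier V (\<lambda>\<omega>. of_real (cos (\<omega> $ i)))" for i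
 proof -
  have "complex_of_real (cos t) = (1/2) * cis t + (1/2) * cis (- t)" for t by (simp add: complex_eq_iff)
  then show ?thesis using add[OF mult[OF const[of "1/2"] cis1(2)[of i]] mult[OF const[of "1/2"] cis1(1)[of i]]] by simp
 qed
 have Im: "multiplier V (\<lambda>\<omega>. of_real (sin (\<omega> $ i)))" for i
 proof -
  have "complex_of_real (sin t) = (- \<i>/2) * cis t + (\<i>/2) * cis (- t)" for t by (simp add: complex_eq_iff)
  then show ?thesis using add[OF mult[OF const[of "- \<i>/2"] cis1(2)[of i]] mult[OF const[of "\<i>/2"] cis1(1)[of i]]] by simp
 qed
 have sum: "multiplier V (\<lambda>\<omega>. \<Sum>i\<in>I. p i \<omega>)" if "finite I" "\<And>i. multiplier V (p i)" for I :: "'d set" and p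
  using that(1) by (induction I rule: finite_induct) (use const[of 0] add that(2) in auto)
 have real: "multiplier V (\<lambda>\<omega>. of_real (f (torus_point \<omega>)))" if "real_polynomial_function f" for f :: "complex^'d => real"
  using that
 proof (induction rule: real_polynomial_function.induct)
  case (linear f)
  then interpret f: bounded_linear f .
  have fz: "f z = (\<Sum>i\<in>UNIV. Re (z $ i) * f (axis i 1) + Im (z $ i) * f (axis i \<i>))" for z
  proof -
   have "z = (\<Sum>i\<in>UNIV. Re (z $ i) *\<^sub>R axis i 1 + Im (z $ i) *\<^sub>R axis i \<i>)"
    by (simp add: vec_eq_iff axis_def if_distrib[of "\<lambda>x. _ *\<^sub>R x"] sum.distrib complex_eq_iff cong: if_cong)
   then have "f z = f (\<Sum>i\<in>UNIV. Re (z $ i) *\<^sub>R axis i 1 + Im (z $ i) *\<^sub>R axis i \<i>)" by (rule arg_cong)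
   then show ?thesis by (simp add: f.sum f.add f.scaleR)
  qed
  have "complex_of_real (f (torus_point \<omega>)) = (\<Sum>i\<in>UNIV. of_real (cos (\<omega> $ i)) * of_real (f (axis i 1)) + of_real (sin (\<omega> $ i)) * of_real (f (axis i \<i>)))" for \<omega>
   unfolding fz[of "torus_point \<omega>"] by (simp add: torus_point_def)
  moreover have "multiplier V (\<lambda>\<omega>. \<Sum>i\<in>UNIV. of_real (cos (\<omega> $ i)) * of_real (f (axis i 1)) + of_real (sin (\<omega> $ i)) * of_real (f (axis i \<i>)))"
   by (intro sum add mult Re Im const) simp
  ultimately show ?case by simp
 qed (use const add mult in auto)
 have "real_polynomial_function (\<lambda>z. Re (q z))" "real_polynomial_function (\<lambda>z. Im (q z))"
  using q[unfolded polynomial_function_def comp_def, rule_format, OF bounded_linear_Re]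
   q[unfolded polynomial_function_def comp_def, rule_format, OF bounded_linear_Im] .
 from add[OF real[OF this(1)] mult[OF const[of \<i>] real[OF this(2)]]]
 show ?thesis by (simp add: complex_eq[symmetric])
qed

section \<open>Approximation order\<close>

lemma W2_norm_nonneg: "0 <= W2_norm s T"
 unfolding W2_norm_def by (simp add: integral_nonneg_AE)

lemma norm_square_measurable:
 assumes "f \<in> borel_measurable M"
 shows "(\<lambda>\<omega>. (norm (f \<omega>))\<^sup>2) \<in> borel_measurable M"
 by (rule borel_measurable_power[OF measurable_compose[OF assms borel_measurable_norm]])

lemma weighted_square_measurable:
 fixes f :: "real^'d::finite => 'b::{real_normed_vector, second_countable_topology}" and g :: "real^'d => real"
 assumes "g \<in> borel_measurable borel" "f \<in> lmeas"
 shows "(\<lambda>\<omega>. g \<omega> * (norm (f \<omega>))\<^sup>2) \<in> lmeas"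
proof (rule borel_measurable_times)
 show "g \<in> lmeas" using assms(1) by (intro measurable_completion) simp
qed (rule norm_square_measurable[OF assms(2)])

lemma W2_norm_le:
 assumes T: "has_fourier T G" and le: "(\<integral>\<^sup>+\<omega>. ennreal ((1 + norm \<omega>) powr (2 * s) * (norm (G \<omega>))\<^sup>2) \<partial>lebesgue) <= ennreal X" and X: "X \<ge> 0"
 shows "W2_norm s T <= sqrt X"
proof -
 have ae: "AE \<omega> in lebesgue. fhat T \<omega> = G \<omega>" by (rule fhat_AE_eq[OF T])
 have m: "fhat T \<in> lmeas" using has_fourier_fhat[OF T] by (auto simp: has_fourier_def)
 have "(\<lambda>\<omega>. (1 + norm \<omega>) powr (2 * s) * (norm (fhat T \<omega>))\<^sup>2) \<in> lmeas"
  by (rule weighted_square_measurable[OF _ m]) measurable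
 then have "(\<integral>\<omega>. (1 + norm \<omega>) powr (2 * s) * (norm (fhat T \<omega>))\<^sup>2 \<partial>lebesgue)
  = enn2real (\<integral>\<^sup>+\<omega>. ennreal ((1 + norm \<omega>) powr (2 * s) * (norm (fhat T \<omega>))\<^sup>2) \<partial>lebesgue)"
  by (rule integral_eq_nn_integral) simp
 also have "(\<integral>\<^sup>+\<omega>. ennreal ((1 + norm \<omega>) powr (2 * s) * (norm (fhat T \<omega>))\<^sup>2) \<partial>lebesgue)
  = (\<integral>\<^sup>+\<omega>. ennreal ((1 + norm \<omega>) powr (2 * s) * (norm (G \<omega>))\<^sup>2) \<partial>lebesgue)"
  by (rule nn_integral_cong_AE) (use ae in eventually_elim, simp)
 also have "enn2real ... <= X" by (rule enn2real_leI[OF X le])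
 finally show ?thesis by (simp add: W2_norm_def)
qed

lemma W2_energy:
 assumes "f \<in> W2 k"
 shows "(\<integral>\<^sup>+\<omega>. ennreal ((1 + norm \<omega>) powr (2 * k) * (norm (fhat f \<omega>))\<^sup>2) \<partial>lebesgue) = ennreal ((W2_norm k f)\<^sup>2)"
proof -
 have i: "integrable lebesgue (\<lambda>\<omega>. (1 + norm \<omega>) powr (2 * k) * (norm (fhat f \<omega>))\<^sup>2)" using assms by (simp add: W2_def)
 have "(W2_norm k f)\<^sup>2 = (\<integral>\<omega>. (1 + norm \<omega>) powr (2 * k) * (norm (fhat f \<omega>))\<^sup>2 \<partial>lebesgue)"
  unfolding W2_norm_def by (rule real_sqrt_pow2) (simp add: integral_nonneg_AE)
 then show ?thesis using nn_integral_eq_integral[OF i] by simp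
qed

lemma W2_fhat_measurable: "f \<in> W2 k ==> fhat f \<in> lmeas"
 using has_fourier_fhat unfolding W2_def has_fourier_def by blast

lemma weight_scaled:
 assumes h: "0 < h" "h < 1" and y: "0 <= (y::real)"
 shows "(1 + y / h) powr (2 * s) <= (h powr (- 2 * s) + 1) * (1 + y) powr (2 * s)"
proof (cases "s \<ge> 0")
 case True
 have "1 + y / h <= (1 + y) * (1 / h)" using h by (simp add: field_simps)
 then have "(1 + y / h) powr (2 * s) <= ((1 + y) * (1 / h)) powr (2 * s)" using True h y by (intro powr_mono2) auto
 also have "... = (1 + y) powr (2 * s) * h powr (- 2 * s)" using h y by (subst powr_mult) (auto simp: powr_minus powr_divide inverse_eq_divide)
 finally show ?thesis by (rule order_trans) (simp add: distrib_right)
next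
 case False
 have "y <= y / h" using h y mult_left_le_one_le[of y h] by (simp add: field_simps)
 then have "(1 + y / h) powr (2 * s) <= (1 + y) powr (2 * s)" using False y by (intro powr_mono2') auto
 then show ?thesis by (rule order_trans) (simp add: distrib_right)
qed

text \<open>Away from the origin the inhomogeneous weight \<open>(1 + |y|)\<^sup>2\<^sup>s\<close> may be replaced by the homogeneous one, which scales.\<close>

lemma weight_far:
 assumes "0 < \<rho>" "\<rho> <= (y::real)"
 shows "(1 + y) powr (2 * s) <= ((1 + 1 / \<rho>) powr (2 * s) + 1) * y powr (2 * s)"
proof (cases "s \<ge> 0")
 case True
 have "1 + y <= (1 + 1 / \<rho>) * y" using assms by (simp add: field_simps)
 then have "(1 + y) powr (2 * s) <= ((1 + 1 / \<rho>) * y) powr (2 * s)" using True assms by (intro powr_mono2) auto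
 also have "... = (1 + 1 / \<rho>) powr (2 * s) * y powr (2 * s)" using assms by (subst powr_mult) auto
 finally show ?thesis by (rule order_trans) (simp add: distrib_right)
next
 case False
 have "(1 + y) powr (2 * s) <= y powr (2 * s)" using False assms by (intro powr_mono2') auto
 then show ?thesis by (rule order_trans) (simp add: distrib_right)
qed

lemma W2_scaled_weight_finite:
 fixes T :: "'d::finite functional"
 assumes T: "T \<in> W2 s" and h: "0 < h" "h < 1"
 shows "(\<integral>\<^sup>+y. ennreal ((1 + norm ((1 / h) *\<^sub>R y)) powr (2 * s) * (norm (fhat T y))\<^sup>2) \<partial>lebesgue) < \<infinity>"
proof -
 let ?K = "h powr (- 2 * s) + 1"
 have "(\<integral>\<^sup>+y. ennreal ((1 + norm ((1 / h) *\<^sub>R y)) powr (2 * s) * (norm (fhat T y))\<^sup>2) \<partial>lebesgue)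
  <= (\<integral>\<^sup>+y. ennreal ?K * ennreal ((1 + norm y) powr (2 * s) * (norm (fhat T y))\<^sup>2) \<partial>lebesgue)"
 proof (rule nn_integral_mono)
  fix y :: "real^'d"
  have "(1 + norm ((1 / h) *\<^sub>R y)) powr (2 * s) <= ?K * (1 + norm y) powr (2 * s)"
   using weight_scaled[OF h norm_ge_zero[of y]] h by simp
  then have "(1 + norm ((1 / h) *\<^sub>R y)) powr (2 * s) * (norm (fhat T y))\<^sup>2 <= ?K * (1 + norm y) powr (2 * s) * (norm (fhat T y))\<^sup>2"
   by (rule mult_right_mono) simp
  then show "ennreal ((1 + norm ((1 / h) *\<^sub>R y)) powr (2 * s) * (norm (fhat T y))\<^sup>2) <= ennreal ?K * ennreal ((1 + norm y) powr (2 * s) * (norm (fhat T y))\<^sup>2)"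
   by (subst ennreal_mult[symmetric]) (auto simp: mult.assoc intro: ennreal_leI)
 qed
 also have "... = ennreal ?K * ennreal ((W2_norm s T)\<^sup>2)"
 proof -
  have "(\<lambda>y. (1 + norm y) powr (2 * s) * (norm (fhat T y))\<^sup>2) \<in> lmeas"
   by (rule weighted_square_measurable[OF _ W2_fhat_measurable[OF T]]) measurable
  then show ?thesis by (subst nn_integral_cmult) (auto simp: W2_energy[OF T])
 qed
 also have "... < \<infinity>" by (simp add: ennreal_mult_less_top)
 finally show ?thesis .
qed

lemma W2_norm_mono:
 assumes f: "f \<in> W2 k" and sk: "s <= k"
 shows "W2_norm s f <= W2_norm k f"
proof -
 have "(\<integral>\<^sup>+\<omega>. ennreal ((1 + norm \<omega>) powr (2 * s) * (norm (fhat f \<omega>))\<^sup>2) \<partial>lebesgue) <= (\<integral>\<^sup>+\<omega>. ennreal ((1 + norm \<omega>) powr (2 * k) * (norm (fhat f \<omega>))\<^sup>2) \<partial>lebesgue)"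
  using sk by (intro nn_integral_mono ennreal_leI mult_right_mono powr_mono) auto
 also have "... = ennreal ((W2_norm k f)\<^sup>2)" by (rule W2_energy[OF f])
 finally have "W2_norm s f <= sqrt ((W2_norm k f)\<^sup>2)"
  using f has_fourier_fhat by (intro W2_norm_le[of f "fhat f"]) (auto simp: W2_def)
 then show ?thesis using W2_norm_nonneg[of k f] by simp
qed

text \<open>Functions in \<open>W\<^sub>2\<^sup>k\<close> can be truncated to bounded Fourier transforms at arbitrarily small
 cost in \<open>W\<^sub>2\<^sup>s\<close>.\<close>

lemma W2_truncation:
 assumes f: "f \<in> W2 k" and sk: "s <= k" and e: "e > 0"
 shows "\<exists>n::nat. (\<integral>\<^sup>+\<omega>. ennreal ((1 + norm \<omega>) powr (2 * s) * (norm (fhat f \<omega> - (if norm (fhat f \<omega>) <= real n then fhat f \<omega> else 0)))\<^sup>2) \<partial>lebesgue) <= ennreal e"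
proof -
 let ?F = "fhat f"
 let ?G = "\<lambda>n \<omega>. ?F \<omega> - (if norm (?F \<omega>) <= real n then ?F \<omega> else 0)"
 have mF: "?F \<in> lmeas" by (rule W2_fhat_measurable[OF f])
 have mG: "?G n \<in> lmeas" for n
 proof (intro borel_measurable_diff mF measurable_If)
  have "{\<omega> \<in> space lebesgue. norm (?F \<omega>) \<in> {..real n}} \<in> sets lebesgue"
   using measurable_sets[OF measurable_compose[OF mF borel_measurable_norm], of "{..real n}"] by (simp add: vimage_def)
  then show "{\<omega> \<in> space lebesgue. norm (?F \<omega>) <= real n} \<in> sets lebesgue" by simp
 qed auto
 have "(\<lambda>n. \<integral>\<^sup>+\<omega>. ennreal ((1 + norm \<omega>) powr (2 * s) * (norm (?G n \<omega>))\<^sup>2) \<partial>lebesgue) \<longlonglongrightarrow> (\<integral>\<^sup>+\<omega>. 0 \<partial>(lebesgue :: (real^'a) measure))"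
 proof (rule nn_integral_dominated_convergence)
  show "(\<lambda>\<omega>. ennreal ((1 + norm \<omega>) powr (2 * s) * (norm (?G n \<omega>))\<^sup>2)) \<in> lmeas" for n
   by (rule measurable_compose[OF weighted_square_measurable[OF _ mG] measurable_ennreal]) measurable
  show "(\<lambda>\<omega>. ennreal ((1 + norm \<omega>) powr (2 * k) * (norm (?F \<omega>))\<^sup>2)) \<in> lmeas"
   by (rule measurable_compose[OF weighted_square_measurable[OF _ mF] measurable_ennreal]) measurable
  show "AE \<omega> in lebesgue. ennreal ((1 + norm \<omega>) powr (2 * s) * (norm (?G n \<omega>))\<^sup>2) <= ennreal ((1 + norm \<omega>) powr (2 * k) * (norm (?F \<omega>))\<^sup>2)" for n
   using sk by (intro AE_I2 ennreal_leI mult_mono[OF powr_mono power_mono]) auto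
  show "(\<integral>\<^sup>+\<omega>. ennreal ((1 + norm \<omega>) powr (2 * k) * (norm (?F \<omega>))\<^sup>2) \<partial>lebesgue) < \<infinity>"
   by (simp add: W2_energy[OF f])
  show "AE \<omega> in lebesgue. (\<lambda>n. ennreal ((1 + norm \<omega>) powr (2 * s) * (norm (?G n \<omega>))\<^sup>2)) \<longlonglongrightarrow> 0"
  proof (rule AE_I2)
   fix \<omega>
   obtain N :: nat where N: "norm (?F \<omega>) <= real N" using real_arch_simple by blast
   have "norm (?F \<omega>) <= real n" if "n \<ge> N" for n using N that by linarith
   then have "ennreal ((1 + norm \<omega>) powr (2 * s) * (norm (?G n \<omega>))\<^sup>2) = 0" if "n \<ge> N" for n using that by simp
   then show "(\<lambda>n. ennreal ((1 + norm \<omega>) powr (2 * s) * (norm (?G n \<omega>))\<^sup>2)) \<longlonglongrightarrow> 0"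
    by (intro tendsto_eventually eventually_sequentiallyI)
  qed
 qed auto
 then have "\<forall>\<^sub>F n in sequentially. (\<integral>\<^sup>+\<omega>. ennreal ((1 + norm \<omega>) powr (2 * s) * (norm (?G n \<omega>))\<^sup>2) \<partial>lebesgue) < ennreal e"
  using e by (intro order_tendstoD(2)[where y=0]) auto
 then obtain n where "(\<integral>\<^sup>+\<omega>. ennreal ((1 + norm \<omega>) powr (2 * s) * (norm (?G n \<omega>))\<^sup>2) \<partial>lebesgue) < ennreal e"
  by (auto simp: eventually_sequentially)
 then show ?thesis by (intro exI[of _ n]) simp
qed

context refinable
begin

text \<open>Folding the part of the integral away from the origin back onto a neighbourhood of the
 origin turns it into the lattice sums that the zeros of the mask control.\<close>

lemma far_field:
 fixes b :: "real^'d => complex"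
 assumes Phi: "\<Phi> \<in> R" and b: "b \<in> lmeas" "\<And>x. norm x \<ge> \<rho> ==> b x = 0"
  and C: "C > 0" and near: "AE x in lebesgue. norm x < \<rho> -->
   (wnorm_le (dual_lattice - {0}) s (symb \<Phi>) x (C * norm x powr k))"
 shows "(\<integral>\<^sup>+y. ennreal (norm y powr (2 * s) * (norm (b (reduce y) * symb \<Phi> y))\<^sup>2) * indicator {y. \<rho> <= norm y} y \<partial>lebesgue)
  <= ennreal (C\<^sup>2) * (\<integral>\<^sup>+x. ennreal (norm x powr (2 * k) * (norm (b x))\<^sup>2) \<partial>lebesgue)"
proof -
 let ?L = "dual_lattice - {0} :: (real^'d) set"
 define \<phi> where "\<phi> y = ennreal (norm y powr (2 * s) * (norm (symb \<Phi> y))\<^sup>2)" for y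
 have m\<phi>: "\<phi> \<in> lmeas" unfolding \<phi>_def
  by (rule measurable_compose[OF weighted_square_measurable[OF _ symb_measurable[OF Phi]] measurable_ennreal]) measurable
 define B where "B x = ennreal ((norm (b x))\<^sup>2)" for x
 have mB: "B \<in> lmeas" unfolding B_def
  by (rule measurable_compose[OF norm_square_measurable[OF b(1)] measurable_ennreal])
 have cL: "countable ?L" by (rule countable_subset[OF _ countable_dual_lattice]) auto
 have mBs: "(\<lambda>y. B (y - \<alpha>)) \<in> lmeas" for \<alpha>
  using measurable_affine[OF _ mB, of 1 "- \<alpha>"] by simp
 have m\<phi>s: "(\<lambda>y. \<phi> (y + \<alpha>)) \<in> lmeas" for \<alpha>
  using measurable_affine[OF _ m\<phi>, of 1 \<alpha>] by (simp add: add.commute)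
 have "(\<integral>\<^sup>+y. ennreal (norm y powr (2 * s) * (norm (b (reduce y) * symb \<Phi> y))\<^sup>2) * indicator {y. \<rho> <= norm y} y \<partial>lebesgue)
  <= (\<integral>\<^sup>+y. \<integral>\<^sup>+\<alpha>. B (y - \<alpha>) * \<phi> y \<partial>count_space ?L \<partial>lebesgue)"
 proof (rule nn_integral_mono)
  fix y
  show "ennreal (norm y powr (2 * s) * (norm (b (reduce y) * symb \<Phi> y))\<^sup>2) * indicator {y. \<rho> <= norm y} y <= (\<integral>\<^sup>+\<alpha>. B (y - \<alpha>) * \<phi> y \<partial>count_space ?L)"
  proof (cases "\<rho> <= norm y \<and> b (reduce y) \<noteq> 0")
   case True
   define \<alpha> where "\<alpha> = y - reduce y"
   have "norm (reduce y) < \<rho>" using b(2)[of "reduce y"] True by force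
   then have "\<alpha> \<noteq> 0" using True by (auto simp: \<alpha>_def)
   moreover have "\<alpha> \<in> dual_lattice" using dual_lattice_minus[OF reduce_dual_lattice[of y]] by (simp add: \<alpha>_def)
   ultimately have "B (y - \<alpha>) * \<phi> y <= (\<integral>\<^sup>+\<alpha>. B (y - \<alpha>) * \<phi> y \<partial>count_space ?L)"
    by (intro nn_integral_ge_point) auto
   moreover have "ennreal (norm y powr (2 * s) * (norm (b (reduce y) * symb \<Phi> y))\<^sup>2) = B (y - \<alpha>) * \<phi> y"
    unfolding B_def \<phi>_def \<alpha>_def by (subst ennreal_mult[symmetric]) (auto simp: norm_mult power_mult_distrib mult_ac)
   ultimately show ?thesis using True by (simp add: indicator_def)
  qed (auto simp: indicator_def)
 qed
 also have "... = (\<integral>\<^sup>+\<alpha>. \<integral>\<^sup>+y. B (y - \<alpha>) * \<phi> y \<partial>lebesgue \<partial>count_space ?L)"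
  by (intro nn_integral_count_space_nn_integral cL borel_measurable_times_ennreal mBs m\<phi>)
 also have "... = (\<integral>\<^sup>+\<alpha>. \<integral>\<^sup>+x. B x * \<phi> (x + \<alpha>) \<partial>lebesgue \<partial>count_space ?L)"
 proof (rule nn_integral_cong)
  fix \<alpha> :: "real^'d"
  show "(\<integral>\<^sup>+y. B (y - \<alpha>) * \<phi> y \<partial>lebesgue) = (\<integral>\<^sup>+x. B x * \<phi> (x + \<alpha>) \<partial>lebesgue)"
   using nn_integral_affine[OF _ borel_measurable_times_ennreal[OF mBs[of \<alpha>] m\<phi>], of 1 \<alpha>] by (simp add: add.commute)
 qed
 also have "... = (\<integral>\<^sup>+x. \<integral>\<^sup>+\<alpha>. B x * \<phi> (x + \<alpha>) \<partial>count_space ?L \<partial>lebesgue)"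
  by (intro nn_integral_count_space_nn_integral[symmetric] cL borel_measurable_times_ennreal mB m\<phi>s)
 also have "... <= (\<integral>\<^sup>+x. ennreal (C\<^sup>2) * ennreal (norm x powr (2 * k) * (norm (b x))\<^sup>2) \<partial>lebesgue)"
 proof (rule nn_integral_mono_AE, use near in eventually_elim)
  fix x assume nr: "norm x < \<rho> --> (wnorm_le (dual_lattice - {0}) s (symb \<Phi>) x (C * norm x powr k))"
  show "(\<integral>\<^sup>+\<alpha>. B x * \<phi> (x + \<alpha>) \<partial>count_space ?L) <= ennreal (C\<^sup>2) * ennreal (norm x powr (2 * k) * (norm (b x))\<^sup>2)"
  proof (cases "norm x < \<rho>")
   case False
   then show ?thesis using b(2)[of x] by (simp add: B_def)
  next
   case True
   have "(\<integral>\<^sup>+\<alpha>. \<phi> (x + \<alpha>) \<partial>count_space ?L) <= ennreal ((C * norm x powr k)\<^sup>2)"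
    unfolding \<phi>_def
   proof (rule nn_integral_count_space_le[OF cL])
    fix F :: "(real^'d) set" assume F: "finite F" "F \<subseteq> dual_lattice - {0}"
    have "(\<Sum>\<alpha>\<in>F. norm (x + \<alpha>) powr (2 * s) * (norm (symb \<Phi> (x + \<alpha>)))\<^sup>2) = (wnorm s (symb \<Phi>) F x)\<^sup>2"
     unfolding powr_double_exponent by (simp add: wnorm_def L2_set_def sum_nonneg power_mult_distrib)
    also have "... <= (C * norm x powr k)\<^sup>2" using nr True F by (intro power_mono) auto
    finally show "(\<Sum>\<alpha>\<in>F. norm (x + \<alpha>) powr (2 * s) * (norm (symb \<Phi> (x + \<alpha>)))\<^sup>2) <= (C * norm x powr k)\<^sup>2" .
   qed simp
   then have "B x * (\<integral>\<^sup>+\<alpha>. \<phi> (x + \<alpha>) \<partial>count_space ?L) <= B x * ennreal ((C * norm x powr k)\<^sup>2)"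
    by (rule mult_left_mono) simp
   also have "... = ennreal (C\<^sup>2) * ennreal (norm x powr (2 * k) * (norm (b x))\<^sup>2)"
    unfolding B_def powr_double_exponent by (simp add: ennreal_mult[symmetric] power_mult_distrib mult_ac)
   finally show ?thesis by (simp add: nn_integral_cmult)
  qed
 qed
 also have "... = ennreal (C\<^sup>2) * (\<integral>\<^sup>+x. ennreal (norm x powr (2 * k) * (norm (b x))\<^sup>2) \<partial>lebesgue)"
  by (rule nn_integral_cmult, rule measurable_compose[OF weighted_square_measurable[OF _ b(1)] measurable_ennreal]) measurable
 finally show ?thesis .
qed

text \<open>Multiplication of the symbol by a periodic function acts on the entries of \<open>\<Phi>\<close> by periodic functions, as \<open>v\<close> is
 periodic too.\<close>

lemma symb_times_periodic: "b * symb \<Phi> y = (\<Sum>i\<in>UNIV. (b * cnj (v (reduce y) $ i)) * fhat (\<Phi> $ i) y)"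
proof -
 have "v (y + (reduce y - y)) = v y" by (rule v_periodic[OF reduce_dual_lattice])
 then show ?thesis by (simp add: symb_def cinner_def vhat_def sum_distrib_left mult.assoc)
qed

end

lemma error_split_near: "x <= 2 * n1 + 2 * n4 ==> 0 <= n1 ==> 0 <= n2 ==> 0 <= n3 ==> 0 <= n4 ==> x <= 4 * (n1 + n2 + n3 + n4)" for x :: real
 by (simp add: distrib_left)

lemma error_split_far: "x <= 2 * n2 + 2 * g ==> g <= 2 * n3 + 2 * n4 ==> 0 <= n1 ==> 0 <= n2 ==> x <= 4 * (n1 + n2 + n3 + n4)" for x :: real
 by (simp add: distrib_left)

context refinable
begin

text \<open>The error is the sum of four parts: the truncation of \<open>F\<close> to a bounded function, the tail of \<open>F\<close> beyond radius
 \<open>\<rho>/h\<close>, the aliasing of the ideal approximant beyond that radius, and the approximation of its multipliers by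
 trigonometric polynomials. The first and the last can be made smaller than any \<open>\<eta>\<close>; the second and third are
 \<open>O(h\<^sup>2\<^sup>k\<^sup>-\<^sup>2\<^sup>s)\<close> after squaring.\<close>

lemma approximant_exists:
 fixes \<rho> c C Cv h \<eta> :: real
 assumes Phi: "\<Phi> \<in> R" and sk: "s < k" and rho: "0 < \<rho>" "\<rho> <= 1" and c: "c > 0" and C: "C > 0" and Cv: "Cv > 0"
  and good: "AE x in lebesgue. norm x < \<rho> --> c <= norm (symb \<Phi> x) \<and> (norm (v x))\<^sup>2 <= Cv"
  and near: "AE x in lebesgue. norm x < \<rho> -->
   (wnorm_le (dual_lattice - {0}) s (symb \<Phi>) x (C * norm x powr k))"
  and f: "f \<in> W2 k" and h: "0 < h" "h < 1" and eta: "\<eta> > 0"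
 shows "\<exists>g\<in>shift_invariant_space s \<Phi>. W2_norm s (f - dilate h g)
  <= sqrt (4 * (\<rho> powr (2 * s - 2 * k) + ((1 + 1 / \<rho>) powr (2 * s) + 1) * C\<^sup>2 / c\<^sup>2) * h powr (2 * k - 2 * s) * (W2_norm k f)\<^sup>2 + \<eta>)"
proof -
 let ?d = "CARD('d)" and ?r = "real CARD('r)"
 let ?V = "shift_invariant_space s \<Phi>"
 let ?K = "(1 + 1 / \<rho>) powr (2 * s) + 1"
 let ?W = "\<lambda>\<omega>::real^'d. (1 + norm \<omega>) powr (2 * s)"
 define F where "F = fhat f"
 define N where "N = W2_norm k f"
 have mF: "F \<in> lmeas" unfolding F_def by (rule W2_fhat_measurable[OF f])
 have hF: "has_fourier f F" unfolding F_def using f has_fourier_fhat by (auto simp: W2_def)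
 have energy: "(\<integral>\<^sup>+\<omega>. ennreal ((1 + norm \<omega>) powr (2 * k) * (norm (F \<omega>))\<^sup>2) \<partial>lebesgue) = ennreal (N\<^sup>2)"
  unfolding F_def N_def by (rule W2_energy[OF f])
 obtain n :: nat where n: "(\<integral>\<^sup>+\<omega>. ennreal (?W \<omega> * (norm (F \<omega> - (if norm (F \<omega>) <= real n then F \<omega> else 0)))\<^sup>2) \<partial>lebesgue) <= ennreal (\<eta> / 8)"
  using W2_truncation[OF f less_imp_le[OF sk], of "\<eta> / 8"] eta unfolding F_def by auto
 define Fn where "Fn \<omega> = (if norm (F \<omega>) <= real n then F \<omega> else 0)" for \<omega>
 have Fn_le: "norm (Fn \<omega>) <= real n" "norm (Fn \<omega>) <= norm (F \<omega>)" for \<omega> by (auto simp: Fn_def)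
 have set_le: "{\<omega> \<in> space lebesgue. g \<omega> <= (t::real)} \<in> sets lebesgue" if "g \<in> lmeas" for g :: "real^'d => real" and t
 proof -
  have "{\<omega> \<in> space lebesgue. g \<omega> \<in> {..t}} \<in> sets lebesgue" using measurable_sets[OF that, of "{..t}"] by (simp add: vimage_def)
  then show ?thesis by simp
 qed
 have mFn: "Fn \<in> lmeas" unfolding Fn_def[abs_def]
  by (intro measurable_If mF set_le measurable_compose[OF mF borel_measurable_norm]) simp
 have mFnh: "(\<lambda>x. Fn ((1 / h) *\<^sub>R x)) \<in> lmeas"
  using measurable_affine[OF _ mFn, of "1 / h" 0] h by simp
 have msymb: "symb \<Phi> \<in> lmeas" by (rule symb_measurable[OF Phi])
 have mv: "(\<lambda>x. (norm (v x))\<^sup>2) \<in> lmeas" by (rule norm_square_measurable[OF A2(2)])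

 (* the symbol is divided out near the origin, where it is bounded below *)
 define S where "S = {x. norm x < \<rho> \<and> c <= norm (symb \<Phi> x) \<and> (norm (v x))\<^sup>2 <= Cv}"
 have S: "S \<in> sets lebesgue"
 proof -
  have eq: "S = ball 0 \<rho> \<inter> ({x \<in> space lebesgue. - norm (symb \<Phi> x) <= - c} \<inter> {x \<in> space lebesgue. (norm (v x))\<^sup>2 <= Cv})"
   by (auto simp: S_def)
  have m: "(\<lambda>x. - norm (symb \<Phi> x)) \<in> lmeas"
   by (rule borel_measurable_uminus[OF measurable_compose[OF msymb borel_measurable_norm]])
  show ?thesis unfolding eq by (intro sets.Int set_le mv m) simp
 qed
 have AE_S: "AE x in lebesgue. norm x < \<rho> --> x \<in> S"
  using good by eventually_elim (simp add: S_def)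
 define b where "b x = (if x \<in> S then Fn ((1 / h) *\<^sub>R x) / symb \<Phi> x else 0)" for x
 have mb: "b \<in> lmeas" unfolding b_def[abs_def]
  by (intro measurable_If borel_measurable_divide mFnh msymb) (use S in auto)
 have b_le: "norm (b x) <= norm (F ((1 / h) *\<^sub>R x)) / c" "norm (b x) <= real n / c" for x
 proof -
  have "norm (b x) <= norm (Fn ((1 / h) *\<^sub>R x)) / c"
   using c by (auto simp: b_def S_def norm_divide intro!: divide_left_mono mult_pos_pos)
  then show "norm (b x) <= norm (F ((1 / h) *\<^sub>R x)) / c"
   by (rule order_trans) (intro divide_right_mono Fn_le less_imp_le[OF c])
  from \<open>norm (b x) <= norm (Fn ((1 / h) *\<^sub>R x)) / c\<close> show "norm (b x) <= real n / c"
   by (rule order_trans) (intro divide_right_mono Fn_le less_imp_le[OF c])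
 qed
 have b_far: "b x = 0" if "norm x \<ge> \<rho>" for x using that by (auto simp: b_def S_def)
 define \<beta> where "\<beta> i x = b x * cnj (v x $ i)" for i x
 have m\<beta>: "\<beta> i \<in> lmeas" for i unfolding \<beta>_def[abs_def]
  by (intro borel_measurable_times mb measurable_compose[OF v_nth_measurable])
   (simp add: borel_measurable_continuous_onI continuous_on_cnj)
 have \<beta>_le: "norm (\<beta> i x) <= real n / c * sqrt Cv" for i x
 proof (cases "x \<in> S")
  case True
  have "norm (v x $ i) <= norm (v x)" by (rule Finite_Cartesian_Product.norm_nth_le)
  also have "... <= sqrt Cv" using True by (intro real_le_rsqrt) (auto simp: S_def)
  finally have "norm (b x) * norm (v x $ i) <= real n / c * sqrt Cv"
   using b_le(2)[of x] c by (intro mult_mono) auto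
  then show ?thesis by (simp add: \<beta>_def norm_mult)
 next
  case False
  then show ?thesis using c Cv by (simp add: \<beta>_def b_def)
 qed
 have \<beta>_far: "\<beta> i x = 0" if "norm x \<ge> 1" for i x using that b_far[of x] rho by (simp add: \<beta>_def)

 (* trigonometric polynomials close to the ideal multipliers *)
 define w where "w i y = ennreal ((1 + norm ((1 / h) *\<^sub>R y)) powr (2 * s) * (norm (fhat (\<Phi> $ i) y))\<^sup>2)" for i y
 have mw: "w i \<in> lmeas" for i unfolding w_def
  by (rule measurable_compose[OF weighted_square_measurable[OF _ fhat_measurable[OF Phi]] measurable_ennreal]) measurable
 have w_fin: "(\<integral>\<^sup>+y. w i y \<partial>lebesgue) < \<infinity>" for i
  unfolding w_def using sobolev Phi by (intro W2_scaled_weight_finite h) auto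
 define \<epsilon> where "\<epsilon> = h ^ ?d * \<eta> / (8 * ?r\<^sup>2)"
 have eps: "\<epsilon> > 0" using h eta by (simp add: \<epsilon>_def)
 have ex: "\<forall>i. \<exists>q :: complex^'d => complex. polynomial_function q \<and>
  (\<integral>\<^sup>+y. w i y * ennreal ((norm (\<beta> i (reduce y) - q (torus_point y)))\<^sup>2) \<partial>lebesgue) <= ennreal \<epsilon>"
  by (intro allI trigonometric_approximation[OF m\<beta> \<beta>_le \<beta>_far mw w_fin eps])
 from choice[OF ex] obtain q :: "'r => complex^'d => complex" where q': "\<forall>i. polynomial_function (q i) \<and>
  (\<integral>\<^sup>+y. w i y * ennreal ((norm (\<beta> i (reduce y) - q i (torus_point y)))\<^sup>2) \<partial>lebesgue) <= ennreal \<epsilon>"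
  by blast
 have q: "polynomial_function (q i)"
  "(\<integral>\<^sup>+y. w i y * ennreal ((norm (\<beta> i (reduce y) - q i (torus_point y)))\<^sup>2) \<partial>lebesgue) <= ennreal \<epsilon>" for i
  using q' by blast+
 have "\<exists>T\<in>?V. has_fourier T (\<lambda>\<omega>. q i (torus_point \<omega>) * fhat (\<Phi> $ i) \<omega>)" for i
  using multiplier_trigonometric_polynomial[OF subspace_shift_invariant_space translate_shift_invariant_space q(1), of s \<Phi> i]
   generators_shift_invariant_space[of \<Phi> i s] has_fourier_entry[OF Phi, of i]
  unfolding multiplier_def by blast
 then obtain T where T: "\<And>i. T i \<in> ?V" "\<And>i. has_fourier (T i) (\<lambda>\<omega>. q i (torus_point \<omega>) * fhat (\<Phi> $ i) \<omega>)"
  by metis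
 define G where "G \<omega> = (\<Sum>i\<in>UNIV. q i (torus_point \<omega>) * fhat (\<Phi> $ i) \<omega>)" for \<omega>
 define g where "g = fscale (of_real (1 / h ^ ?d)) (\<Sum>i\<in>UNIV. T i)"
 have gV: "g \<in> ?V" unfolding g_def
  by (intro functional.subspace_scale[OF subspace_shift_invariant_space] functional.subspace_sum[OF subspace_shift_invariant_space] T(1))
 have hsum: "has_fourier (\<Sum>i\<in>UNIV. T i) G" unfolding G_def[abs_def] by (intro has_fourier_sum T(2)) simp
 have "has_fourier (dilate h g) (\<lambda>\<omega>. of_real (h ^ ?d) * (of_real (1 / h ^ ?d) * G (h *\<^sub>R \<omega>)))"
  unfolding g_def by (rule has_fourier_dilate[OF has_fourier_cmult[OF hsum] h(1)])
 moreover have "of_real (h ^ ?d) * (of_real (1 / h ^ ?d) * z) = z" for z :: complex using h by (simp add: field_simps)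
 ultimately have "has_fourier (dilate h g) (\<lambda>\<omega>. G (h *\<^sub>R \<omega>))" by simp
 then have hdiff: "has_fourier (f - dilate h g) (\<lambda>\<omega>. F \<omega> - G (h *\<^sub>R \<omega>))" by (rule has_fourier_diff[OF hF])
 have mG: "G \<in> lmeas" using hsum by (simp add: has_fourier_def)

 (* Q is the ideal approximant; near the origin it agrees with the truncation of F *)
 define Q where "Q y = b (reduce y) * symb \<Phi> y" for y
 have Qsum: "Q y - G y = (\<Sum>i\<in>UNIV. (\<beta> i (reduce y) - q i (torus_point y)) * fhat (\<Phi> $ i) y)" for y
  unfolding Q_def symb_times_periodic G_def \<beta>_def by (simp add: sum_subtractf left_diff_distrib)
 have mbr: "(\<lambda>y. b (reduce y)) \<in> lmeas"
  by (rule reduce_measurable[OF mb b_le(2)]) (use b_far rho in auto)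
 have mQ: "Q \<in> lmeas" unfolding Q_def[abs_def] by (intro borel_measurable_times mbr msymb)
 have mscale: "(\<lambda>\<omega>. u (h *\<^sub>R \<omega>)) \<in> lmeas" if "u \<in> lmeas" for u :: "real^'d => 'x::topological_space"
  using measurable_affine[OF _ that, of h 0] h by simp
 let ?a1 = "\<lambda>\<omega>. ennreal (?W \<omega> * (norm (F \<omega> - Fn \<omega>))\<^sup>2)"
 let ?I = "{\<omega>. \<rho> <= norm (h *\<^sub>R \<omega>)} :: (real^'d) set"
 let ?a2 = "\<lambda>\<omega>. ennreal (?W \<omega> * (norm (F \<omega>))\<^sup>2) * indicator ?I \<omega>"
 let ?a3 = "\<lambda>\<omega>. ennreal (?W \<omega> * (norm (Q (h *\<^sub>R \<omega>)))\<^sup>2) * indicator ?I \<omega>"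
 let ?a4 = "\<lambda>\<omega>. ennreal (?W \<omega> * (norm (Q (h *\<^sub>R \<omega>) - G (h *\<^sub>R \<omega>)))\<^sup>2)"
 have I: "?I \<in> sets lebesgue"
 proof -
  have "closed ?I" by (intro closed_Collect_le continuous_intros)
  then show ?thesis by (simp add: lebesgue_closedin)
 qed
 have mW: "?W \<in> borel_measurable borel" by measurable
 have ma: "?a1 \<in> lmeas" "?a2 \<in> lmeas" "?a3 \<in> lmeas" "?a4 \<in> lmeas"
  by (intro measurable_compose[OF weighted_square_measurable[OF mW] measurable_ennreal] borel_measurable_times_ennreal
    borel_measurable_indicator I borel_measurable_diff mF mFn mscale mQ mG)+
 have sum4: "4 * (ennreal a + ennreal b + ennreal c + ennreal d) = ennreal (4 * (a + b + c + d))" if "0 <= a" "0 <= b" "0 <= c" "0 <= d" for a b c d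
  using that by (simp add: ennreal_mult)
 have split: "AE \<omega> in lebesgue. ennreal (?W \<omega> * (norm (F \<omega> - G (h *\<^sub>R \<omega>)))\<^sup>2) <= 4 * (?a1 \<omega> + ?a2 \<omega> + ?a3 \<omega> + ?a4 \<omega>)"
 proof -
  have "AE \<omega> in lebesgue. norm (0 + h *\<^sub>R \<omega>) < \<rho> --> 0 + h *\<^sub>R \<omega> \<in> S" by (rule AE_affine[OF _ AE_S]) (use h in auto)
  then show ?thesis
  proof eventually_elim
   case (elim \<omega>)
   let ?y = "h *\<^sub>R \<omega>"
   let ?n1 = "(norm (F \<omega> - Fn \<omega>))\<^sup>2" and ?n2 = "(norm (F \<omega>))\<^sup>2 * indicator ?I \<omega>"
    and ?n3 = "(norm (Q ?y))\<^sup>2 * indicator ?I \<omega>" and ?n4 = "(norm (Q ?y - G ?y))\<^sup>2"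
   have nn: "0 <= ?n1" "0 <= ?n2" "0 <= ?n3" "0 <= ?n4" by auto
   have "(norm (F \<omega> - G ?y))\<^sup>2 <= 4 * (?n1 + ?n2 + ?n3 + ?n4)"
   proof (cases "norm ?y < \<rho>")
    case True
    then have "?y \<in> S" using elim by simp
    moreover have "reduce ?y = ?y" using True rho pi_gt3 by (intro reduce_small) linarith
    ultimately have "Q ?y = Fn \<omega>" using h c by (auto simp: Q_def b_def S_def)
    then have "(norm (F \<omega> - G ?y))\<^sup>2 <= 2 * ?n1 + 2 * ?n4"
     using norm_add_squared_le[of "F \<omega> - Fn \<omega>" "Q ?y - G ?y"] by simp
    then show ?thesis by (rule error_split_near[OF _ nn])
   next
    case False
    then have "\<omega> \<in> ?I" by simp
    then have ind: "?n2 = (norm (F \<omega>))\<^sup>2" "?n3 = (norm (Q ?y))\<^sup>2" by simp_all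
    have "(norm (F \<omega> - G ?y))\<^sup>2 <= 2 * (norm (F \<omega>))\<^sup>2 + 2 * (norm (G ?y))\<^sup>2" by (rule norm_diff_squared_le)
    moreover have "(norm (G ?y))\<^sup>2 <= 2 * (norm (Q ?y))\<^sup>2 + 2 * ?n4"
     using norm_diff_squared_le[of "Q ?y" "Q ?y - G ?y"] by simp
    ultimately show ?thesis unfolding ind by (rule error_split_far[OF _ _ nn(1)]) simp
   qed
   then have "?W \<omega> * (norm (F \<omega> - G ?y))\<^sup>2 <= ?W \<omega> * (4 * (?n1 + ?n2 + ?n3 + ?n4))" by (rule mult_left_mono) simp
   also have "... = 4 * (?W \<omega> * ?n1 + ?W \<omega> * ?n2 + ?W \<omega> * ?n3 + ?W \<omega> * ?n4)" by (simp add: algebra_simps)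
   finally have "ennreal (?W \<omega> * (norm (F \<omega> - G ?y))\<^sup>2) <= ennreal (4 * (?W \<omega> * ?n1 + ?W \<omega> * ?n2 + ?W \<omega> * ?n3 + ?W \<omega> * ?n4))" by (rule ennreal_leI)
   also have "... = 4 * (ennreal (?W \<omega> * ?n1) + ennreal (?W \<omega> * ?n2) + ennreal (?W \<omega> * ?n3) + ennreal (?W \<omega> * ?n4))"
    by (rule sum4[symmetric]) (use nn in \<open>auto intro: mult_nonneg_nonneg\<close>)
   also have "... = 4 * (?a1 \<omega> + ?a2 \<omega> + ?a3 \<omega> + ?a4 \<omega>)" by (simp add: indicator_def)
   finally show ?case .
  qed
 qed

 have i1: "(\<integral>\<^sup>+\<omega>. ?a1 \<omega> \<partial>lebesgue) <= ennreal (\<eta> / 8)" using n unfolding Fn_def .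

 define H where "H = h powr (2 * k - 2 * s)"
 have H0: "H \<ge> 0" by (simp add: H_def)

 have i2: "(\<integral>\<^sup>+\<omega>. ?a2 \<omega> \<partial>lebesgue) <= ennreal (\<rho> powr (2 * s - 2 * k) * H * N\<^sup>2)"
 proof -
  let ?c = "\<rho> powr (2 * s - 2 * k) * H"
  have "(\<integral>\<^sup>+\<omega>. ?a2 \<omega> \<partial>lebesgue) <= (\<integral>\<^sup>+\<omega>. ennreal ?c * ennreal ((1 + norm \<omega>) powr (2 * k) * (norm (F \<omega>))\<^sup>2) \<partial>lebesgue)"
  proof (rule nn_integral_mono)
   fix \<omega> :: "real^'d"
   show "?a2 \<omega> <= ennreal ?c * ennreal ((1 + norm \<omega>) powr (2 * k) * (norm (F \<omega>))\<^sup>2)"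
   proof (cases "\<omega> \<in> ?I")
    case True
    then have "\<rho> / h <= 1 + norm \<omega>" using h by (simp add: field_simps)
    then have "(1 + norm \<omega>) powr (2 * s - 2 * k) <= (\<rho> / h) powr (2 * s - 2 * k)" using sk rho h by (intro powr_mono2') auto
    also have "... = ?c"
    proof -
     have "h powr (2 * s - 2 * k) = 1 / H" unfolding H_def by (simp add: powr_minus_divide[symmetric])
     then show ?thesis using rho h by (simp add: powr_divide)
    qed
    finally have "(1 + norm \<omega>) powr (2 * s - 2 * k) * (1 + norm \<omega>) powr (2 * k) <= ?c * (1 + norm \<omega>) powr (2 * k)"
     by (rule mult_right_mono) simp
    then have "?W \<omega> <= ?c * (1 + norm \<omega>) powr (2 * k)" by (simp add: powr_add[symmetric])
    then have "?W \<omega> * (norm (F \<omega>))\<^sup>2 <= ?c * (1 + norm \<omega>) powr (2 * k) * (norm (F \<omega>))\<^sup>2" by (rule mult_right_mono) simp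
    then show ?thesis using True H0 by (subst ennreal_mult[symmetric]) (auto simp: mult.assoc intro: ennreal_leI)
   qed simp
  qed
  also have "... = ennreal ?c * ennreal (N\<^sup>2)"
   by (subst nn_integral_cmult, rule measurable_compose[OF weighted_square_measurable[OF _ mF] measurable_ennreal]) (simp_all add: energy)
  finally show ?thesis using H0 by (simp add: ennreal_mult[symmetric])
 qed

 have scale: "ennreal (h ^ ?d) * (\<integral>\<^sup>+\<omega>. u (h *\<^sub>R \<omega>) \<partial>lebesgue) = (\<integral>\<^sup>+y. u y \<partial>lebesgue)"
  if "u \<in> lmeas" for u :: "real^'d => ennreal"
  using nn_integral_affine[OF _ that, of h 0] h by simp
 have hd: "ennreal (h ^ ?d) \<noteq> 0" "ennreal (h ^ ?d) \<noteq> top" using h by auto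

 have i3: "(\<integral>\<^sup>+\<omega>. ?a3 \<omega> \<partial>lebesgue) <= ennreal (?K * C\<^sup>2 / c\<^sup>2 * H * N\<^sup>2)"
 proof -
  define \<phi> where "\<phi> y = ennreal (norm y powr (2 * s) * (norm (Q y))\<^sup>2) * indicator {y. \<rho> <= norm y} y" for y
  define \<psi> where "\<psi> y = ennreal (norm y powr (2 * k) * (norm (b y))\<^sup>2)" for y
  have "closed {y::real^'d. \<rho> <= norm y}" by (intro closed_Collect_le continuous_intros)
  then have far: "{y::real^'d. \<rho> <= norm y} \<in> sets lebesgue" by (simp add: lebesgue_closedin)
  have pw: "(\<lambda>y::real^'d. norm y powr t) \<in> borel_measurable borel" for t by measurable
  have m\<phi>: "\<phi> \<in> lmeas" unfolding \<phi>_def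
   by (rule borel_measurable_times_ennreal[OF measurable_compose[OF weighted_square_measurable[OF pw mQ] measurable_ennreal] borel_measurable_indicator[OF far]])
  have m\<psi>: "\<psi> \<in> lmeas" unfolding \<psi>_def
   by (rule measurable_compose[OF weighted_square_measurable[OF pw mb] measurable_ennreal])
  let ?c = "?K * h powr (- 2 * s)" and ?e = "h powr (2 * k) / c\<^sup>2"
  have c0: "0 <= ?c" "0 <= ?e" by (auto simp: add_nonneg_nonneg)
  have "(\<integral>\<^sup>+\<omega>. ?a3 \<omega> \<partial>lebesgue) <= (\<integral>\<^sup>+\<omega>. ennreal ?c * \<phi> (h *\<^sub>R \<omega>) \<partial>lebesgue)"
  proof (rule nn_integral_mono)
   fix \<omega> :: "real^'d"
   show "?a3 \<omega> <= ennreal ?c * \<phi> (h *\<^sub>R \<omega>)"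
   proof (cases "\<omega> \<in> ?I")
    case True
    have "h * norm \<omega> <= 1 * norm \<omega>" using h by (intro mult_right_mono) auto
    then have "\<rho> <= norm \<omega>" using True h by simp
    then have "?W \<omega> <= ?K * norm \<omega> powr (2 * s)" by (rule weight_far[OF rho(1)])
    also have "norm \<omega> powr (2 * s) = h powr (- 2 * s) * norm (h *\<^sub>R \<omega>) powr (2 * s)"
    proof -
     have "h powr (- 2 * s) * h powr (2 * s) = 1" using h by (simp add: powr_add[symmetric])
     then show ?thesis using h by (simp add: powr_mult mult.assoc[symmetric])
    qed
    finally have "?W \<omega> * (norm (Q (h *\<^sub>R \<omega>)))\<^sup>2 <= ?K * (h powr (- 2 * s) * norm (h *\<^sub>R \<omega>) powr (2 * s)) * (norm (Q (h *\<^sub>R \<omega>)))\<^sup>2"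
     by (rule mult_right_mono) simp
    also have "... = ?c * (norm (h *\<^sub>R \<omega>) powr (2 * s) * (norm (Q (h *\<^sub>R \<omega>)))\<^sup>2)" by (simp only: mult.assoc)
    finally have "ennreal (?W \<omega> * (norm (Q (h *\<^sub>R \<omega>)))\<^sup>2) <= ennreal ?c * ennreal (norm (h *\<^sub>R \<omega>) powr (2 * s) * (norm (Q (h *\<^sub>R \<omega>)))\<^sup>2)"
     by (subst ennreal_mult[symmetric, OF c0(1)]) (auto intro: ennreal_leI)
    then show ?thesis using True by (simp add: \<phi>_def)
   qed simp
  qed
  also have "... = ennreal ?c * (\<integral>\<^sup>+\<omega>. \<phi> (h *\<^sub>R \<omega>) \<partial>lebesgue)" by (rule nn_integral_cmult[OF mscale[OF m\<phi>]])
  also have "(\<integral>\<^sup>+\<omega>. \<phi> (h *\<^sub>R \<omega>) \<partial>lebesgue) <= ennreal (C\<^sup>2) * (\<integral>\<^sup>+\<omega>. \<psi> (h *\<^sub>R \<omega>) \<partial>lebesgue)"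
  proof (subst ennreal_mult_le_mult_iff[OF hd, symmetric])
   have "ennreal (h ^ ?d) * (\<integral>\<^sup>+\<omega>. \<phi> (h *\<^sub>R \<omega>) \<partial>lebesgue) = (\<integral>\<^sup>+y. \<phi> y \<partial>lebesgue)" by (rule scale[OF m\<phi>])
   also have "... <= ennreal (C\<^sup>2) * (\<integral>\<^sup>+y. \<psi> y \<partial>lebesgue)"
    unfolding \<phi>_def \<psi>_def Q_def by (rule far_field[OF Phi mb b_far C near])
   also have "(\<integral>\<^sup>+y. \<psi> y \<partial>lebesgue) = ennreal (h ^ ?d) * (\<integral>\<^sup>+\<omega>. \<psi> (h *\<^sub>R \<omega>) \<partial>lebesgue)" by (rule scale[OF m\<psi>, symmetric])
   finally show "ennreal (h ^ ?d) * (\<integral>\<^sup>+\<omega>. \<phi> (h *\<^sub>R \<omega>) \<partial>lebesgue) <= ennreal (h ^ ?d) * (ennreal (C\<^sup>2) * (\<integral>\<^sup>+\<omega>. \<psi> (h *\<^sub>R \<omega>) \<partial>lebesgue))"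
    by (simp only: mult.left_commute)
  qed
  also have "(\<integral>\<^sup>+\<omega>. \<psi> (h *\<^sub>R \<omega>) \<partial>lebesgue) <= (\<integral>\<^sup>+\<omega>. ennreal ?e * ennreal ((1 + norm \<omega>) powr (2 * k) * (norm (F \<omega>))\<^sup>2) \<partial>lebesgue)"
  proof (rule nn_integral_mono)
   fix \<omega> :: "real^'d"
   have 1: "norm (h *\<^sub>R \<omega>) powr (2 * k) <= h powr (2 * k) * (1 + norm \<omega>) powr (2 * k)"
    using h k_pos by (simp add: powr_mult mult_left_mono powr_mono2)
   have "norm (b (h *\<^sub>R \<omega>)) <= norm (F \<omega>) / c" using b_le(1)[of "h *\<^sub>R \<omega>"] h by simp
   then have "(norm (b (h *\<^sub>R \<omega>)))\<^sup>2 <= (norm (F \<omega>) / c)\<^sup>2" by (intro power_mono) auto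
   then have "norm (h *\<^sub>R \<omega>) powr (2 * k) * (norm (b (h *\<^sub>R \<omega>)))\<^sup>2 <= h powr (2 * k) * (1 + norm \<omega>) powr (2 * k) * (norm (F \<omega>) / c)\<^sup>2"
    by (intro mult_mono 1) auto
   also have "... = ?e * ((1 + norm \<omega>) powr (2 * k) * (norm (F \<omega>))\<^sup>2)" by (simp add: power_divide)
   finally show "\<psi> (h *\<^sub>R \<omega>) <= ennreal ?e * ennreal ((1 + norm \<omega>) powr (2 * k) * (norm (F \<omega>))\<^sup>2)"
    unfolding \<psi>_def by (subst ennreal_mult[symmetric, OF c0(2)]) (auto intro: ennreal_leI)
  qed
  also have "... = ennreal ?e * ennreal (N\<^sup>2)"
   by (subst nn_integral_cmult, rule measurable_compose[OF weighted_square_measurable[OF _ mF] measurable_ennreal]) (simp_all add: energy)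
  finally have "(\<integral>\<^sup>+\<omega>. ?a3 \<omega> \<partial>lebesgue) <= ennreal ?c * (ennreal (C\<^sup>2) * (ennreal ?e * ennreal (N\<^sup>2)))"
   by (simp only: mult_left_mono zero_le)
  also have "... = ennreal (?c * (C\<^sup>2 * (?e * N\<^sup>2)))"
   using c0 by (simp only: ennreal_mult[symmetric] zero_le_power2 mult_nonneg_nonneg)
  also have "?c * (C\<^sup>2 * (?e * N\<^sup>2)) = ?K * C\<^sup>2 / c\<^sup>2 * (h powr (- 2 * s) * h powr (2 * k)) * N\<^sup>2" by simp
  also have "h powr (- 2 * s) * h powr (2 * k) = H" unfolding H_def by (simp only: powr_add[symmetric]) simp
  finally show ?thesis .
 qed

 have i4: "(\<integral>\<^sup>+\<omega>. ?a4 \<omega> \<partial>lebesgue) <= ennreal (\<eta> / 8)"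
 proof -
  define e where "e i y = w i y * ennreal ((norm (\<beta> i (reduce y) - q i (torus_point y)))\<^sup>2)" for i y
  have mt: "(\<lambda>\<omega>. q i (torus_point \<omega>)) \<in> lmeas" for i
  proof (rule measurable_completion)
   have "continuous_on UNIV (\<lambda>\<omega>. q i (torus_point \<omega>))"
    by (rule continuous_on_compose2[OF continuous_on_polymonial_function[OF q(1), of UNIV] continuous_torus_point]) simp
   then show "(\<lambda>\<omega>. q i (torus_point \<omega>)) \<in> borel_measurable lborel" by (simp add: borel_measurable_continuous_onI)
  qed
  have me: "e i \<in> lmeas" for i unfolding e_def
   by (intro borel_measurable_times_ennreal mw measurable_compose[OF norm_square_measurable measurable_ennreal] borel_measurable_diff mt
     reduce_measurable[OF m\<beta> \<beta>_le \<beta>_far])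
  have "(\<integral>\<^sup>+\<omega>. ?a4 \<omega> \<partial>lebesgue) <= (\<integral>\<^sup>+\<omega>. (\<Sum>i\<in>UNIV. ennreal ?r * e i (h *\<^sub>R \<omega>)) \<partial>lebesgue)"
  proof (rule nn_integral_mono)
   fix \<omega> :: "real^'d"
   let ?y = "h *\<^sub>R \<omega>"
   let ?z = "\<lambda>i. (norm (\<beta> i (reduce ?y) - q i (torus_point ?y)))\<^sup>2" and ?p = "\<lambda>i. (norm (fhat (\<Phi> $ i) ?y))\<^sup>2"
   have "(norm (Q ?y - G ?y))\<^sup>2 <= (\<Sum>i\<in>UNIV. norm ((\<beta> i (reduce ?y) - q i (torus_point ?y)) * fhat (\<Phi> $ i) ?y))\<^sup>2"
    unfolding Qsum by (intro power_mono norm_sum) simp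
   also have "... <= (\<Sum>i\<in>UNIV. (norm ((\<beta> i (reduce ?y) - q i (torus_point ?y)) * fhat (\<Phi> $ i) ?y))\<^sup>2) * ?r"
    by (rule sum_squared_le_sum_of_squares)
   also have "... = (\<Sum>i\<in>UNIV. ?z i * ?p i) * ?r" by (simp add: norm_mult power_mult_distrib)
   finally have "?W \<omega> * (norm (Q ?y - G ?y))\<^sup>2 <= ?W \<omega> * ((\<Sum>i\<in>UNIV. ?z i * ?p i) * ?r)" by (rule mult_left_mono) simp
   also have "... = (\<Sum>i\<in>UNIV. ?r * (?W \<omega> * ?p i * ?z i))"
    by (simp add: sum_distrib_left sum_distrib_right mult_ac)
   finally have "?a4 \<omega> <= ennreal (\<Sum>i\<in>UNIV. ?r * (?W \<omega> * ?p i * ?z i))" by (rule ennreal_leI)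
   also have "... = (\<Sum>i\<in>UNIV. ennreal (?r * (?W \<omega> * ?p i * ?z i)))" by (rule sum_ennreal[symmetric]) simp
   also have "... = (\<Sum>i\<in>UNIV. ennreal ?r * e i ?y)"
    using h by (intro sum.cong refl) (simp add: e_def w_def ennreal_mult)
   finally show "?a4 \<omega> <= (\<Sum>i\<in>UNIV. ennreal ?r * e i (h *\<^sub>R \<omega>))" .
  qed
  also have "... = (\<Sum>i\<in>UNIV. ennreal ?r * (\<integral>\<^sup>+\<omega>. e i (h *\<^sub>R \<omega>) \<partial>lebesgue))"
  proof -
   have "(\<lambda>\<omega>. ennreal ?r * e i (h *\<^sub>R \<omega>)) \<in> lmeas" for i
    by (intro borel_measurable_times_ennreal borel_measurable_const mscale me)
   then show ?thesis by (simp add: nn_integral_sum nn_integral_cmult mscale me)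
  qed
  also have "... <= (\<Sum>i\<in>(UNIV::'r set). ennreal (\<eta> / (8 * ?r)))"
  proof (rule sum_mono)
   fix i
   have "ennreal (h ^ ?d) * (\<integral>\<^sup>+\<omega>. e i (h *\<^sub>R \<omega>) \<partial>lebesgue) <= ennreal \<epsilon>"
    unfolding scale[OF me] unfolding e_def by (rule q(2))
   also have "ennreal \<epsilon> = ennreal (h ^ ?d) * ennreal (\<eta> / (8 * ?r\<^sup>2))"
    using h eta by (subst ennreal_mult[symmetric]) (auto simp: \<epsilon>_def)
   finally have "(\<integral>\<^sup>+\<omega>. e i (h *\<^sub>R \<omega>) \<partial>lebesgue) <= ennreal (\<eta> / (8 * ?r\<^sup>2))"
    by (simp only: ennreal_mult_le_mult_iff[OF hd])
   then have "ennreal ?r * (\<integral>\<^sup>+\<omega>. e i (h *\<^sub>R \<omega>) \<partial>lebesgue) <= ennreal ?r * ennreal (\<eta> / (8 * ?r\<^sup>2))" by (rule mult_left_mono) simp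
   also have "... = ennreal (\<eta> / (8 * ?r))"
    using eta by (subst ennreal_mult[symmetric]) (auto simp: power2_eq_square)
   finally show "ennreal ?r * (\<integral>\<^sup>+\<omega>. e i (h *\<^sub>R \<omega>) \<partial>lebesgue) <= ennreal (\<eta> / (8 * ?r))" .
  qed
  also have "... = ennreal (\<Sum>i\<in>(UNIV::'r set). \<eta> / (8 * ?r))" using eta by (intro sum_ennreal) auto
  also have "(\<Sum>i\<in>(UNIV::'r set). \<eta> / (8 * ?r)) = \<eta> / 8" by simp
  finally show ?thesis .
 qed

 let ?A = "\<rho> powr (2 * s - 2 * k) * H * N\<^sup>2" and ?B = "?K * C\<^sup>2 / c\<^sup>2 * H * N\<^sup>2"
 have AB: "0 <= ?A" "0 <= ?B" using H0 by (auto simp: add_nonneg_nonneg)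
 have "(\<integral>\<^sup>+\<omega>. ennreal (?W \<omega> * (norm (F \<omega> - G (h *\<^sub>R \<omega>)))\<^sup>2) \<partial>lebesgue) <= (\<integral>\<^sup>+\<omega>. 4 * (?a1 \<omega> + ?a2 \<omega> + ?a3 \<omega> + ?a4 \<omega>) \<partial>lebesgue)"
  by (rule nn_integral_mono_AE[OF split])
 also have "... = 4 * ((\<integral>\<^sup>+\<omega>. ?a1 \<omega> \<partial>lebesgue) + (\<integral>\<^sup>+\<omega>. ?a2 \<omega> \<partial>lebesgue) + (\<integral>\<^sup>+\<omega>. ?a3 \<omega> \<partial>lebesgue) + (\<integral>\<^sup>+\<omega>. ?a4 \<omega> \<partial>lebesgue))"
  by (simp only: nn_integral_cmult nn_integral_add borel_measurable_add ma)
 also have "... <= 4 * (ennreal (\<eta> / 8) + ennreal ?A + ennreal ?B + ennreal (\<eta> / 8))"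
  by (intro mult_left_mono add_mono i1 i2 i3 i4) simp
 also have "... = ennreal (4 * (\<eta> / 8 + ?A + ?B + \<eta> / 8))"
  by (rule sum4) (use AB eta in auto)
 finally have le: "(\<integral>\<^sup>+\<omega>. ennreal (?W \<omega> * (norm (F \<omega> - G (h *\<^sub>R \<omega>)))\<^sup>2) \<partial>lebesgue) <= ennreal (4 * (\<eta> / 8 + ?A + ?B + \<eta> / 8))" .
 have "W2_norm s (f - dilate h g) <= sqrt (4 * (\<eta> / 8 + ?A + ?B + \<eta> / 8))"
  by (rule W2_norm_le[OF hdiff le]) (use AB eta in auto)
 also have "4 * (\<eta> / 8 + ?A + ?B + \<eta> / 8) = 4 * (\<rho> powr (2 * s - 2 * k) + ?K * C\<^sup>2 / c\<^sup>2) * H * N\<^sup>2 + \<eta>"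
  by (simp add: algebra_simps)
 finally show ?thesis using gV unfolding H_def N_def by blast
qed

text \<open>For \<open>h \<ge> 1\<close> the approximant \<open>0\<close> suffices. For \<open>h < 1\<close>, letting \<open>\<eta>\<close> tend to \<open>0\<close> bounds the infimum.\<close>

lemma approximation_order:
 assumes Phi: "\<Phi> \<in> R" and sk: "s < k" and c: "c > 0"
  and lo: "\<forall>\<^sub>F \<omega> in ae_nhds 0. c <= norm (symb \<Phi> \<omega>)" and l2: "symb_order \<Phi>"
 shows "provides_approximation_order s k \<Phi>"
proof -
 obtain r1 where r1: "r1 > 0" "AE \<omega> in lebesgue. norm \<omega> < r1 --> c <= norm (symb \<Phi> \<omega>)"
  using lo unfolding eventually_ae_nhds_0 by blast
 obtain cv Cv r2 where r2: "cv > 0" "Cv > 0" "r2 > 0" "AE \<omega> in lebesgue. norm \<omega> < r2 --> cv <= (norm (v \<omega>))\<^sup>2 \<and> (norm (v \<omega>))\<^sup>2 <= Cv"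
  by (rule v_norm_bounds)
 obtain C r3 where r3: "C > 0" "r3 > 0" "AE \<omega> in lebesgue. norm \<omega> < r3 -->
  (wnorm_le (dual_lattice - {0}) s (symb \<Phi>) \<omega> (C * norm \<omega> powr k))"
  using l2 unfolding symb_order_def by blast
 define \<rho> where "\<rho> = min 1 (min r1 (min r2 r3))"
 have rho: "0 < \<rho>" "\<rho> <= 1" using r1 r2 r3 by (auto simp: \<rho>_def)
 have good: "AE x in lebesgue. norm x < \<rho> --> c <= norm (symb \<Phi> x) \<and> (norm (v x))\<^sup>2 <= Cv"
  using r1(2) r2(4) by eventually_elim (simp add: \<rho>_def)
 have near: "AE x in lebesgue. norm x < \<rho> --> (wnorm_le (dual_lattice - {0}) s (symb \<Phi>) x (C * norm x powr k))"
  using r3(3) by eventually_elim (simp add: \<rho>_def)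
 define A where "A = 4 * (\<rho> powr (2 * s - 2 * k) + ((1 + 1 / \<rho>) powr (2 * s) + 1) * C\<^sup>2 / c\<^sup>2)"
 have A: "A \<ge> 0" by (auto simp: A_def add_nonneg_nonneg)
 let ?V = "shift_invariant_space s \<Phi>"
 have bdd: "bdd_below ((\<lambda>g. W2_norm s (f - g)) ` dilate h ` ?V)" for f h
  by (rule bdd_belowI[of _ 0]) (auto simp: W2_norm_nonneg)
 have lower: "(INF g\<in>dilate h ` ?V. W2_norm s (f - g)) <= W2_norm s (f - dilate h g)" if "g \<in> ?V" for f h g
  by (rule cINF_lower[OF bdd]) (use that in blast)
 have "(INF g\<in>dilate h ` ?V. W2_norm s (f - g)) <= (1 + sqrt A) * h powr (k - s) * W2_norm k f"
  if f: "f \<in> W2 k" and h: "h > 0" for f h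
 proof (cases "h < 1")
  case False
  have "(INF g\<in>dilate h ` ?V. W2_norm s (f - g)) <= W2_norm s (f - dilate h 0)"
   by (rule lower[OF functional.subspace_0[OF subspace_shift_invariant_space]])
  also have "f - dilate h 0 = f" by (auto simp: dilate_def fun_eq_iff)
  also have "W2_norm s f <= 1 * W2_norm k f" using W2_norm_mono[OF f] sk by simp
  also have "... <= ((1 + sqrt A) * h powr (k - s)) * W2_norm k f"
  proof (rule mult_right_mono[OF _ W2_norm_nonneg])
   have "1 <= h powr (k - s)" using False sk by (intro ge_one_powr_ge_zero) auto
   then have "1 * 1 <= (1 + sqrt A) * h powr (k - s)" using A by (intro mult_mono) auto
   then show "1 <= (1 + sqrt A) * h powr (k - s)" by simp
  qed
  finally show ?thesis .
 next
  case True
  define X where "X = A * h powr (2 * k - 2 * s) * (W2_norm k f)\<^sup>2"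
  have X: "X \<ge> 0" using A by (simp add: X_def)
  let ?t = "INF g\<in>dilate h ` ?V. W2_norm s (f - g)"
  have t: "?t <= sqrt (X + \<eta>)" if eta: "\<eta> > 0" for \<eta>
  proof -
   obtain g where g: "g \<in> ?V" "W2_norm s (f - dilate h g) <= sqrt (X + \<eta>)"
    using approximant_exists[OF Phi sk rho c r3(1) r2(2) good near f h True eta] unfolding X_def A_def by blast
   show ?thesis using lower[OF g(1), where f=f and h=h] g(2) by (rule order_trans)
  qed
  have "?t <= sqrt X"
  proof (cases "?t <= 0")
   case True
   then show ?thesis using real_sqrt_ge_zero[OF X] by linarith
  next
   case False
   have "?t\<^sup>2 <= X"
   proof (rule field_le_epsilon)
    fix \<eta> :: real assume eta: "\<eta> > 0"
    have "?t\<^sup>2 <= (sqrt (X + \<eta>))\<^sup>2" using t[OF eta] False by (intro power_mono) auto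
    then show "?t\<^sup>2 <= X + \<eta>" using X eta by simp
   qed
   then show ?thesis by (rule real_le_rsqrt)
  qed
  also have "sqrt X = sqrt A * h powr (k - s) * W2_norm k f"
  proof -
   have "h powr (2 * k - 2 * s) = (h powr (k - s))\<^sup>2" by (simp add: powr_double_exponent[symmetric] algebra_simps)
   then show ?thesis unfolding X_def by (simp add: real_sqrt_mult W2_norm_nonneg)
  qed
  also have "... <= (1 + sqrt A) * h powr (k - s) * W2_norm k f"
   by (intro mult_right_mono W2_norm_nonneg) auto
  finally show ?thesis .
 qed
 then show ?thesis unfolding provides_approximation_order_def by blast
qed

end

section \<open>Universal supervectors and approximation order\<close>

theorem theorem51:
  fixes P :: "real^'d::finite \<Rightarrow> complex^'r^'r::finite"
    and R B :: "('d functional ^ 'r) set"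
    and s k :: real
    and v :: "real^'d \<Rightarrow> complex^'r"
  assumes mask: "refinement_mask P"
    and space: "vfunctional.subspace R"
    and basis: "finite B" "vfunctional.independent B" "vfunctional.span B = R"
    and sobolev: "\<forall>\<Phi>\<in>R. \<forall>i. \<Phi> $ i \<in> W2 s"
    and refinable: "\<forall>\<Phi>\<in>R. solves_refinement P \<Phi>"
    and k_pos: "k > 0"
    and A1: "\<forall>l \<in> unit_vertices - {0}.
          (\<lambda>\<omega>. norm (gramian s B (\<omega> + pi *\<^sub>R l))) \<in> O[ae_nhds 0](\<lambda>_. 1)"
        "(\<lambda>\<omega>. norm (gramian s B \<omega>)) \<in> O[ae_nhds 0](\<lambda>\<omega>. norm \<omega> powr (2 * s))"
    and A1_supplement: "s < 0 \<Longrightarrow> k \<notin> \<nat> \<or> (s \<le> -1 \<and> CARD('d) \<ge> 3) \<Longrightarrow>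
          (\<lambda>\<omega>. norm (gramian0 s B \<omega>)) \<in> O[ae_nhds 0](\<lambda>_. 1)"
    and A2: "periodic v" "v \<in> borel_measurable lebesgue"
        "(\<lambda>\<omega>. Re (cinner (v \<omega>) (v \<omega>))) \<in> \<Theta>[ae_nhds 0](\<lambda>_. 1)"
    and A3: "\<forall>\<Phi>\<in>R. \<exists>\<rho>>0.
          (\<Sum>\<^sub>\<infinity>\<beta>\<in>dual_lattice - {0}. ennreal (norm \<beta> powr (2 * s)) *
             (SUP \<gamma>\<in>{\<gamma>. real (sum \<gamma> UNIV) \<le> k}.
                (mderiv_Linf_norm (ball \<beta> \<rho>) \<gamma> (\<lambda>\<omega>. cinner (v \<omega>) (vhat \<Phi> \<omega>)))\<^sup>2)) < \<infinity>"
    and Z: "condition_Z k P v"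
  shows "ae_zero_of_order (2 * k) 0 (\<lambda>\<omega>. qform (gramian0 s B \<omega>) (v \<omega>))
    \<and> (\<forall>\<Phi>\<in>R. \<forall>g U. open U \<and> 0 \<in> U \<and> smooth_on U g \<and>
          (\<forall>\<^sub>F \<omega> in ae_nhds 0. cinner (v \<omega>) (vhat \<Phi> \<omega>) = g \<omega>) \<longrightarrow>
          (\<lambda>\<omega>. cinner (v \<omega>) (vhat \<Phi> \<omega>) - g 0) \<in> O[ae_nhds 0](\<lambda>\<omega>. of_real (norm \<omega> powr k)))
    \<and> ((\<lambda>\<omega>. qform (gramian s B \<omega>) (v \<omega>)) \<in> \<Theta>[ae_nhds 0](\<lambda>\<omega>. norm \<omega> powr (2 * s)) \<longrightarrow>
          universal_supervector s k B v \<and> provides_coherent_order s k B)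
    \<and> ((\<forall>\<^sub>F \<omega> in ae_nhds 0. invertible (gramian s B \<omega>)) \<and>
       (\<lambda>\<omega>. norm (matrix_inv (gramian s B \<omega>))) \<in> O[ae_nhds 0](\<lambda>\<omega>. norm \<omega> powr (- 2 * s)) \<longrightarrow>
          (\<lambda>\<omega>. qform (gramian s B \<omega>) (v \<omega>)) \<in> \<Theta>[ae_nhds 0](\<lambda>\<omega>. norm \<omega> powr (2 * s)))
    \<and> (\<forall>\<Phi>\<in>R. \<forall>c>0. (\<forall>\<^sub>F \<omega> in ae_nhds 0. c \<le> norm (cinner (v \<omega>) (vhat \<Phi> \<omega>))) \<longrightarrow>
          (\<lambda>\<omega>. qform (gramian s B \<omega>) (v \<omega>)) \<in> \<Theta>[ae_nhds 0](\<lambda>\<omega>. norm \<omega> powr (2 * s)) \<and>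
          universal_supervector s k B v \<and> provides_coherent_order s k B \<and>
          (s < k \<longrightarrow> provides_approximation_order s k \<Phi>))"
proof -
 interpret refinable P R B s k v
  by unfold_locales (fact mask basis(1) basis(3) sobolev refinable k_pos A1 A2 Z)+
 have symb: "symb \<Phi> = (\<lambda>\<omega>. cinner (v \<omega>) (vhat \<Phi> \<omega>))" for \<Phi>
  by (simp add: fun_eq_iff symb_def)
 have order: "symb_order \<Phi>" if "\<Phi> \<in> R" for \<Phi>
  unfolding symb_order_def
  by (rule symb_l2[OF that A1_supplement]) (use A3 that in \<open>auto simp only: symb\<close>)
 then have order_B: "symb_order \<Psi>" if "\<Psi> \<in> B" for \<Psi>
  using that B_subset by blast
 (* smoothness enters only through continuity at the origin *)
 have at_0: "(\<lambda>\<omega>. cinner (v \<omega>) (vhat \<Phi> \<omega>) - g 0) \<in> O[ae_nhds 0](\<lambda>\<omega>. of_real (norm \<omega> powr k))"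
  if Phi: "\<Phi> \<in> R" and U: "open U" "0 \<in> U" and g: "smooth_on U g"
   and ev: "\<forall>\<^sub>F \<omega> in ae_nhds 0. cinner (v \<omega>) (vhat \<Phi> \<omega>) = g \<omega>" for \<Phi> g U
 proof -
  have "g differentiable_on U" using g[unfolded smooth_on_def, rule_format, of "[]"] by simp
  then have "isCont g 0"
   using U by (meson continuous_on_eq_continuous_at differentiable_imp_continuous_on)
  from symb_value_at_0[OF Phi this] ev show ?thesis by (simp only: symb)
 qed
 have ev: "\<forall>\<^sub>F \<omega> in ae_nhds 0. c <= norm (symb \<Phi> \<omega>)"
  if "\<forall>\<^sub>F \<omega> in ae_nhds 0. c <= norm (cinner (v \<omega>) (vhat \<Phi> \<omega>))" for \<Phi> and c :: real
  using that by (simp only: symb)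
 have lower: "(\<lambda>\<omega>. qform (gramian s B \<omega>) (v \<omega>)) \<in> \<Theta>[ae_nhds 0](\<lambda>\<omega>. norm \<omega> powr (2 * s))"
  if "\<Phi> \<in> R" "c > 0" "\<forall>\<^sub>F \<omega> in ae_nhds 0. c <= norm (cinner (v \<omega>) (vhat \<Phi> \<omega>))" for \<Phi> and c :: real
  by (rule qform_theta_if_symb_lower[OF that(1,2) ev[OF that(3)]])
 have approx: "provides_approximation_order s k \<Phi>"
  if "\<Phi> \<in> R" "c > 0" "\<forall>\<^sub>F \<omega> in ae_nhds 0. c <= norm (cinner (v \<omega>) (vhat \<Phi> \<omega>))" "s < k" for \<Phi> and c :: real
  by (rule approximation_order[OF that(1,4,2) ev[OF that(3)] order[OF that(1)]])
 have super: "universal_supervector s k B v \<and> provides_coherent_order s k B"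
  if "(\<lambda>\<omega>. qform (gramian s B \<omega>) (v \<omega>)) \<in> \<Theta>[ae_nhds 0](\<lambda>\<omega>. norm \<omega> powr (2 * s))"
  by (intro conjI supervector_and_coherence[OF order_B that])
 show ?thesis
 proof (intro conjI ballI allI impI; (elim conjE)?)
  show "ae_zero_of_order (2 * k) 0 (\<lambda>\<omega>. qform (gramian0 s B \<omega>) (v \<omega>))"
   by (rule gramian0_zero[OF order_B])
 qed (fact at_0 super[THEN conjunct1] super[THEN conjunct2] qform_theta_if_invertible lower lower[THEN super, THEN conjunct1]
   lower[THEN super, THEN conjunct2] approx | (rule at_0 super[THEN conjunct1] super[THEN conjunct2]
   qform_theta_if_invertible lower lower[THEN super, THEN conjunct1] lower[THEN super, THEN conjunct2] approx; assumption))+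
qed

end
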